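(* For each integer $\eta > 0$ there exist $r = \mathcal{O}(\eta)$ and $c = 2^{\mathcal{O}(\eta)}$ such that every graph $G$ with $\mathrm{tw}(G) > \eta$ has an $(\eta, r, c)$-modulator hitting family $\mathcal{P}$ of size $|V(G)|^{\mathcal{O}(\eta)}$. Furthermore, $\mathcal{P}$ can be constructed in time $|V(G)|^{\mathcal{O}(\eta)}$.
   Context: Graphs are finite, simple, undirected. $\mathrm{tw}(G)$ denotes the treewidth of $G$. For $A \subseteq V(G)$, $N_G(A)$ is the set of vertices outside $A$ with a neighbor in $A$, and the boundary of $A$ is $\partial_G(A) = N_G(V(G)\setminus A)$ (the vertices of $A$ having a neighbor outside $A$). A set $A \subseteq V(G)$ is an $r$-protrusion if $\mathrm{tw}(G[A]) \le r$ and $|\partial_G(A)| \le r$. A set $X \subseteq V(G)$ is a treewidth-$\eta$ modulator if $\mathrm{tw}(G - X) \le \eta$. For integers $\eta, r, c$, a family $\mathcal{P} \subseteq 2^{V(G)}$ is an $(\eta, r, c)$-modulator hitting family for $G$ if (i) $\mathcal{P}$ is non-empty, (ii) each $A \in \mathcal{P}$ is an $r$-protrusion in $G$, and (iii) for every treewidth-$\eta$ modulator $X \subseteq V(G)$ the number of sets $A \in \mathcal{P}$ with $A \cap X \neq \emptyset$ is at least $|\mathcal{P}|/c$. *)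

theory Defs
  imports
    Complex_Main
    "HOL-Library.Landau_Symbols"
    "Graph_Theory.Graph_Theory"
begin

text \<open>
  Finite simple undirected graphs are digraphs satisfying the locale \<^locale>\<open>graph\<close>: finite,
  symmetric, without loops and without parallel arcs.  An undirected edge is a pair of
  opposite arcs.
\<close>

section \<open>Treewidth\<close>

text \<open>
  The predicate \<open>tree\<close> of \<^theory>\<open>Graph_Theory.Digraph_Component\<close> excludes directed cycles only:
  it rejects every symmetric graph with an edge (traversing an edge back and forth is a cycle of
  length 2) and accepts acyclic orientations of undirected cycles.  For symmetric graphs, the
  undirected cycles are the cycles of length at least 3.
\<close>

definition undirected_tree :: "('a, 'b) pre_digraph \<Rightarrow> bool" where
  "undirected_tree T \<longleftrightarrow>
     graph T \<and> Digraph_Component.connected T \<and> \<not> (\<exists>p. pre_digraph.cycle T p \<and> 3 \<le> length p)"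

text \<open>
  Connected graphs are non-empty in the library, so the last condition also says that every
  vertex lies in some bag.
\<close>

definition tree_decomposition ::
  "('a, 'b) pre_digraph \<Rightarrow> ('n, 'm) pre_digraph \<Rightarrow> ('n \<Rightarrow> 'a set) \<Rightarrow> bool" where
  "tree_decomposition G T bag \<longleftrightarrow>
     undirected_tree T \<and>
     (\<forall>x\<in>verts T. bag x \<subseteq> verts G) \<and>
     (\<forall>u v. u \<rightarrow>\<^bsub>G\<^esub> v \<longrightarrow> (\<exists>x\<in>verts T. u \<in> bag x \<and> v \<in> bag x)) \<and>
     (\<forall>v\<in>verts G. Digraph_Component.connected (T \<restriction> {x \<in> verts T. v \<in> bag x}))"

text \<open>
  Truncated subtraction: the graph without vertices gets width 0 instead of -1, which does not
  affect upper bounds by natural numbers.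
\<close>

definition decomposition_width :: "('n, 'm) pre_digraph \<Rightarrow> ('n \<Rightarrow> 'a set) \<Rightarrow> nat" where
  "decomposition_width T bag = Max ((\<lambda>x. card (bag x)) ` verts T) - 1"

text \<open>Up to isomorphism, the nodes of a finite tree are natural numbers.\<close>

definition treewidth :: "('a, 'b) pre_digraph \<Rightarrow> nat" where
  "treewidth G = (LEAST w. \<exists>(T :: (nat, nat \<times> nat) pre_digraph) bag.
     tree_decomposition G T bag \<and> decomposition_width T bag = w)"


section \<open>Protrusions and modulator hitting families\<close>

definition neighborhood :: "('a, 'b) pre_digraph \<Rightarrow> 'a set \<Rightarrow> 'a set" where
  "neighborhood G A = {v \<in> verts G - A. \<exists>u\<in>A. u \<rightarrow>\<^bsub>G\<^esub> v}"

definition boundary :: "('a, 'b) pre_digraph \<Rightarrow> 'a set \<Rightarrow> 'a set" where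
  "boundary G A = neighborhood G (verts G - A)"

definition protrusion :: "nat \<Rightarrow> ('a, 'b) pre_digraph \<Rightarrow> 'a set \<Rightarrow> bool" where
  "protrusion r G A \<longleftrightarrow>
     A \<subseteq> verts G \<and> treewidth (G \<restriction> A) \<le> r \<and> card (boundary G A) \<le> r"

definition treewidth_modulator :: "nat \<Rightarrow> ('a, 'b) pre_digraph \<Rightarrow> 'a set \<Rightarrow> bool" where
  "treewidth_modulator \<eta> G X \<longleftrightarrow> X \<subseteq> verts G \<and> treewidth (G \<restriction> (verts G - X)) \<le> \<eta>"

text \<open>The condition \<open>0 < c\<close> rules out \<open>x / 0 = 0\<close>, which would make the last condition void.\<close>

definition modulator_hitting_family ::
  "nat \<Rightarrow> nat \<Rightarrow> nat \<Rightarrow> ('a, 'b) pre_digraph \<Rightarrow> 'a set set \<Rightarrow> bool" where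
  "modulator_hitting_family \<eta> r c G P \<longleftrightarrow>
     0 < c \<and> P \<noteq> {} \<and> (\<forall>A\<in>P. protrusion r G A) \<and>
     (\<forall>X. treewidth_modulator \<eta> G X \<longrightarrow>
        real (card {A \<in> P. A \<inter> X \<noteq> {}}) \<ge> real (card P) / real c)"


section \<open>Model of computation\<close>

text \<open>
  A random access machine with structured control flow: registers and an unbounded memory, both
  indexed by and holding natural numbers, indirect addressing, and unit cost for each instruction
  and each test.  Arithmetic is limited to addition and truncated subtraction; with unit-cost
  multiplication the model would no longer be polynomially equivalent to Turing machines.
\<close>

datatype program =
    Skip
  | Const nat nat          (* R x := k *)
  | Add nat nat nat        (* R x := R y + R z *)
  | Sub nat nat nat        (* R x := R y - R z *)
  | Load nat nat           (* R x := M (R y) *)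
  | Store nat nat          (* M (R x) := R y *)
  | Seq program program
  | IfPos nat program program
  | WhilePos nat program

type_synonym state = "(nat \<Rightarrow> nat) \<times> (nat \<Rightarrow> nat)"

text \<open>\<open>exec p \<sigma> t \<sigma>'\<close>: started in \<open>\<sigma>\<close>, the program \<open>p\<close> halts in \<open>\<sigma>'\<close> after exactly \<open>t\<close> steps.\<close>

inductive exec :: "program \<Rightarrow> state \<Rightarrow> nat \<Rightarrow> state \<Rightarrow> bool" where
  exec_Skip: "exec Skip (R, M) 1 (R, M)"
| exec_Const: "exec (Const x k) (R, M) 1 (R(x := k), M)"
| exec_Add: "exec (Add x y z) (R, M) 1 (R(x := R y + R z), M)"
| exec_Sub: "exec (Sub x y z) (R, M) 1 (R(x := R y - R z), M)"
| exec_Load: "exec (Load x y) (R, M) 1 (R(x := M (R y)), M)"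
| exec_Store: "exec (Store x y) (R, M) 1 (R, M(R x := R y))"
| exec_Seq: "exec p \<sigma> t \<sigma>' \<Longrightarrow> exec q \<sigma>' t' \<sigma>'' \<Longrightarrow> exec (Seq p q) \<sigma> (t + t') \<sigma>''"
| exec_IfPos_True: "0 < R x \<Longrightarrow> exec p (R, M) t \<sigma> \<Longrightarrow> exec (IfPos x p q) (R, M) (1 + t) \<sigma>"
| exec_IfPos_False: "R x = 0 \<Longrightarrow> exec q (R, M) t \<sigma> \<Longrightarrow> exec (IfPos x p q) (R, M) (1 + t) \<sigma>"
| exec_WhilePos_True:
    "0 < R x \<Longrightarrow> exec p (R, M) t \<sigma> \<Longrightarrow> exec (WhilePos x p) \<sigma> t' \<sigma>' \<Longrightarrow>
     exec (WhilePos x p) (R, M) (1 + t + t') \<sigma>'"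
| exec_WhilePos_False: "R x = 0 \<Longrightarrow> exec (WhilePos x p) (R, M) 1 (R, M)"

text \<open>
  Input: a list \<open>vs\<close> enumerates the \<open>n\<close> vertices.  Register 0 contains \<open>n\<close>, memory cells
  \<open>0, \<dots>, n * n - 1\<close> contain the adjacency matrix row by row, and everything else is 0.
\<close>

definition graph_input :: "'a list \<Rightarrow> ('a, 'b) pre_digraph \<Rightarrow> state" where
  "graph_input vs G =
     (let n = length vs in
       ((\<lambda>_. 0)(0 := n),
        (\<lambda>k. if k < n * n \<and> (vs ! (k div n)) \<rightarrow>\<^bsub>G\<^esub> (vs ! (k mod n)) then 1 else 0)))"

text \<open>
  Output: register 0 contains the number of sets, and from the address in register 1 on, the
  memory contains their characteristic vectors of length \<open>n\<close> one after the other.  As the number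
  of sets equals the cardinality of the family, no set is listed twice.
\<close>

definition family_output :: "'a list \<Rightarrow> 'a set set \<Rightarrow> state \<Rightarrow> bool" where
  "family_output vs P \<sigma> \<longleftrightarrow>
     (case \<sigma> of (R, M) \<Rightarrow>
       R 0 = card P \<and>
       P = (\<lambda>j. {vs ! i | i. i < length vs \<and> M (R 1 + j * length vs + i) = 1}) ` {..<R 0})"

end

theory Submission
  imports Defs
begin

text \<open>
  Call a connected set \<open>C\<close> with at most \<open>2\<eta> + 2\<close> neighbors small if it can be searched with \<open>3\<eta> + 3\<close>
  guards, that is, if \<open>C\<close> and its neighbors have a tree decomposition with bags of this size and all
  neighbors in the root bag.  Every such \<open>C\<close> that avoids a treewidth-\<open>\<eta>\<close> modulator is small.  Hence if
  some \<open>C\<close> can be searched with \<open>5\<eta> + 5\<close> guards but not with \<open>3\<eta> + 3\<close>, then all these \<open>C\<close>, together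
  with their neighbors, form a family all of whose members are hit by every modulator.

  Otherwise, small sets are closed under intersecting unions with few neighbors, and the argument for
  important separators shows that a vertex lies in at most \<open>4 ^ (2\<eta> + 2)\<close> maximal small sets.  The
  family consists of the neighborhoods \<open>S\<close> of maximal small sets, each filled up with all maximal small
  sets attached to it, and of the edges between the vertices that lie in no small set.  Given a modulator
  \<open>X\<close>, mark the vertices outside \<open>X\<close> in the neighborhoods and edges hit by \<open>X\<close>, and close the
  corresponding bags of a tree decomposition of \<open>G - X\<close> under lowest common ancestors: the bags obtained
  are few compared to the members hit, and the rest of \<open>G - X\<close> splits into few regions attached to
  at most \<open>2\<eta> + 2\<close> vertices.  Components of the regions are small, so a member of the family that is not hit meets one of the bags or
  has its neighborhood inside the attachment of a region.  This bounds the number of those members.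

  Reachability and the existence of winning strategies are least fixed points of monotone operators on
  tables indexed by \<open>O(\<eta>)\<close> vertices, which a random access machine can iterate.
\<close>

text \<open>Bags have at most \<open>\<eta> + 1\<close> vertices. A region is attached to at most
  two marked bags, whence the bound \<open>2 * \<eta> + 2\<close> on neighborhoods. Searching a
  component of such a region means descending a decomposition while its neighborhood stays guarded:
  \<open>(\<eta> + 1) + (2 * \<eta> + 2) = 3 * \<eta> + 3\<close> guards. Uniting two small sets or
  shrinking one costs \<open>2 * \<eta> + 2\<close> more guards, hence
  \<open>5 * \<eta> + 5\<close>. Repeating this would let the number of guards drift upwards. The
  case distinction prevents it: either some set lies in the gap between both numbers, or the
  additional guards can always be saved again.

  Searching replaces treewidth because it can be decided by such iterations and still yields tree
  decompositions, so that the members of the family are protrusions.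

  Since the treewidth exceeds \<open>\<eta> > 0\<close>, there are at least two vertices, and
  constant factors can be absorbed into the exponent of \<open>n\<close>. It remains to keep
  exponents linear in \<open>\<eta>\<close>: tuples have length \<open>O(\<eta>)\<close>, and apart
  from operations on tuples the formulas to be decided have a shape independent of
  \<open>\<eta>\<close>.\<close>

section \<open>Programs of the random access machine as functions on states\<close>

lemma exec_subst: "exec p \<sigma> t \<sigma>' \<Longrightarrow> t = t2 \<Longrightarrow> \<sigma>' = \<sigma>2 \<Longrightarrow> exec p \<sigma> t2 \<sigma>2"
  by simp

text \<open>Induction on the number of remaining rounds. The invariant fixes the loop register to
  \<open>n - i\<close>, so exactly \<open>n\<close> rounds are run; the bound charges one test for
  each of them and one for leaving the loop.\<close>

lemma exec_counting_loop:
  assumes body: "\<And>i R M. i < n \<Longrightarrow> I i R M \<Longrightarrow>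
      \<exists>R' M' t. exec p (R, M) t (R', M') \<and> t \<le> T \<and> I (Suc i) R' M'"
    and counter: "\<And>i R M. i \<le> n \<Longrightarrow> I i R M \<Longrightarrow> R q = n - i"
    and init: "I 0 R M"
  shows "\<exists>R' M' t. exec (WhilePos q p) (R, M) t (R', M') \<and> t \<le> n * (T + 1) + 1 \<and> I n R' M'"
proof -
  have "i \<le> n \<Longrightarrow> I i R M \<Longrightarrow>
      \<exists>R' M' t. exec (WhilePos q p) (R, M) t (R', M') \<and> t \<le> (n - i) * (T + 1) + 1 \<and> I n R' M'"
    for i R M
  proof (induction "n - i" arbitrary: i R M)
    case 0
    then have "R q = 0" using counter by simp
    then have "exec (WhilePos q p) (R, M) 1 (R, M)" by (rule exec_WhilePos_False)
    moreover have "i = n" using 0 by simp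
    ultimately show ?case using 0 by force
  next
    case (Suc d)
    then have i: "i < n" by simp
    obtain R1 M1 t1 where 1: "exec p (R, M) t1 (R1, M1)" "t1 \<le> T" "I (Suc i) R1 M1"
      using body[OF i Suc.prems(2)] by blast
    obtain R2 M2 t2 where 2: "exec (WhilePos q p) (R1, M1) t2 (R2, M2)"
        "t2 \<le> (n - Suc i) * (T + 1) + 1" "I n R2 M2"
      using Suc.hyps(1)[of "Suc i" R1 M1] Suc.hyps(2) i 1 by fastforce
    have "0 < R q" using counter[OF Suc.prems] i by simp
    then have "exec (WhilePos q p) (R, M) (1 + t1 + t2) (R2, M2)"
      by (rule exec_WhilePos_True[OF _ 1(1) 2(1)])
    moreover have "1 + t1 + t2 \<le> (n - i) * (T + 1) + 1"
    proof -
      have "n - i = Suc (n - Suc i)" using i by simp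
      then show ?thesis using 1 2 by simp
    qed
    ultimately show ?case using 2 by blast
  qed
  from this[of 0 R M] init show ?thesis by simp
qed

text \<open>
  Shallow embedding: a state \<open>(e, M)\<close> assigns values \<open>e\<close> to variables and \<open>M\<close> to memory.
  Variable \<open>x\<close> lives in register \<open>2 * x\<close>, variable 0 holds \<open>n\<close>, and the odd registers are
  temporaries, register 1 holding the value of an expression.
\<close>

definition computes :: "nat \<Rightarrow> (state \<Rightarrow> nat) \<Rightarrow> bool" where
  "computes d h \<longleftrightarrow> (\<exists>p k. \<forall>R M. 2 \<le> R 0 \<longrightarrow>
     (\<exists>R' t. exec p (R, M) t (R', M) \<and> t \<le> R 0 ^ d \<and> R' 1 = h (\<lambda>x. R (2 * x), M) \<and>
        (\<forall>y. even y \<or> k \<le> y \<longrightarrow> R' y = R y)))"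

text \<open>Odd registers from \<open>k\<close> on survive, so an enclosing loop can keep its
  counter in a fresh odd register, out of reach of its body.\<close>

definition runs :: "nat \<Rightarrow> (state \<Rightarrow> state) \<Rightarrow> bool" where
  "runs d f \<longleftrightarrow> (\<exists>p k. \<forall>R M. 2 \<le> R 0 \<longrightarrow>
     (\<exists>R' M' t. exec p (R, M) t (R', M') \<and> t \<le> R 0 ^ d \<and>
        (\<lambda>x. R' (2 * x), M') = f (\<lambda>x. R (2 * x), M) \<and>
        (\<forall>y. odd y \<and> k \<le> y \<longrightarrow> R' y = R y)))"

lemma power_mono_exp: "a \<le> b \<Longrightarrow> 2 \<le> (n::nat) \<Longrightarrow> n ^ a \<le> n ^ b"
  by (simp add: power_increasing)

text \<open>Constant factors turn into factors of \<open>n\<close>, because \<open>n\<close> is at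
  least 2. In this way all running times are kept in the pure form \<open>n ^ d\<close>.\<close>

lemma power_ge_mult: "2 \<le> (n::nat) \<Longrightarrow> 2 ^ k * n ^ d \<le> n ^ (d + k)"
  by (simp add: power_add mult.commute power_mono)

lemma power_ge_one: "2 \<le> (n::nat) \<Longrightarrow> 1 \<le> n ^ d"
  by simp

text \<open>One factor of \<open>n\<close> pays for the rounds and four more for the constant 16.
  The 11 steps are the setup and cleanup of \<open>computes_sum\<close>, the more expensive of the
  two kinds of loops.\<close>

lemma loop_time:
  assumes n: "2 \<le> (n::nat)" and t: "t \<le> n * (n ^ d + c) + 1" and c: "c \<le> 4"
  shows "t + 11 \<le> n ^ (d + 5)"
proof -
  define y where "y = n * n ^ d"
  have "n * 1 \<le> n * n ^ d" using n by (intro mult_le_mono2) simp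
  then have "n \<le> y" by (simp add: y_def)
  have "n * c \<le> n * 4" using c by (rule mult_le_mono2)
  then have "t \<le> y + 4 * n + 1" using t unfolding y_def distrib_left by linarith
  then have "t + 11 \<le> 16 * y" using \<open>n \<le> y\<close> n by linarith
  also have "\<dots> = 2 ^ 4 * n ^ Suc d" unfolding y_def by simp
  also have "\<dots> \<le> n ^ (Suc d + 4)" using n by (rule power_ge_mult)
  also have "Suc d + 4 = d + 5" by simp
  finally show ?thesis .
qed

lemma computes_mono:
  assumes "computes d h" "d \<le> d'"
  shows "computes d' h"
proof -
  obtain p k where p: "\<forall>R M. 2 \<le> R 0 \<longrightarrow>
     (\<exists>R' t. exec p (R, M) t (R', M) \<and> t \<le> R 0 ^ d \<and> R' 1 = h (\<lambda>x. R (2 * x), M) \<and>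
        (\<forall>y. even y \<or> k \<le> y \<longrightarrow> R' y = R y))"
    using assms(1) unfolding computes_def by auto
  show ?thesis
    unfolding computes_def
  proof (intro exI[of _ p] exI[of _ k] allI impI)
    fix R M :: "nat \<Rightarrow> nat"
    assume n: "2 \<le> R 0"
    then obtain R' t where *: "exec p (R, M) t (R', M)" "t \<le> R 0 ^ d"
        "R' 1 = h (\<lambda>x. R (2 * x), M)" "\<forall>y. even y \<or> k \<le> y \<longrightarrow> R' y = R y"
      using p[rule_format, of R M] by auto
    have "t \<le> R 0 ^ d'" using *(2) power_mono_exp[OF assms(2) n] by (rule le_trans)
    then show "\<exists>R' t. exec p (R, M) t (R', M) \<and> t \<le> R 0 ^ d' \<and> R' 1 = h (\<lambda>x. R (2 * x), M) \<and>
        (\<forall>y. even y \<or> k \<le> y \<longrightarrow> R' y = R y)"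
      using * by (intro exI[of _ R'] exI[of _ t]) simp
  qed
qed

lemma runs_mono:
  assumes "runs d f" "d \<le> d'"
  shows "runs d' f"
proof -
  obtain p k where p: "\<forall>R M. 2 \<le> R 0 \<longrightarrow>
     (\<exists>R' M' t. exec p (R, M) t (R', M') \<and> t \<le> R 0 ^ d \<and>
        (\<lambda>x. R' (2 * x), M') = f (\<lambda>x. R (2 * x), M) \<and>
        (\<forall>y. odd y \<and> k \<le> y \<longrightarrow> R' y = R y))"
    using assms(1) unfolding runs_def by auto
  show ?thesis
    unfolding runs_def
  proof (intro exI[of _ p] exI[of _ k] allI impI)
    fix R M :: "nat \<Rightarrow> nat"
    assume n: "2 \<le> R 0"
    then obtain R' M' t where *: "exec p (R, M) t (R', M')" "t \<le> R 0 ^ d"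
        "(\<lambda>x. R' (2 * x), M') = f (\<lambda>x. R (2 * x), M)" "\<forall>y. odd y \<and> k \<le> y \<longrightarrow> R' y = R y"
      using p[rule_format, of R M] by auto
    have "t \<le> R 0 ^ d'" using *(2) power_mono_exp[OF assms(2) n] by (rule le_trans)
    then show "\<exists>R' M' t. exec p (R, M) t (R', M') \<and> t \<le> R 0 ^ d' \<and>
        (\<lambda>x. R' (2 * x), M') = f (\<lambda>x. R (2 * x), M) \<and>
        (\<forall>y. odd y \<and> k \<le> y \<longrightarrow> R' y = R y)"
      using * by (intro exI[of _ R'] exI[of _ M'] exI[of _ t]) simp
  qed
qed

lemma computes_const: "computes 0 (\<lambda>s. k)"
proof -
  have "exec (Const 1 k) (R, M) 1 (R(1 := k), M)" for R M
    by (rule exec_Const)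
  then show ?thesis unfolding computes_def
    by (intro exI[of _ "Const 1 k"] exI[of _ 2] allI impI) (fastforce)
qed

lemma computes_var: "computes 1 (\<lambda>s. fst s x)"
proof -
  have "exec (Seq (Const 1 0) (Add 1 1 (2 * x))) (R, M) (1 + 1) (R(1 := R (2 * x)), M)" for R M
    by (rule exec_subst, rule exec_Seq, rule exec_Const, rule exec_Add) (auto simp: fun_eq_iff)
  then show ?thesis unfolding computes_def
    by (intro exI[of _ "Seq (Const 1 0) (Add 1 1 (2 * x))"] exI[of _ 2] allI impI) (fastforce)
qed

text \<open>The first value is parked in an odd register \<open>c\<close> beyond the temporaries of
  both programs, so that evaluating the second operand cannot destroy it.\<close>

lemma computes_binary:
  assumes 1: "computes d1 h1" and 2: "computes d2 h2"
    and op: "\<And>c R M. exec (op c) (R, M) 1 (R(1 := g (R c) (R 1)), M)"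
  shows "computes (max d1 d2 + 3) (\<lambda>s. g (h1 s) (h2 s))"
proof -
  obtain p1 k1 where p1: "\<forall>R M. 2 \<le> R 0 \<longrightarrow>
     (\<exists>R' t. exec p1 (R, M) t (R', M) \<and> t \<le> R 0 ^ d1 \<and> R' 1 = h1 (\<lambda>x. R (2 * x), M) \<and>
        (\<forall>y. even y \<or> k1 \<le> y \<longrightarrow> R' y = R y))"
    using 1 unfolding computes_def by auto
  obtain p2 k2 where p2: "\<forall>R M. 2 \<le> R 0 \<longrightarrow>
     (\<exists>R' t. exec p2 (R, M) t (R', M) \<and> t \<le> R 0 ^ d2 \<and> R' 1 = h2 (\<lambda>x. R (2 * x), M) \<and>
        (\<forall>y. even y \<or> k2 \<le> y \<longrightarrow> R' y = R y))"
    using 2 unfolding computes_def by auto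
  define c where "c = 2 * (k1 + k2) + 3"
  have c: "odd c" "k1 \<le> c" "k2 \<le> c" "c \<noteq> 1" "1 < c"
    by (auto simp: c_def)
  define p where "p = Seq p1 (Seq (Const c 0) (Seq (Add c c 1) (Seq p2 (op c))))"
  show ?thesis
    unfolding computes_def
  proof (intro exI[of _ p] exI[of _ "c + 1"] allI impI)
    fix R M :: "nat \<Rightarrow> nat"
    assume n: "2 \<le> R 0"
    obtain R1 t1 where R1: "exec p1 (R, M) t1 (R1, M)" "t1 \<le> R 0 ^ d1"
        "R1 1 = h1 (\<lambda>x. R (2 * x), M)" "\<And>y. even y \<or> k1 \<le> y \<Longrightarrow> R1 y = R y"
      using p1[rule_format, of R M, OF n] by blast
    define S where "S = R1(c := R1 1)"
    have S0: "S 0 = R 0" using R1(4)[of 0] c by (simp add: S_def)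
    have Sx: "S (2 * x) = R (2 * x)" for x using R1(4)[of "2 * x"] c
      by (auto simp: S_def)
    obtain R2 t2 where R2: "exec p2 (S, M) t2 (R2, M)" "t2 \<le> R 0 ^ d2"
        "R2 1 = h2 (\<lambda>x. S (2 * x), M)" "\<And>y. even y \<or> k2 \<le> y \<Longrightarrow> R2 y = S y"
      using p2[rule_format, of S M] n S0 by auto
    have "exec p (R, M) (t1 + (1 + (1 + (t2 + 1)))) (R2(1 := g (R2 c) (R2 1)), M)"
      unfolding p_def
    proof (rule exec_Seq[OF R1(1)], rule exec_Seq[OF exec_Const], rule exec_Seq[OF _ exec_Seq[OF R2(1) op]])
      have "(R1(c := 0))(c := (R1(c := 0)) c + (R1(c := 0)) 1) = S"
        using c by (auto simp: S_def fun_eq_iff)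
      then show "exec (Add c c 1) (R1(c := 0), M) 1 (S, M)"
        by (metis exec_Add)
    qed
    moreover have "t1 + (1 + (1 + (t2 + 1))) \<le> R 0 ^ (max d1 d2 + 3)"
    proof -
      have "t1 \<le> R 0 ^ max d1 d2" "t2 \<le> R 0 ^ max d1 d2" "1 \<le> R 0 ^ max d1 d2"
        using R1(2) R2(2) n power_mono_exp[of d1 "max d1 d2"] power_mono_exp[of d2 "max d1 d2"]
        by (auto intro: le_trans)
      then show ?thesis using power_ge_mult[OF n, of 3 "max d1 d2"] by simp
    qed
    moreover have "R2 c = h1 (\<lambda>x. R (2 * x), M)"
      using R2(4)[of c] c R1(3) by (simp add: S_def)
    moreover have "R2 1 = h2 (\<lambda>x. R (2 * x), M)"
      using R2(3) Sx by simp
    moreover have "(R2(1 := g (R2 c) (R2 1))) y = R y" if "even y \<or> c + 1 \<le> y" for y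
    proof -
      have "y \<noteq> 1" "y \<noteq> c" using that c by auto
      moreover have "R2 y = S y" "R1 y = R y"
        using that R2(4)[of y] R1(4)[of y] c by auto
      ultimately show ?thesis by (simp add: S_def)
    qed
    ultimately show "\<exists>R' t. exec p (R, M) t (R', M) \<and> t \<le> R 0 ^ (max d1 d2 + 3) \<and>
        R' 1 = g (h1 (\<lambda>x. R (2 * x), M)) (h2 (\<lambda>x. R (2 * x), M)) \<and>
        (\<forall>y. even y \<or> c + 1 \<le> y \<longrightarrow> R' y = R y)"
      by (intro exI[of _ "R2(1 := g (R2 c) (R2 1))"] exI[of _ "t1 + (1 + (1 + (t2 + 1)))"]) simp
  qed
qed

lemma computes_plus:
  assumes "computes d1 h1" "computes d2 h2"
  shows "computes (max d1 d2 + 3) (\<lambda>s. h1 s + h2 s)"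
  by (rule computes_binary[OF assms, where op = "\<lambda>c. Add 1 c 1"]) (rule exec_Add)

lemma computes_minus:
  assumes "computes d1 h1" "computes d2 h2"
  shows "computes (max d1 d2 + 3) (\<lambda>s. h1 s - h2 s)"
  by (rule computes_binary[OF assms, where op = "\<lambda>c. Sub 1 c 1"]) (rule exec_Sub)

lemma computes_load:
  assumes "computes d h"
  shows "computes (d + 1) (\<lambda>s. snd s (h s))"
proof -
  obtain p k where p: "\<forall>R M. 2 \<le> R 0 \<longrightarrow>
     (\<exists>R' t. exec p (R, M) t (R', M) \<and> t \<le> R 0 ^ d \<and> R' 1 = h (\<lambda>x. R (2 * x), M) \<and>
        (\<forall>y. even y \<or> k \<le> y \<longrightarrow> R' y = R y))"
    using assms unfolding computes_def by auto
  show ?thesis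
    unfolding computes_def
  proof (intro exI[of _ "Seq p (Load 1 1)"] exI[of _ "k + 2"] allI impI)
    fix R M :: "nat \<Rightarrow> nat"
    assume n: "2 \<le> R 0"
    obtain R1 t1 where R1: "exec p (R, M) t1 (R1, M)" "t1 \<le> R 0 ^ d"
        "R1 1 = h (\<lambda>x. R (2 * x), M)" "\<And>y. even y \<or> k \<le> y \<Longrightarrow> R1 y = R y"
      using p[rule_format, of R M, OF n] by blast
    have "exec (Seq p (Load 1 1)) (R, M) (t1 + 1) (R1(1 := M (R1 1)), M)"
      by (rule exec_Seq[OF R1(1) exec_Load])
    moreover have "t1 + 1 \<le> R 0 ^ (d + 1)"
      using power_ge_mult[OF n, of 1 d] R1(2) power_ge_one[OF n, of d]
      unfolding power_one_right by linarith
    moreover have "(R1(1 := M (R1 1))) y = R y" if "even y \<or> k + 2 \<le> y" for y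
      using that R1(4)[of y] by auto
    ultimately show "\<exists>R' t. exec (Seq p (Load 1 1)) (R, M) t (R', M) \<and> t \<le> R 0 ^ (d + 1) \<and>
        R' 1 = snd (\<lambda>x. R (2 * x), M) (h (\<lambda>x. R (2 * x), M)) \<and>
        (\<forall>y. even y \<or> k + 2 \<le> y \<longrightarrow> R' y = R y)"
      using R1(3) by (intro exI[of _ "R1(1 := M (R1 1))"] exI[of _ "t1 + 1"]) (simp del: One_nat_def)
  qed
qed

text \<open>A loop over \<open>x\<close> with accumulator \<open>a\<close>, countdown
  \<open>q\<close> and the constant 1 in \<open>u\<close>, all in odd registers that
  \<open>p\<close> leaves alone. The old value of \<open>x\<close> is saved in \<open>s\<close> and
  restored at the end; thus the sum is again an expression without side effects and can be
  nested.\<close>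

lemma computes_sum:
  assumes "computes d h" "x \<noteq> 0"
  shows "computes (d + 5) (\<lambda>s. \<Sum>v<fst s 0. h ((fst s)(x := v), snd s))"
proof -
  obtain p k where p: "\<forall>R M. 2 \<le> R 0 \<longrightarrow>
     (\<exists>R' t. exec p (R, M) t (R', M) \<and> t \<le> R 0 ^ d \<and> R' 1 = h (\<lambda>x. R (2 * x), M) \<and>
        (\<forall>y. even y \<or> k \<le> y \<longrightarrow> R' y = R y))"
    using assms unfolding computes_def by auto
  define a where "a = 2 * k + 3"
  define s where "s = 2 * k + 5"
  define q where "q = 2 * k + 7"
  define u where "u = 2 * k + 9"
  define X where "X = 2 * x"
  have neq: "a \<noteq> 0" "s \<noteq> 0" "q \<noteq> 0" "u \<noteq> 0" "X \<noteq> 0" "a \<noteq> s" "a \<noteq> q" "a \<noteq> u" "s \<noteq> q" "s \<noteq> u" "q \<noteq> u"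
      "a \<noteq> X" "s \<noteq> X" "q \<noteq> X" "u \<noteq> X" "a \<noteq> 1" "s \<noteq> 1" "q \<noteq> 1" "u \<noteq> 1" "X \<noteq> 1"
      "odd a" "odd s" "odd q" "odd u" "even X" "k \<le> a" "k \<le> s" "k \<le> q" "k \<le> u"
      "a < u + 1" "s < u + 1" "q < u + 1"
  proof -
    have par: "odd a" "odd s" "odd q" "odd u" "even X"
      by (simp_all add: a_def s_def q_def u_def X_def)
    have ord: "k \<le> a" "1 < a" "a < s" "s < q" "q < u"
      by (simp_all add: a_def s_def q_def u_def)
    have X: "X \<noteq> 0" using assms(2) by (simp add: X_def)
    have "a \<noteq> X" "s \<noteq> X" "q \<noteq> X" "u \<noteq> X" "X \<noteq> 1" using par by auto
    then show "a \<noteq> 0" "s \<noteq> 0" "q \<noteq> 0" "u \<noteq> 0" "X \<noteq> 0" "a \<noteq> s" "a \<noteq> q" "a \<noteq> u" "s \<noteq> q" "s \<noteq> u" "q \<noteq> u"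
      "a \<noteq> X" "s \<noteq> X" "q \<noteq> X" "u \<noteq> X" "a \<noteq> 1" "s \<noteq> 1" "q \<noteq> 1" "u \<noteq> 1" "X \<noteq> 1"
      "odd a" "odd s" "odd q" "odd u" "even X" "k \<le> a" "k \<le> s" "k \<le> q" "k \<le> u"
      "a < u + 1" "s < u + 1" "q < u + 1"
      using par ord X by simp_all
  qed
  define b where "b = Seq p (Seq (Add a a 1) (Seq (Add X X u) (Sub q q u)))"
  \<comment> \<open>There is no move instruction: a copy is a reset to 0 followed by an
    addition.\<close>
  define init where "init = Seq (Const a 0) (Seq (Const s 0) (Seq (Add s s X) (Seq (Const X 0)
      (Seq (Const q 0) (Seq (Add q q 0) (Const u 1))))))"
  define fin where "fin = Seq (Const X 0) (Seq (Add X X s) (Seq (Const 1 0) (Add 1 1 a)))"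
  show ?thesis
    unfolding computes_def
  proof (intro exI[of _ "Seq init (Seq (WhilePos q b) fin)"] exI[of _ "u + 1"] allI impI)
    fix R M :: "nat \<Rightarrow> nat"
    assume n: "2 \<le> R 0"
    define n where "n = R 0"
    define H where "H = (\<lambda>v. h ((\<lambda>x. R (2 * x))(x := v), M))"
    define R0 where "R0 = R(a := 0, s := R X, X := 0, q := n, u := 1)"
    have "exec init (R, M) (1 + (1 + (1 + (1 + (1 + (1 + 1)))))) (R0, M)"
      unfolding init_def
      by (rule exec_subst, (rule exec_Seq exec_Const exec_Add)+)
        (use neq in \<open>auto simp: fun_eq_iff R0_def n_def\<close>)
    then have init: "exec init (R, M) 7 (R0, M)" by (simp add: eval_nat_numeral)
    define I where "I = (\<lambda>i Q M'. M' = M \<and> Q a = (\<Sum>v<i. H v) \<and> Q s = R X \<and> Q X = i \<and>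
        Q q = n - i \<and> Q u = 1 \<and>
        (\<forall>y. (even y \<or> u + 1 \<le> y) \<and> y \<noteq> X \<longrightarrow> Q y = R y))"
    have "\<exists>Q' M' t. exec (WhilePos q b) (R0, M) t (Q', M') \<and> t \<le> n * (n ^ d + 3 + 1) + 1 \<and> I n Q' M'"
    proof (rule exec_counting_loop)
      show "I 0 R0 M" using neq unfolding I_def R0_def by auto
      show "Q q = n - i" if "I i Q N" for i Q N using that by (simp add: I_def)
      fix i Q N
      assume i: "i < n" and I: "I i Q N"
      have Q0: "Q 0 = n" using I neq by (auto simp: I_def n_def)
      obtain Q1 t1 where Q1: "exec p (Q, M) t1 (Q1, M)" "t1 \<le> n ^ d"
        "Q1 1 = h (\<lambda>x. Q (2 * x), M)" "\<And>y. even y \<or> k \<le> y \<Longrightarrow> Q1 y = Q y"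
        using p[rule_format, of Q M] n Q0 n_def by auto
      have "(\<lambda>x. Q (2 * x)) = (\<lambda>x. R (2 * x))(x := i)"
        using I by (auto simp: I_def fun_eq_iff X_def)
      then have v: "Q1 1 = H i" using Q1(3) by (simp add: H_def)
      define Q2 where "Q2 = Q1(a := Q1 a + Q1 1, X := Q1 X + Q1 u, q := Q1 q - Q1 u)"
      have e: "exec b (Q, M) (t1 + (1 + (1 + 1))) (Q2, M)"
        unfolding b_def
        by (rule exec_subst, rule exec_Seq[OF Q1(1)], (rule exec_Seq exec_Const exec_Add exec_Sub)+)
          (use neq in \<open>auto simp: fun_eq_iff Q2_def\<close>)
      have "I (Suc i) Q2 M"
      proof -
        have "Q1 a = Q a" "Q1 X = Q X" "Q1 u = Q u" "Q1 q = Q q" "Q1 s = Q s"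
          using Q1(4) neq by auto
        moreover have "Q1 y = R y" if "even y \<or> u + 1 \<le> y" "y \<noteq> X" for y
        proof -
          have "k \<le> u" using neq by simp
          then have "Q1 y = Q y" using Q1(4)[of y] that by auto
          then show ?thesis using that I by (auto simp: I_def)
        qed
        ultimately show ?thesis using I neq v unfolding I_def Q2_def
          by auto
      qed
      then show "\<exists>R' M' t. exec b (Q, N) t (R', M') \<and> t \<le> n ^ d + 3 \<and> I (Suc i) R' M'"
        using e Q1(2) I by (intro exI[of _ Q2] exI[of _ M] exI[of _ "t1 + (1 + (1 + 1))"]) (simp add: I_def)
    qed
    then obtain Q N t where QN: "exec (WhilePos q b) (R0, M) t (Q, N)" "t \<le> n * (n ^ d + 3 + 1) + 1" "I n Q N"
      by blast
    moreover have "N = M" using QN(3) by (simp add: I_def)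
    ultimately have Q: "exec (WhilePos q b) (R0, M) t (Q, M)" "t \<le> n * (n ^ d + 4) + 1" "I n Q M"
      by (auto simp: add.commute)
    define Q' where "Q' = Q(X := R X, 1 := (\<Sum>v<n. H v))"
    have "exec fin (Q, M) (1 + (1 + (1 + 1))) (Q', M)"
      unfolding fin_def
      by (rule exec_subst, (rule exec_Seq exec_Const exec_Add)+)
        (use neq Q(3) in \<open>auto simp: fun_eq_iff Q'_def I_def\<close>)
    then have fin: "exec fin (Q, M) 4 (Q', M)" by (simp add: eval_nat_numeral)
    have "exec (Seq init (Seq (WhilePos q b) fin)) (R, M) (7 + (t + 4)) (Q', M)"
      by (rule exec_Seq[OF init exec_Seq[OF Q(1) fin]])
    moreover have "7 + (t + 4) \<le> R 0 ^ (d + 5)"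
    proof -
      have n2: "2 \<le> n" using n n_def by simp
      have "7 + (t + 4) = t + 11" by simp
      also have "\<dots> \<le> n ^ (d + 5)" by (rule loop_time[OF n2 Q(2) order_refl])
      finally show ?thesis unfolding n_def .
    qed
    moreover have "Q' y = R y" if "even y \<or> u + 1 \<le> y" for y
    proof -
      have "y \<noteq> 1" using that neq(4,19,32) by auto
      moreover have "y \<noteq> X \<Longrightarrow> Q y = R y" using Q(3) that unfolding I_def by blast
      ultimately show ?thesis by (simp add: Q'_def)
    qed
    moreover have "Q' 1 = (\<Sum>v<n. H v)" by (simp add: Q'_def)
    ultimately show "\<exists>R' t. exec (Seq init (Seq (WhilePos q b) fin)) (R, M) t (R', M) \<and> t \<le> R 0 ^ (d + 5) \<and>
        R' 1 = (\<Sum>v<fst (\<lambda>x. R (2 * x), M) 0. h ((fst (\<lambda>x. R (2 * x), M))(x := v), snd (\<lambda>x. R (2 * x), M))) \<and>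
        (\<forall>y. even y \<or> u + 1 \<le> y \<longrightarrow> R' y = R y)"
      by (intro exI[of _ Q'] exI[of _ "7 + (t + 4)"]) (simp add: H_def n_def)
  qed
qed

lemma computesE:
  assumes "computes d h"
  obtains p k where "\<And>R M. 2 \<le> R (0::nat) \<Longrightarrow>
     \<exists>R' t. exec p (R, M) t (R', M) \<and> t \<le> R 0 ^ d \<and> R' 1 = h (\<lambda>x. R (2 * x), M) \<and>
        (\<forall>y. even y \<or> k \<le> y \<longrightarrow> R' y = R y)"
  using assms unfolding computes_def by (elim exE) (rule that, blast)

lemma runsE:
  assumes "runs d f"
  obtains p k where "\<And>R M. 2 \<le> R (0::nat) \<Longrightarrow>
     \<exists>R' M' t. exec p (R, M) t (R', M') \<and> t \<le> R 0 ^ d \<and>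
        (\<lambda>x. R' (2 * x), M') = f (\<lambda>x. R (2 * x), M) \<and>
        (\<forall>y. odd y \<and> k \<le> y \<longrightarrow> R' y = R y)"
  using assms unfolding runs_def by (elim exE) (rule that, blast)

lemma runs_assign:
  assumes "computes d h"
  shows "runs (d + 2) (\<lambda>s. ((fst s)(x := h s), snd s))"
proof -
  obtain p k where p: "\<And>R M. 2 \<le> R 0 \<Longrightarrow>
     \<exists>R' t. exec p (R, M) t (R', M) \<and> t \<le> R 0 ^ d \<and> R' 1 = h (\<lambda>x. R (2 * x), M) \<and>
        (\<forall>y. even y \<or> k \<le> y \<longrightarrow> R' y = R y)"
    using computesE[OF assms] by blast
  define p' where "p' = Seq p (Seq (Const (2 * x) 0) (Add (2 * x) (2 * x) 1))"
  show ?thesis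
    unfolding runs_def
  proof (intro exI[of _ p'] exI[of _ k] allI impI)
    fix R M :: "nat \<Rightarrow> nat"
    assume n: "2 \<le> R 0"
    obtain R1 t1 where R1: "exec p (R, M) t1 (R1, M)" "t1 \<le> R 0 ^ d"
        "R1 1 = h (\<lambda>x. R (2 * x), M)" "\<And>y. even y \<or> k \<le> y \<Longrightarrow> R1 y = R y"
      using p[of R M, OF n] by blast
    have "exec p' (R, M) (t1 + (1 + 1)) (R1(2 * x := R1 1), M)"
      unfolding p'_def
      by (rule exec_Seq[OF R1(1)], rule exec_subst, rule exec_Seq[OF exec_Const exec_Add])
        (auto simp: fun_eq_iff)
    moreover have "t1 + (1 + 1) \<le> R 0 ^ (d + 2)"
      using power_ge_mult[OF n, of 2 d] R1(2) power_ge_one[OF n, of d]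
      unfolding power2_eq_square by linarith
    moreover have "(\<lambda>y. (R1(2 * x := R1 1)) (2 * y)) = (\<lambda>y. R (2 * y))(x := h (\<lambda>x. R (2 * x), M))"
      using R1(3,4) by (auto simp: fun_eq_iff)
    moreover have "(R1(2 * x := R1 1)) y = R y" if "odd y \<and> k \<le> y" for y
    proof -
      have "y \<noteq> 2 * x" "R1 y = R y" using that R1(4)[of y] by auto
      then show ?thesis by simp
    qed
    ultimately show "\<exists>R' M' t. exec p' (R, M) t (R', M') \<and> t \<le> R 0 ^ (d + 2) \<and>
        (\<lambda>x. R' (2 * x), M') = ((fst (\<lambda>x. R (2 * x), M))(x := h (\<lambda>x. R (2 * x), M)), snd (\<lambda>x. R (2 * x), M)) \<and>
        (\<forall>y. odd y \<and> k \<le> y \<longrightarrow> R' y = R y)"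
      by (intro exI[of _ "R1(2 * x := R1 1)"] exI[of _ M] exI[of _ "t1 + (1 + 1)"]) simp
  qed
qed

lemma runs_store:
  assumes "computes d1 h1" "computes d2 h2"
  shows "runs (max d1 d2 + 3) (\<lambda>s. (fst s, (snd s)(h1 s := h2 s)))"
proof -
  obtain p1 k1 where p1: "\<And>R M. 2 \<le> R 0 \<Longrightarrow>
     \<exists>R' t. exec p1 (R, M) t (R', M) \<and> t \<le> R 0 ^ d1 \<and> R' 1 = h1 (\<lambda>x. R (2 * x), M) \<and>
        (\<forall>y. even y \<or> k1 \<le> y \<longrightarrow> R' y = R y)"
    using computesE[OF assms(1)] by blast
  obtain p2 k2 where p2: "\<And>R M. 2 \<le> R 0 \<Longrightarrow>
     \<exists>R' t. exec p2 (R, M) t (R', M) \<and> t \<le> R 0 ^ d2 \<and> R' 1 = h2 (\<lambda>x. R (2 * x), M) \<and>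
        (\<forall>y. even y \<or> k2 \<le> y \<longrightarrow> R' y = R y)"
    using computesE[OF assms(2)] by blast
  define c where "c = 2 * (k1 + k2) + 3"
  have c: "odd c" "k1 \<le> c" "k2 \<le> c" "c \<noteq> 1" "1 < c"
    by (auto simp: c_def)
  define p where "p = Seq p1 (Seq (Const c 0) (Seq (Add c c 1) (Seq p2 (Store c 1))))"
  show ?thesis
    unfolding runs_def
  proof (intro exI[of _ p] exI[of _ "c + 1"] allI impI)
    fix R M :: "nat \<Rightarrow> nat"
    assume n: "2 \<le> R 0"
    obtain R1 t1 where R1: "exec p1 (R, M) t1 (R1, M)" "t1 \<le> R 0 ^ d1"
        "R1 1 = h1 (\<lambda>x. R (2 * x), M)" "\<And>y. even y \<or> k1 \<le> y \<Longrightarrow> R1 y = R y"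
      using p1[of R M, OF n] by blast
    define S where "S = R1(c := R1 1)"
    have S0: "S 0 = R 0" using R1(4)[of 0] c by (simp add: S_def)
    have Sx: "S (2 * x) = R (2 * x)" for x using R1(4)[of "2 * x"] c
      by (auto simp: S_def)
    obtain R2 t2 where R2: "exec p2 (S, M) t2 (R2, M)" "t2 \<le> R 0 ^ d2"
        "R2 1 = h2 (\<lambda>x. S (2 * x), M)" "\<And>y. even y \<or> k2 \<le> y \<Longrightarrow> R2 y = S y"
      using p2[of S M] n S0 by auto
    have "exec p (R, M) (t1 + (1 + (1 + (t2 + 1)))) (R2, M(R2 c := R2 1))"
      unfolding p_def
    proof (rule exec_Seq[OF R1(1)], rule exec_Seq[OF exec_Const],
        rule exec_Seq[OF _ exec_Seq[OF R2(1) exec_Store]])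
      have "(R1(c := 0))(c := (R1(c := 0)) c + (R1(c := 0)) 1) = S"
        using c by (auto simp: S_def fun_eq_iff)
      then show "exec (Add c c 1) (R1(c := 0), M) 1 (S, M)"
        by (metis exec_Add)
    qed
    moreover have "t1 + (1 + (1 + (t2 + 1))) \<le> R 0 ^ (max d1 d2 + 3)"
    proof -
      have "t1 \<le> R 0 ^ max d1 d2" "t2 \<le> R 0 ^ max d1 d2" "1 \<le> R 0 ^ max d1 d2"
        using R1(2) R2(2) n power_mono_exp[of d1 "max d1 d2"] power_mono_exp[of d2 "max d1 d2"]
        by (auto intro: le_trans)
      then show ?thesis using power_ge_mult[OF n, of 3 "max d1 d2"] by simp
    qed
    moreover have "R2 c = h1 (\<lambda>x. R (2 * x), M)"
      using R2(4)[of c] c R1(3) by (simp add: S_def)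
    moreover have "R2 1 = h2 (\<lambda>x. R (2 * x), M)"
      using R2(3) Sx by simp
    moreover have "R2 y = R y" if "even y \<or> c + 1 \<le> y" for y
    proof -
      have "y \<noteq> 1" "y \<noteq> c" using that c by auto
      moreover have "R2 y = S y" "R1 y = R y"
        using that R2(4)[of y] R1(4)[of y] c by auto
      ultimately show ?thesis by (simp add: S_def)
    qed
    ultimately show "\<exists>R' M' t. exec p (R, M) t (R', M') \<and> t \<le> R 0 ^ (max d1 d2 + 3) \<and>
        (\<lambda>x. R' (2 * x), M') = (fst (\<lambda>x. R (2 * x), M), (snd (\<lambda>x. R (2 * x), M))
          (h1 (\<lambda>x. R (2 * x), M) := h2 (\<lambda>x. R (2 * x), M))) \<and>
        (\<forall>y. odd y \<and> c + 1 \<le> y \<longrightarrow> R' y = R y)"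
      by (intro exI[of _ R2] exI[of _ "M(R2 c := R2 1)"] exI[of _ "t1 + (1 + (1 + (t2 + 1)))"]) simp
  qed
qed

text \<open>Time bounds are powers of the value of variable 0 at the start. The bounds of
  consecutive programs refer to the same \<open>n\<close> only if the first program preserves
  it.\<close>

definition keeps_n :: "(state \<Rightarrow> state) \<Rightarrow> bool" where
  "keeps_n f \<longleftrightarrow> (\<forall>s. fst (f s) 0 = fst s 0)"

lemma runs_seq:
  assumes 1: "runs d1 f" and 2: "runs d2 g" and f: "keeps_n f"
  shows "runs (max d1 d2 + 1) (\<lambda>s. g (f s))"
proof -
  obtain p1 k1 where p1: "\<And>R M. 2 \<le> R (0::nat) \<Longrightarrow>
     \<exists>R' M' t. exec p1 (R, M) t (R', M') \<and> t \<le> R 0 ^ d1 \<and>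
        (\<lambda>x. R' (2 * x), M') = f (\<lambda>x. R (2 * x), M) \<and>
        (\<forall>y. odd y \<and> k1 \<le> y \<longrightarrow> R' y = R y)"
    using runsE[OF 1] by blast
  obtain p2 k2 where p2: "\<And>R M. 2 \<le> R (0::nat) \<Longrightarrow>
     \<exists>R' M' t. exec p2 (R, M) t (R', M') \<and> t \<le> R 0 ^ d2 \<and>
        (\<lambda>x. R' (2 * x), M') = g (\<lambda>x. R (2 * x), M) \<and>
        (\<forall>y. odd y \<and> k2 \<le> y \<longrightarrow> R' y = R y)"
    using runsE[OF 2] by blast
  show ?thesis
    unfolding runs_def
  proof (intro exI[of _ "Seq p1 p2"] exI[of _ "max k1 k2"] allI impI)
    fix R M :: "nat \<Rightarrow> nat"
    assume n: "2 \<le> R 0"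
    obtain R1 M1 t1 where R1: "exec p1 (R, M) t1 (R1, M1)" "t1 \<le> R 0 ^ d1"
        "(\<lambda>x. R1 (2 * x), M1) = f (\<lambda>x. R (2 * x), M)" "\<forall>y. odd y \<and> k1 \<le> y \<longrightarrow> R1 y = R y"
      using p1[of R M, OF n] by blast
    have "fst (f (\<lambda>x. R (2 * x), M)) 0 = R 0"
      using f by (simp add: keeps_n_def)
    then have n1: "R1 0 = R 0" unfolding R1(3)[symmetric] by simp
    obtain R2 M2 t2 where R2: "exec p2 (R1, M1) t2 (R2, M2)" "t2 \<le> R 0 ^ d2"
        "(\<lambda>x. R2 (2 * x), M2) = g (\<lambda>x. R1 (2 * x), M1)" "\<forall>y. odd y \<and> k2 \<le> y \<longrightarrow> R2 y = R1 y"
      using p2[of R1 M1] n unfolding n1 by blast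
    have "exec (Seq p1 p2) (R, M) (t1 + t2) (R2, M2)"
      by (rule exec_Seq[OF R1(1) R2(1)])
    moreover have "t1 + t2 \<le> R 0 ^ (max d1 d2 + 1)"
    proof -
      have "t1 \<le> R 0 ^ max d1 d2" "t2 \<le> R 0 ^ max d1 d2"
        using R1(2) R2(2) n power_mono_exp[of d1 "max d1 d2"] power_mono_exp[of d2 "max d1 d2"]
        by (auto intro: le_trans)
      then show ?thesis using power_ge_mult[OF n, of 1 "max d1 d2"]
        unfolding power_one_right by linarith
    qed
    moreover have "(\<lambda>x. R2 (2 * x), M2) = g (f (\<lambda>x. R (2 * x), M))"
      using R1(3) R2(3) by simp
    ultimately show "\<exists>R' M' t. exec (Seq p1 p2) (R, M) t (R', M') \<and> t \<le> R 0 ^ (max d1 d2 + 1) \<and>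
        (\<lambda>x. R' (2 * x), M') = g (f (\<lambda>x. R (2 * x), M)) \<and>
        (\<forall>y. odd y \<and> max k1 k2 \<le> y \<longrightarrow> R' y = R y)"
      using R1(4) R2(4) by (intro exI[of _ R2] exI[of _ M2] exI[of _ "t1 + t2"]) simp
  qed
qed

lemma runs_if:
  assumes 1: "computes d1 h" and 2: "runs d2 f"
  shows "runs (max d1 d2 + 2) (\<lambda>s. if 0 < h s then f s else s)"
proof -
  obtain p1 k1 where p1: "\<And>R M. 2 \<le> R 0 \<Longrightarrow>
     \<exists>R' t. exec p1 (R, M) t (R', M) \<and> t \<le> R 0 ^ d1 \<and> R' 1 = h (\<lambda>x. R (2 * x), M) \<and>
        (\<forall>y. even y \<or> k1 \<le> y \<longrightarrow> R' y = R y)"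
    using computesE[OF 1] by blast
  obtain p2 k2 where p2: "\<And>R M. 2 \<le> R (0::nat) \<Longrightarrow>
     \<exists>R' M' t. exec p2 (R, M) t (R', M') \<and> t \<le> R 0 ^ d2 \<and>
        (\<lambda>x. R' (2 * x), M') = f (\<lambda>x. R (2 * x), M) \<and>
        (\<forall>y. odd y \<and> k2 \<le> y \<longrightarrow> R' y = R y)"
    using runsE[OF 2] by blast
  show ?thesis
    unfolding runs_def
  proof (intro exI[of _ "Seq p1 (IfPos 1 p2 Skip)"] exI[of _ "max k1 k2"] allI impI)
    fix R M :: "nat \<Rightarrow> nat"
    assume n: "2 \<le> R 0"
    obtain R1 t1 where R1: "exec p1 (R, M) t1 (R1, M)" "t1 \<le> R 0 ^ d1"
        "R1 1 = h (\<lambda>x. R (2 * x), M)" "\<And>y. even y \<or> k1 \<le> y \<Longrightarrow> R1 y = R y"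
      using p1[of R M, OF n] by blast
    have n1: "R1 0 = R 0" using R1(4) by simp
    have e: "(\<lambda>x. R1 (2 * x)) = (\<lambda>x. R (2 * x))" using R1(4) by auto
    obtain R2 M2 t2 where R2: "exec p2 (R1, M) t2 (R2, M2)" "t2 \<le> R 0 ^ d2"
        "(\<lambda>x. R2 (2 * x), M2) = f (\<lambda>x. R (2 * x), M)" "\<forall>y. odd y \<and> k2 \<le> y \<longrightarrow> R2 y = R1 y"
      using p2[of R1 M] n unfolding n1 e by blast
    have T: "t1 \<le> R 0 ^ max d1 d2" "t2 \<le> R 0 ^ max d1 d2" "1 \<le> R 0 ^ max d1 d2"
        "4 * R 0 ^ max d1 d2 \<le> R 0 ^ (max d1 d2 + 2)"
        using R1(2) R2(2) n power_mono_exp[of d1 "max d1 d2"] power_mono_exp[of d2 "max d1 d2"]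
          power_ge_mult[OF n, of 2 "max d1 d2"]
        by (auto intro: le_trans)
    let ?concl = "\<exists>R' M' t. exec (Seq p1 (IfPos 1 p2 Skip)) (R, M) t (R', M') \<and>
        t \<le> R 0 ^ (max d1 d2 + 2) \<and>
        (\<lambda>x. R' (2 * x), M') = (if 0 < h (\<lambda>x. R (2 * x), M) then f (\<lambda>x. R (2 * x), M)
          else (\<lambda>x. R (2 * x), M)) \<and>
        (\<forall>y. odd y \<and> max k1 k2 \<le> y \<longrightarrow> R' y = R y)"
    show ?concl
    proof (cases "0 < R1 1")
      case True
      have "exec (Seq p1 (IfPos 1 p2 Skip)) (R, M) (t1 + (1 + t2)) (R2, M2)"
        by (rule exec_Seq[OF R1(1) exec_IfPos_True[OF True R2(1)]])
      moreover have "t1 + (1 + t2) \<le> R 0 ^ (max d1 d2 + 2)" using T by linarith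
      ultimately show ?thesis using R1(3,4) R2(3,4) True
        by (intro exI[of _ R2] exI[of _ M2] exI[of _ "t1 + (1 + t2)"]) simp
    next
      case False
      then have z: "R1 1 = 0" by simp
      have "exec (Seq p1 (IfPos 1 p2 Skip)) (R, M) (t1 + (1 + 1)) (R1, M)"
        by (rule exec_Seq[OF R1(1) exec_IfPos_False[where R = R1, OF z exec_Skip]])
      moreover have "t1 + (1 + 1) \<le> R 0 ^ (max d1 d2 + 2)" using T by linarith
      ultimately show ?thesis using R1(3,4) e False
        by (intro exI[of _ R1] exI[of _ M] exI[of _ "t1 + (1 + 1)"]) simp
    qed
  qed
qed

text \<open>The number of rounds is read off once, in the initial state. The increment of
  \<open>x\<close> starts from whatever value \<open>f\<close> leaves there, so invariants also have
  to show that \<open>f\<close> preserves \<open>x\<close>.\<close>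

definition loop :: "nat \<Rightarrow> (state \<Rightarrow> state) \<Rightarrow> state \<Rightarrow> state" where
  "loop x f s = ((\<lambda>s. let s' = f s in ((fst s')(x := fst s' x + 1), snd s')) ^^ fst s 0)
     ((fst s)(x := 0), snd s)"

text \<open>Termination is governed by a countdown in a register that the body cannot reach; hence
  the body is executed exactly \<open>n\<close> times, whatever it does to \<open>x\<close>.\<close>

lemma runs_loop:
  assumes f: "runs d f" and n: "keeps_n f" and x: "x \<noteq> 0"
  shows "runs (d + 5) (loop x f)"
proof -
  obtain p k where p: "\<And>R M. 2 \<le> R (0::nat) \<Longrightarrow>
     \<exists>R' M' t. exec p (R, M) t (R', M') \<and> t \<le> R 0 ^ d \<and>
        (\<lambda>x. R' (2 * x), M') = f (\<lambda>x. R (2 * x), M) \<and>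
        (\<forall>y. odd y \<and> k \<le> y \<longrightarrow> R' y = R y)"
    using runsE[OF f] by blast
  define q where "q = 2 * k + 7"
  define u where "u = 2 * k + 9"
  define X where "X = 2 * x"
  have neq: "q \<noteq> 0" "u \<noteq> 0" "X \<noteq> 0" "q \<noteq> u" "u \<noteq> q" "q \<noteq> X" "u \<noteq> X"
      "odd q" "odd u" "even X" "k \<le> q" "k \<le> u" "q < u + 1"
  proof -
    have par: "odd q" "odd u" "even X"
      by (simp_all add: q_def u_def X_def)
    have ord: "k \<le> q" "1 < q" "q < u"
      by (simp_all add: q_def u_def)
    have X: "X \<noteq> 0" using x by (simp add: X_def)
    have "q \<noteq> X" "u \<noteq> X" using par by auto
    then show "q \<noteq> 0" "u \<noteq> 0" "X \<noteq> 0" "q \<noteq> u" "u \<noteq> q" "q \<noteq> X" "u \<noteq> X"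
      "odd q" "odd u" "even X" "k \<le> q" "k \<le> u" "q < u + 1"
      using par ord X by simp_all
  qed
  define b where "b = Seq p (Seq (Add X X u) (Sub q q u))"
  define init where "init = Seq (Const X 0) (Seq (Const q 0) (Seq (Add q q 0) (Const u 1)))"
  define g where "g = (\<lambda>s. let s' = f s in ((fst s')(x := fst s' x + 1), snd s'))"
  have g0: "fst (g s) 0 = fst s 0" for s
    using n x by (cases s) (simp add: keeps_n_def g_def Let_def)
  show ?thesis
    unfolding runs_def
  proof (intro exI[of _ "Seq init (WhilePos q b)"] exI[of _ "u + 1"] allI impI)
    fix R M :: "nat \<Rightarrow> nat"
    assume n2: "2 \<le> R 0"
    define n where "n = R 0"
    define R0 where "R0 = R(X := 0, q := n, u := 1)"
    define s0 where "s0 = ((\<lambda>x. R (2 * x))(x := 0), M)"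
    have "exec init (R, M) (1 + (1 + (1 + 1))) (R0, M)"
      unfolding init_def
      by (rule exec_subst, (rule exec_Seq exec_Const exec_Add)+)
        (use neq in \<open>auto simp: fun_eq_iff R0_def n_def\<close>)
    then have init: "exec init (R, M) 4 (R0, M)" by (simp add: eval_nat_numeral)
    have gn: "fst ((g ^^ i) s0) 0 = n" for i
    proof (induction i)
      case (Suc i) then show ?case by (simp add: g0)
    qed (use x in \<open>simp add: s0_def n_def\<close>)
    define I where "I = (\<lambda>i Q M'. (\<lambda>x. Q (2 * x), M') = (g ^^ i) s0 \<and>
        Q q = n - i \<and> Q u = 1 \<and> (\<forall>y. odd y \<and> u + 1 \<le> y \<longrightarrow> Q y = R y))"
    have "\<exists>Q' M' t. exec (WhilePos q b) (R0, M) t (Q', M') \<and> t \<le> n * (n ^ d + 2 + 1) + 1 \<and> I n Q' M'"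
    proof (rule exec_counting_loop)
      have "(\<lambda>x. R0 (2 * x)) = (\<lambda>x. R (2 * x))(x := 0)"
      proof
        fix z
        have "2 * z \<noteq> q" "2 * z \<noteq> u" using neq by auto
        then show "R0 (2 * z) = ((\<lambda>x. R (2 * x))(x := 0)) z"
          using neq by (simp add: R0_def X_def)
      qed
      moreover have "R0 q = n" "R0 u = 1" using neq by (auto simp: R0_def)
      moreover have "R0 y = R y" if "odd y" "u + 1 \<le> y" for y
        using neq that by (auto simp: R0_def)
      ultimately show "I 0 R0 M" unfolding I_def s0_def by simp
      show "Q q = n - i" if "I i Q N" for i Q N using that by (simp add: I_def)
      fix i Q N
      assume i: "i < n" and I: "I i Q N"
      have Qs: "(\<lambda>x. Q (2 * x), N) = (g ^^ i) s0" using I by (simp add: I_def)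
      have Q0: "Q 0 = n" using gn[of i] unfolding Qs[symmetric] by simp
      obtain Q1 N1 t1 where Q1: "exec p (Q, N) t1 (Q1, N1)" "t1 \<le> n ^ d"
        "(\<lambda>x. Q1 (2 * x), N1) = f (\<lambda>x. Q (2 * x), N)" "\<And>y. odd y \<and> k \<le> y \<Longrightarrow> Q1 y = Q y"
        using p[of Q N] n2 Q0 n_def by auto
      define Q2 where "Q2 = Q1(X := Q1 X + Q1 u, q := Q1 q - Q1 u)"
      have e: "exec b (Q, N) (t1 + (1 + 1)) (Q2, N1)"
        unfolding b_def
        by (rule exec_subst, rule exec_Seq[OF Q1(1)], (rule exec_Seq exec_Add exec_Sub)+)
          (use neq in \<open>auto simp: fun_eq_iff Q2_def\<close>)
      have u1: "Q1 u = 1" "Q1 q = n - i"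
        using Q1(4) I neq by (auto simp: I_def)
      have "I (Suc i) Q2 N1"
        unfolding I_def
      proof (intro conjI allI impI)
        have "(\<lambda>z. Q2 (2 * z)) = (\<lambda>z. Q1 (2 * z))(x := Q1 (2 * x) + 1)"
        proof
          fix z
          have "2 * z \<noteq> q" using neq by auto
          then show "Q2 (2 * z) = ((\<lambda>z. Q1 (2 * z))(x := Q1 (2 * x) + 1)) z"
            using u1 by (simp add: Q2_def X_def)
        qed
        then have "(\<lambda>z. Q2 (2 * z), N1) = g (\<lambda>x. Q (2 * x), N)"
          unfolding g_def Q1(3)[symmetric] by simp
        then show "(\<lambda>z. Q2 (2 * z), N1) = (g ^^ Suc i) s0" using Qs by simp
        show "Q2 q = n - Suc i" using u1 neq by (simp add: Q2_def)
        show "Q2 u = 1" using u1 neq by (simp add: Q2_def)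
        fix y assume y: "odd y \<and> u + 1 \<le> y"
        then have "y \<noteq> X" "y \<noteq> q" "k \<le> y" using neq by auto
        then show "Q2 y = R y" using y I Q1(4)[of y] by (simp add: Q2_def I_def)
      qed
      moreover have "t1 + (1 + 1) \<le> n ^ d + 2" using Q1(2) by simp
      ultimately show "\<exists>R' M' t. exec b (Q, N) t (R', M') \<and> t \<le> n ^ d + 2 \<and> I (Suc i) R' M'"
        using e by blast
    qed
    then obtain Q N t where Q: "exec (WhilePos q b) (R0, M) t (Q, N)" "t \<le> n * (n ^ d + (2 + 1)) + 1" "I n Q N"
      unfolding add.assoc by blast
    have "exec (Seq init (WhilePos q b)) (R, M) (4 + t) (Q, N)"
      by (rule exec_Seq[OF init Q(1)])
    moreover have "4 + t \<le> R 0 ^ (d + 5)"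
    proof -
      have n2: "2 \<le> n" using n2 n_def by simp
      have "4 + t \<le> t + 11" by simp
      also have "\<dots> \<le> n ^ (d + 5)" by (rule loop_time[OF n2 Q(2)]) simp
      finally show ?thesis unfolding n_def .
    qed
    moreover have "(\<lambda>x. Q (2 * x), N) = loop x f (\<lambda>x. R (2 * x), M)"
      using Q(3) unfolding I_def loop_def g_def s0_def n_def by simp
    moreover have "\<forall>y. odd y \<and> u + 1 \<le> y \<longrightarrow> Q y = R y"
      using Q(3) unfolding I_def by simp
    ultimately show "\<exists>R' M' t. exec (Seq init (WhilePos q b)) (R, M) t (R', M') \<and> t \<le> R 0 ^ (d + 5) \<and>
        (\<lambda>x. R' (2 * x), M') = loop x f (\<lambda>x. R (2 * x), M) \<and>
        (\<forall>y. odd y \<and> u + 1 \<le> y \<longrightarrow> R' y = R y)"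
      by blast
  qed
qed

section \<open>Connected sets, components and neighborhoods\<close>

locale ugraph =
  fixes V :: "'a set" and E :: "'a \<Rightarrow> 'a \<Rightarrow> bool"
  assumes fin_V [simp]: "finite V"
    and E_sym: "E x y \<Longrightarrow> E y x"
    and E_V: "E x y \<Longrightarrow> x \<in> V \<and> y \<in> V"
    and E_irrefl: "\<not> E x x"
begin

definition nb :: "'a set \<Rightarrow> 'a set" where
  "nb C = {y. y \<notin> C \<and> (\<exists>x\<in>C. E x y)}"

definition rE :: "'a set \<Rightarrow> 'a \<Rightarrow> 'a \<Rightarrow> bool" where
  "rE A x y \<longleftrightarrow> E x y \<and> x \<in> A \<and> y \<in> A"

definition conn :: "'a set \<Rightarrow> bool" where
  "conn C \<longleftrightarrow> C \<noteq> {} \<and> C \<subseteq> V \<and> (\<forall>x\<in>C. \<forall>y\<in>C. (rE C)\<^sup>*\<^sup>* x y)"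

text \<open>For \<open>v\<close> in \<open>S\<close> no step is possible and the value is just
  \<open>{v}\<close>; the lemmas therefore require \<open>v \<in> V - S\<close>.\<close>

definition comp :: "'a set \<Rightarrow> 'a \<Rightarrow> 'a set" where
  "comp S v = {u. (rE (V - S))\<^sup>*\<^sup>* v u}"

lemma nb_V: "nb C \<subseteq> V"
  using E_V by (auto simp: nb_def)

lemma finite_nb [simp]: "finite (nb C)"
  using nb_V fin_V by (rule finite_subset)

lemma conn_V: "conn C \<Longrightarrow> C \<subseteq> V"
  by (simp add: conn_def)

lemma conn_ne: "conn C \<Longrightarrow> C \<noteq> {}"
  by (simp add: conn_def)

lemma conn_finite: "conn C \<Longrightarrow> finite C"
  using conn_V fin_V by (rule finite_subset)

lemma rE_mono: "A \<subseteq> B \<Longrightarrow> (rE A)\<^sup>*\<^sup>* x y \<Longrightarrow> (rE B)\<^sup>*\<^sup>* x y"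
  by (rule predicate2D[OF rtranclp_mono]) (auto simp: rE_def)

lemma rE_sym: "(rE A)\<^sup>*\<^sup>* x y \<Longrightarrow> (rE A)\<^sup>*\<^sup>* y x"
proof (induction rule: rtranclp_induct)
  case (step y z)
  then have "rE A z y" using E_sym by (simp add: rE_def)
  then show ?case using step.IH by (rule converse_rtranclp_into_rtranclp)
qed simp

lemma connI:
  assumes "x \<in> C" "C \<subseteq> V" "\<And>y. y \<in> C \<Longrightarrow> (rE C)\<^sup>*\<^sup>* x y"
  shows "conn C"
  unfolding conn_def
proof (intro conjI ballI)
  fix y z assume "y \<in> C" "z \<in> C"
  then show "(rE C)\<^sup>*\<^sup>* y z"
    using rE_sym[OF assms(3)[of y]] assms(3)[of z] by simp
qed (use assms in auto)

lemma comp_in: "v \<in> comp S v"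
  by (simp add: comp_def)

lemma comp_sub:
  assumes "v \<in> V - S"
  shows "comp S v \<subseteq> V - S"
proof
  fix u assume "u \<in> comp S v"
  then have "(rE (V - S))\<^sup>*\<^sup>* v u" by (simp add: comp_def)
  then show "u \<in> V - S" by (induction rule: rtranclp_induct) (use assms in \<open>auto simp: rE_def\<close>)
qed

lemma comp_closed:
  assumes "x \<in> comp S v" "E x y" "x \<in> V - S" "y \<notin> S"
  shows "y \<in> comp S v"
proof -
  have "rE (V - S) x y" using assms E_V[OF assms(2)] by (auto simp: rE_def)
  then show ?thesis using assms(1) by (auto simp: comp_def)
qed

lemma comp_nb:
  assumes "v \<in> V - S"
  shows "nb (comp S v) \<subseteq> S"
  using comp_closed[of _ S v] comp_sub[OF assms] unfolding nb_def by blast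

lemma comp_conn:
  assumes v: "v \<in> V - S"
  shows "conn (comp S v)"
proof (rule connI)
  show "v \<in> comp S v" by (rule comp_in)
  show "comp S v \<subseteq> V" using comp_sub[OF v] by auto
  fix y assume "y \<in> comp S v"
  then have "(rE (V - S))\<^sup>*\<^sup>* v y" by (simp add: comp_def)
  then show "(rE (comp S v))\<^sup>*\<^sup>* v y"
  proof (induction rule: rtranclp_induct)
    case (step y z)
    then have "y \<in> comp S v" by (simp add: comp_def)
    moreover have "z \<in> comp S v" using step by (simp add: comp_def rtranclp.rtrancl_into_rtrancl)
    ultimately have "rE (comp S v) y z" using step by (simp add: rE_def)
    then show ?case by (rule rtranclp.rtrancl_into_rtrancl[OF step.IH])
  qed simp
qed

text \<open>A path inside \<open>C\<close> that starts in \<open>D\<close> can leave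
  \<open>D\<close> only through \<open>nb D\<close>, which \<open>C\<close> avoids. Most inclusions
  between connected sets and components below are instances of this.\<close>

lemma conn_subset:
  assumes C: "conn C" and "C \<inter> nb D = {}" "C \<inter> D \<noteq> {}"
  shows "C \<subseteq> D"
proof
  obtain x where x: "x \<in> C" "x \<in> D" using assms(3) by auto
  fix y assume "y \<in> C"
  then have "(rE C)\<^sup>*\<^sup>* x y" using C x by (auto simp: conn_def)
  then show "y \<in> D"
  proof (induction rule: rtranclp_induct)
    case (step y z)
    then show ?case using assms(2) by (auto simp: rE_def nb_def)
  qed (rule x)
qed

lemma conn_sub_comp:
  assumes "conn C" "C \<inter> S = {}" "v \<in> C"
  shows "C \<subseteq> comp S v"
proof (rule conn_subset[OF assms(1)])
  have "v \<in> V - S" using assms conn_V by blast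
  then show "C \<inter> nb (comp S v) = {}" using comp_nb assms(2) by blast
  show "C \<inter> comp S v \<noteq> {}" using comp_in assms(3) by auto
qed

text \<open>A connected set is determined by a separator that contains its neighborhood and avoids
  it, together with any one of its vertices. This is what allows a program to represent vertex sets
  of arbitrary size by short tuples.\<close>

lemma comp_eq:
  assumes "conn C" "C \<inter> S = {}" "v \<in> C" "nb C \<subseteq> S"
  shows "comp S v = C"
proof
  have v: "v \<in> V - S" using assms conn_V by blast
  show "comp S v \<subseteq> C"
    by (rule conn_subset[OF comp_conn[OF v]]) (use comp_sub[OF v] assms comp_in[of v S] in auto)
qed (rule conn_sub_comp[OF assms(1-3)])

lemma comp_same:
  assumes "v \<in> V - S" "u \<in> comp S v"
  shows "comp S u = comp S v"
  by (rule comp_eq) (use comp_conn[OF assms(1)] comp_sub[OF assms(1)] comp_nb[OF assms(1)] assms in auto)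

lemma conn_Un:
  assumes "conn C" "conn D" "C \<inter> D \<noteq> {}"
  shows "conn (C \<union> D)"
proof -
  obtain x where "x \<in> C" "x \<in> D" using assms(3) by auto
  then show ?thesis using assms
    by (intro connI[of x]) (auto simp: conn_def intro: rE_mono[of C] rE_mono[of D])
qed

lemma conn_insert:
  assumes C: "conn C" and x: "x \<in> nb C"
  shows "conn (insert x C)"
proof -
  obtain y where y: "y \<in> C" "E y x" using x by (auto simp: nb_def)
  have "(rE (insert x C))\<^sup>*\<^sup>* y z" if "z \<in> insert x C" for z
  proof (cases "z = x")
    case True
    then show ?thesis using y by (auto simp: rE_def)
  next
    case False
    then show ?thesis using C y that by (auto simp: conn_def intro: rE_mono[of C])
  qed
  then show ?thesis using y C E_V by (intro connI[of y]) (auto simp: conn_def)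
qed

lemma conn_singleton: "x \<in> V \<Longrightarrow> conn {x}"
  by (rule connI) auto

text \<open>A vertex in one of the neighborhoods on the left is in one of those on the right, and a
  vertex in both on the left is in both on the right. Counting union and intersection separately
  gives the inequality.\<close>

lemma nb_submodular:
  "card (nb (C \<inter> D)) + card (nb (C \<union> D)) \<le> card (nb C) + card (nb D)"
proof -
  have "card (nb (C \<inter> D)) + card (nb (C \<union> D)) =
      card (nb (C \<inter> D) \<union> nb (C \<union> D)) + card (nb (C \<inter> D) \<inter> nb (C \<union> D))"
    by (rule card_Un_Int) auto
  also have "\<dots> \<le> card (nb C \<union> nb D) + card (nb C \<inter> nb D)"
    by (intro add_mono card_mono finite_UnI finite_Int finite_nb disjI1) (auto simp: nb_def)
  also have "\<dots> = card (nb C) + card (nb D)"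
    by (rule card_Un_Int[symmetric]) auto
  finally show ?thesis .
qed

lemma nb_Un: "nb (C \<union> D) \<subseteq> nb C \<union> nb D"
  by (auto simp: nb_def)

lemma nb_extend: "W \<subseteq> nb Z \<Longrightarrow> Z \<subseteq> Y \<Longrightarrow> Y \<inter> W = {} \<Longrightarrow> W \<subseteq> nb Y"
  unfolding nb_def by blast

section \<open>Winning sets\<close>

text \<open>The component \<open>C\<close> can be searched by placing at most \<open>p\<close> guards at a time.\<close>

inductive win :: "nat \<Rightarrow> 'a set \<Rightarrow> bool" for p where
  win: "nb C \<subseteq> S \<Longrightarrow> S \<subseteq> V \<Longrightarrow> card S \<le> p \<Longrightarrow> C \<subseteq> V \<Longrightarrow>
    (\<And>v. v \<in> C - S \<Longrightarrow> win p (comp S v)) \<Longrightarrow> win p C"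

lemma win_mono: "win p C \<Longrightarrow> p \<le> q \<Longrightarrow> win q C"
proof (induction rule: win.induct)
  case (win C S)
  then show ?case by (intro win.intros[of C S]) auto
qed

lemma comp_anti:
  assumes "v \<in> V - S'" "S \<subseteq> S'"
  shows "comp S' v \<subseteq> comp S v"
  by (rule conn_sub_comp[OF comp_conn[OF assms(1)] _ comp_in])
    (use comp_sub[OF assms(1)] assms(2) in auto)

text \<open>The old strategy is followed while \<open>N\<close> stays occupied, at a price of
  \<open>q\<close>. The invariant is that the neighborhood of the current component lies in
  \<open>N\<close> together with the neighborhood of the component that the old strategy
  faces.\<close>

lemma win_subset:
  assumes "win p C" "D \<subseteq> C" "nb D \<subseteq> N \<union> nb C" "N \<subseteq> V" "card N \<le> q"
  shows "win (p + q) D"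
  using assms
proof (induction arbitrary: D rule: win.induct)
  case (win C S)
  show ?case
  proof (rule win.intros[of D "S \<union> N"])
    show "card (S \<union> N) \<le> p + q"
      using card_Un_le[of S N] win by linarith
    fix v assume v: "v \<in> D - (S \<union> N)"
    then have vV: "v \<in> V - (S \<union> N)" using win by auto
    have sub: "comp (S \<union> N) v \<subseteq> comp S v" by (rule comp_anti[OF vV]) simp
    have "nb (comp (S \<union> N) v) \<subseteq> N \<union> nb (comp S v)"
    proof
      fix w assume w: "w \<in> nb (comp (S \<union> N) v)"
      then have "w \<in> S \<union> N" using comp_nb[OF vV] by auto
      moreover have "w \<notin> comp S v" if "w \<in> S" using that comp_sub[of v S] vV by auto
      ultimately show "w \<in> N \<union> nb (comp S v)" using w sub by (auto simp: nb_def)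
    qed
    then show "win (p + q) (comp (S \<union> N) v)"
      using win.IH[of v] v win.prems sub win.hyps by auto
  qed (use win in auto)
qed

text \<open>The first move occupies both neighborhoods; \<open>j \<le> k\<close> keeps these
  \<open>2 * j\<close> guards within \<open>k + j\<close>. Each remaining component lies inside one
  of the two sets, where the old strategy works with the other neighborhood kept guarded.\<close>

lemma win_Un:
  assumes w: "win k C" "win k D" and C: "conn C" and D: "conn D"
    and j: "card (nb C) \<le> j" "card (nb D) \<le> j" and K: "K = k + j" "j \<le> k"
  shows "win K (C \<union> D)"
proof (rule win.intros[of "C \<union> D" "nb C \<union> nb D"])
  show "nb (C \<union> D) \<subseteq> nb C \<union> nb D" by (rule nb_Un)
  show "nb C \<union> nb D \<subseteq> V" using nb_V by simp
  show "card (nb C \<union> nb D) \<le> K" using card_Un_le[of "nb C" "nb D"] j K by linarith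
  show "C \<union> D \<subseteq> V" using C D conn_V by auto
  have *: "win K (comp (nb A \<union> nb B) v)"
    if "win k A" "conn A" "card (nb B) \<le> j" "v \<in> A" "v \<notin> nb A \<union> nb B" for A B v
  proof -
    have v: "v \<in> V - (nb A \<union> nb B)" using that conn_V by auto
    have "comp (nb A \<union> nb B) v \<subseteq> comp (nb A) v" by (rule comp_anti[OF v]) simp
    also have "comp (nb A) v = A" by (rule comp_eq) (use that in \<open>auto simp: nb_def\<close>)
    finally show ?thesis unfolding K
      by (rule win_subset[OF that(1), where N = "nb B"]) (use comp_nb[OF v] nb_V that in auto)
  qed
  fix v assume v: "v \<in> C \<union> D - (nb C \<union> nb D)"
  show "win K (comp (nb C \<union> nb D) v)"
  proof (cases "v \<in> C")
    case True
    then show ?thesis using *[of C D v] w C j v by auto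
  next
    case False
    then show ?thesis using *[of D C v] w D j v by (auto simp: Un_commute)
  qed
qed

end

section \<open>Important separators\<close>

text \<open>\<open>F\<close> plays the role of the small sides of a tangle.\<close>

locale small_sides = ugraph +
  fixes F :: "'a set set" and j :: nat
  assumes F_conn: "C \<in> F \<Longrightarrow> conn C"
    and F_nb: "C \<in> F \<Longrightarrow> card (nb C) \<le> j"
    and F_Un: "C \<in> F \<Longrightarrow> D \<in> F \<Longrightarrow> C \<inter> D \<noteq> {} \<Longrightarrow> card (nb (C \<union> D)) \<le> j \<Longrightarrow> C \<union> D \<in> F"
    and F_sub: "C \<in> F \<Longrightarrow> D \<subseteq> C \<Longrightarrow> conn D \<Longrightarrow> card (nb D) \<le> j \<Longrightarrow> D \<in> F"
begin

definition Fmax :: "'a set set" where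
  "Fmax = {C \<in> F. \<forall>D\<in>F. C \<subseteq> D \<longrightarrow> D = C}"

lemma finite_F: "finite F"
  by (rule finite_subset[of _ "Pow V"]) (use F_conn conn_V in auto)

lemma FmaxD: "C \<in> Fmax \<Longrightarrow> C \<in> F" "C \<in> Fmax \<Longrightarrow> D \<in> F \<Longrightarrow> C \<subseteq> D \<Longrightarrow> D = C"
  by (auto simp: Fmax_def)

lemma finite_Fmax: "finite Fmax"
  using finite_F by (rule finite_subset[rotated]) (auto simp: Fmax_def)

lemma ex_Fmax:
  assumes "C \<in> F"
  obtains D where "D \<in> Fmax" "C \<subseteq> D"
proof -
  have "finite {D \<in> F. C \<subseteq> D}" using finite_F by simp
  moreover have "{D \<in> F. C \<subseteq> D} \<noteq> {}" using assms by auto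
  ultimately obtain D where D: "D \<in> F" "C \<subseteq> D" "\<forall>D'\<in>{D \<in> F. C \<subseteq> D}. D \<subseteq> D' \<longrightarrow> D = D'"
    using finite_has_maximal by (metis (no_types, lifting) mem_Collect_eq)
  have "D \<in> Fmax" unfolding Fmax_def using D by auto
  then show ?thesis using that D by blast
qed

text \<open>The branching for important separators. \<open>Z\<close> is forced into the set,
  \<open>W\<close> is forced into its neighborhood, and \<open>l\<close> bounds the remaining
  neighborhood sizes from below. Each branch lowers the measure \<open>2 * j - l - card W\<close>: a
  vertex moved to \<open>Z\<close> raises the minimum, a vertex moved to \<open>W\<close> enlarges
  \<open>W\<close>. At measure 0 both \<open>l\<close> and \<open>card W\<close> have reached
  \<open>j\<close>, so that the neighborhood is \<open>W\<close>, and connectedness leaves at most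
  one set.\<close>

lemma card_Fmax_aux:
  assumes "conn Z" "W \<subseteq> nb Z"
    "\<And>C. C \<in> F \<Longrightarrow> Z \<subseteq> C \<Longrightarrow> C \<inter> W = {} \<Longrightarrow> l \<le> card (nb C)"
    "2 * j \<le> l + card W + \<mu>"
  shows "card {C \<in> Fmax. Z \<subseteq> C \<and> C \<inter> W = {}} \<le> 2 ^ \<mu>"
  using assms
proof (induction \<mu> arbitrary: Z W l)
  case 0
  have W: "nb C = W" if C: "C \<in> Fmax" "Z \<subseteq> C" "C \<inter> W = {}" for C
  proof -
    have sub: "W \<subseteq> nb C" by (rule nb_extend[OF 0(2) C(2,3)])
    then have "card W \<le> card (nb C)" by (rule card_mono[OF finite_nb])
    moreover have "card (nb C) \<le> j" "l \<le> card (nb C)"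
      using C FmaxD(1) F_nb 0 by auto
    ultimately have "card (nb C) = card W" using 0(4) by linarith
    then show ?thesis using sub by (metis card_subset_eq finite_nb)
  qed
  have "C = D" if C: "C \<in> Fmax" "Z \<subseteq> C" "C \<inter> W = {}" and D: "D \<in> Fmax" "Z \<subseteq> D" "D \<inter> W = {}" for C D
  proof -
    have cC: "conn C" "conn D" using C D FmaxD(1) F_conn by auto
    have "C \<inter> D \<noteq> {}" using C D 0(1) conn_ne by blast
    then show ?thesis
      using conn_subset[OF cC(1), of D] conn_subset[OF cC(2), of C] W[OF C] W[OF D] C D by blast
  qed
  then have "card {C \<in> Fmax. Z \<subseteq> C \<and> C \<inter> W = {}} \<le> Suc 0"
    by (intro card_le_Suc0_iff_eq[THEN iffD2]) (use finite_Fmax in auto)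
  then show ?case by simp
next
  case (Suc \<mu>)
  let ?M = "\<lambda>Z W. {C \<in> Fmax. Z \<subseteq> C \<and> C \<inter> W = {}}"
  define A where "A = {C \<in> F. Z \<subseteq> C \<and> C \<inter> W = {}}"
  show ?case
  proof (cases "?M Z W = {}")
    case True
    show ?thesis by (simp only: True card.empty)
  next
    case False
    then have "A \<noteq> {}" using FmaxD(1) by (auto simp: A_def)
    have finA: "finite A" using finite_F by (simp add: A_def)
    \<comment> \<open>\<open>Y\<close> will have the minimum neighborhood size \<open>l'\<close>
      among all candidates and the maximum cardinality among those that attain it. By submodularity
      it is part of every maximal candidate; by its cardinality every candidate properly above it
      has a larger neighborhood.\<close>
    define l' where "l' = Min ((\<lambda>C. card (nb C)) ` A)"
    have l'_le: "l' \<le> card (nb C)" if "C \<in> A" for C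
      unfolding l'_def using that finA by simp
    define B where "B = {C \<in> A. card (nb C) = l'}"
    have "l' \<in> (\<lambda>C. card (nb C)) ` A"
      unfolding l'_def using finA \<open>A \<noteq> {}\<close> by (intro Min_in) auto
    then have "B \<noteq> {}" by (auto simp: B_def)
    have finB: "finite B" using finA by (simp add: B_def)
    have "Max (card ` B) \<in> card ` B" using finB \<open>B \<noteq> {}\<close> by (intro Max_in) auto
    then obtain Y where "Y \<in> B" "Max (card ` B) = card Y" by auto
    then have Y: "Y \<in> B" "\<And>C. C \<in> B \<Longrightarrow> card C \<le> card Y"
      using finB by (auto simp flip: \<open>Max (card ` B) = card Y\<close>)
    have YF: "Y \<in> F" "Z \<subseteq> Y" "Y \<inter> W = {}" "card (nb Y) = l'" using Y by (auto simp: A_def B_def)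
    have connY: "conn Y" using YF F_conn by auto
    have ll: "l \<le> l'" using Suc.prems(3)[OF YF(1-3)] YF by simp
    have YM: "Y \<subseteq> C" if C: "C \<in> ?M Z W" for C
    proof -
      have CF: "C \<in> F" "Z \<subseteq> C" "C \<inter> W = {}" using C FmaxD by auto
      obtain z where z: "z \<in> Z" using Suc.prems(1) conn_ne by blast
      \<comment> \<open>\<open>C \<inter> Y\<close> need not be connected. Its component around
        \<open>Z\<close> has no larger neighborhood and, by \<open>F_sub\<close>, would be a
        candidate below the minimum.\<close>
      define D where "D = comp (- (C \<inter> Y)) z"
      have CY: "C \<inter> Y \<subseteq> V" using connY conn_V by auto
      have zV: "z \<in> V - (- (C \<inter> Y))" using z CF YF CY by auto
      have D: "conn D" "D \<subseteq> C \<inter> Y" "z \<in> D"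
        unfolding D_def using comp_conn[OF zV] comp_sub[OF zV] comp_in by auto
      have ZD: "Z \<subseteq> D" unfolding D_def
        by (rule conn_sub_comp[OF Suc.prems(1) _ z]) (use CF YF in auto)
      have "nb D \<subseteq> nb (C \<inter> Y)"
        using comp_nb[OF zV] D(2) unfolding D_def[symmetric] by (auto simp: nb_def)
      then have nbD: "card (nb D) \<le> card (nb (C \<inter> Y))" by (intro card_mono) auto
      have "l' \<le> card (nb (C \<inter> Y))"
      proof (rule ccontr)
        assume "\<not> l' \<le> card (nb (C \<inter> Y))"
        then have less: "card (nb D) < l'" using nbD by simp
        moreover have "l' \<le> j" using F_nb[OF YF(1)] YF by simp
        ultimately have "D \<in> F" using F_sub[OF YF(1)] D by auto
        then have "D \<in> A" using ZD D YF by (auto simp: A_def)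
        then show False using l'_le[of D] less by simp
      qed
      then have "card (nb (C \<union> Y)) \<le> card (nb C)"
        using nb_submodular[of C Y] YF by simp
      then have "C \<union> Y \<in> F" using F_Un[OF CF(1) YF(1)] z CF YF F_nb[OF CF(1)] by auto
      then have "C \<union> Y = C" using FmaxD(2)[of C "C \<union> Y"] C by auto
      then show ?thesis by auto
    qed
    have WY: "W \<subseteq> nb Y"
      by (rule nb_extend[OF Suc.prems(2) YF(2,3)])
    show ?thesis
    \<comment> \<open>If no vertex is left to branch on, all candidates avoid \<open>nb Y\<close>
      and hence cannot extend beyond \<open>Y\<close>.\<close>
    proof (cases "nb Y \<subseteq> W")
      case True
      have "C = Y" if C: "C \<in> ?M Z W" for C
      proof -
        have "conn C" using C FmaxD(1) F_conn by auto
        moreover have "C \<inter> nb Y = {}" using True C by auto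
        moreover have "C \<inter> Y \<noteq> {}" using YM[OF C] connY conn_ne by auto
        ultimately show ?thesis using conn_subset YM[OF C] by blast
      qed
      then have "?M Z W \<subseteq> {Y}" by blast
      then have "card (?M Z W) \<le> 1" using card_mono[of "{Y}"] by fastforce
      then show ?thesis by (meson one_le_numeral one_le_power order_trans)
    next
      case False
      then obtain v where v: "v \<in> nb Y" "v \<notin> W" by auto
      have 1: "card (?M (insert v Y) W) \<le> 2 ^ \<mu>"
      proof (rule Suc.IH)
        show "conn (insert v Y)" by (rule conn_insert[OF connY v(1)])
        show "W \<subseteq> nb (insert v Y)" using WY v by (auto simp: nb_def)
        show "2 * j \<le> Suc l' + card W + \<mu>" using Suc.prems(4) ll by simp
        fix C assume C: "C \<in> F" "insert v Y \<subseteq> C" "C \<inter> W = {}"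
        then have CA: "C \<in> A" using YF by (auto simp: A_def)
        have "card (nb C) \<noteq> l'"
        proof
          assume "card (nb C) = l'"
          then have "C \<in> B" using CA by (simp add: B_def)
          then have "card C \<le> card Y" by (rule Y(2))
          moreover have "Y \<subset> C" using C v by (auto simp: nb_def)
          then have "card Y < card C" using C F_conn conn_finite by (intro psubset_card_mono) auto
          ultimately show False by simp
        qed
        then show "Suc l' \<le> card (nb C)" using l'_le[OF CA] by simp
      qed
      have 2: "card (?M Y (insert v W)) \<le> 2 ^ \<mu>"
      proof (rule Suc.IH)
        show "conn Y" by (rule connY)
        show "insert v W \<subseteq> nb Y" using WY v by auto
        have "finite W" using WY finite_nb by (rule finite_subset)
        then show "2 * j \<le> l' + card (insert v W) + \<mu>" using Suc.prems(4) ll v by simp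
        fix C assume "C \<in> F" "Y \<subseteq> C" "C \<inter> insert v W = {}"
        then show "l' \<le> card (nb C)" using l'_le[of C] YF by (auto simp: A_def)
      qed
      have "?M Z W \<subseteq> ?M (insert v Y) W \<union> ?M Y (insert v W)"
        using YM by blast
      then have "card (?M Z W) \<le> card (?M (insert v Y) W \<union> ?M Y (insert v W))"
        by (intro card_mono) (use finite_Fmax in auto)
      also have "\<dots> \<le> 2 ^ \<mu> + 2 ^ \<mu>"
        using card_Un_le 1 2 by (meson add_mono order_trans)
      finally show ?thesis by simp
    qed
  qed
qed

text \<open>With nothing forced yet the measure is \<open>2 * j\<close>, and
  \<open>2 ^ (2 * j) = 4 ^ j\<close>.\<close>

lemma card_Fmax:
  assumes "v \<in> V"
  shows "card {C \<in> Fmax. v \<in> C} \<le> 4 ^ j"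
  using card_Fmax_aux[OF conn_singleton[OF assms], of "{}" 0 "2 * j"] by (simp add: power_mult)

end

section \<open>Nice tree decompositions\<close>

context ugraph
begin

text \<open>
  \<open>dec w U B\<close>: the subgraph induced by \<open>U\<close> has a nice tree decomposition with root bag \<open>B\<close>
  and bags of size at most \<open>w\<close>.
\<close>

inductive dec :: "nat \<Rightarrow> 'a set \<Rightarrow> 'a set \<Rightarrow> bool" for w where
  empty: "dec w {} {}"
| insert: "dec w U B \<Longrightarrow> v \<in> V - U \<Longrightarrow> (\<And>u. u \<in> U \<Longrightarrow> E v u \<Longrightarrow> u \<in> B) \<Longrightarrow>
    card (insert v B) \<le> w \<Longrightarrow> dec w (insert v U) (insert v B)"
| forget: "dec w U B \<Longrightarrow> B' \<subseteq> B \<Longrightarrow> dec w U B'"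
| join: "dec w U1 B \<Longrightarrow> dec w U2 B \<Longrightarrow> U1 \<inter> U2 \<subseteq> B \<Longrightarrow>
    (\<And>x y. x \<in> U1 - B \<Longrightarrow> y \<in> U2 - B \<Longrightarrow> \<not> E x y) \<Longrightarrow> dec w (U1 \<union> U2) B"

lemma dec_sub: "dec w U B \<Longrightarrow> B \<subseteq> U \<and> U \<subseteq> V \<and> card B \<le> w"
proof (induction rule: dec.induct)
  case (forget U B B')
  then have "card B' \<le> card B" by (meson card_mono fin_V finite_subset order_trans)
  then show ?case using forget by auto
qed auto

lemma dec_finite: "dec w U B \<Longrightarrow> finite U \<and> finite B"
  using dec_sub finite_subset[OF _ fin_V] by (meson order_trans)

text \<open>The guards walk down the decomposition with \<open>N\<close> permanently occupied. Only
  forget nodes require a move: a vertex introduced at the root has its neighbors in the bag and does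
  not touch \<open>C\<close>, and at a join \<open>C\<close> lies on one side.\<close>

lemma dec_win:
  assumes "dec w U B" "conn C" "C \<subseteq> U - B" "nb C \<subseteq> N \<union> B" "N \<subseteq> V" "card N \<le> q"
  shows "win (w + q) C"
  using assms
proof (induction arbitrary: C rule: dec.induct)
  case empty
  then show ?case using conn_ne by auto
next
  case (insert U B v)
  have "v \<notin> nb C"
  proof
    assume "v \<in> nb C"
    then obtain x where "x \<in> C" "E v x" using E_sym by (auto simp: nb_def)
    then show False using insert.hyps(3)[of x] insert.prems by auto
  qed
  then show ?case using insert.IH[of C] insert.prems by auto
next
  case (forget U B B')
  have B: "B \<subseteq> U" "U \<subseteq> V" "card B \<le> w" using dec_sub[OF forget.hyps(1)] by auto
  show ?case
  \<comment> \<open>\<open>C\<close> may contain vertices of \<open>B - B'\<close>, so the whole bag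
    below is occupied; the components that remain avoid it and are covered by the induction
    hypothesis.\<close>
  proof (rule win.intros[of C "N \<union> B"])
    show "card (N \<union> B) \<le> w + q" using card_Un_le[of N B] B forget.prems by linarith
    fix v assume v: "v \<in> C - (N \<union> B)"
    have vV: "v \<in> V - (N \<union> B)" using v forget.prems(1) conn_V by auto
    have "comp (N \<union> B) v \<inter> nb C = {}"
      using comp_sub[OF vV] forget.prems(3) forget.hyps(2) by blast
    then have "comp (N \<union> B) v \<subseteq> C"
      using v comp_in by (intro conn_subset[OF comp_conn[OF vV]]) auto
    then show "win (w + q) (comp (N \<union> B) v)"
      by (intro forget.IH comp_conn[OF vV])
        (use forget.prems comp_sub[OF vV] comp_nb[OF vV] in auto)
  qed (use B forget conn_V in auto)
next
  case (join U1 B U2)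
  show ?case
  proof (cases "C \<inter> U1 = {}")
    case True
    then have "C \<subseteq> U2 - B" using join.prems by auto
    then show ?thesis using join.IH(2)[of C] join.prems by auto
  next
    case False
    have "C \<subseteq> U1 - B"
    proof (rule conn_subset[OF join.prems(1)])
      show "C \<inter> (U1 - B) \<noteq> {}" using False join.prems by auto
      show "C \<inter> nb (U1 - B) = {}"
        using join.hyps(4) join.prems(2) unfolding nb_def by blast
    qed
    then show ?thesis using join.IH(1)[of C] join.prems by auto
  qed
qed

text \<open>An edge is charged to an endpoint that is forgotten no later than the other one: at that
  moment the other endpoint is in the same bag. Consequently any vertex set \<open>Z\<close> of the
  decomposed part spans at most \<open>w * card Z\<close> edges. Edges inside the root bag are still
  uncharged, which is the first alternative.\<close>

lemma dec_orientation:
  assumes "dec w U B"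
  shows "\<exists>f. (\<forall>u. finite (f u) \<and> card (f u) \<le> w) \<and> (\<forall>u\<in>B. f u = {}) \<and>
    (\<forall>x\<in>U. \<forall>y\<in>U. E x y \<longrightarrow> x \<in> B \<and> y \<in> B \<or> y \<in> f x \<or> x \<in> f y)"
  using assms
proof (induction rule: dec.induct)
  case empty
  then show ?case by (intro exI[of _ "\<lambda>_. {}"]) auto
next
  case (insert U B v)
  then obtain f where f: "\<forall>u. finite (f u) \<and> card (f u) \<le> w" "\<forall>u\<in>B. f u = {}"
    "\<forall>x\<in>U. \<forall>y\<in>U. E x y \<longrightarrow> x \<in> B \<and> y \<in> B \<or> y \<in> f x \<or> x \<in> f y" by blast
  have v: "u \<in> B" if "u \<in> U" "E v u \<or> E u v" for u
    using insert.hyps(3)[OF that(1)] that(2) E_sym[of u v] by blast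
  show ?case
  proof (intro exI[of _ "f(v := {})"] conjI ballI impI)
    fix x y assume xy: "x \<in> insert v U" "y \<in> insert v U" "E x y"
    show "x \<in> insert v B \<and> y \<in> insert v B \<or> y \<in> (f(v := {})) x \<or> x \<in> (f(v := {})) y"
    proof (cases "x = v \<or> y = v")
      case True
      then show ?thesis using xy v E_irrefl by auto
    next
      case False
      then show ?thesis using xy f(3) by auto
    qed
  qed (use f in auto)
next
  case (forget U B B')
  then obtain f where f: "\<forall>u. finite (f u) \<and> card (f u) \<le> w" "\<forall>u\<in>B. f u = {}"
    "\<forall>x\<in>U. \<forall>y\<in>U. E x y \<longrightarrow> x \<in> B \<and> y \<in> B \<or> y \<in> f x \<or> x \<in> f y" by blast
  have B: "finite B" "card B \<le> w"
    using dec_sub[OF forget.hyps(1)] dec_finite[OF forget.hyps(1)] by simp_all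
  \<comment> \<open>A vertex of the bag has not been charged with anything so far; when forgotten,
    it takes the entire bag.\<close>
  define g where "g = (\<lambda>u. if u \<in> B - B' then B else f u)"
  have g: "f u \<subseteq> g u" for u using f(2) by (auto simp: g_def)
  show ?case
  proof (intro exI[of _ g] conjI ballI impI)
    fix x y assume xy: "x \<in> U" "y \<in> U" "E x y"
    then consider "x \<in> B" "y \<in> B" | "y \<in> f x \<or> x \<in> f y" using f(3) by blast
    then show "x \<in> B' \<and> y \<in> B' \<or> y \<in> g x \<or> x \<in> g y"
    proof cases
      case 1
      then show ?thesis by (auto simp: g_def)
    next
      case 2
      then show ?thesis using g by blast
    qed
  qed (use f B forget in \<open>auto simp: g_def\<close>)
next
  case (join U1 B U2)
  then obtain f g where f: "\<forall>u. finite (f u) \<and> card (f u) \<le> w" "\<forall>u\<in>B. f u = {}"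
    "\<forall>x\<in>U1. \<forall>y\<in>U1. E x y \<longrightarrow> x \<in> B \<and> y \<in> B \<or> y \<in> f x \<or> x \<in> f y"
    and g: "\<forall>u. finite (g u) \<and> card (g u) \<le> w" "\<forall>u\<in>B. g u = {}"
    "\<forall>x\<in>U2. \<forall>y\<in>U2. E x y \<longrightarrow> x \<in> B \<and> y \<in> B \<or> y \<in> g x \<or> x \<in> g y" by blast
  define h where "h = (\<lambda>u. if u \<in> U1 then f u else g u)"
  have h1: "h u = f u" if "u \<in> U1" for u using that by (simp add: h_def)
  have h2: "h u = g u" if "u \<in> U2" for u using that f(2) g(2) join.hyps(3) by (auto simp: h_def)
  show ?case
  proof (intro exI[of _ h] conjI ballI impI)
    fix x y assume xy: "x \<in> U1 \<union> U2" "y \<in> U1 \<union> U2" "E x y"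
    have "\<not> (x \<in> U1 - B \<and> y \<in> U2 - B)" "\<not> (y \<in> U1 - B \<and> x \<in> U2 - B)"
      using join.hyps(4)[of x y] join.hyps(4)[of y x] xy(3) E_sym[OF xy(3)] by blast+
    moreover have "B \<subseteq> U1" "B \<subseteq> U2" using join.hyps dec_sub by auto
    ultimately have "x \<in> U1 \<and> y \<in> U1 \<or> x \<in> U2 \<and> y \<in> U2" using xy by auto
    then show "x \<in> B \<and> y \<in> B \<or> y \<in> h x \<or> x \<in> h y"
      using f(3) g(3) xy h1 h2 by metis
  qed (use f g in \<open>auto simp: h_def\<close>)
qed

text \<open>
  Marking the bags in which an element of \<open>M\<close> is forgotten, and closing under lowest common
  ancestors, yields \<open>Z\<close>.  The vertices outside of \<open>Z\<close> fall into the closed regions \<open>\<W>\<close>, each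
  attached to at most two bags, and the region \<open>Q\<close> around the root, attached to \<open>Y\<close>.
\<close>

definition marking :: "nat \<Rightarrow> 'a set \<Rightarrow> 'a set \<Rightarrow> 'a set \<Rightarrow> 'a set \<Rightarrow> 'a set set \<Rightarrow> 'a set \<Rightarrow> 'a set \<Rightarrow> bool"
  where
  "marking w U B M Z \<W> Y Q \<longleftrightarrow>
     Z \<subseteq> U \<and> M \<inter> (U - B) \<subseteq> Z \<and> Y \<subseteq> Z \<and> card Y \<le> w \<and> B \<inter> Z \<subseteq> Y \<and>
     Q \<subseteq> U \<and> Q \<inter> Z = {} \<and> B - Z \<subseteq> Q \<and> U \<subseteq> Z \<union> Q \<union> \<Union>\<W> \<and> nb Q \<inter> U \<subseteq> Y \<and>
     finite \<W> \<and>
     (\<forall>W\<in>\<W>. W \<subseteq> U - B \<and> W \<inter> Z = {} \<and> (\<exists>N\<subseteq>Z. card N \<le> 2 * w \<and> nb W \<inter> U \<subseteq> N)) \<and>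
     card \<W> + 2 \<le> 3 * card (M \<inter> (U - B)) \<and> card Z + w \<le> 2 * w * card (M \<inter> (U - B))"

lemma ex_subset_mono: "\<exists>N\<subseteq>Z. P N \<Longrightarrow> Z \<subseteq> Z' \<Longrightarrow> \<exists>N\<subseteq>Z'. P N"
  by (meson order_trans)

lemma marking_region:
  "marking w U B M Z \<W> Y Q \<Longrightarrow> W \<in> \<W> \<Longrightarrow>
    W \<subseteq> U - B \<and> W \<inter> Z = {} \<and> (\<exists>N\<subseteq>Z. card N \<le> 2 * w \<and> nb W \<inter> U \<subseteq> N)"
  by (simp add: marking_def)

lemma markingD:
  assumes "marking w U B M Z \<W> Y Q"
  shows "Z \<subseteq> U" "M \<inter> (U - B) \<subseteq> Z" "Y \<subseteq> Z" "card Y \<le> w" "B \<inter> Z \<subseteq> Y" "Q \<subseteq> U" "Q \<inter> Z = {}"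
    "B - Z \<subseteq> Q" "U \<subseteq> Z \<union> Q \<union> \<Union>\<W>" "nb Q \<inter> U \<subseteq> Y" "finite \<W>"
    "card \<W> + 2 \<le> 3 * card (M \<inter> (U - B))" "card Z + w \<le> 2 * w * card (M \<inter> (U - B))"
  using assms by (simp_all add: marking_def)

text \<open>Bottom-up construction. When an element of \<open>M\<close> is forgotten, its bag
  \<open>B\<close> joins \<open>Z\<close>, and the open region \<open>Q\<close> is closed: from now
  on it touches only its old attachment \<open>Y\<close> and \<open>B\<close>, at most
  \<open>2 * w\<close> vertices. A join of two branches that both contain marks also adds its bag.
  Such joins do not consume an element of \<open>M\<close>; they are paid for by the slack terms
  \<open>2\<close> and \<open>w\<close> in the two bounds, since two copies of the slack become
  one.\<close>

lemma dec_marking: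
  assumes "dec w U B"
  shows "M \<inter> (U - B) = {} \<or> (\<exists>Z \<W> Y Q. marking w U B M Z \<W> Y Q)"
  using assms
proof (induction rule: dec.induct)
  case (insert U B v)
  have eq: "insert v U - insert v B = U - B" using insert.hyps(2) by auto
  have BU: "B \<subseteq> U" using dec_sub[OF insert.hyps(1)] by simp
  have v: "u \<in> B" if "u \<in> U" "E v u \<or> E u v" for u
    using insert.hyps(3)[OF that(1)] that(2) E_sym[of u v] by blast
  show ?case
  proof (cases "M \<inter> (U - B) = {}")
    case True
    then show ?thesis using eq by simp
  next
    case False
    then obtain Z \<W> Y Q where m: "marking w U B M Z \<W> Y Q" using insert.IH by blast
    have "marking w (insert v U) (insert v B) M Z \<W> Y (insert v Q)"
      unfolding marking_def eq
    proof (intro conjI ballI)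
      note ZU = markingD[OF m]
      show "nb (insert v Q) \<inter> insert v U \<subseteq> Y"
        using ZU v unfolding nb_def by blast
      fix W assume W: "W \<in> \<W>"
      note W = marking_region[OF m W]
      have "nb W \<inter> insert v U \<subseteq> nb W \<inter> U" using v W unfolding nb_def by blast
      moreover obtain N where "N \<subseteq> Z" "card N \<le> 2 * w" "nb W \<inter> U \<subseteq> N"
        using W by blast
      ultimately show "\<exists>N\<subseteq>Z. card N \<le> 2 * w \<and> nb W \<inter> insert v U \<subseteq> N" by blast
      show "W \<subseteq> U - B" "W \<inter> Z = {}" using W by simp_all
    qed (use markingD[OF m] insert.hyps(2) in auto)
    then show ?thesis by blast
  qed
next
  case (forget U B B')
  have BU: "B \<subseteq> U" "card B \<le> w" "U \<subseteq> V" using dec_sub[OF forget.hyps(1)] by auto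
  have fin: "finite U" "finite B" using dec_finite[OF forget.hyps(1)] by simp_all
  show ?case
  proof (cases "M \<inter> (B - B') = {}")
    case True
    then have eq: "M \<inter> (U - B') = M \<inter> (U - B)" using forget BU by auto
    show ?thesis
    proof (cases "M \<inter> (U - B) = {}")
      case False
      then obtain Z \<W> Y Q where m: "marking w U B M Z \<W> Y Q" using forget.IH by blast
      have "marking w U B' M Z \<W> Y Q"
        unfolding marking_def eq
      proof (intro conjI ballI)
        fix W assume "W \<in> \<W>"
        note W = marking_region[OF m this]
        show "W \<subseteq> U - B'" using W forget.hyps(2) by auto
        show "W \<inter> Z = {}" "\<exists>N\<subseteq>Z. card N \<le> 2 * w \<and> nb W \<inter> U \<subseteq> N" using W by simp_all
      next
        show "B' \<inter> Z \<subseteq> Y" "B' - Z \<subseteq> Q" using markingD(5,8)[OF m] forget.hyps(2) by auto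
      qed (rule markingD[OF m])+
      then show ?thesis by blast
    qed (use eq in simp)
  next
    case False
    have split: "M \<inter> (U - B') = M \<inter> (U - B) \<union> M \<inter> (B - B')" "M \<inter> (U - B) \<inter> (M \<inter> (B - B')) = {}"
      using BU forget.hyps(2) by auto
    have "0 < card (M \<inter> (B - B'))" using False fin by (simp add: card_gt_0_iff)
    then have c: "card (M \<inter> (U - B)) + 1 \<le> card (M \<inter> (U - B'))"
      unfolding split(1) using split(2) fin by (subst card_Un_disjoint) auto
    show ?thesis
    proof (cases "M \<inter> (U - B) = {}")
      case True
      \<comment> \<open>The first mark: everything below the bag is one region. Here
        \<open>1 + 2 \<le> 3\<close> and \<open>w + w \<le> 2 * w\<close> determine the coefficients
        3 and \<open>2 * w\<close>.\<close>
      have "marking w U B' M B {U - B} B {}"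
        unfolding marking_def
      proof (intro conjI ballI)
        have "1 \<le> card (M \<inter> (U - B'))" using c by simp
        then show "card {U - B} + 2 \<le> 3 * card (M \<inter> (U - B'))" by simp
        have "2 * w * 1 \<le> 2 * w * card (M \<inter> (U - B'))"
          using \<open>1 \<le> card (M \<inter> (U - B'))\<close> by (rule mult_le_mono2)
        then show "card B + w \<le> 2 * w * card (M \<inter> (U - B'))" using BU(2) by linarith
        fix W assume "W \<in> {U - B}"
        then have "nb W \<inter> U \<subseteq> B" by (auto simp: nb_def)
        then show "\<exists>N\<subseteq>B. card N \<le> 2 * w \<and> nb W \<inter> U \<subseteq> N" using BU by auto
      qed (use BU forget True in \<open>auto simp: nb_def\<close>)
      then show ?thesis by blast
    next
      case False
      then obtain Z \<W> Y Q where m: "marking w U B M Z \<W> Y Q" using forget.IH by blast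
      \<comment> \<open>A further mark above an existing one costs one more region and one more bag,
        less than the coefficients allow for a new element of \<open>M\<close>.\<close>
      have "marking w U B' M (Z \<union> B) (insert (Q - B) \<W>) B {}"
        unfolding marking_def
      proof (intro conjI ballI)
        have "card (insert (Q - B) \<W>) \<le> card \<W> + 1"
          using markingD(11)[OF m] by (simp add: card_insert_if)
        then show "card (insert (Q - B) \<W>) + 2 \<le> 3 * card (M \<inter> (U - B'))"
          using c m by (simp add: marking_def)
        have "card (Z \<union> B) + w \<le> card Z + w + w" using card_Un_le[of Z B] BU by simp
        also have "\<dots> \<le> 2 * w * card (M \<inter> (U - B)) + w" using m by (simp add: marking_def)
        also have "\<dots> \<le> 2 * w * (card (M \<inter> (U - B)) + 1)" by simp
        also have "\<dots> \<le> 2 * w * card (M \<inter> (U - B'))" using c by (rule mult_le_mono2)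
        finally show "card (Z \<union> B) + w \<le> 2 * w * card (M \<inter> (U - B'))" .
        fix W assume W: "W \<in> insert (Q - B) \<W>"
        have Y: "Y \<subseteq> Z" "card Y \<le> w" "nb Q \<inter> U \<subseteq> Y" using m by (auto simp: marking_def)
        have "\<exists>N\<subseteq>Z \<union> B. card N \<le> 2 * w \<and> nb (Q - B) \<inter> U \<subseteq> N"
        proof (intro exI[of _ "Y \<union> B"] conjI)
          show "card (Y \<union> B) \<le> 2 * w" using card_Un_le[of Y B] BU Y by simp
          show "nb (Q - B) \<inter> U \<subseteq> Y \<union> B" using Y unfolding nb_def by blast
        qed (use Y in auto)
        moreover have "\<exists>N\<subseteq>Z \<union> B. card N \<le> 2 * w \<and> nb W \<inter> U \<subseteq> N" if "W \<in> \<W>"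
          by (rule ex_subset_mono[of Z]) (use marking_region[OF m that] in auto)
        ultimately show "\<exists>N\<subseteq>Z \<union> B. card N \<le> 2 * w \<and> nb W \<inter> U \<subseteq> N"
          using W by blast
        show "W \<subseteq> U - B'" "W \<inter> (Z \<union> B) = {}"
          using marking_region[OF m, of W] W markingD(6,7)[OF m] forget.hyps(2) by blast+
      next
        show "M \<inter> (U - B') \<subseteq> Z \<union> B" using markingD(2)[OF m] by auto
        show "U \<subseteq> Z \<union> B \<union> {} \<union> \<Union>(insert (Q - B) \<W>)" using markingD(9)[OF m] by auto
      qed (use markingD(1,11)[OF m] BU forget.hyps(2) in \<open>auto simp: nb_def\<close>)
      then show ?thesis by blast
    qed
  qed
next
  case (join U1 B U2)
  have BU: "B \<subseteq> U1" "B \<subseteq> U2" "card B \<le> w" "U1 \<subseteq> V" "U2 \<subseteq> V" using join.hyps dec_sub by auto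
  have noE: "\<not> E x y" "\<not> E y x" if "x \<in> U1 - B" "y \<in> U2 - B" for x y
    using join.hyps(4)[OF that] E_sym[of y x] by blast+
  \<comment> \<open>A branch \<open>D\<close> without marks is merged into the open region around
    the root, so neither a bag nor a region is added.\<close>
  have one: "\<exists>Z \<W> Y Q. marking w (A \<union> D) B M Z \<W> Y Q"
    if m: "marking w A B M Z \<W> Y Q" and D: "M \<inter> (D - B) = {}" and AD: "A \<inter> D \<subseteq> B" "B \<subseteq> A" "B \<subseteq> D"
      and noE: "\<And>x y. x \<in> A - B \<Longrightarrow> y \<in> D - B \<Longrightarrow> \<not> E x y \<and> \<not> E y x" for A D Z \<W> Y Q
  proof -
    have eq: "M \<inter> (A \<union> D - B) = M \<inter> (A - B)" using D by auto
    have ZU: "Z \<subseteq> A" "B - Z \<subseteq> Q" "B \<inter> Z \<subseteq> Y" "nb Q \<inter> A \<subseteq> Y" "Q \<subseteq> A" "Q \<inter> Z = {}"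
      "Y \<subseteq> Z" "A \<subseteq> Z \<union> Q \<union> \<Union>\<W>"
      using m by (simp_all add: marking_def)
    have "marking w (A \<union> D) B M Z \<W> Y (Q \<union> (D - Z))"
      unfolding marking_def eq
    proof (intro conjI ballI)
      show "nb (Q \<union> (D - Z)) \<inter> (A \<union> D) \<subseteq> Y"
      proof
        fix y assume y: "y \<in> nb (Q \<union> (D - Z)) \<inter> (A \<union> D)"
        then obtain x where x: "x \<in> Q \<union> (D - Z)" "E x y" and yQ: "y \<notin> Q" "y \<notin> D - Z" "y \<in> A \<union> D"
          by (auto simp: nb_def)
        have yA: "y \<in> A" using yQ ZU by auto
        show "y \<in> Y"
        proof (cases "x \<in> Q")
          case True
          then show ?thesis using x yQ yA ZU by (auto simp: nb_def)
        next
          case False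
          then have "x \<in> D - B" using x ZU AD by auto
          then have "y \<in> B" using noE yA x by blast
          then show ?thesis using ZU yQ by auto
        qed
      qed
      fix W assume W: "W \<in> \<W>"
      then have "W \<subseteq> A - B" using m by (simp add: marking_def)
      then have "nb W \<inter> (A \<union> D) \<subseteq> nb W \<inter> A" using noE AD unfolding nb_def by blast
      then show "\<exists>N\<subseteq>Z. card N \<le> 2 * w \<and> nb W \<inter> (A \<union> D) \<subseteq> N"
        using marking_region[OF m W] by (meson order_trans)
    next
      show "M \<inter> (A - B) \<subseteq> Z" "card Y \<le> w" "finite \<W>"
        "card \<W> + 2 \<le> 3 * card (M \<inter> (A - B))" "card Z + w \<le> 2 * w * card (M \<inter> (A - B))"
        "\<And>W. W \<in> \<W> \<Longrightarrow> W \<inter> Z = {}"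
        using m by (simp_all add: marking_def)
      show "W \<subseteq> A \<union> D - B" if "W \<in> \<W>" for W
      proof -
        have "W \<subseteq> A - B" using m that by (simp add: marking_def)
        then show ?thesis by auto
      qed
    qed (use ZU in auto)
    then show ?thesis by blast
  qed
  show ?case
  proof (cases "M \<inter> (U1 - B) = {}")
    case True
    show ?thesis
    proof (cases "M \<inter> (U2 - B) = {}")
      case True
      then have "M \<inter> (U1 \<union> U2 - B) = {}" using \<open>M \<inter> (U1 - B) = {}\<close> by auto
      then show ?thesis ..
    next
      case False
      then obtain Z \<W> Y Q where "marking w U2 B M Z \<W> Y Q" using join.IH by blast
      then have "\<exists>Z \<W> Y Q. marking w (U2 \<union> U1) B M Z \<W> Y Q"
        by (rule one) (use True BU join.hyps(3) noE in auto)
      then show ?thesis by (simp add: Un_commute)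
    qed
  next
    case 1: False
    then obtain Z1 \<W>1 Y1 Q1 where m1: "marking w U1 B M Z1 \<W>1 Y1 Q1" using join.IH by blast
    show ?thesis
    proof (cases "M \<inter> (U2 - B) = {}")
      case True
      then have "\<exists>Z \<W> Y Q. marking w (U1 \<union> U2) B M Z \<W> Y Q"
        by (rule one[OF m1]) (use BU join.hyps(3) noE in auto)
      then show ?thesis by blast
    next
      case False
      then obtain Z2 \<W>2 Y2 Q2 where m2: "marking w U2 B M Z2 \<W>2 Y2 Q2" using join.IH by blast
      have fin: "finite (M \<inter> (U1 - B))" "finite (M \<inter> (U2 - B))"
        using dec_finite[OF join.hyps(1)] dec_finite[OF join.hyps(2)] by simp_all
      have "M \<inter> (U1 \<union> U2 - B) = (M \<inter> (U1 - B)) \<union> (M \<inter> (U2 - B))" by auto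
      then have c: "card (M \<inter> (U1 \<union> U2 - B)) = card (M \<inter> (U1 - B)) + card (M \<inter> (U2 - B))"
        using fin join.hyps(3) by (subst card_Un_disjoint[symmetric]) auto
      \<comment> \<open>Both open regions are closed and \<open>B\<close> is added. The new bounds
        are sums of the old ones: \<open>\<W>1\<close> and \<open>\<W>2\<close> come with a slack of
        2 each, of which one pays for the two new regions, and likewise one \<open>w\<close> pays
        for \<open>B\<close>.\<close>
      let ?\<W> = "\<W>1 \<union> \<W>2 \<union> {Q1 - B, Q2 - B}"
      let ?Z = "Z1 \<union> Z2 \<union> B"
      have region: "\<exists>N\<subseteq>Z \<union> B. card N \<le> 2 * w \<and> nb W \<inter> (A \<union> D) \<subseteq> N"
        if W: "W \<in> insert (Q - B) \<W>" and m: "marking w A B M Z \<W> Y Q" and AD: "B \<subseteq> A"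
        and noE: "\<And>x y. x \<in> A - B \<Longrightarrow> y \<in> D - B \<Longrightarrow> \<not> E x y \<and> \<not> E y x" for A D Z \<W> Y Q W
      proof -
        have Y: "Y \<subseteq> Z" "card Y \<le> w" "nb Q \<inter> A \<subseteq> Y" "Q \<subseteq> A" using m by (auto simp: marking_def)
        have WA: "W \<subseteq> A - B" using W Y marking_region[OF m, of W] by auto
        have "\<exists>N\<subseteq>Z \<union> B. card N \<le> 2 * w \<and> nb W \<inter> A \<subseteq> N"
        proof (cases "W = Q - B")
          case True
          have "card (Y \<union> B) \<le> 2 * w" using card_Un_le[of Y B] BU Y by simp
          moreover have "nb W \<inter> A \<subseteq> Y \<union> B" using Y unfolding nb_def True by blast
          ultimately show ?thesis using Y by blast
        next
          case False
          then have "W \<in> \<W>" using W by simp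
          show ?thesis
            by (rule ex_subset_mono[of Z]) (use marking_region[OF m \<open>W \<in> \<W>\<close>] in auto)
        qed
        moreover have "nb W \<inter> (A \<union> D) \<subseteq> nb W \<inter> A" using noE WA AD unfolding nb_def by blast
        ultimately show ?thesis by (meson order_trans)
      qed
      have z1: "Z1 \<subseteq> U1" "B \<inter> Z1 \<subseteq> Y1" "M \<inter> (U1 - B) \<subseteq> Z1" "Q1 \<subseteq> U1" "Q1 \<inter> Z1 = {}" "finite \<W>1"
        "U1 \<subseteq> Z1 \<union> Q1 \<union> \<Union>\<W>1" "\<And>W. W \<in> \<W>1 \<Longrightarrow> W \<subseteq> U1 - B" "\<And>W. W \<in> \<W>1 \<Longrightarrow> W \<inter> Z1 = {}"
        "card \<W>1 + 2 \<le> 3 * card (M \<inter> (U1 - B))" "card Z1 + w \<le> 2 * w * card (M \<inter> (U1 - B))"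
        using m1 by (simp_all add: marking_def)
      have z2: "Z2 \<subseteq> U2" "B \<inter> Z2 \<subseteq> Y2" "M \<inter> (U2 - B) \<subseteq> Z2" "Q2 \<subseteq> U2" "Q2 \<inter> Z2 = {}" "finite \<W>2"
        "U2 \<subseteq> Z2 \<union> Q2 \<union> \<Union>\<W>2" "\<And>W. W \<in> \<W>2 \<Longrightarrow> W \<subseteq> U2 - B" "\<And>W. W \<in> \<W>2 \<Longrightarrow> W \<inter> Z2 = {}"
        "card \<W>2 + 2 \<le> 3 * card (M \<inter> (U2 - B))" "card Z2 + w \<le> 2 * w * card (M \<inter> (U2 - B))"
        using m2 by (simp_all add: marking_def)
      have "marking w (U1 \<union> U2) B M ?Z ?\<W> B {}"
        unfolding marking_def
      proof (intro conjI ballI)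
        fix W assume W: "W \<in> ?\<W>"
        then consider (1) "W \<in> insert (Q1 - B) \<W>1" | (2) "W \<in> insert (Q2 - B) \<W>2" by blast
        then have "W \<subseteq> U1 - B \<and> W \<inter> Z1 = {} \<and> (\<exists>N\<subseteq>Z1 \<union> B. card N \<le> 2 * w \<and> nb W \<inter> (U1 \<union> U2) \<subseteq> N)
          \<or> W \<subseteq> U2 - B \<and> W \<inter> Z2 = {} \<and> (\<exists>N\<subseteq>Z2 \<union> B. card N \<le> 2 * w \<and> nb W \<inter> (U1 \<union> U2) \<subseteq> N)"
        proof cases
          case 1
          then have "W \<subseteq> U1 - B \<and> W \<inter> Z1 = {}" using z1 by blast
          then show ?thesis using region[OF 1 m1 BU(1), of U2] noE by blast
        next
          case 2
          then have "W \<subseteq> U2 - B \<and> W \<inter> Z2 = {}" using z2 by blast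
          then show ?thesis using region[OF 2 m2 BU(2), of U1] noE by (simp add: Un_commute)
        qed
        then have W: "W \<subseteq> U1 \<union> U2 - B \<and> W \<inter> ?Z = {} \<and>
            (\<exists>N\<subseteq>?Z. card N \<le> 2 * w \<and> nb W \<inter> (U1 \<union> U2) \<subseteq> N)"
        proof (elim disjE conjE)
          assume a: "W \<subseteq> U1 - B" "W \<inter> Z1 = {}"
            "\<exists>N\<subseteq>Z1 \<union> B. card N \<le> 2 * w \<and> nb W \<inter> (U1 \<union> U2) \<subseteq> N"
          have "W \<inter> ?Z = {}" using a(1,2) z2(1) join.hyps(3) by blast
          moreover have "Z1 \<union> B \<subseteq> ?Z" by auto
          ultimately have "\<exists>N\<subseteq>?Z. card N \<le> 2 * w \<and> nb W \<inter> (U1 \<union> U2) \<subseteq> N"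
            by (intro ex_subset_mono[OF a(3)])
          with \<open>W \<inter> ?Z = {}\<close> show ?thesis using a(1) by blast
        next
          assume a: "W \<subseteq> U2 - B" "W \<inter> Z2 = {}"
            "\<exists>N\<subseteq>Z2 \<union> B. card N \<le> 2 * w \<and> nb W \<inter> (U1 \<union> U2) \<subseteq> N"
          have "W \<inter> ?Z = {}" using a(1,2) z1(1) join.hyps(3) by blast
          moreover have "Z2 \<union> B \<subseteq> ?Z" by auto
          ultimately have "\<exists>N\<subseteq>?Z. card N \<le> 2 * w \<and> nb W \<inter> (U1 \<union> U2) \<subseteq> N"
            by (intro ex_subset_mono[OF a(3)])
          with \<open>W \<inter> ?Z = {}\<close> show ?thesis using a(1) by blast
        qed
        show "W \<subseteq> U1 \<union> U2 - B" "W \<inter> ?Z = {}"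
          "\<exists>N\<subseteq>?Z. card N \<le> 2 * w \<and> nb W \<inter> (U1 \<union> U2) \<subseteq> N"
          using W by simp_all
      next
        have "card ?\<W> \<le> card (\<W>1 \<union> \<W>2) + card {Q1 - B, Q2 - B}" by (rule card_Un_le)
        moreover have "card (\<W>1 \<union> \<W>2) \<le> card \<W>1 + card \<W>2" by (rule card_Un_le)
        moreover have "card {Q1 - B, Q2 - B} \<le> 2" by (simp add: card_insert_if)
        ultimately show "card ?\<W> + 2 \<le> 3 * card (M \<inter> (U1 \<union> U2 - B))"
          unfolding c distrib_left using z1(10) z2(10) by linarith
        have "card ?Z \<le> card Z1 + card Z2 + card B"
          using card_Un_le[of "Z1 \<union> Z2" B] card_Un_le[of Z1 Z2] by linarith
        then show "card ?Z + w \<le> 2 * w * card (M \<inter> (U1 \<union> U2 - B))"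
          unfolding c distrib_left using z1(11) z2(11) BU(3) by linarith
        show "U1 \<union> U2 \<subseteq> ?Z \<union> {} \<union> \<Union>?\<W>" using z1(7) z2(7) by auto
        show "M \<inter> (U1 \<union> U2 - B) \<subseteq> ?Z" using z1(3) z2(3) by auto
        show "?Z \<subseteq> U1 \<union> U2" using z1(1) z2(1) BU by auto
        show "finite ?\<W>" using z1(6) z2(6) by simp
      qed (use BU in \<open>auto simp: nb_def\<close>)
      then show ?thesis by blast
    qed
  qed
qed simp

text \<open>The summand 1 in the bound on the regions is for an empty \<open>M \<inter> U\<close>,
  where all of \<open>U\<close> is a single region. Otherwise the open region around the root is
  counted as a region too, covered by the slack.\<close>

theorem dec_regions:
  assumes "dec w U {}"
  obtains Z \<W> where "Z \<subseteq> U" "M \<inter> U \<subseteq> Z" "card Z \<le> 2 * w * card (M \<inter> U)"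
    "finite \<W>" "card \<W> \<le> 3 * card (M \<inter> U) + 1" "U \<subseteq> Z \<union> \<Union>\<W>"
    "\<And>W. W \<in> \<W> \<Longrightarrow> W \<inter> Z = {} \<and> (\<exists>N\<subseteq>Z. card N \<le> 2 * w \<and> nb W \<inter> U \<subseteq> N)"
proof (cases "M \<inter> U = {}")
  case True
  show ?thesis
    by (rule that[of "{}" "{U}"]) (use True in \<open>auto simp: nb_def\<close>)
next
  case False
  then obtain Z \<W> Y Q where "marking w U {} M Z \<W> Y Q"
    using dec_marking[OF assms, of M] by auto
  then have m: "Z \<subseteq> U" "M \<inter> U \<subseteq> Z" "Y \<subseteq> Z" "card Y \<le> w" "U \<subseteq> Z \<union> Q \<union> \<Union>\<W>" "nb Q \<inter> U \<subseteq> Y"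
     "finite \<W>" "\<And>W. W \<in> \<W> \<Longrightarrow> W \<inter> Z = {} \<and> (\<exists>N\<subseteq>Z. card N \<le> 2 * w \<and> nb W \<inter> U \<subseteq> N)"
     "Q \<inter> Z = {}" "card \<W> + 2 \<le> 3 * card (M \<inter> U)" "card Z + w \<le> 2 * w * card (M \<inter> U)"
    unfolding marking_def by simp_all
  show ?thesis
  proof (rule that[of Z "insert Q \<W>"])
    fix W assume "W \<in> insert Q \<W>"
    then consider "W = Q" | "W \<in> \<W>" by auto
    then show "W \<inter> Z = {} \<and> (\<exists>N\<subseteq>Z. card N \<le> 2 * w \<and> nb W \<inter> U \<subseteq> N)"
    proof cases
      case 1
      then show ?thesis using m(3,4,6,9) by auto
    qed (rule m(8))
  next
    show "card (insert Q \<W>) \<le> 3 * card (M \<inter> U) + 1"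
      using m(7,10) by (simp add: card_insert_if)
  qed (use m in auto)
qed

end

lemma sum_le_card_mult: "(\<And>x. x \<in> A \<Longrightarrow> f x \<le> K) \<Longrightarrow> sum f A \<le> card A * (K :: nat)"
  using sum_bounded_above[of A f K] by simp

section \<open>The hitting family\<close>

text \<open>
  \<open>gap\<close>: every set with a small boundary that can be searched with \<open>5 * \<eta> + 5\<close> guards can be
  searched with \<open>3 * \<eta> + 3\<close>.  Otherwise such a set by itself is a hitting family.
\<close>

locale gap_graph = ugraph +
  fixes \<eta> :: nat
  assumes gap: "conn C \<Longrightarrow> card (nb C) \<le> 2 * \<eta> + 2 \<Longrightarrow> win (5 * \<eta> + 5) C \<Longrightarrow> win (3 * \<eta> + 3) C"
begin

definition smalls :: "'a set set" where
  "smalls = {C. conn C \<and> card (nb C) \<le> 2 * \<eta> + 2 \<and> win (3 * \<eta> + 3) C}"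

text \<open>Both closure properties cost \<open>2 * \<eta> + 2\<close> guards on top of
  \<open>3 * \<eta> + 3\<close>, and the gap assumption takes them back.\<close>

sublocale small_sides V E smalls "2 * \<eta> + 2"
proof
  fix C D assume C: "C \<in> smalls" and D: "D \<in> smalls" and CD: "C \<inter> D \<noteq> {}"
    and j: "card (nb (C \<union> D)) \<le> 2 * \<eta> + 2"
  have "win (5 * \<eta> + 5) (C \<union> D)"
    by (rule win_Un[of "3 * \<eta> + 3" C D "2 * \<eta> + 2"]) (use C D in \<open>auto simp: smalls_def\<close>)
  then show "C \<union> D \<in> smalls"
    using conn_Un[of C D] C D CD j gap by (auto simp: smalls_def)
next
  fix C D assume C: "C \<in> smalls" and D: "D \<subseteq> C" "conn D" "card (nb D) \<le> 2 * \<eta> + 2"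
  have "win (3 * \<eta> + 3 + (2 * \<eta> + 2)) D"
    by (rule win_subset[of _ C _ "nb D"]) (use C D nb_V in \<open>auto simp: smalls_def\<close>)
  then have "win (5 * \<eta> + 5) D" by (simp add: algebra_simps)
  then show "D \<in> smalls" using gap D by (simp add: smalls_def)
qed (auto simp: smalls_def)

definition high :: "'a set" where
  "high = V - \<Union>smalls"

text \<open>Maximal small sets with the same neighborhood are merged into one member. Taken
  separately, arbitrarily many of them could hang on the same few vertices and be missed by a
  modulator; after merging, missed members can be counted by neighborhoods.\<close>

definition fill :: "'a set \<Rightarrow> 'a set" where
  "fill S = S \<union> \<Union>{C \<in> Fmax. nb C = S}"

text \<open>A vertex in no small set may have only neighbors of the same kind and then lies in no
  neighborhood of a small set. These edges ensure that the family covers it.\<close>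

definition high_edges :: "'a set set" where
  "high_edges = {{u, v} |u v. u \<in> high \<and> v \<in> high \<and> E u v}"

definition family :: "'a set set" where
  "family = fill ` nb ` Fmax \<union> high_edges"

lemma ex_Fmax_of_low:
  assumes "v \<in> V" "v \<notin> high"
  obtains C where "C \<in> Fmax" "v \<in> C"
  using assms ex_Fmax unfolding high_def by blast

lemma Fmax_conn: "C \<in> Fmax \<Longrightarrow> conn C"
  using FmaxD(1) F_conn by blast

lemma fill_sub: "C \<in> Fmax \<Longrightarrow> C \<union> nb C \<subseteq> fill (nb C)"
  by (auto simp: fill_def)

lemma fill_V: "C \<in> Fmax \<Longrightarrow> fill (nb C) \<subseteq> V"
  using nb_V Fmax_conn conn_V unfolding fill_def by blast

lemma finite_family: "finite family"
proof (rule finite_subset)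
  show "family \<subseteq> Pow V"
    using fill_V E_V by (auto simp: family_def high_edges_def high_def)
qed simp

text \<open>
  If \<open>s\<close> had no neighbor outside of the fill, it could be added to the components, which
  contradicts their maximality.
\<close>

lemma fill_boundary:
  assumes C: "C \<in> Fmax" and s: "s \<in> nb C"
  shows "\<exists>y. E s y \<and> y \<notin> fill (nb C)"
proof (rule ccontr)
  assume "\<not> ?thesis"
  then have N: "\<And>y. E s y \<Longrightarrow> y \<in> fill (nb C)" by blast
  define S where "S = nb C"
  define T where "T = {D \<in> Fmax. nb D = S}"
  define D where "D = insert s (\<Union>T)"
  have CT: "C \<in> T" using C by (simp add: T_def S_def)
  have TV: "B \<subseteq> V" "conn B" "nb B = S" "B \<in> smalls" if "B \<in> T" for B
    using that Fmax_conn conn_V FmaxD(1) by (auto simp: T_def)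
  have sV: "s \<in> V" using s nb_V by auto
  have "conn D"
  proof (rule connI[of s])
    show "D \<subseteq> V" using TV(1) sV by (auto simp: D_def)
    fix y assume "y \<in> D"
    then consider "y = s" | B where "B \<in> T" "y \<in> B" by (auto simp: D_def)
    then show "(rE D)\<^sup>*\<^sup>* s y"
    proof cases
      case 2
      have "conn (insert s B)" using conn_insert[OF TV(2)] TV(3) 2 s S_def by auto
      then have "(rE (insert s B))\<^sup>*\<^sup>* s y" using 2 by (auto simp: conn_def)
      then show ?thesis by (rule rE_mono[rotated]) (use 2 in \<open>auto simp: D_def\<close>)
    qed simp
  qed (simp add: D_def)
  moreover have nbD: "nb D \<subseteq> S"
  proof
    fix y assume y: "y \<in> nb D"
    then obtain x where x: "x \<in> D" "E x y" "y \<notin> D" by (auto simp: nb_def)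
    show "y \<in> S"
    proof (cases "x = s")
      case True
      then have "y \<in> fill S" using N x S_def by auto
      then show ?thesis using x by (auto simp: fill_def D_def T_def)
    next
      case False
      then obtain B where "B \<in> T" "x \<in> B" using x by (auto simp: D_def)
      then show ?thesis using TV(3)[of B] x by (auto simp: nb_def D_def)
    qed
  qed
  moreover have cS: "card S \<le> 2 * \<eta> + 2" using F_nb FmaxD(1)[OF C] by (simp add: S_def)
  moreover have "win (3 * \<eta> + 3) D"
  proof (rule gap)
    show "conn D" by fact
    show cD: "card (nb D) \<le> 2 * \<eta> + 2"
      using card_mono[OF _ nbD] cS finite_nb[of C] by (simp add: S_def)
    show "win (5 * \<eta> + 5) D"
    proof (rule win.intros[of D S])
      fix v assume v: "v \<in> D - S"
      then obtain B where B: "B \<in> T" "v \<in> B" using s by (auto simp: D_def S_def)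
      then have "comp S v = B"
        by (intro comp_eq) (use TV[of B] in \<open>auto simp: nb_def\<close>)
      then show "win (5 * \<eta> + 5) (comp S v)"
        using TV(4)[OF B(1)] by (auto simp: smalls_def intro: win_mono)
    qed (use nbD cS nb_V \<open>conn D\<close> conn_V in \<open>auto simp: S_def\<close>)
  qed
  moreover have "card (nb D) \<le> card S"
    using nbD finite_nb[of C] by (intro card_mono) (simp_all add: S_def)
  ultimately have "D \<in> smalls" by (simp add: smalls_def)
  moreover have "C \<subseteq> D" using CT by (auto simp: D_def)
  ultimately have "D = C" using FmaxD(2)[OF C] by blast
  then show False using s by (auto simp: D_def nb_def)
qed

text \<open>The neighborhood is recovered as the set of vertices of the fill that see something
  outside. Hence \<open>fill\<close> is injective on neighborhoods, and counting neighborhoods is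
  the same as counting members.\<close>

lemma fill_determines:
  assumes C: "C \<in> Fmax"
  shows "nb C = {s \<in> fill (nb C). \<exists>y. E s y \<and> y \<notin> fill (nb C)}"
proof
  show "{s \<in> fill (nb C). \<exists>y. E s y \<and> y \<notin> fill (nb C)} \<subseteq> nb C"
    unfolding fill_def nb_def by blast
qed (use fill_boundary[OF C] in \<open>auto simp: fill_def\<close>)

lemma inj_fill: "inj_on fill (nb ` Fmax)"
proof (rule inj_onI)
  fix S T assume "S \<in> nb ` Fmax" "T \<in> nb ` Fmax" and eq: "fill S = fill T"
  then obtain C D where "C \<in> Fmax" "S = nb C" "D \<in> Fmax" "T = nb D" by blast
  then have "S = {s \<in> fill S. \<exists>y. E s y \<and> y \<notin> fill S}" "T = {s \<in> fill T. \<exists>y. E s y \<and> y \<notin> fill T}"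
    using fill_determines by blast+
  then show "S = T" unfolding eq by simp
qed

text \<open>An isolated vertex is caught by one guard placed on it, so it forms a small set.\<close>

lemma high_neighbor:
  assumes "v \<in> high"
  shows "\<exists>y. E v y"
proof (rule ccontr)
  assume "\<not> ?thesis"
  then have "nb {v} = {}" by (auto simp: nb_def)
  moreover have "v \<in> V" using assms by (simp add: high_def)
  moreover have "win (3 * \<eta> + 3) {v}"
    by (rule win.intros[of _ "{v}"]) (use calculation in auto)
  ultimately have "{v} \<in> smalls" by (simp add: smalls_def conn_singleton)
  then show False using assms by (auto simp: high_def)
qed

text \<open>The number of regions has an additive constant, which at least one hit member must
  absorb. With \<open>X = V\<close> this also shows that the family is non-empty.\<close>

lemma family_hits:
  assumes X: "X \<subseteq> V" "X \<noteq> {}"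
  shows "{A \<in> family. A \<inter> X \<noteq> {}} \<noteq> {}"
proof -
  obtain x where x: "x \<in> X" using X by auto
  have xV: "x \<in> V" using x X by auto
  have fillf: "fill (nb C) \<in> family" if "C \<in> Fmax" for C using that by (auto simp: family_def)
  show ?thesis
  proof (cases "x \<in> high")
    case False
    then obtain C where C: "C \<in> Fmax" "x \<in> C" using ex_Fmax_of_low xV by blast
    then have "x \<in> fill (nb C)" using fill_sub by auto
    then show ?thesis using fillf[OF C(1)] x by blast
  next
    case True
    then obtain y where y: "E x y" using high_neighbor by blast
    show ?thesis
    proof (cases "y \<in> high")
      case True
      then have "{x, y} \<in> family" using y \<open>x \<in> high\<close> unfolding family_def high_edges_def by blast
      then show ?thesis using x by blast
    next
      case False
      then obtain C where C: "C \<in> Fmax" "y \<in> C" using ex_Fmax_of_low E_V[OF y] by blast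
      then have "x \<notin> C" using \<open>x \<in> high\<close> FmaxD(1) by (auto simp: high_def)
      then have "x \<in> nb C" using C y E_sym by (auto simp: nb_def)
      then have "x \<in> fill (nb C)" using fill_sub C by auto
      then show ?thesis using fillf[OF C(1)] x by blast
    qed
  qed
qed

text \<open>Write \<open>j = 2 * \<eta> + 2\<close>. The 1 stands for the hit members themselves. A
  hit member marks at most \<open>j + 2\<close> vertices, \<open>j\<close> as a neighborhood and 2
  as an edge, and each marked vertex yields at most \<open>2 * (\<eta> + 1)\<close> vertices of
  \<open>Z\<close>. A vertex of \<open>Z\<close> accounts for at most \<open>4 ^ j\<close>
  neighborhoods and \<open>\<eta> + 1\<close> edges that are missed, a region for at most
  \<open>2 ^ j\<close> neighborhoods.\<close>

definition ratio :: nat where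
  "ratio = 1 + 2 * (\<eta> + 1) * (2 * \<eta> + 4) * (4 ^ (2 * \<eta> + 2) + (\<eta> + 1)) +
     (3 * (2 * \<eta> + 4) + 1) * 2 ^ (2 * \<eta> + 2)"

theorem family_hitting:
  assumes X: "X \<subseteq> V" "X \<noteq> {}" and dec: "dec (\<eta> + 1) (V - X) {}"
  shows "card family \<le> ratio * card {A \<in> family. A \<inter> X \<noteq> {}}"
proof -
  define w where "w = \<eta> + 1"
  define j where "j = 2 * \<eta> + 2"
  have j: "2 * w = j" "w + j = 3 * \<eta> + 3" by (simp_all add: w_def j_def)
  define P1 where "P1 = {A \<in> family. A \<inter> X \<noteq> {}}"
  define S1 where "S1 = {S \<in> nb ` Fmax. fill S \<inter> X \<noteq> {}}"
  define S0 where "S0 = {S \<in> nb ` Fmax. fill S \<inter> X = {}}"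
  define E1 where "E1 = {e \<in> high_edges. e \<inter> X \<noteq> {}}"
  define E0 where "E0 = {e \<in> high_edges. e \<inter> X = {}}"
  have finP1: "finite P1" using finite_family by (simp add: P1_def)
  have finS1: "finite S1" using finite_Fmax by (simp add: S1_def)
  have E1P1: "E1 \<subseteq> P1" by (auto simp: E1_def P1_def family_def)
  have finE1: "finite E1" using E1P1 finP1 by (rule finite_subset)
  have cE1: "card E1 \<le> card P1" by (rule card_mono[OF finP1 E1P1])
  have cS1: "card S1 \<le> card P1"
  proof -
    have "card S1 = card (fill ` S1)"
      by (rule card_image[symmetric], rule inj_on_subset[OF inj_fill]) (auto simp: S1_def)
    also have "\<dots> \<le> card P1"
      by (rule card_mono[OF finP1]) (auto simp: S1_def P1_def family_def)
    finally show ?thesis .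
  qed
  have P1pos: "1 \<le> card P1"
    using family_hits[OF X] finP1 unfolding P1_def by (simp add: Suc_leI card_gt_0_iff)
  have S1E1: "\<Union>S1 \<union> \<Union>E1 \<subseteq> V"
    using nb_V E_V by (auto simp: S1_def E1_def high_edges_def)
  define M where "M = (\<Union>S1 \<union> \<Union>E1) - X"
  have cM: "card M \<le> (j + 2) * card P1"
  proof -
    have "card M \<le> card (\<Union>S1 \<union> \<Union>E1)"
    proof (rule card_mono)
      show "finite (\<Union>S1 \<union> \<Union>E1)" using S1E1 fin_V by (rule finite_subset)
    qed (auto simp: M_def)
    also have "\<dots> \<le> card (\<Union>S1) + card (\<Union>E1)" by (rule card_Un_le)
    also have "card (\<Union>S1) \<le> (\<Sum>S\<in>S1. card S)" by (rule card_Union_le_sum_card)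
    also have "\<dots> \<le> card S1 * j"
      using F_nb FmaxD(1) by (intro sum_le_card_mult) (auto simp: S1_def j_def)
    also have "card (\<Union>E1) \<le> (\<Sum>e\<in>E1. card e)" by (rule card_Union_le_sum_card)
    also have "\<dots> \<le> card E1 * 2"
    proof (rule sum_le_card_mult)
      fix e assume "e \<in> E1"
      then obtain u v where "e = {u, v}" by (auto simp: E1_def high_edges_def)
      then show "card e \<le> 2" by (simp add: card_insert_if)
    qed
    finally have "card M \<le> card S1 * j + card E1 * 2" by linarith
    also have "\<dots> \<le> card P1 * j + card P1 * 2"
      using cS1 cE1 by (intro add_mono mult_le_mono1)
    finally show ?thesis by (simp add: algebra_simps)
  qed
  define U where "U = V - X"
  have MU: "M \<inter> U = M"
    using S1E1 by (auto simp: M_def U_def)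
  have decU: "dec w U {}" using dec by (simp add: w_def U_def)
  obtain Z \<W> where Z: "Z \<subseteq> U" "M \<inter> U \<subseteq> Z" "card Z \<le> 2 * w * card (M \<inter> U)"
    "finite \<W>" "card \<W> \<le> 3 * card (M \<inter> U) + 1" "U \<subseteq> Z \<union> \<Union>\<W>"
    "\<And>W. W \<in> \<W> \<Longrightarrow> W \<inter> Z = {} \<and> (\<exists>N\<subseteq>Z. card N \<le> 2 * w \<and> nb W \<inter> U \<subseteq> N)"
    using dec_regions[OF decU, of M] by metis
  obtain NW where NW: "\<And>W. W \<in> \<W> \<Longrightarrow> NW W \<subseteq> Z \<and> card (NW W) \<le> j \<and> nb W \<inter> U \<subseteq> NW W"
    using Z(7) j(1) by metis
  have finZ: "finite Z" using Z(1) fin_V finite_subset unfolding U_def by blast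
  have nbZ: "nb C \<subseteq> X \<union> Z" if "C \<in> Fmax" "nb C \<in> S1" for C
    using that Z(2) MU unfolding M_def by blast
  \<comment> \<open>Otherwise \<open>y\<close> would be in no small set and would lie in a hit edge
    or in the neighborhood of a maximal small set whose fill is hit; in both cases \<open>y\<close>
    is marked and belongs to \<open>Z\<close>.\<close>
  have sees: "\<exists>C\<in>Fmax. nb C \<in> S1 \<and> y \<in> C" if y: "y \<in> U - Z" and x: "x \<in> X" "E y x" for x y
  proof (cases "y \<in> high")
    case False
    then obtain C where C: "C \<in> Fmax" "y \<in> C" using ex_Fmax_of_low E_V x by blast
    then have "x \<in> fill (nb C)" using fill_sub[OF C(1)] x by (auto simp: nb_def)
    then have "nb C \<in> S1" using C x by (auto simp: S1_def)
    then show ?thesis using C by blast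
  next
    case True
    have False
    proof (cases "x \<in> high")
      case True
      then have "{y, x} \<in> E1" using \<open>y \<in> high\<close> x unfolding E1_def high_edges_def by blast
      then have "y \<in> M" using y by (auto simp: M_def U_def)
      then show False using y Z(2) MU by blast
    next
      case False
      then obtain C where C: "C \<in> Fmax" "x \<in> C" using ex_Fmax_of_low E_V x by blast
      then have S1: "nb C \<in> S1" using fill_sub[OF C(1)] x by (auto simp: S1_def)
      have "y \<notin> C" using \<open>y \<in> high\<close> C FmaxD(1) by (auto simp: high_def)
      then have "y \<in> nb C" using C x E_sym by (auto simp: nb_def)
      then show False using nbZ[OF C(1) S1] y by (auto simp: U_def)
    qed
    then show ?thesis ..
  qed
  \<comment> \<open>A component of the rest that sees \<open>X\<close> is swallowed by one maximal
    small set, because the neighborhood of that set lies in \<open>X \<union> Z\<close> and cannot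
    cut the component. A component that does not see \<open>X\<close> stays inside a region,
    inherits its attachment and is searched by descending the decomposition.\<close>
  have component: "(\<exists>C\<in>Fmax. nb C \<in> S1 \<and> comp (X \<union> Z) v \<subseteq> C) \<or>
      (comp (X \<union> Z) v \<in> smalls \<and> (\<exists>W\<in>\<W>. nb (comp (X \<union> Z) v) \<subseteq> NW W))"
    if v: "v \<in> U - Z" for v
  proof -
    define K where "K = comp (X \<union> Z) v"
    have vV: "v \<in> V - (X \<union> Z)" using v by (auto simp: U_def)
    have K: "conn K" "K \<subseteq> V - (X \<union> Z)" "nb K \<subseteq> X \<union> Z" "v \<in> K"
      unfolding K_def using comp_conn[OF vV] comp_sub[OF vV] comp_nb[OF vV] comp_in by auto
    show ?thesis
    proof (cases "nb K \<inter> X = {}")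
      case False
      then obtain x y where xy: "x \<in> X" "y \<in> K" "E y x" by (auto simp: nb_def)
      then obtain C where C: "C \<in> Fmax" "nb C \<in> S1" "y \<in> C" using sees[of y x] K by (auto simp: U_def)
      have "K \<subseteq> C"
        by (rule conn_subset[OF K(1)]) (use nbZ[OF C(1,2)] K(2) C xy in auto)
      then show ?thesis using C K_def by auto
    next
      case True
      obtain W where W: "W \<in> \<W>" "v \<in> W" using v Z(6) by auto
      have "K \<subseteq> W"
      proof (rule conn_subset[OF K(1)])
        show "K \<inter> nb W = {}" using NW[OF W(1)] K(2) by (auto simp: U_def)
      qed (use W K in auto)
      have "nb K \<subseteq> NW W"
      proof
        fix y assume y: "y \<in> nb K"
        then have yZ: "y \<in> Z" "y \<in> U" using K(3) True Z(1) by auto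
        then have "y \<notin> W" using Z(7)[OF W(1)] by auto
        then have "y \<in> nb W" using y \<open>K \<subseteq> W\<close> by (auto simp: nb_def)
        then show "y \<in> NW W" using NW[OF W(1)] yZ by auto
      qed
      moreover have "finite (NW W)" using NW[OF W(1)] finZ finite_subset by blast
      ultimately have "card (nb K) \<le> j" using card_mono[of "NW W" "nb K"] NW[OF W(1)] by simp
      moreover have "win (3 * \<eta> + 3) K"
        unfolding j(2)[symmetric]
        by (rule dec_win[OF decU K(1)]) (use K(2) nb_V[of K] \<open>card (nb K) \<le> j\<close> in \<open>auto simp: U_def\<close>)
      ultimately have "K \<in> smalls" unfolding smalls_def using K(1) by (simp add: j_def)
      then show ?thesis using W \<open>nb K \<subseteq> NW W\<close> K_def by blast
    qed
  qed
  have highZ: "v \<in> Z" if "v \<in> high - X" for v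
  proof (rule ccontr)
    assume "v \<notin> Z"
    then have "v \<in> U - Z" using that by (auto simp: U_def high_def)
    from component[OF this] have "\<exists>C\<in>smalls. v \<in> C"
      using comp_in[of v "X \<union> Z"] FmaxD(1) by blast
    then show False using that by (auto simp: high_def)
  qed
  \<comment> \<open>Missed edges have both ends in \<open>Z\<close>, where the orientation leaves at
    most \<open>w\<close> edges for each vertex.\<close>
  have cE0: "card E0 \<le> w * card Z"
  proof -
    obtain f where f: "\<forall>u. finite (f u) \<and> card (f u) \<le> w"
      "\<forall>x\<in>U. \<forall>y\<in>U. E x y \<longrightarrow> y \<in> f x \<or> x \<in> f y"
      using dec_orientation[OF decU] by auto
    have "E0 \<subseteq> (\<lambda>(x, y). {x, y}) ` (SIGMA x:Z. f x)"
    proof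
      fix e assume "e \<in> E0"
      then obtain x y where e: "e = {x, y}" "x \<in> high - X" "y \<in> high - X" "E x y"
        by (auto simp: E0_def high_edges_def)
      then have "x \<in> Z" "y \<in> Z" using highZ by auto
      moreover have "y \<in> f x \<or> x \<in> f y" using f(2) e Z(1) calculation by blast
      ultimately show "e \<in> (\<lambda>(x, y). {x, y}) ` (SIGMA x:Z. f x)"
        using e(1) by (auto simp: insert_commute image_iff)
    qed
    moreover have "finite (SIGMA x:Z. f x)" using f finZ by auto
    ultimately have "card E0 \<le> card (SIGMA x:Z. f x)" by (meson card_image_le card_mono finite_imageI order_trans)
    also have "\<dots> = (\<Sum>x\<in>Z. card (f x))" using f finZ by (intro card_SigmaI) auto
    also have "\<dots> \<le> card Z * w" using f by (intro sum_le_card_mult) auto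
    finally show ?thesis by (simp add: mult.commute)
  qed
  \<comment> \<open>A maximal small set with a missed fill either meets \<open>Z\<close>, or it lies
    inside a single component. The component cannot be part of another maximal set with a hit
    neighborhood, so it is small, by maximality it is the set itself, and its neighborhood is one of
    the \<open>2 ^ j\<close> subsets of an attachment.\<close>
  have cS0: "card S0 \<le> card Z * 4 ^ j + card \<W> * 2 ^ j"
  proof -
    let ?A = "\<Union>z\<in>Z. {C \<in> Fmax. z \<in> C}"
    let ?B = "\<Union>W\<in>\<W>. Pow (NW W)"
    have finNW: "finite (NW W)" if "W \<in> \<W>" for W using NW[OF that] finZ finite_subset by blast
    have "S0 \<subseteq> nb ` ?A \<union> ?B"
    proof
      fix S assume "S \<in> S0"
      then obtain C where C: "C \<in> Fmax" "S = nb C" "fill (nb C) \<inter> X = {}" by (auto simp: S0_def)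
      have CX: "C \<inter> X = {}" "C \<subseteq> V" using fill_sub[OF C(1)] C Fmax_conn conn_V by auto
      obtain v where v: "v \<in> C" using Fmax_conn[OF C(1)] conn_ne by auto
      show "S \<in> nb ` ?A \<union> ?B"
      proof (cases "C \<inter> Z = {}")
        case False
        then show ?thesis using C by blast
      next
        case True
        then have vU: "v \<in> U - Z" using v CX by (auto simp: U_def)
        have sub: "C \<subseteq> comp (X \<union> Z) v"
          by (rule conn_sub_comp[OF Fmax_conn[OF C(1)] _ v]) (use CX True in auto)
        from component[OF vU] show ?thesis
        proof
          assume "\<exists>D\<in>Fmax. nb D \<in> S1 \<and> comp (X \<union> Z) v \<subseteq> D"
          then obtain D where D: "D \<in> Fmax" "nb D \<in> S1" "C \<subseteq> D" using sub by blast
          then have "D = C" using FmaxD C(1) by blast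
          then show ?thesis using D C by (auto simp: S1_def)
        next
          assume "comp (X \<union> Z) v \<in> smalls \<and> (\<exists>W\<in>\<W>. nb (comp (X \<union> Z) v) \<subseteq> NW W)"
          moreover from this have "comp (X \<union> Z) v = C" using FmaxD(2)[OF C(1)] sub by blast
          ultimately show ?thesis using C by auto
        qed
      qed
    qed
    then have "card S0 \<le> card (nb ` ?A \<union> ?B)"
      by (rule card_mono[rotated]) (use finZ finite_Fmax Z(4) finNW in auto)
    also have "\<dots> \<le> card (nb ` ?A) + card ?B" by (rule card_Un_le)
    also have "card (nb ` ?A) \<le> card ?A" by (rule card_image_le) (use finZ finite_Fmax in auto)
    also have "card ?A \<le> (\<Sum>z\<in>Z. card {C \<in> Fmax. z \<in> C})" by (rule card_UN_le[OF finZ])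
    also have "\<dots> \<le> card Z * 4 ^ j"
      using card_Fmax Z(1) by (intro sum_le_card_mult) (auto simp: U_def j_def)
    also have "card ?B \<le> (\<Sum>W\<in>\<W>. card (Pow (NW W)))" by (rule card_UN_le[OF Z(4)])
    also have "\<dots> \<le> card \<W> * 2 ^ j"
    proof (intro sum_le_card_mult)
      fix W assume "W \<in> \<W>"
      then show "card (Pow (NW W)) \<le> 2 ^ j" using NW finNW by (simp add: card_Pow power_increasing)
    qed
    finally show ?thesis by simp
  qed
  have "family \<subseteq> P1 \<union> (fill ` S0 \<union> E0)"
    by (auto simp: family_def P1_def S0_def E0_def)
  then have "card family \<le> card (P1 \<union> (fill ` S0 \<union> E0))"
  proof (rule card_mono[rotated])
    have "E0 \<subseteq> family" by (auto simp: E0_def family_def)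
    then show "finite (P1 \<union> (fill ` S0 \<union> E0))"
      using finP1 finite_Fmax finite_family finite_subset by (auto simp: S0_def)
  qed
  also have "\<dots> \<le> card P1 + (card (fill ` S0) + card E0)"
    by (meson card_Un_le add_left_mono order_trans)
  also have "card (fill ` S0) \<le> card S0"
    by (rule card_image_le) (use finite_Fmax in \<open>simp add: S0_def\<close>)
  finally have "card family \<le> card P1 + (card Z * 4 ^ j + card \<W> * 2 ^ j + w * card Z)"
    using cS0 cE0 by linarith
  also have "\<dots> = card P1 + card Z * (4 ^ j + w) + card \<W> * 2 ^ j"
    by (simp add: algebra_simps)
  also have "\<dots> \<le> card P1 + (2 * w * ((j + 2) * card P1)) * (4 ^ j + w) +
      ((3 * (j + 2) + 1) * card P1) * 2 ^ j"
  proof (intro add_mono mult_le_mono1 order_refl)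
    show "card Z \<le> 2 * w * ((j + 2) * card P1)"
      using Z(3) cM unfolding MU by (meson mult_le_mono2 order_trans)
    show "card \<W> \<le> (3 * (j + 2) + 1) * card P1"
      using Z(5) cM P1pos unfolding MU by (simp add: algebra_simps)
  qed
  also have "\<dots> = ratio * card P1"
    unfolding ratio_def w_def j_def by (simp add: algebra_simps)
  finally show ?thesis by (simp add: P1_def)
qed

end

section \<open>Treewidth\<close>

lemma connected_iff:
  assumes sym: "sym (arcs_ends H)" and sub: "arcs_ends H \<subseteq> verts H \<times> verts H"
  shows "Digraph_Component.connected H \<longleftrightarrow>
    verts H \<noteq> {} \<and> (\<forall>u\<in>verts H. \<forall>v\<in>verts H. (u, v) \<in> (arcs_ends H)\<^sup>*)"
proof -
  have "symcl (arcs_ends H) = arcs_ends H"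
    using sym by (auto simp: symcl_def dest: symD)
  moreover have "(u, v) \<in> rtrancl_on (verts H) (arcs_ends H) \<longleftrightarrow> (u, v) \<in> (arcs_ends H)\<^sup>*"
    if "u \<in> verts H" for u v
  proof
    assume "(u, v) \<in> (arcs_ends H)\<^sup>*"
    then show "(u, v) \<in> rtrancl_on (verts H) (arcs_ends H)"
    proof induction
      case (step y z)
      then show ?case using sub by (auto intro: rtrancl_on_into_rtrancl_on)
    qed (use that in simp)
  qed (rule rtrancl_on_rtranclI)
  ultimately show ?thesis unfolding connected_conv by auto
qed

lemma arcs_ends_induce: "arcs_ends (T \<restriction> S) = arcs_ends T \<inter> S \<times> S"
  by (auto simp: arcs_ends_conv)

lemma sym_arcs_ends_induce: "sym (arcs_ends T) \<Longrightarrow> sym (arcs_ends (T \<restriction> S))"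
  unfolding arcs_ends_induce by (auto simp: sym_def)

lemma connected_induce_iff:
  assumes "sym (arcs_ends T)"
  shows "Digraph_Component.connected (T \<restriction> S) \<longleftrightarrow>
    S \<noteq> {} \<and> (\<forall>u\<in>S. \<forall>v\<in>S. (u, v) \<in> (arcs_ends T \<inter> S \<times> S)\<^sup>*)"
  using connected_iff[OF sym_arcs_ends_induce[OF assms], of S] by (simp add: arcs_ends_induce)

text \<open>A simple path around the edge and the reverse arc close up to a cycle. As the path
  avoids the edge it has at least two arcs, so the cycle has length at least 3, which is what
  \<open>undirected_tree\<close> forbids.\<close>

lemma tree_edge_separates:
  assumes T: "undirected_tree T" and xy: "(x, y) \<in> arcs_ends T"
  shows "(x, y) \<notin> (arcs_ends T - {(x, y), (y, x)})\<^sup>*"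
proof
  assume path: "(x, y) \<in> (arcs_ends T - {(x, y), (y, x)})\<^sup>*"
  interpret T: graph T using T by (simp add: undirected_tree_def)
  define H where "H = T\<lparr>arcs := {a \<in> arcs T. arc_to_ends T a \<notin> {(x, y), (y, x)}}\<rparr>"
  have H: "verts H = verts T" "arcs H \<subseteq> arcs T" "tail H = tail T" "head H = head T"
    by (auto simp: H_def)
  interpret H: wf_digraph H by unfold_locales (use H in \<open>auto simp: subset_iff\<close>)
  have ends: "arcs_ends H = arcs_ends T - {(x, y), (y, x)}"
    by (auto simp: arcs_ends_def arc_to_ends_def H_def)
  have V: "x \<in> verts T" "y \<in> verts T" using T.adj_in_verts xy by auto
  then have "x \<rightarrow>\<^sup>*\<^bsub>H\<^esub> y" using path ends H by (simp add: H.reachable_conv)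
  then obtain p where p: "pre_digraph.apath H x p y" using H.reachable_apath by blast
  have sub: "subgraph H T"
    by (rule subgraphI) (use H T.wf_digraph_axioms H.wf_digraph_axioms in \<open>auto simp: compatible_def\<close>)
  have pT: "T.apath x p y" by (rule T.subgraph_apath_imp_apath[OF p sub])
  obtain a where a: "a \<in> arcs T" "tail T a = y" "head T a = x"
    using T.graph_symmetric[OF xy] by auto
  have ne: "x \<noteq> y" using xy T.adj_not_same by blast
  have aw: "T.awalk x p y" "distinct (T.awalk_verts x p)" using pT by (auto simp: T.apath_def)
  have cyc: "T.awalk x (p @ [a]) x"
    using aw a V by (auto simp: T.awalk_simps)
  have "T.awalk_verts x (p @ [a]) = T.awalk_verts x p @ [x]"
    using T.awalk_verts_append[OF cyc] a by simp
  moreover obtain ws where ws: "T.awalk_verts x p = x # ws"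
    using aw(1) by (cases p) (auto simp: T.awalk_simps)
  ultimately have "tl (T.awalk_verts x (p @ [a])) = ws @ [x]" by simp
  moreover have "distinct (ws @ [x])" using aw(2) ws by auto
  ultimately have "T.cycle (p @ [a])" unfolding T.cycle_def using cyc by auto
  moreover have "2 \<le> length p"
  proof (rule ccontr)
    assume "\<not> 2 \<le> length p"
    moreover have "p \<noteq> []" using aw(1) ne by (auto simp: T.awalk_simps)
    ultimately obtain b where b: "p = [b]" by (cases p) (auto simp: neq_Nil_conv not_le less_Suc_eq)
    then have "H.awalk x [b] y" using p by (simp add: pre_digraph.apath_def)
    then have "b \<in> arcs H" "arc_to_ends T b = (x, y)"
      using H by (auto simp: H.awalk_simps arc_to_ends_def)
    then show False by (auto simp: H_def)
  qed
  ultimately show False using T unfolding undirected_tree_def by auto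
qed

section \<open>From tree decompositions to nice tree decompositions\<close>

context ugraph
begin

lemma dec_bag:
  assumes "B \<subseteq> V" "card B \<le> w"
  shows "dec w B B"
proof -
  have "finite B" using assms(1) fin_V by (rule finite_subset)
  then show ?thesis using assms
  proof (induction B)
    case (insert v B)
    then have "dec w B B" by auto
    then show ?case using insert by (intro dec.insert) auto
  qed (rule dec.empty)
qed

lemma dec_grow:
  assumes "dec w U B" "C \<subseteq> V" "C \<inter> U \<subseteq> B" "card (B \<union> C) \<le> w"
    "\<And>u v. u \<in> C - B \<Longrightarrow> v \<in> U - B \<Longrightarrow> \<not> E u v"
  shows "dec w (U \<union> C) (B \<union> C)"
proof -
  have "finite C" using assms(2) fin_V by (rule finite_subset)
  then show ?thesis using assms(2-)
  proof (induction C)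
    case empty
    then show ?case using assms(1) by simp
  next
    case (insert v C)
    have fB: "finite B" using dec_finite[OF assms(1)] by simp
    have "card (B \<union> C) \<le> card (B \<union> insert v C)" using fB insert.hyps by (intro card_mono) auto
    then have IH: "dec w (U \<union> C) (B \<union> C)"
      using insert.prems by (intro insert.IH) auto
    show ?case
    proof (cases "v \<in> U \<union> C")
      case True
      then have "v \<in> B" using insert by auto
      then show ?thesis using IH dec_sub[OF assms(1)] by (simp add: insert_absorb subset_iff)
    next
      case False
      then have "v \<notin> B" using dec_sub[OF assms(1)] by auto
      have "dec w (insert v (U \<union> C)) (insert v (B \<union> C))"
      proof (rule dec.insert[OF IH])
        fix u assume u: "u \<in> U \<union> C" "E v u"
        show "u \<in> B \<union> C"
          using insert.prems(4)[of v u] u \<open>v \<notin> B\<close> by auto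
      qed (use insert.prems False in auto)
      then show ?thesis by simp
    qed
  qed
qed

text \<open>Induction on a connected set \<open>W\<close> of nodes with root \<open>x\<close>. An
  edge from \<open>x\<close> to some \<open>y\<close> in \<open>W\<close> splits \<open>W\<close>
  into two connected parts. The decomposition of the part of \<open>y\<close> is cut down to
  \<open>bag x \<inter> bag y\<close>, grown to \<open>bag x\<close> and joined with that of the
  part of \<open>x\<close>.\<close>

lemma dec_of_tree:
  assumes T: "undirected_tree T"
    and bagV: "\<And>t. t \<in> verts T \<Longrightarrow> bag t \<subseteq> V \<and> card (bag t) \<le> w"
    and edge: "\<And>u v. u \<in> A \<Longrightarrow> v \<in> A \<Longrightarrow> E u v \<Longrightarrow> \<exists>t\<in>verts T. u \<in> bag t \<and> v \<in> bag t"
    and bagA: "\<And>t. t \<in> verts T \<Longrightarrow> bag t \<subseteq> A"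
    and conn_bag: "\<And>v s t. s \<in> verts T \<Longrightarrow> t \<in> verts T \<Longrightarrow> v \<in> bag s \<Longrightarrow> v \<in> bag t \<Longrightarrow>
      (s, t) \<in> (arcs_ends T \<inter> {z. v \<in> bag z} \<times> {z. v \<in> bag z})\<^sup>*"
    and W: "finite W" "W \<subseteq> verts T" "x \<in> W" "\<forall>z\<in>W. (x, z) \<in> (arcs_ends T \<inter> W \<times> W)\<^sup>*"
  shows "dec w (\<Union> (bag ` W)) (bag x)"
  using W
proof (induction "card W" arbitrary: W x rule: less_induct)
  case less
  define R where "R = arcs_ends T"
  have symR: "(b, a) \<in> R" if "(a, b) \<in> R" for a b
  proof -
    interpret T: graph T using T by (simp add: undirected_tree_def)
    show ?thesis using T.graph_symmetric that by (simp add: R_def)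
  qed
  show ?case
  proof (cases "W = {x}")
    case True
    then show ?thesis using dec_bag bagV less.prems by simp
  next
    case False
    then obtain z where z: "z \<in> W" "z \<noteq> x" using less.prems by auto
    then have "(x, z) \<in> (R \<inter> W \<times> W)\<^sup>*" using less.prems by (simp add: R_def)
    then obtain y where y: "(x, y) \<in> R \<inter> W \<times> W" "y \<noteq> x \<or> y = x"
      using z by (metis converse_rtranclE)
    define e where "e = {(x, y), (y, x)}"
    have xyR: "(x, y) \<in> R" "x \<in> W" "y \<in> W" using y by auto
    have sep: "(x, y) \<notin> (R - e)\<^sup>*"
      using tree_edge_separates[OF T, of x y] xyR by (simp add: R_def e_def)
    define RW where "RW = R \<inter> W \<times> W - e"
    have RWsub: "RW \<subseteq> R - e" by (auto simp: RW_def)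
    have symRW: "sym RW" using symR by (auto simp: RW_def e_def sym_def)
    then have symRW': "(b, a) \<in> RW\<^sup>*" if "(a, b) \<in> RW\<^sup>*" for a b
      using that sym_rtrancl[OF symRW] by (auto dest: symD)
    have "sym (R - e)" using symR by (auto simp: e_def sym_def)
    then have symRe: "(b, a) \<in> (R - e)\<^sup>*" if "(a, b) \<in> (R - e)\<^sup>*" for a b
      using that sym_rtrancl[of "R - e"] by (auto dest: symD)
    \<comment> \<open>The side of \<open>x\<close> is taken in the whole tree instead of
      \<open>W\<close>: the nodes that contain a vertex, or the node that covers an edge, may lie
      outside \<open>W\<close>.\<close>
    define N where "N = {t. (x, t) \<in> (R - e)\<^sup>*}"
    define Wx where "Wx = {z \<in> W. (x, z) \<in> RW\<^sup>*}"
    define Wy where "Wy = {z \<in> W. (y, z) \<in> RW\<^sup>*}"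
    have split: "(x, z) \<in> RW\<^sup>* \<or> (y, z) \<in> RW\<^sup>*" if "z \<in> W" for z
    proof -
      have "(x, z) \<in> (R \<inter> W \<times> W)\<^sup>*" using less.prems that by (simp add: R_def)
      then show ?thesis
      proof induction
        case (step a b)
        show ?case
        proof (cases "(a, b) \<in> e")
          case True
          then show ?thesis by (auto simp: e_def)
        next
          case False
          then have "(a, b) \<in> RW" using step by (simp add: RW_def)
          then show ?thesis using step.IH by (meson rtrancl.rtrancl_into_rtrancl)
        qed
      qed simp
    qed
    have W_eq: "W = Wx \<union> Wy" using split by (auto simp: Wx_def Wy_def)
    have WxN: "Wx \<subseteq> N" using rtrancl_mono[OF RWsub] by (auto simp: Wx_def N_def)
    have WyN: "Wy \<inter> N = {}"
    proof -
      have False if "(y, t) \<in> RW\<^sup>*" "(x, t) \<in> (R - e)\<^sup>*" for t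
        using that sep symRe rtrancl_mono[OF RWsub] by (meson rtrancl_trans subsetD)
      then show ?thesis by (auto simp: Wy_def N_def)
    qed
    have xyW: "x \<in> Wx" "y \<in> Wy" using xyR by (auto simp: Wx_def Wy_def)
    have conn_part: "(s, t) \<in> (R \<inter> P \<times> P)\<^sup>*"
      if P: "P = {z \<in> W. (s, z) \<in> RW\<^sup>*}" and st: "(s, t) \<in> RW\<^sup>*" "s \<in> W" for s t P
      using st
    proof (induction rule: rtrancl_induct)
      case (step a b)
      then have "(a, b) \<in> R \<inter> P \<times> P"
        by (auto simp: P RW_def intro: rtrancl.rtrancl_into_rtrancl)
      then show ?case using step by (meson rtrancl.rtrancl_into_rtrancl)
    qed simp
    have cx: "\<forall>z\<in>Wx. (x, z) \<in> (arcs_ends T \<inter> Wx \<times> Wx)\<^sup>*"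
      using conn_part[OF Wx_def] xyR by (auto simp: Wx_def R_def)
    have cy: "\<forall>z\<in>Wy. (y, z) \<in> (arcs_ends T \<inter> Wy \<times> Wy)\<^sup>*"
      using conn_part[OF Wy_def] xyR by (auto simp: Wy_def R_def)
    have disj: "Wx \<inter> Wy = {}" using WxN WyN by auto
    have cards: "card Wx < card W" "card Wy < card W"
      using W_eq disj xyW less.prems(1) by (auto intro!: psubset_card_mono)
    have Wsub: "Wx \<subseteq> W" "Wy \<subseteq> W" by (auto simp: Wx_def Wy_def)
    have fin: "finite Wx" "finite Wy" using Wsub less.prems(1) finite_subset by auto
    define Ux where "Ux = \<Union> (bag ` Wx)"
    define Uy where "Uy = \<Union> (bag ` Wy)"
    have dx: "dec w Ux (bag x)"
      unfolding Ux_def using less.hyps[OF cards(1) fin(1) _ xyW(1) cx] Wsub less.prems by auto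
    have dy: "dec w Uy (bag y)"
      unfolding Uy_def using less.hyps[OF cards(2) fin(2) _ xyW(2) cy] Wsub less.prems by auto
    \<comment> \<open>The nodes containing \<open>v\<close> are connected, so bags on both sides of
      the edge force \<open>v\<close> into the bags of both its ends.\<close>
    have cross: "v \<in> bag x \<and> v \<in> bag y"
      if "s \<in> verts T" "t \<in> verts T" "v \<in> bag s" "v \<in> bag t" "s \<in> N" "t \<notin> N" for v s t
    proof -
      have "(s, t) \<in> (R \<inter> {z. v \<in> bag z} \<times> {z. v \<in> bag z})\<^sup>*"
        using conn_bag that by (simp add: R_def)
      then have "t \<in> N \<or> v \<in> bag x \<and> v \<in> bag y"
      proof induction
        case (step a b)
        show ?case
        proof (cases "(a, b) \<in> e")
          case True
          then show ?thesis using step by (auto simp: e_def)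
        next
          case False
          then have "a \<in> N \<Longrightarrow> b \<in> N"
            using step unfolding N_def by (auto intro: rtrancl.rtrancl_into_rtrancl)
          then show ?thesis using step by blast
        qed
      qed (use that in simp)
      then show ?thesis using that by simp
    qed
    have WT: "Wx \<subseteq> verts T" "Wy \<subseteq> verts T" "x \<in> verts T" "y \<in> verts T"
      using Wsub less.prems xyW by auto
    have xN: "x \<in> N" "y \<notin> N" using WxN WyN xyW by auto
    define B where "B = bag x \<inter> bag y"
    have bagx: "v \<in> bag x" if v: "v \<in> Uy" and t: "t \<in> N" "t \<in> verts T" "v \<in> bag t" for v t
    proof -
      obtain s where "s \<in> Wy" "v \<in> bag s" using v by (auto simp: Uy_def)
      then show ?thesis using cross[of t s v] t WT WyN by auto
    qed
    have bagy: "v \<in> bag x \<and> v \<in> bag y" if v: "v \<in> Ux" and t: "t \<notin> N" "t \<in> verts T" "v \<in> bag t" for v t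
    proof -
      obtain s where "s \<in> Wx" "v \<in> bag s" using v by (auto simp: Ux_def)
      then show ?thesis using cross[of s t v] t WT WxN by auto
    qed
    have noE: "\<not> E u v" if u: "u \<in> Ux - B" and v: "v \<in> Uy - bag x" for u v
    proof
      assume "E u v"
      moreover have "u \<in> A" "v \<in> A" using u v bagA WT by (auto simp: Ux_def Uy_def)
      ultimately obtain t where t: "t \<in> verts T" "u \<in> bag t" "v \<in> bag t" using edge by blast
      show False
      proof (cases "t \<in> N")
        case True
        then show False using bagx t v by auto
      next
        case False
        then show False using bagy t u by (auto simp: B_def)
      qed
    qed
    have bx: "bag x \<subseteq> Ux" using xyW by (auto simp: Ux_def)
    have "dec w Uy B" by (rule dec.forget[OF dy]) (simp add: B_def)
    then have "dec w (Uy \<union> bag x) (B \<union> bag x)"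
    proof (rule dec_grow)
      show "bag x \<inter> Uy \<subseteq> B"
      proof
        fix v assume v: "v \<in> bag x \<inter> Uy"
        then obtain s where "s \<in> Wy" "v \<in> bag s" by (auto simp: Uy_def)
        then show "v \<in> B" using bagy[of v s] v bx WT WyN by (auto simp: B_def)
      qed
      then have *: "B = bag x \<inter> Uy" using xyW by (auto simp: B_def Uy_def)
      show "\<not> E u v" if "u \<in> bag x - B" "v \<in> Uy - B" for u v
        using noE[of u v] that bx * by auto
      show "card (B \<union> bag x) \<le> w" using bagV WT by (simp add: B_def Un_absorb1)
    qed (use bagV WT in auto)
    then have dy': "dec w (Uy \<union> bag x) (bag x)" by (simp add: B_def Un_absorb1)
    have "dec w (Ux \<union> (Uy \<union> bag x)) (bag x)"
    proof (rule dec.join[OF dx dy'])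
      show "Ux \<inter> (Uy \<union> bag x) \<subseteq> bag x"
      proof
        fix v assume v: "v \<in> Ux \<inter> (Uy \<union> bag x)"
        then consider "v \<in> bag x" | t where "v \<in> Uy" "t \<in> Wx" "v \<in> bag t" by (auto simp: Ux_def)
        then show "v \<in> bag x" using bagx WxN WT by cases auto
      qed
      show "\<not> E u v" if "u \<in> Ux - bag x" "v \<in> Uy \<union> bag x - bag x" for u v
        using noE[of u v] that by (auto simp: B_def)
    qed
    moreover have "Ux \<union> (Uy \<union> bag x) = \<Union> (bag ` W)"
      using bx W_eq by (auto simp: Ux_def Uy_def)
    ultimately show ?thesis by simp
  qed
qed

end

section \<open>From search strategies to tree decompositions\<close>

context ugraph
begin

text \<open>
  A tree decomposition with nodes \<open>0, \<dots>, m - 1\<close> such that every node \<open>i > 0\<close> is attached to the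
  smaller node \<open>p i\<close>.
\<close>

definition ptd :: "nat \<Rightarrow> 'a set \<Rightarrow> nat \<Rightarrow> (nat \<Rightarrow> nat) \<Rightarrow> (nat \<Rightarrow> 'a set) \<Rightarrow> bool" where
  "ptd w U m p bag \<longleftrightarrow> 0 < m \<and> (\<forall>i. 0 < i \<and> i < m \<longrightarrow> p i < i) \<and>
     (\<forall>i<m. bag i \<subseteq> V \<and> card (bag i) \<le> w) \<and> U = (\<Union>i<m. bag i) \<and>
     (\<forall>i. 0 < i \<and> i < m \<longrightarrow> bag i \<inter> (\<Union>l<i. bag l) \<subseteq> bag (p i)) \<and>
     (\<forall>u\<in>U. \<forall>v\<in>U. E u v \<longrightarrow> (\<exists>i<m. u \<in> bag i \<and> v \<in> bag i))"

lemma ptdD: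
  assumes "ptd w U m p bag"
  shows "0 < m" "\<And>i. 0 < i \<Longrightarrow> i < m \<Longrightarrow> p i < i" "\<And>i. i < m \<Longrightarrow> bag i \<subseteq> V \<and> card (bag i) \<le> w"
    "U = (\<Union>i<m. bag i)" "\<And>i. 0 < i \<Longrightarrow> i < m \<Longrightarrow> bag i \<inter> (\<Union>l<i. bag l) \<subseteq> bag (p i)"
    "\<And>u v. u \<in> U \<Longrightarrow> v \<in> U \<Longrightarrow> E u v \<Longrightarrow> \<exists>i<m. u \<in> bag i \<and> v \<in> bag i"
proof -
  note c = assms[unfolded ptd_def]
  note c2 = c[THEN conjunct2] note c3 = c2[THEN conjunct2] note c4 = c3[THEN conjunct2]
  note c5 = c4[THEN conjunct2] note c6 = c5[THEN conjunct2]
  show "0 < m" by (rule c[THEN conjunct1])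
  show "p i < i" if "0 < i" "i < m" for i by (rule c2[THEN conjunct1, rule_format]) (use that in simp)
  show "bag i \<subseteq> V \<and> card (bag i) \<le> w" if "i < m" for i
    by (rule c3[THEN conjunct1, rule_format, OF that])
  show "U = (\<Union>i<m. bag i)" by (rule c4[THEN conjunct1])
  show "bag i \<inter> (\<Union>l<i. bag l) \<subseteq> bag (p i)" if "0 < i" "i < m" for i
    by (rule c5[THEN conjunct1, rule_format]) (use that in simp)
  show "\<exists>i<m. u \<in> bag i \<and> v \<in> bag i" if "u \<in> U" "v \<in> U" "E u v" for u v
    by (rule c6[rule_format, OF that])
qed

lemma ptd_single: "B \<subseteq> V \<Longrightarrow> card B \<le> w \<Longrightarrow> ptd w B 1 p (\<lambda>_. B)"
  by (auto simp: ptd_def)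

lemma ptd_add:
  assumes t: "ptd w U m p bag" and q: "q < m" and B: "B \<subseteq> V" "card B \<le> w" "B \<inter> U \<subseteq> bag q"
    and E: "\<And>u v. u \<in> B - U \<Longrightarrow> v \<in> U \<Longrightarrow> E u v \<Longrightarrow> v \<in> B"
  shows "ptd w (U \<union> B) (Suc m) (p(m := q)) (bag(m := B))"
proof -
  note t' = ptdD[OF t]
  have before: "(\<Union>l<i. (bag(m := B)) l) = (\<Union>l<i. bag l)" if "i \<le> m" for i
    using that by (intro SUP_cong) auto
  show ?thesis
    unfolding ptd_def
  proof (intro conjI allI impI ballI)
    fix i assume i: "0 < i \<and> i < Suc m"
    then show "(p(m := q)) i < i" using t'(2) q by auto
    show "(bag(m := B)) i \<inter> (\<Union>l<i. (bag(m := B)) l) \<subseteq> (bag(m := B)) ((p(m := q)) i)"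
    proof (cases "i = m")
      case True
      then show ?thesis using B(3) t'(4) q before[of i] by auto
    next
      case False
      then have "i < m" using i by simp
      then have "p i < m" using t'(2)[of i] i by simp
      then show ?thesis using t'(5)[of i] before[of i] \<open>i < m\<close> i by auto
    qed
  next
    show "U \<union> B = (\<Union>i<Suc m. (bag(m := B)) i)"
      using before[of m] t'(4) by (auto simp: lessThan_Suc)
  next
    fix u v assume uv: "u \<in> U \<union> B" "v \<in> U \<union> B" "E u v"
    consider "u \<in> U" "v \<in> U" | "u \<in> B" "v \<in> B"
      using uv E[of u v] E[of v u] E_sym[OF uv(3)] by blast
    then show "\<exists>i<Suc m. u \<in> (bag(m := B)) i \<and> v \<in> (bag(m := B)) i"
    proof cases
      case 1
      then obtain i where "i < m" "u \<in> bag i" "v \<in> bag i" using t'(6) uv by blast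
      then show ?thesis by (intro exI[of _ i]) auto
    qed (intro exI[of _ m], auto)
  qed (use t' B in \<open>auto simp: less_Suc_eq\<close>)
qed

text \<open>Extension of an arbitrary decomposition that has a bag around the neighborhood of
  \<open>C\<close>, with all old bags preserved. Being uniform in the given decomposition, the
  property allows components to be attached one after the other to the same bag.\<close>

definition addable :: "nat \<Rightarrow> 'a set \<Rightarrow> bool" where
  "addable w C \<longleftrightarrow> (\<forall>U m p bag q. ptd w U m p bag \<longrightarrow> q < m \<longrightarrow> C \<inter> U = {} \<longrightarrow> nb C \<subseteq> bag q \<longrightarrow>
     (\<exists>m' p' bag'. m \<le> m' \<and> (\<forall>i<m. bag' i = bag i) \<and> ptd w (U \<union> C) m' p' bag'))"

lemma addableD:
  assumes "addable w C" "ptd w U m p bag" "q < m" "C \<inter> U = {}" "nb C \<subseteq> bag q"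
  shows "\<exists>m' p' bag'. m \<le> m' \<and> (\<forall>i<m. bag' i = bag i) \<and> ptd w (U \<union> C) m' p' bag'"
  by (rule assms(1)[unfolded addable_def, rule_format, OF assms(2-5)])

lemma ptd_add_many:
  assumes "finite \<D>" "ptd w U m p bag" "q < m"
    "\<And>D. D \<in> \<D> \<Longrightarrow> addable w D" "\<And>D. D \<in> \<D> \<Longrightarrow> D \<inter> U = {}" "\<And>D. D \<in> \<D> \<Longrightarrow> nb D \<subseteq> bag q"
    "\<And>C D. C \<in> \<D> \<Longrightarrow> D \<in> \<D> \<Longrightarrow> C \<noteq> D \<Longrightarrow> C \<inter> D = {}"
  shows "\<exists>m' p' bag'. m \<le> m' \<and> (\<forall>i<m. bag' i = bag i) \<and> ptd w (U \<union> \<Union>\<D>) m' p' bag'"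
  using assms(1,4-7)
proof (induction \<D>)
  case empty
  then show ?case using assms(2) by auto
next
  case (insert D \<D>)
  have "\<exists>m' p' bag'. m \<le> m' \<and> (\<forall>i<m. bag' i = bag i) \<and> ptd w (U \<union> \<Union>\<D>) m' p' bag'"
    by (rule insert.IH) (use insert.prems in auto)
  then obtain m' p' bag' where *: "m \<le> m'" "\<forall>i<m. bag' i = bag i" "ptd w (U \<union> \<Union>\<D>) m' p' bag'"
    by blast
  have "D \<inter> C = {}" if "C \<in> \<D>" for C
    using insert.prems(4)[of D C] that insert.hyps(2) by auto
  then have "D \<inter> (U \<union> \<Union>\<D>) = {}" using insert.prems(2)[of D] by auto
  moreover have "addable w D" "nb D \<subseteq> bag' q" "q < m'"
    using insert.prems * assms(3) by auto
  ultimately have "\<exists>m'' p'' bag''. m' \<le> m'' \<and> (\<forall>i<m'. bag'' i = bag' i) \<and>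
      ptd w (U \<union> \<Union>\<D> \<union> D) m'' p'' bag''"
    by (intro addableD[OF _ *(3), of D q])
  then obtain m'' p'' bag'' where
    **: "m' \<le> m''" "\<forall>i<m'. bag'' i = bag' i" "ptd w (U \<union> \<Union>\<D> \<union> D) m'' p'' bag''"
    by blast
  have "U \<union> \<Union>\<D> \<union> D = U \<union> \<Union>(insert D \<D>)" by auto
  then show ?case using * **
    by (intro exI[of _ m''] exI[of _ p''] exI[of _ bag'']) simp
qed

lemma comps_disjoint:
  assumes "u \<in> V - S" "v \<in> V - S" "comp S u \<noteq> comp S v"
  shows "comp S u \<inter> comp S v = {}"
proof (rule ccontr)
  assume "\<not> ?thesis"
  then obtain x where x: "x \<in> comp S u" "x \<in> comp S v" by auto
  have "comp S x = comp S u" "comp S x = comp S v"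
    using comp_same[OF assms(1) x(1)] comp_same[OF assms(2) x(2)] .
  then show False using assms(3) by simp
qed

text \<open>The guards of the first move form a new bag, and the remaining components are hung below
  it by induction. Only the guards in \<open>C \<union> nb C\<close> are taken: others may occur in
  distant bags already, which would disconnect their nodes.\<close>

lemma win_addable: "win w C \<Longrightarrow> addable w C"
proof (induction rule: win.induct)
  case (win C S)
  show ?case
    unfolding addable_def
  proof (intro allI impI)
    fix U m p bag q
    assume t: "ptd w U m p bag" and q: "q < m" and CU: "C \<inter> U = {}" and nbC: "nb C \<subseteq> bag q"
    define B where "B = S \<inter> (C \<union> nb C)"
    have finS: "finite S" using win.hyps(2) fin_V by (rule finite_subset)
    have "card B \<le> card S" unfolding B_def by (rule card_mono[OF finS]) auto
    have nbU: "nb C \<subseteq> U" using nbC q ptdD(4)[OF t] by blast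
    have t1: "ptd w (U \<union> B) (Suc m) (p(m := q)) (bag(m := B))"
    proof (rule ptd_add[OF t q])
      show "B \<subseteq> V" using win.hyps(2) by (auto simp: B_def)
      show "card B \<le> w" using \<open>card B \<le> card S\<close> win.hyps(3) by simp
      show "B \<inter> U \<subseteq> bag q" using CU nbC by (auto simp: B_def)
      fix u v assume uv: "u \<in> B - U" "v \<in> U" "E u v"
      then have "u \<in> C" using nbU by (auto simp: B_def)
      then have "v \<in> nb C" using uv CU by (auto simp: nb_def)
      then show "v \<in> B" using win.hyps(1) by (auto simp: B_def)
    qed
    define \<D> where "\<D> = comp S ` (C - S)"
    have vV: "v \<in> V - S" if "v \<in> C - S" for v using that win.hyps(4) by auto
    have sub: "comp S v \<subseteq> C - S" if v: "v \<in> C - S" for v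
    proof -
      have "comp S v \<subseteq> C"
        using comp_sub[OF vV[OF v]] win.hyps(1) comp_in[of v S] v
        by (intro conn_subset[OF comp_conn[OF vV[OF v]]]) auto
      then show ?thesis using comp_sub[OF vV[OF v]] by auto
    qed
    have "\<exists>m' p' bag'. Suc m \<le> m' \<and> (\<forall>i<Suc m. bag' i = (bag(m := B)) i) \<and>
        ptd w ((U \<union> B) \<union> \<Union>\<D>) m' p' bag'"
    proof (rule ptd_add_many[OF _ t1, of _ m])
      show "finite \<D>" using finite_subset[OF win.hyps(4) fin_V] by (simp add: \<D>_def)
      fix D assume "D \<in> \<D>"
      then obtain v where v: "v \<in> C - S" "D = comp S v" by (auto simp: \<D>_def)
      show "addable w D" using win.IH v by simp
      show "D \<inter> (U \<union> B) = {}" using sub[OF v(1)] v CU by (auto simp: B_def)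
      have "nb D \<subseteq> S" using comp_nb[OF vV[OF v(1)]] v by simp
      moreover have "nb D \<subseteq> C \<union> nb C" using sub[OF v(1)] v by (auto simp: nb_def)
      ultimately show "nb D \<subseteq> (bag(m := B)) m" by (auto simp: B_def)
    next
      fix D D' assume "D \<in> \<D>" "D' \<in> \<D>" "D \<noteq> D'"
      then obtain u v where "u \<in> C - S" "v \<in> C - S" "D = comp S u" "D' = comp S v"
        by (auto simp: \<D>_def)
      then show "D \<inter> D' = {}" using comps_disjoint[OF vV vV] \<open>D \<noteq> D'\<close> by blast
    qed simp
    moreover have "(U \<union> B) \<union> \<Union>\<D> = U \<union> C"
    proof
      show "U \<union> B \<union> \<Union>\<D> \<subseteq> U \<union> C" using sub nbU by (auto simp: B_def \<D>_def)
      show "U \<union> C \<subseteq> U \<union> B \<union> \<Union>\<D>" using comp_in by (auto simp: B_def \<D>_def)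
    qed
    ultimately obtain m' p' bag' where "Suc m \<le> m'" "\<forall>i<Suc m. bag' i = (bag(m := B)) i"
        "ptd w (U \<union> C) m' p' bag'" by auto
    then show "\<exists>m' p' bag'. m \<le> m' \<and> (\<forall>i<m. bag' i = bag i) \<and> ptd w (U \<union> C) m' p' bag'"
      by (intro exI[of _ m'] exI[of _ p'] exI[of _ bag']) auto
  qed
qed

lemma ptd_of_wins:
  assumes S: "S \<subseteq> V" "card S \<le> w" and T: "finite \<D>" "\<And>D. D \<in> \<D> \<Longrightarrow> win w D \<and> D \<inter> S = {} \<and> nb D \<subseteq> S"
    "\<And>C D. C \<in> \<D> \<Longrightarrow> D \<in> \<D> \<Longrightarrow> C \<noteq> D \<Longrightarrow> C \<inter> D = {}"
  shows "\<exists>m p bag. ptd w (S \<union> \<Union>\<D>) m p bag"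
  using ptd_add_many[OF T(1) ptd_single[OF S, of id], of 0] T win_addable by auto

end

section \<open>From parent functions to trees\<close>

definition parent_tree :: "nat \<Rightarrow> (nat \<Rightarrow> nat) \<Rightarrow> (nat, nat \<times> nat) pre_digraph" where
  "parent_tree m p = \<lparr>verts = {..<m}, arcs = {(i, p i) |i. 0 < i \<and> i < m} \<union> {(p i, i) |i. 0 < i \<and> i < m},
     tail = fst, head = snd\<rparr>"

lemma parent_tree_sel [simp]:
  "verts (parent_tree m p) = {..<m}" "tail (parent_tree m p) = fst" "head (parent_tree m p) = snd"
  "arcs (parent_tree m p) = {(i, p i) |i. 0 < i \<and> i < m} \<union> {(p i, i) |i. 0 < i \<and> i < m}"
  by (simp_all add: parent_tree_def)

lemma arcs_ends_parent_tree:
  "arcs_ends (parent_tree m p) = {(i, p i) |i. 0 < i \<and> i < m} \<union> {(p i, i) |i. 0 < i \<and> i < m}"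
  by (simp add: arcs_ends_conv)

lemma sym_parent_tree: "sym (arcs_ends (parent_tree m p))"
  unfolding arcs_ends_parent_tree by (auto simp: sym_def)

lemma graph_parent_tree:
  assumes p: "\<And>i. 0 < i \<Longrightarrow> i < m \<Longrightarrow> p i < i"
  shows "graph (parent_tree m p)"
proof -
  let ?T = "parent_tree m p"
  have "arcs ?T = (\<lambda>i. (i, p i)) ` {0<..<m} \<union> (\<lambda>i. (p i, i)) ` {0<..<m}" by auto
  then have fin: "finite (arcs ?T)" by (simp only: finite_Un finite_imageI finite_greaterThanLessThan simp_thms)
  have arc: "fst a < m \<and> snd a < m \<and> fst a \<noteq> snd a" if "a \<in> arcs ?T" for a
  proof -
    have "\<exists>i. 0 < i \<and> i < m \<and> (a = (i, p i) \<or> a = (p i, i))"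
      using that unfolding parent_tree_sel by (elim UnE CollectE exE conjE) (intro exI conjI, assumption+, simp)+
    then obtain i where i: "0 < i" "i < m" "a = (i, p i) \<or> a = (p i, i)" by (elim exE conjE)
    then show ?thesis using p[OF i(1,2)] by auto
  qed
  show ?thesis
  proof unfold_locales
    show "finite (arcs ?T)" by (rule fin)
    show "symmetric ?T" unfolding symmetric_def by (rule sym_parent_tree)
    show "tail ?T e \<in> verts ?T" "head ?T e \<in> verts ?T" "tail ?T e \<noteq> head ?T e" if "e \<in> arcs ?T" for e
      using arc[OF that] by simp_all
  qed (simp_all add: arc_to_ends_def prod_eq_iff)
qed

text \<open>Parents get smaller and stay inside \<open>X\<close>, so following them always ends in
  the least element \<open>x\<close>.\<close>

lemma connected_parent_tree:
  assumes p: "\<And>i. 0 < i \<Longrightarrow> i < m \<Longrightarrow> p i < i" and X: "X \<subseteq> {..<m}" "x \<in> X"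
    and up: "\<And>i. i \<in> X \<Longrightarrow> x < i \<Longrightarrow> p i \<in> X" and least: "\<And>i. i \<in> X \<Longrightarrow> x \<le> i"
  shows "Digraph_Component.connected (parent_tree m p \<restriction> X)"
proof -
  define R where "R = arcs_ends (parent_tree m p) \<inter> X \<times> X"
  have symR: "sym R" using sym_parent_tree[of m p] by (auto simp: R_def sym_def)
  have to_x: "(i, x) \<in> R\<^sup>*" if "i \<in> X" for i
    using that
  proof (induction i rule: less_induct)
    case (less i)
    show ?case
    proof (cases "i = x")
      case False
      then have i: "x < i" "i < m" using least[OF less.prems] X less.prems by auto
      then have "p i < i" "p i \<in> X" using p up less.prems by auto
      then have "(p i, x) \<in> R\<^sup>*" by (rule less.IH)
      moreover have "(i, p i) \<in> R"
        using i less.prems \<open>p i \<in> X\<close> unfolding R_def arcs_ends_parent_tree by auto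
      ultimately show ?thesis by (rule converse_rtrancl_into_rtrancl[rotated])
    qed simp
  qed
  moreover have "(x, i) \<in> R\<^sup>*" if "i \<in> X" for i
    using to_x[OF that] sym_rtrancl[OF symR] by (auto dest: symD)
  ultimately show ?thesis
    unfolding connected_induce_iff[OF sym_parent_tree] R_def[symmetric]
    using X by (meson empty_iff rtrancl_trans)
qed

lemma (in pre_digraph) cas_nth:
  assumes "cas u c v" "i < length c"
  shows "tail G (c ! i) = (if i = 0 then u else head G (c ! (i - 1)))"
  using assms by (induction c arbitrary: u i) (auto simp: nth_Cons')

lemma (in pre_digraph) cas_last:
  assumes "cas u c v" "c \<noteq> []"
  shows "head G (last c) = v"
  using assms by (induction c arbitrary: u) (auto split: if_splits)

text \<open>Both cyclic neighbors of the largest node on a cycle are smaller and adjacent to it,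
  hence both are its parent. On a cycle of length at least 3 they sit at different positions,
  although the nodes of a cycle are distinct.\<close>

lemma no_cycle_parent_tree:
  assumes p: "\<And>i. 0 < i \<Longrightarrow> i < m \<Longrightarrow> p i < i"
  shows "\<not> (pre_digraph.cycle (parent_tree m p) c \<and> 3 \<le> length c)"
proof
  interpret pre_digraph "parent_tree m p" .
  assume c: "cycle c \<and> 3 \<le> length c"
  define L where "L = length c"
  have L: "3 \<le> L" "0 < L" using c by (auto simp: L_def)
  obtain u where u: "awalk u c u" "distinct (tl (awalk_verts u c))" "c \<noteq> []"
    using c by (auto simp: cycle_def)
  then have cas: "cas u c u" by (simp add: awalk_def)
  have arcs: "c ! i \<in> arcs (parent_tree m p)" if "i < L" for i
    using u(1) that unfolding awalk_def L_def by (meson nth_mem subsetD)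
  define h where "h = (\<lambda>i. snd (c ! i))"
  have "distinct (map snd c)" using u(2) awalk_verts_conv'[OF cas] u(3) by simp
  then have inj: "h i = h k \<longleftrightarrow> i = k" if "i < L" "k < L" for i k
    using that by (simp add: distinct_conv_nth L_def h_def) metis
  have next': "fst (c ! ((i + 1) mod L)) = h i" if "i < L" for i
  proof (cases "i + 1 = L")
    case True
    then have "length c - 1 = i" by (simp add: L_def)
    then have "c ! i = last c" using last_conv_nth[OF u(3)] by simp
    then show ?thesis using cas_last[OF cas u(3)] cas_nth[OF cas, of 0] True L by (simp add: h_def L_def)
  next
    case False
    then have "i + 1 < L" using that by simp
    then show ?thesis using cas_nth[OF cas, of "i + 1"] by (simp add: h_def L_def)
  qed
  have arc: "(0 < a \<and> b = p a) \<or> (0 < b \<and> a = p b)" "a < m" "b < m" "a < b \<or> b < a"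
    if "(a, b) \<in> arcs (parent_tree m p)" for a b
    using that p by (auto intro: less_trans)
  define x where "x = Max (h ` {..<L})"
  have "x \<in> h ` {..<L}" unfolding x_def by (rule Max_in) (use L(2) in \<open>simp_all add: lessThan_empty_iff\<close>)
  then obtain i where i: "i < L" "x = h i" by auto
  have le: "h k \<le> x" if "k < L" for k unfolding x_def using that by (intro Max_ge) auto
  have to_max: "a = p x" if "(a, x) \<in> arcs (parent_tree m p) \<or> (x, a) \<in> arcs (parent_tree m p)" "a \<le> x" for a
  proof -
    have "(0 < a \<and> x = p a) \<or> (0 < x \<and> a = p x)" "a < m" using that(1) arc by blast+
    then show ?thesis using p[of a] that(2) by auto
  qed
  \<comment> \<open>The positions before and after the maximum, taken modulo \<open>L\<close>; they
    coincide only for \<open>L \<le> 2\<close>.\<close>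
  define j where "j = (i + (L - 1)) mod L"
  define k where "k = (i + 1) mod L"
  have jk: "j < L" "k < L" using L by (simp_all add: j_def k_def)
  have "(j + 1) mod L = i"
  proof -
    have "(j + 1) mod L = (i + (L - 1) + 1) mod L" unfolding j_def by (simp add: mod_simps)
    also have "i + (L - 1) + 1 = i + L" using L by simp
    finally show ?thesis using i by simp
  qed
  then have "fst (c ! i) = h j" using next'[OF jk(1)] by simp
  then have "(h j, x) = c ! i" using i by (simp add: h_def prod_eq_iff)
  then have "(h j, x) \<in> arcs (parent_tree m p)" using arcs[OF i(1)] by (simp only:)
  then have 1: "h j = p x" using to_max[of "h j"] le[OF jk(1)] by blast
  have "fst (c ! k) = x" using next'[OF i(1)] i by (simp add: k_def)
  then have "(x, h k) = c ! k" by (simp add: h_def prod_eq_iff)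
  then have "(x, h k) \<in> arcs (parent_tree m p)" using arcs[OF jk(2)] by (simp only:)
  then have 2: "h k = p x" using to_max[of "h k"] le[OF jk(2)] by blast
  have "j = k" using 1 2 inj[OF jk] by simp
  then have "(i + (L - 1)) mod L = (i + 1) mod L" by (simp add: j_def k_def)
  moreover have "(i + (L - 1)) mod L = (if i = 0 then L - 1 else i - 1)"
    using i L by (auto simp: mod_if)
  moreover have "(i + 1) mod L = (if i = L - 1 then 0 else i + 1)"
    using i L by (auto simp: mod_if)
  ultimately show False using L i by (auto split: if_splits)
qed

lemma undirected_tree_parent_tree:
  assumes "0 < m" "\<And>i. 0 < i \<Longrightarrow> i < m \<Longrightarrow> p i < i"
  shows "undirected_tree (parent_tree m p)"
proof -
  have "arcs_ends (parent_tree m p \<restriction> {..<m}) = arcs_ends (parent_tree m p)"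
    unfolding arcs_ends_induce arcs_ends_parent_tree using assms(2) by (auto intro: less_trans)
  then have "Digraph_Component.connected (parent_tree m p \<restriction> {..<m}) \<longleftrightarrow>
      Digraph_Component.connected (parent_tree m p)"
    by (simp add: connected_conv)
  moreover have "Digraph_Component.connected (parent_tree m p \<restriction> {..<m})"
    by (rule connected_parent_tree[of m p _ 0]) (use assms in \<open>auto intro: less_trans\<close>)
  ultimately show ?thesis
    using graph_parent_tree[OF assms(2)] no_cycle_parent_tree[OF assms(2)]
    by (simp add: undirected_tree_def)
qed

section \<open>Treewidth bounds in terms of both kinds of decompositions\<close>

locale graph_treewidth = G: graph G for G :: "('a, 'b) pre_digraph"
begin

sublocale ugraph "verts G" "dominates G"
proof
  show "u \<rightarrow>\<^bsub>G\<^esub> v \<Longrightarrow> v \<rightarrow>\<^bsub>G\<^esub> u" for u v by (rule G.graph_symmetric)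
  show "u \<rightarrow>\<^bsub>G\<^esub> v \<Longrightarrow> u \<in> verts G \<and> v \<in> verts G" for u v by (simp add: G.adj_in_verts)
  show "\<not> u \<rightarrow>\<^bsub>G\<^esub> u" for u using G.adj_not_same by blast
qed simp

lemma ptd_tree_decomposition:
  assumes t: "ptd w U m p bag"
  shows "tree_decomposition (G \<restriction> U) (parent_tree m p) bag"
    "decomposition_width (parent_tree m p) bag \<le> w - 1"
proof -
  note t' = ptdD[OF t]
  show "tree_decomposition (G \<restriction> U) (parent_tree m p) bag"
    unfolding tree_decomposition_def
  proof (intro conjI allI impI ballI)
    show "undirected_tree (parent_tree m p)" by (rule undirected_tree_parent_tree[OF t'(1,2)])
    show "bag x \<subseteq> verts (G \<restriction> U)" if "x \<in> verts (parent_tree m p)" for x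
      using that t'(4) by auto
    show "\<exists>x\<in>verts (parent_tree m p). u \<in> bag x \<and> v \<in> bag x" if "u \<rightarrow>\<^bsub>G \<restriction> U\<^esub> v" for u v
      using that t'(6) unfolding arcs_ends_induce by auto
    fix v assume "v \<in> verts (G \<restriction> U)"
    then have ex: "\<exists>i. i < m \<and> v \<in> bag i" using t'(4) by auto
    define x where "x = (LEAST i. i < m \<and> v \<in> bag i)"
    have x: "x < m" "v \<in> bag x" using LeastI_ex[OF ex] by (auto simp: x_def)
    have le: "x \<le> i" if "i < m" "v \<in> bag i" for i
      unfolding x_def by (rule Least_le) (use that in simp)
    show "Digraph_Component.connected
        (parent_tree m p \<restriction> {x \<in> verts (parent_tree m p). v \<in> bag x})"
    proof (rule connected_parent_tree[of m p _ x, OF t'(2)])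
      fix i assume i: "i \<in> {x \<in> verts (parent_tree m p). v \<in> bag x}" "x < i"
      then have "v \<in> bag (p i)" using t'(5)[of i] x by auto
      moreover have "p i < i" using t'(2) i by auto
      ultimately show "p i \<in> {x \<in> verts (parent_tree m p). v \<in> bag x}" using i by auto
    qed (use x le in auto)
  qed
  have "Max ((\<lambda>x. card (bag x)) ` {..<m}) \<le> w"
    using t' by (subst Max_le_iff) auto
  then show "decomposition_width (parent_tree m p) bag \<le> w - 1"
    by (simp add: decomposition_width_def)
qed

lemma treewidth_le:
  assumes "ptd w U m p bag"
  shows "treewidth (G \<restriction> U) \<le> w - 1"
proof -
  have "treewidth (G \<restriction> U) \<le> decomposition_width (parent_tree m p) bag"
    unfolding treewidth_def
    by (rule Least_le) (use ptd_tree_decomposition[OF assms] in blast)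
  then show ?thesis using ptd_tree_decomposition(2)[OF assms] by simp
qed

lemma treewidth_dec:
  assumes U: "U \<subseteq> verts G" and tw: "treewidth (G \<restriction> U) \<le> \<eta>"
  shows "dec (\<eta> + 1) U {}"
proof -
  \<comment> \<open>The single bag \<open>U\<close> shows that decompositions exist, so that the
    minimum in \<open>treewidth\<close> is attained.\<close>
  have "ptd (card U) U 1 id (\<lambda>_. U)" using U by (intro ptd_single) auto
  then have "\<exists>w (T :: (nat, nat \<times> nat) pre_digraph) bag. tree_decomposition (G \<restriction> U) T bag \<and>
      decomposition_width T bag = w"
    using ptd_tree_decomposition(1) by blast
  then have "\<exists>(T :: (nat, nat \<times> nat) pre_digraph) bag. tree_decomposition (G \<restriction> U) T bag \<and>
      decomposition_width T bag = treewidth (G \<restriction> U)"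
    unfolding treewidth_def by (rule LeastI_ex)
  then obtain T :: "(nat, nat \<times> nat) pre_digraph" and bag where
    td: "tree_decomposition (G \<restriction> U) T bag" and width: "decomposition_width T bag \<le> \<eta>"
    using tw by auto
  have T: "undirected_tree T" and bagU: "\<And>t. t \<in> verts T \<Longrightarrow> bag t \<subseteq> U"
    and edges: "\<And>u v. u \<in> U \<Longrightarrow> v \<in> U \<Longrightarrow> u \<rightarrow>\<^bsub>G\<^esub> v \<Longrightarrow> \<exists>t\<in>verts T. u \<in> bag t \<and> v \<in> bag t"
    and conn: "\<And>v. v \<in> U \<Longrightarrow> Digraph_Component.connected (T \<restriction> {t \<in> verts T. v \<in> bag t})"
    using td unfolding tree_decomposition_def arcs_ends_induce by auto
  interpret T: graph T using T by (simp add: undirected_tree_def)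
  have symT: "sym (arcs_ends T)" using T.graph_symmetric by (auto simp: sym_def)
  have subT: "arcs_ends T \<subseteq> verts T \<times> verts T" using T.adj_in_verts by auto
  have connT: "verts T \<noteq> {} \<and> (\<forall>u\<in>verts T. \<forall>v\<in>verts T. (u, v) \<in> (arcs_ends T)\<^sup>*)"
    using T connected_iff[OF symT subT] unfolding undirected_tree_def by simp
  then obtain x where x: "x \<in> verts T" by auto
  have VT: "arcs_ends T \<inter> verts T \<times> verts T = arcs_ends T" using T.adj_in_verts by auto
  have "dec (\<eta> + 1) (\<Union> (bag ` verts T)) (bag x)"
  proof (rule dec_of_tree[OF T, of bag _ U])
    fix t assume t: "t \<in> verts T"
    have "card (bag t) \<le> Max ((\<lambda>x. card (bag x)) ` verts T)" using t by (intro Max_ge) auto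
    then have "card (bag t) \<le> \<eta> + 1" using width by (simp add: decomposition_width_def)
    then show "bag t \<subseteq> verts G \<and> card (bag t) \<le> \<eta> + 1" using bagU[OF t] U by auto
  next
    fix v s t assume vst: "s \<in> verts T" "t \<in> verts T" "v \<in> bag s" "v \<in> bag t"
    define S where "S = {t \<in> verts T. v \<in> bag t}"
    have "Digraph_Component.connected (T \<restriction> S)" using conn[of v] bagU vst by (auto simp: S_def)
    then have "(s, t) \<in> (arcs_ends T \<inter> S \<times> S)\<^sup>*"
      using vst unfolding connected_induce_iff[OF symT] by (auto simp: S_def)
    moreover have "arcs_ends T \<inter> S \<times> S \<subseteq> arcs_ends T \<inter> {z. v \<in> bag z} \<times> {z. v \<in> bag z}"
      by (auto simp: S_def)
    ultimately show "(s, t) \<in> (arcs_ends T \<inter> {z. v \<in> bag z} \<times> {z. v \<in> bag z})\<^sup>*"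
      using rtrancl_mono by blast
  qed (use edges bagU x connT VT in auto)
  moreover have "\<Union> (bag ` verts T) = U"
  proof
    show "U \<subseteq> \<Union> (bag ` verts T)"
    proof
      fix v assume "v \<in> U"
      from conn[OF this] show "v \<in> \<Union> (bag ` verts T)"
        unfolding connected_induce_iff[OF symT] by auto
    qed
  qed (use bagU in auto)
  ultimately have "dec (\<eta> + 1) U (bag x)" by simp
  then show ?thesis by (rule dec.forget) simp
qed

end

section \<open>The family of an arbitrary graph and its hitting property\<close>

context ugraph
begin

definition bad :: "nat \<Rightarrow> 'a set \<Rightarrow> bool" where
  "bad \<eta> C \<longleftrightarrow> conn C \<and> card (nb C) \<le> 2 * \<eta> + 2 \<and> win (5 * \<eta> + 5) C \<and> \<not> win (3 * \<eta> + 3) C"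

definition small :: "nat \<Rightarrow> 'a set \<Rightarrow> bool" where
  "small \<eta> C \<longleftrightarrow> conn C \<and> card (nb C) \<le> 2 * \<eta> + 2 \<and> win (3 * \<eta> + 3) C"

definition maximal_small :: "nat \<Rightarrow> 'a set \<Rightarrow> bool" where
  "maximal_small \<eta> C \<longleftrightarrow> small \<eta> C \<and> (\<forall>D. small \<eta> D \<longrightarrow> C \<subseteq> D \<longrightarrow> D = C)"

text \<open>Both cases are in one definition, since the program itself has to find out which of them
  holds.\<close>

definition hit_family :: "nat \<Rightarrow> 'a set set" where
  "hit_family \<eta> =
     (if \<exists>C. bad \<eta> C then {C \<union> nb C |C. bad \<eta> C}
      else {nb C \<union> \<Union>{D. maximal_small \<eta> D \<and> nb D = nb C} |C. maximal_small \<eta> C} \<union>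
        {{u, v} |u v. E u v \<and> (\<forall>C. small \<eta> C \<longrightarrow> u \<notin> C \<and> v \<notin> C)})"

end

text \<open>With \<open>x = 2 ^ \<eta>\<close> and \<open>\<eta> + 1 \<le> x\<close> everything is
  bounded by powers of \<open>x\<close>: at most \<open>x ^ 2\<close> from two linear factors and
  \<open>x ^ 4\<close> from \<open>4 ^ (2 * \<eta> + 2)\<close>. The coefficient
  \<open>1 + 2 * 68 + 52\<close> is below \<open>1024 = 2 ^ 10\<close>.\<close>

lemma ratio_le: "gap_graph.ratio \<eta> \<le> 2 ^ (6 * \<eta> + 10)" if "gap_graph V E \<eta>" for V E
proof -
  interpret gap_graph V E \<eta> by fact
  have e: "\<eta> + 1 \<le> 2 ^ \<eta>" by (induction \<eta>) auto
  have p: "(2::nat) ^ (a + b) = 2 ^ a * 2 ^ b" for a b by (rule power_add)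
  define x :: nat where "x = 2 ^ \<eta>"
  have x: "\<eta> + 1 \<le> x" "1 \<le> x" using e by (auto simp: x_def)
  have pw: "(2::nat) ^ (k * \<eta>) = x ^ k" for k by (simp add: x_def mult.commute flip: power_mult)
  have four: "(4::nat) ^ (2 * \<eta> + 2) = 16 * x ^ 4"
  proof -
    have "(4::nat) ^ k = 2 ^ (2 * k)" for k by (simp add: power_mult)
    then have "(4::nat) ^ (2 * \<eta> + 2) = 2 ^ (2 * (2 * \<eta> + 2))" .
    also have "2 * (2 * \<eta> + 2) = 4 * \<eta> + 4" by simp
    finally show ?thesis by (simp add: power_add pw)
  qed
  have two: "(2::nat) ^ (2 * \<eta> + 2) = 4 * x ^ 2" by (simp add: power_add pw)
  have x4: "x ^ a \<le> x ^ b" if "a \<le> b" for a b using x(2) that by (simp add: power_increasing)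
  define A where "A = (\<eta> + 1) * (2 * \<eta> + 4) * (4 ^ (2 * \<eta> + 2) + (\<eta> + 1))"
  define B where "B = (3 * (2 * \<eta> + 4) + 1) * 2 ^ (2 * \<eta> + 2)"
  have "A \<le> x * (4 * x) * (17 * x ^ 4)"
    unfolding A_def
  proof (intro mult_mono)
    show "4 ^ (2 * \<eta> + 2) + (\<eta> + 1) \<le> 17 * x ^ 4"
      unfolding four using x x4[of 1 4] by simp
  qed (use x in auto)
  also have "\<dots> = 68 * (x ^ 2 * x ^ 4)" by (simp add: power2_eq_square)
  also have "\<dots> = 68 * x ^ 6" by (simp flip: power_add)
  finally have 1: "A \<le> 68 * x ^ 6" .
  have "B \<le> (13 * x) * (4 * x ^ 2)"
    unfolding two B_def by (intro mult_mono) (use x in auto)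
  also have "\<dots> = 52 * x ^ 3" by (simp add: power2_eq_square power3_eq_cube)
  also have "\<dots> \<le> 52 * x ^ 6" using x4[of 3 6] by simp
  finally have 2: "B \<le> 52 * x ^ 6" .
  have "ratio = 1 + 2 * A + B" unfolding ratio_def A_def B_def by (simp only: mult.assoc)
  moreover have "1 \<le> x ^ 6" using x(2) by simp
  ultimately have "ratio \<le> 1024 * x ^ 6" using 1 2 by linarith
  also have "\<dots> = 2 ^ (6 * \<eta> + 10)" by (simp add: power_add pw)
  finally show ?thesis .
qed

context graph_treewidth
begin

lemma induce_all: "G \<restriction> verts G = G"
  by (rule pre_digraph.equality) auto

lemma boundary_sub:
  assumes "A \<subseteq> verts G" "\<And>u v. v \<in> A \<Longrightarrow> u \<rightarrow>\<^bsub>G\<^esub> v \<Longrightarrow> u \<notin> A \<Longrightarrow> v \<in> S"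
  shows "boundary G A \<subseteq> S"
  using assms by (auto simp: boundary_def neighborhood_def)

lemma protrusionI:
  assumes A: "ptd r A m p bag" and S: "finite S" "card S \<le> r"
    "\<And>u v. v \<in> A \<Longrightarrow> u \<rightarrow>\<^bsub>G\<^esub> v \<Longrightarrow> u \<notin> A \<Longrightarrow> v \<in> S"
  shows "protrusion r G A"
proof -
  have "A \<subseteq> verts G" using ptdD(3,4)[OF A] by blast
  moreover from this have "card (boundary G A) \<le> card S"
    by (intro card_mono[OF S(1)] boundary_sub S(3))
  ultimately show ?thesis
    using treewidth_le[OF A] S(2) by (auto simp: protrusion_def)
qed

text \<open>\<open>S\<close> is the root bag and the given sets are hung below it. Connected sets
  with the same neighborhood that meet are equal, so the sets are disjoint; no edge leaves them
  except into \<open>S\<close>, so the boundary of the union is contained in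
  \<open>S\<close>.\<close>

lemma protrusion_components:
  assumes S: "S \<subseteq> verts G" "card S \<le> r" and D: "\<And>D. D \<in> \<D> \<Longrightarrow> conn D \<and> win r D \<and> nb D = S"
  shows "protrusion r G (S \<union> \<Union>\<D>)"
proof -
  have fin: "finite \<D>"
    by (rule finite_subset[of _ "Pow (verts G)"]) (use D conn_V in auto)
  have "\<exists>m p bag. ptd r (S \<union> \<Union>\<D>) m p bag"
  proof (rule ptd_of_wins[OF S fin])
    fix D assume "D \<in> \<D>"
    then show "win r D \<and> D \<inter> S = {} \<and> nb D \<subseteq> S" using D[of D] by (auto simp: nb_def)
  next
    fix C D assume CD: "C \<in> \<D>" "D \<in> \<D>" "C \<noteq> D"
    show "C \<inter> D = {}"
    proof (rule ccontr)
      assume ne: "C \<inter> D \<noteq> {}"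
      have "nb C = nb D" "C \<inter> nb C = {}" "D \<inter> nb D = {}" using D CD by (auto simp: nb_def)
      then have "C \<subseteq> D" "D \<subseteq> C"
        using conn_subset[of C D] conn_subset[of D C] D CD ne by auto
      then show False using CD by simp
    qed
  qed
  then obtain m p bag where t: "ptd r (S \<union> \<Union>\<D>) m p bag" by blast
  have fS: "finite S" using S(1) fin_V by (rule finite_subset)
  show ?thesis
  proof (rule protrusionI[OF t fS S(2)])
    fix u v assume uv: "v \<in> S \<union> \<Union>\<D>" "u \<rightarrow>\<^bsub>G\<^esub> v" "u \<notin> S \<union> \<Union>\<D>"
    show "v \<in> S"
    proof (rule ccontr)
      assume "v \<notin> S"
      then obtain D' where D': "D' \<in> \<D>" "v \<in> D'" using uv by auto
      then have "u \<in> nb D'" using uv E_sym[OF uv(2)] by (auto simp: nb_def)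
      then show False using D[OF D'(1)] uv by auto
    qed
  qed
qed

theorem hit_family_hitting:
  assumes tw: "\<eta> < treewidth G"
  shows "modulator_hitting_family \<eta> (5 * \<eta> + 5) (2 ^ (6 * \<eta> + 10)) G (hit_family \<eta>)"
proof -
  have mod: "X \<noteq> {} \<and> X \<subseteq> verts G \<and> dec (\<eta> + 1) (verts G - X) {}" if X: "treewidth_modulator \<eta> G X" for X
  proof (intro conjI)
    show "X \<noteq> {}" using X tw induce_all by (auto simp: treewidth_modulator_def)
    show "X \<subseteq> verts G" using X by (simp add: treewidth_modulator_def)
    show "dec (\<eta> + 1) (verts G - X) {}"
      using X by (intro treewidth_dec) (auto simp: treewidth_modulator_def)
  qed
  show ?thesis
  proof (cases "\<exists>C. bad \<eta> C")
    case True
    then have P: "hit_family \<eta> = {C \<union> nb C |C. bad \<eta> C}" by (simp add: hit_family_def)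
    show ?thesis
      unfolding modulator_hitting_family_def
    proof (intro conjI ballI allI impI)
      show "hit_family \<eta> \<noteq> {}" using True P by auto
      fix A assume "A \<in> hit_family \<eta>"
      then obtain C where C: "bad \<eta> C" "A = nb C \<union> \<Union>{C}" using P by auto
      then show "protrusion (5 * \<eta> + 5) G A"
        unfolding C(2) using C nb_V by (intro protrusion_components) (auto simp: bad_def)
    next
      fix X assume X: "treewidth_modulator \<eta> G X"
      \<comment> \<open>If \<open>C\<close> avoided \<open>X\<close>, it could be searched inside
        the decomposition of \<open>G - X\<close> with its neighborhood kept guarded, hence with
        \<open>3 * \<eta> + 3\<close> guards, contrary to \<open>bad\<close>. So every member is
        hit.\<close>
      have "C \<inter> X \<noteq> {}" if C: "bad \<eta> C" for C
      proof
        assume "C \<inter> X = {}"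
        have "win (\<eta> + 1 + (2 * \<eta> + 2)) C"
          by (rule dec_win[where U = "verts G - X" and B = "{}" and N = "nb C"])
            (use C mod[OF X] \<open>C \<inter> X = {}\<close> conn_V[of C] nb_V in \<open>auto simp: bad_def\<close>)
        moreover have "\<eta> + 1 + (2 * \<eta> + 2) = 3 * \<eta> + 3" by simp
        ultimately show False using C unfolding bad_def by metis
      qed
      then have "{A \<in> hit_family \<eta>. A \<inter> X \<noteq> {}} = hit_family \<eta>" unfolding P by blast
      then show "real (card (hit_family \<eta>)) / real (2 ^ (6 * \<eta> + 10))
          \<le> real (card {A \<in> hit_family \<eta>. A \<inter> X \<noteq> {}})"
        by (simp add: divide_le_eq mult_le_cancel_left1)
    qed simp
  next
    case False
    interpret gap: gap_graph "verts G" "dominates G" \<eta>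
      by unfold_locales (use False in \<open>auto simp: bad_def\<close>)
    have small: "small \<eta> C \<longleftrightarrow> C \<in> gap.smalls" for C by (simp add: small_def gap.smalls_def)
    have max: "maximal_small \<eta> C \<longleftrightarrow> C \<in> gap.Fmax" for C
      by (auto simp: maximal_small_def gap.Fmax_def small)
    have P: "hit_family \<eta> = gap.family"
    proof -
      have "{nb C \<union> \<Union>{D. maximal_small \<eta> D \<and> nb D = nb C} |C. maximal_small \<eta> C} = gap.fill ` nb ` gap.Fmax"
        unfolding gap.fill_def max by auto
      moreover have "{{u, v} |u v. u \<rightarrow>\<^bsub>G\<^esub> v \<and> (\<forall>C. small \<eta> C \<longrightarrow> u \<notin> C \<and> v \<notin> C)} = gap.high_edges"
      proof -
        have "(u \<rightarrow>\<^bsub>G\<^esub> v \<and> (\<forall>C. small \<eta> C \<longrightarrow> u \<notin> C \<and> v \<notin> C)) \<longleftrightarrow>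
            (u \<in> gap.high \<and> v \<in> gap.high \<and> u \<rightarrow>\<^bsub>G\<^esub> v)" for u v
          using E_V by (auto simp: gap.high_def small)
        then show ?thesis by (simp add: gap.high_edges_def)
      qed
      ultimately show ?thesis using False by (simp add: hit_family_def gap.family_def)
    qed
    have ratio: "gap.ratio \<le> 2 ^ (6 * \<eta> + 10)" by (rule ratio_le[OF gap.gap_graph_axioms])
    show ?thesis
      unfolding modulator_hitting_family_def P
    proof (intro conjI ballI allI impI)
      \<comment> \<open>The empty graph has treewidth 0 by truncated subtraction and is thus
        excluded by \<open>\<eta> < treewidth G\<close>.\<close>
      have "verts G \<noteq> {}"
      proof
        assume e: "verts G = {}"
        have "ptd 0 {} 1 id (\<lambda>_. {})" by (rule ptd_single) auto
        then have "treewidth (G \<restriction> {}) \<le> 0 - 1" by (rule treewidth_le)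
        then show False using tw e induce_all by simp
      qed
      then show "gap.family \<noteq> {}" using gap.family_hits[of "verts G"] by auto
      fix A assume "A \<in> gap.family"
      then consider C where "C \<in> gap.Fmax" "A = gap.fill (nb C)"
        | u v where "u \<rightarrow>\<^bsub>G\<^esub> v" "A = {u, v}"
        unfolding gap.family_def gap.high_edges_def by blast
      then show "protrusion (5 * \<eta> + 5) G A"
      proof cases
        case 1
        show ?thesis
          unfolding 1(2) gap.fill_def
        proof (rule protrusion_components)
          show "card (nb C) \<le> 5 * \<eta> + 5" using gap.F_nb gap.FmaxD(1) 1 by fastforce
          fix D assume "D \<in> {D \<in> gap.Fmax. nb D = nb C}"
          then show "conn D \<and> win (5 * \<eta> + 5) D \<and> nb D = nb C"
            using gap.FmaxD(1)[of D] by (auto simp: gap.smalls_def intro: win_mono)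
        qed (rule nb_V)
      next
        case 2
        have c: "card {u, v} \<le> 5 * \<eta> + 5" by (simp add: card_insert_if)
        then have "ptd (5 * \<eta> + 5) {u, v} 1 id (\<lambda>_. {u, v})"
          using E_V[OF 2(1)] by (intro ptd_single) auto
        then show ?thesis unfolding 2(2) by (rule protrusionI) (use c in auto)
      qed
    next
      fix X assume X: "treewidth_modulator \<eta> G X"
      define N where "N = card {A \<in> gap.family. A \<inter> X \<noteq> {}}"
      have "card gap.family \<le> gap.ratio * N"
        unfolding N_def using mod[OF X] by (intro gap.family_hitting) auto
      also have "\<dots> \<le> 2 ^ (6 * \<eta> + 10) * N" using ratio by (rule mult_le_mono1)
      finally have "real (card gap.family) \<le> real (2 ^ (6 * \<eta> + 10)) * real N"
        by (metis of_nat_mono of_nat_mult)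
      then show "real (card gap.family) / real (2 ^ (6 * \<eta> + 10))
          \<le> real (card {A \<in> gap.family. A \<inter> X \<noteq> {}})"
        unfolding N_def[symmetric] by (simp add: divide_le_eq mult.commute)
    qed simp
  qed
qed

end

section \<open>Queries\<close>

definition query :: "nat \<Rightarrow> (state \<Rightarrow> bool) \<Rightarrow> bool" where
  "query d Q \<longleftrightarrow> computes d (\<lambda>s. of_bool (Q s))"

lemma query_mono: "query d Q \<Longrightarrow> d \<le> d' \<Longrightarrow> query d' Q"
  unfolding query_def by (rule computes_mono)

lemma query_not:
  assumes "query d Q"
  shows "query (d + 3) (\<lambda>s. \<not> Q s)"
proof -
  have "of_bool (\<not> b) = 1 - (of_bool b :: nat)" for b by (cases b) auto
  then show ?thesis
    using computes_minus[OF computes_const[of 1] assms[unfolded query_def]] by (simp add: query_def)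
qed

lemma query_conj:
  assumes "query d P" "query d Q"
  shows "query (d + 6) (\<lambda>s. P s \<and> Q s)"
proof -
  have "of_bool (a \<and> b) = of_bool a - (1 - (of_bool b :: nat))" for a b by (cases a; cases b) auto
  moreover have "computes (max d (max 0 d + 3) + 3) (\<lambda>s. of_bool (P s) - (1 - of_bool (Q s)))"
    using assms unfolding query_def by (intro computes_minus computes_const)
  ultimately show ?thesis unfolding query_def by (simp add: max_def add.commute)
qed

lemma query_disj:
  assumes "query d P" "query d Q"
  shows "query (d + 12) (\<lambda>s. P s \<or> Q s)"
  using query_not[OF query_conj[OF query_not[OF assms(1)] query_not[OF assms(2)]]]
  by (auto simp: add.assoc)

lemma query_pos:
  assumes "computes d h"
  shows "query (d + 6) (\<lambda>s. 0 < h s)"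
proof -
  have "of_bool (0 < k) = 1 - (1 - k)" for k :: nat by (cases k) auto
  moreover have "computes (max 0 (max 0 d + 3) + 3) (\<lambda>s. 1 - (1 - h s))"
    using assms by (intro computes_minus computes_const)
  ultimately show ?thesis unfolding query_def by (simp add: max_def add.commute)
qed

lemma query_less:
  assumes "computes d g" "computes d h"
  shows "query (d + 9) (\<lambda>s. g s < h s)"
  using query_pos[OF computes_minus[OF assms(2,1)]] by (simp add: add.commute)

lemma query_eq:
  assumes "computes d g" "computes d h"
  shows "query (d + 9) (\<lambda>s. g s = h s)"
proof -
  have "of_bool (a = b) = 1 - ((a - b) + (b - a))" for a b :: nat by (cases a b rule: linorder_cases) auto
  moreover have "computes (max 0 (max (max d d + 3) (max d d + 3) + 3) + 3)
      (\<lambda>s. 1 - ((g s - h s) + (h s - g s)))"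
    using assms by (intro computes_minus computes_plus computes_const)
  ultimately show ?thesis unfolding query_def by (simp add: max_def add.commute)
qed

text \<open>A bounded quantifier is decided by counting its witnesses. Each one raises the exponent
  by a constant, so quantifying over a tuple costs an exponent linear in its length.\<close>

lemma query_ex:
  assumes "query d Q" "x \<noteq> 0"
  shows "query (d + 11) (\<lambda>s. \<exists>v<fst s 0. Q ((fst s)(x := v), snd s))"
proof -
  have "computes (d + 5) (\<lambda>s. \<Sum>v<fst s 0. of_bool (Q ((fst s)(x := v), snd s)))"
    using computes_sum[OF assms(1)[unfolded query_def] assms(2)] .
  then have "query (d + 11) (\<lambda>s. 0 < (\<Sum>v<fst s 0. of_bool (Q ((fst s)(x := v), snd s)) :: nat))"
    using query_pos by (fastforce simp: add.assoc)
  moreover have "0 < (\<Sum>v<fst s 0. of_bool (Q ((fst s)(x := v), snd s)) :: nat) \<longleftrightarrow>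
      (\<exists>v<fst s 0. Q ((fst s)(x := v), snd s))" for s
    by (auto simp: zero_less_iff_neq_zero[where 'a = nat])
  ultimately show ?thesis by simp
qed

lemma query_False: "query 0 (\<lambda>s. False)"
  using computes_const[of 0] by (simp add: query_def)

lemma query_var_in:
  "query (22 + 12 * length xs) (\<lambda>s. fst s x \<in> fst s ` set xs)"
proof (induction xs)
  case Nil
  then show ?case using query_mono[OF query_False] by simp
next
  case (Cons y ys)
  have "query (22 + 12 * length ys) (\<lambda>s. fst s x = fst s y)"
    using query_eq[OF computes_var computes_var] by (rule query_mono) simp
  from query_disj[OF this Cons.IH] show ?case by (simp add: add.assoc)
qed

section \<open>Tuples\<close>

definition tuples :: "nat \<Rightarrow> nat \<Rightarrow> nat list set" where
  "tuples n a = {t. length t = a \<and> set t \<subseteq> {..<n}}"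

lemma finite_tuples: "finite (tuples n a)"
  unfolding tuples_def using finite_lists_length_eq[of "{..<n}" a] by (simp add: conj_commute)

lemma card_tuples: "card (tuples n a) = n ^ a"
  unfolding tuples_def using card_lists_length_eq[of "{..<n}" a] by (simp add: conj_commute)

text \<open>The number with digits \<open>t\<close> in base \<open>n\<close>, most significant digit
  first. By Horner's scheme it needs no product other than multiplication by \<open>n\<close>, which
  the machine can perform by repeated addition.\<close>

definition code :: "nat \<Rightarrow> nat list \<Rightarrow> nat" where
  "code n t = foldl (\<lambda>a x. a * n + x) 0 t"

lemma code_Nil [simp]: "code n [] = 0"
  by (simp add: code_def)

lemma code_snoc [simp]: "code n (t @ [x]) = code n t * n + x"
  by (simp add: code_def)

lemma code_less: "t \<in> tuples n a \<Longrightarrow> code n t < n ^ a"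
proof (induction t arbitrary: a rule: rev_induct)
  case (snoc x t)
  then obtain b where b: "a = Suc b" "t \<in> tuples n b" "x < n"
    by (auto simp: tuples_def)
  then have "code n t < n ^ b" using snoc.IH by simp
  then have "(code n t + 1) * n \<le> n ^ b * n" by (intro mult_le_mono1) simp
  then show ?case using b by (simp add: mult.commute)
qed (simp add: tuples_def)

lemma code_inj:
  "s \<in> tuples n a \<Longrightarrow> t \<in> tuples n a \<Longrightarrow> code n s = code n t \<longleftrightarrow> s = t"
proof (induction s arbitrary: t a rule: rev_induct)
  case (snoc x s)
  obtain b y t' where t: "t = t' @ [y]" "a = Suc b"
    using snoc.prems by (cases t rule: rev_cases) (auto simp: tuples_def)
  then have *: "s \<in> tuples n b" "t' \<in> tuples n b" "x < n" "y < n"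
    using snoc.prems by (auto simp: tuples_def)
  have "code n s * n + x = code n t' * n + y \<longleftrightarrow> code n s = code n t' \<and> x = y"
  proof
    assume eq: "code n s * n + x = code n t' * n + y"
    then have "(code n s * n + x) mod n = (code n t' * n + y) mod n" by simp
    then have "x = y" using * by simp
    then show "code n s = code n t' \<and> x = y" using eq * by simp
  qed simp
  then show ?case using snoc.IH[OF *(1,2)] t by simp
qed (auto simp: tuples_def)

fun upds :: "(nat \<Rightarrow> nat) \<Rightarrow> nat list \<Rightarrow> nat list \<Rightarrow> nat \<Rightarrow> nat" where
  "upds e (x # xs) (v # vs) = upds (e(x := v)) xs vs"
| "upds e _ _ = e"

lemma upds_other [simp]: "z \<notin> set xs \<Longrightarrow> upds e xs t z = e z"
  by (induction e xs t rule: upds.induct) auto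

lemma map_upds [simp]:
  "distinct xs \<Longrightarrow> length t = length xs \<Longrightarrow> map (upds e xs t) xs = t"
  by (induction e xs t rule: upds.induct) auto

lemma map_upds_other: "set ys \<inter> set xs = {} \<Longrightarrow> map (upds e xs t) ys = map e ys"
  by (rule map_cong) (auto intro!: upds_other)

lemma ex_tuples_Suc:
  "(\<exists>t\<in>tuples n (Suc a). P t) \<longleftrightarrow> (\<exists>v<n. \<exists>t\<in>tuples n a. P (v # t))"
proof
  assume "\<exists>t\<in>tuples n (Suc a). P t"
  then obtain t where t: "t \<in> tuples n (Suc a)" "P t" by blast
  then obtain v t' where "t = v # t'" by (cases t) (auto simp: tuples_def)
  then show "\<exists>v<n. \<exists>t\<in>tuples n a. P (v # t)" using t by (auto simp: tuples_def)
next
  assume "\<exists>v<n. \<exists>t\<in>tuples n a. P (v # t)"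
  then obtain v t where "v < n" "t \<in> tuples n a" "P (v # t)" by blast
  then show "\<exists>t\<in>tuples n (Suc a). P t" by (intro bexI[of _ "v # t"]) (auto simp: tuples_def)
qed

lemma query_ex_tuple:
  assumes "query d Q" "0 \<notin> set xs"
  shows "query (d + 11 * length xs)
    (\<lambda>s. \<exists>t\<in>tuples (fst s 0) (length xs). Q (upds (fst s) xs t, snd s))"
  using assms(2)
proof (induction xs)
  case Nil
  then show ?case using assms(1) by (simp add: tuples_def)
next
  case (Cons x xs)
  have "query (d + 11 * length xs + 11) (\<lambda>s. \<exists>v<fst s 0. (\<lambda>s. \<exists>t\<in>tuples (fst s 0) (length xs).
      Q (upds (fst s) xs t, snd s)) ((fst s)(x := v), snd s))"
    using Cons by (intro query_ex) auto
  moreover have "(\<lambda>s. \<exists>v<fst s 0. (\<lambda>s. \<exists>t\<in>tuples (fst s 0) (length xs).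
      Q (upds (fst s) xs t, snd s)) ((fst s)(x := v), snd s)) =
      (\<lambda>s. \<exists>t\<in>tuples (fst s 0) (length (x # xs)). Q (upds (fst s) (x # xs) t, snd s))"
    using Cons.prems by (auto simp: ex_tuples_Suc fun_eq_iff)
  ultimately show ?case by (simp add: algebra_simps)
qed

text \<open>Multiplication by \<open>n\<close> is a sum over the scratch variable 1.\<close>

lemma computes_times_n:
  assumes "computes d h" "\<And>(e :: nat \<Rightarrow> nat) M v. h (e(1 := v), M) = h (e, M)"
  shows "computes (d + 5) (\<lambda>s. h s * fst s 0)"
proof -
  have "computes (d + 5) (\<lambda>s. \<Sum>v<fst s 0. h ((fst s)(1 := v), snd s))"
    by (rule computes_sum[OF assms(1)]) simp
  then show ?thesis unfolding assms(2) by (simp add: mult.commute)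
qed

lemma computes_code:
  assumes "1 \<notin> set xs" "0 \<notin> set xs"
  shows "computes (1 + 8 * length xs) (\<lambda>s. code (fst s 0) (map (fst s) xs))"
  using assms
proof (induction xs rule: rev_induct)
  case Nil
  then show ?case using computes_mono[OF computes_const[of 0]] by simp
next
  case (snoc x xs)
  have "computes (1 + 8 * length xs + 5) (\<lambda>s. code (fst s 0) (map (fst s) xs) * fst s 0)"
  proof (rule computes_times_n)
    fix e M :: "nat \<Rightarrow> nat" and v
    have "map (e(1 := v)) xs = map e xs" using snoc.prems by auto
    then show "code (fst (e(1 := v), M) 0) (map (fst (e(1 := v), M)) xs) =
        code (fst (e, M) 0) (map (fst (e, M)) xs)" by (simp only: fst_conv) simp
  qed (use snoc in simp)
  from computes_plus[OF this computes_var[of x]] show ?case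
    by (simp add: max_def algebra_simps)
qed

definition lookup :: "nat \<Rightarrow> nat list \<Rightarrow> state \<Rightarrow> bool" where
  "lookup b xs s \<longleftrightarrow> 0 < snd s (fst s b + code (fst s 0) (map (fst s) xs))"

lemma query_lookup:
  assumes "1 \<notin> set xs" "0 \<notin> set xs"
  shows "query (11 + 8 * length xs) (lookup b xs)"
proof -
  have "query (max 1 (1 + 8 * length xs) + 3 + 1 + 6)
      (\<lambda>s. 0 < snd s (fst s b + code (fst s 0) (map (fst s) xs)))"
    by (intro query_pos computes_load computes_plus computes_var computes_code assms)
  then show ?thesis unfolding lookup_def[abs_def] by (simp add: max_def)
qed

section \<open>Loops over tuples\<close>

fun loops :: "nat list \<Rightarrow> (state \<Rightarrow> state) \<Rightarrow> state \<Rightarrow> state" where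
  "loops [] f = f"
| "loops (x # xs) f = loop x (loops xs f)"

lemma keeps_nD: "keeps_n f \<Longrightarrow> fst (f s) 0 = fst s 0"
  unfolding keeps_n_def by blast

lemma loop_keeps_n:
  assumes "keeps_n f" "x \<noteq> 0"
  shows "keeps_n (loop x f)"
proof -
  have "fst (((\<lambda>s. let s' = f s in ((fst s')(x := fst s' x + 1), snd s')) ^^ i) s) 0 = fst s 0" for i s
    using assms(2) by (induction i) (simp_all add: keeps_nD[OF assms(1)] Let_def)
  then show ?thesis using assms(2) unfolding keeps_n_def loop_def by simp
qed

lemma loops_keeps_n: "keeps_n f \<Longrightarrow> 0 \<notin> set xs \<Longrightarrow> keeps_n (loops xs f)"
  by (induction xs) (auto intro: loop_keeps_n)

lemma runs_loops:
  assumes "runs d f" "keeps_n f" "0 \<notin> set xs"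
  shows "runs (d + 5 * length xs) (loops xs f)"
  using assms(3)
proof (induction xs)
  case (Cons x xs)
  then have "runs (d + 5 * length xs + 5) (loop x (loops xs f))"
    by (intro runs_loop loops_keeps_n assms(2)) auto
  then show ?case by (simp add: algebra_simps)
qed (use assms in simp)

lemma loop_invariant:
  assumes init: "I 0 ((fst s)(x := 0), snd s)" and n: "fst s 0 = n"
    and step: "\<And>v s. v < n \<Longrightarrow> I v s \<Longrightarrow> fst s x = v \<Longrightarrow>
      fst (f s) x = v \<and> I (Suc v) ((fst (f s))(x := Suc v), snd (f s))"
  shows "I n (loop x f s)"
proof -
  define g where "g = (\<lambda>s. let s' = f s in ((fst s')(x := fst s' x + 1), snd s'))"
  have "v \<le> n \<Longrightarrow> I v ((g ^^ v) ((fst s)(x := 0), snd s)) \<and> fst ((g ^^ v) ((fst s)(x := 0), snd s)) x = v" for v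
  proof (induction v)
    case (Suc v)
    then have "v < n" by simp
    then show ?case using Suc.IH step[of v] by (simp add: g_def Let_def)
  qed (use init in simp)
  then show ?thesis unfolding loop_def g_def[symmetric] n by simp
qed

text \<open>Nested loops visit the tuples in the order of their codes, so the invariant may be
  indexed by the code of the current tuple. The claim is generalized to a fixed prefix
  \<open>pre\<close>: the inner loops process exactly the block of codes that begin with it. The
  invariant has to ignore the loop variables, as they are reset and incremented between the
  tuples.\<close>

lemma loops_invariant:
  assumes xs: "distinct xs"
    and insens: "\<And>c s x v. x \<in> set xs \<Longrightarrow> J c ((fst s)(x := v), snd s) \<longleftrightarrow> J c s"
    and n: "\<And>c s. J c s \<Longrightarrow> fst s 0 = n"
    and step: "\<And>t s. t \<in> tuples n (length xs) \<Longrightarrow> map (fst s) xs = t \<Longrightarrow> J (code n t) s \<Longrightarrow>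
      J (Suc (code n t)) (f s) \<and> map (fst (f s)) xs = t"
    and init: "J 0 s"
  shows "J (n ^ length xs) (loops xs f s)"
proof -
  have "J ((code n pre + 1) * n ^ length zs) (loops zs f s) \<and> map (fst (loops zs f s)) ys = pre"
    if "xs = ys @ zs" "pre \<in> tuples n (length ys)" "map (fst s) ys = pre"
      "J (code n pre * n ^ length zs) s" for ys zs pre s
    using that
  proof (induction zs arbitrary: ys pre s)
    case Nil
    then show ?case using step[of pre s] by simp
  next
    case (Cons z zs)
    let ?I = "\<lambda>v s. J ((code n pre * n + v) * n ^ length zs) s \<and> map (fst s) ys = pre"
    have zx: "z \<in> set xs" "z \<notin> set ys" using Cons.prems(1) xs by auto
    have upd: "map ((fst s)(z := v)) ys = map (fst s) ys" for s :: state and v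
      using zx by auto
    have "?I n (loop z (loops zs f) s)"
    proof (rule loop_invariant[where I = ?I and n = n])
      show "?I 0 ((fst s)(z := 0), snd s)"
        using Cons.prems insens[OF zx(1)] unfolding fst_conv snd_conv upd by (simp add: mult.assoc)
      show "fst s 0 = n" using n Cons.prems(4) by blast
      fix v and s' :: state
      assume v: "v < n" and I: "?I v s'" and z: "fst s' z = v"
      have "J ((code n (pre @ [v]) + 1) * n ^ length zs) (loops zs f s') \<and>
          map (fst (loops zs f s')) (ys @ [z]) = pre @ [v]"
        by (rule Cons.IH) (use Cons.prems v I z in \<open>auto simp: tuples_def\<close>)
      then show "fst (loops zs f s') z = v \<and>
          ?I (Suc v) ((fst (loops zs f s'))(z := Suc v), snd (loops zs f s'))"
        using insens[OF zx(1)] unfolding fst_conv snd_conv upd by simp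
    qed
    then show ?case by (simp add: algebra_simps)
  qed
  from this[of "[]" xs "[]" s] init show ?thesis by (simp add: tuples_def)
qed

section \<open>Tables\<close>

definition table :: "nat \<Rightarrow> nat \<Rightarrow> nat \<Rightarrow> (nat \<Rightarrow> nat) \<Rightarrow> nat list set" where
  "table n a B M = {t \<in> tuples n a. 0 < M (B + code n t)}"

definition enter :: "nat \<Rightarrow> nat list \<Rightarrow> (state \<Rightarrow> bool) \<Rightarrow> state \<Rightarrow> state" where
  "enter b xs Q s = (if Q s then (fst s, (snd s)(fst s b + code (fst s 0) (map (fst s) xs) := 1)) else s)"

lemma runs_enter:
  assumes "query d Q" "1 \<notin> set xs" "0 \<notin> set xs" "4 + 8 * length xs \<le> d"
  shows "runs (d + 5) (enter b xs Q)"
proof -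
  have "runs (max (max 1 (1 + 8 * length xs) + 3) 0 + 3)
      (\<lambda>s. (fst s, (snd s)(fst s b + code (fst s 0) (map (fst s) xs) := 1)))"
    by (intro runs_store computes_plus computes_var computes_code computes_const assms)
  then have "runs (d + 3) (\<lambda>s. (fst s, (snd s)(fst s b + code (fst s 0) (map (fst s) xs) := 1)))"
    by (rule runs_mono) (use assms(4) in simp)
  from runs_if[OF assms(1)[unfolded query_def] this]
  show ?thesis unfolding enter_def[abs_def] by (simp add: max_def add.commute)
qed

lemma table_upd:
  assumes "t \<in> tuples n a"
  shows "table n a B (M(B + code n t := Suc 0)) = insert t (table n a B M)"
  using code_inj assms by (auto simp: table_def)

text \<open>
  \<open>n ^ a\<close> rounds reach a fixed point, since every round before that enlarges the table.
\<close>

definition stage :: "nat \<Rightarrow> nat list \<Rightarrow> nat list \<Rightarrow> (state \<Rightarrow> bool) \<Rightarrow> state \<Rightarrow> state" where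
  "stage b ys xs Q = loops ys (loops xs (enter b xs Q))"

lemma keeps_n_enter: "keeps_n (enter b xs Q)"
  by (simp add: keeps_n_def enter_def)

lemma runs_stage:
  assumes "query d Q" "1 \<notin> set xs" "0 \<notin> set xs" "0 \<notin> set ys" "4 + 8 * length xs \<le> d"
  shows "runs (d + 5 + 5 * length xs + 5 * length ys) (stage b ys xs Q)"
  unfolding stage_def
  by (intro runs_loops loops_keeps_n keeps_n_enter runs_enter assms)

lemma keeps_n_stage: "0 \<notin> set xs \<Longrightarrow> 0 \<notin> set ys \<Longrightarrow> keeps_n (stage b ys xs Q)"
  unfolding stage_def by (intro loops_keeps_n keeps_n_enter)

definition same_off :: "nat set \<Rightarrow> nat \<Rightarrow> nat \<Rightarrow> state \<Rightarrow> state \<Rightarrow> bool" where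
  "same_off X lo hi s s' \<longleftrightarrow> (\<forall>z. z \<notin> X \<longrightarrow> fst s' z = fst s z) \<and>
     (\<forall>k. k < lo \<or> hi \<le> k \<longrightarrow> snd s' k = snd s k)"

lemma same_off_upd:
  "x \<in> X \<Longrightarrow> same_off X lo hi s ((fst s')(x := v), snd s') \<longleftrightarrow> same_off X lo hi s s'"
  unfolding same_off_def by auto

lemma same_off_trans:
  "same_off X lo hi s s' \<Longrightarrow> same_off Y lo hi s' s'' \<Longrightarrow> X \<subseteq> Z \<Longrightarrow> Y \<subseteq> Z \<Longrightarrow> same_off Z lo hi s s''"
  unfolding same_off_def by (metis subsetD)

text \<open>Entries are made in place, so \<open>\<Phi>\<close> is evaluated on a table that changes
  during the round. Soundness is assumed for every subset of \<open>L\<close> and thus persists. If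
  the round makes no new entry, all tuples were tested against one and the same table; this table is
  closed under \<open>\<Phi>\<close> and contains \<open>L\<close> by completeness.\<close>

lemma round_correct:
  assumes xs: "distinct xs" "0 \<notin> set xs" "b \<notin> set xs" and n: "n = fst s0 0" and B: "B = fst s0 b"
    and a: "a = length xs"
    and Q: "\<And>s. same_off (set xs) B (B + n ^ a) s0 s \<Longrightarrow> map (fst s) xs \<in> tuples n a \<Longrightarrow>
        Q s \<longleftrightarrow> \<Phi> (table n a B (snd s)) (map (fst s) xs)"
    and sound: "\<And>T t. T \<subseteq> L \<Longrightarrow> t \<in> tuples n a \<Longrightarrow> \<Phi> T t \<Longrightarrow> t \<in> L"
    and L0: "table n a B (snd s0) \<subseteq> L"
    and complete: "\<And>T. T \<subseteq> tuples n a \<Longrightarrow> (\<And>t. t \<in> tuples n a \<Longrightarrow> \<Phi> T t \<Longrightarrow> t \<in> T) \<Longrightarrow> L \<subseteq> T"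
  defines "s1 \<equiv> loops xs (enter b xs Q) s0"
  shows "same_off (set xs) B (B + n ^ a) s0 s1 \<and> table n a B (snd s1) \<subseteq> L \<and>
    (L \<subseteq> table n a B (snd s1) \<or> card (table n a B (snd s0)) < card (table n a B (snd s1)))"
proof -
  define T0 where "T0 = table n a B (snd s0)"
  define J where "J = (\<lambda>c s. same_off (set xs) B (B + n ^ a) s0 s \<and> table n a B (snd s) \<subseteq> L \<and>
    T0 \<subseteq> table n a B (snd s) \<and>
    (T0 = table n a B (snd s) \<longrightarrow> (\<forall>t\<in>tuples n a. code n t < c \<longrightarrow> \<Phi> T0 t \<longrightarrow> t \<in> T0)))"
  have fin: "finite (table n a B M)" for M
    unfolding table_def using finite_tuples by simp
  have "J (n ^ length xs) s1"
    unfolding s1_def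
  proof (rule loops_invariant[OF xs(1)])
    show "J c ((fst s)(x := v), snd s) \<longleftrightarrow> J c s" if "x \<in> set xs" for c s x v
      unfolding J_def same_off_upd[OF that] by simp
    show "fst s 0 = n" if "J c s" for c s
      using that xs n unfolding J_def same_off_def by auto
    show "J 0 s0" unfolding J_def T0_def same_off_def using L0 by auto
    fix t s
    assume t: "t \<in> tuples n (length xs)" "map (fst s) xs = t" and J: "J (code n t) s"
    have ta: "t \<in> tuples n a" using t a by simp
    have same: "same_off (set xs) B (B + n ^ a) s0 s" using J by (simp add: J_def)
    then have nb: "fst s 0 = n" "fst s b = B" using xs n B by (auto simp: same_off_def)
    define T where "T = table n a B (snd s)"
    have TJ: "T \<subseteq> L" "T0 \<subseteq> T" "T0 = T \<Longrightarrow> t' \<in> tuples n a \<Longrightarrow> code n t' < code n t \<Longrightarrow> \<Phi> T0 t' \<Longrightarrow> t' \<in> T0" for t'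
      using J by (auto simp: J_def T_def)
    have Qs: "Q s \<longleftrightarrow> \<Phi> T t" using Q[OF same] t ta by (simp add: T_def)
    have less: "code n t' < Suc (code n t) \<longleftrightarrow> code n t' < code n t \<or> t' = t" if "t' \<in> tuples n a" for t'
      using code_inj[OF that ta] by auto
    show "J (Suc (code n t)) (enter b xs Q s) \<and> map (fst (enter b xs Q s)) xs = t"
    proof (cases "Q s")
      case False
      then have "\<not> \<Phi> T t" using Qs by simp
      then have "\<forall>t'\<in>tuples n a. code n t' < Suc (code n t) \<longrightarrow> \<Phi> T0 t' \<longrightarrow> t' \<in> T0" if "T0 = T"
        using less TJ(3)[OF that] that by auto
      then show ?thesis using False J t(2) by (simp add: enter_def J_def T_def)
    next
      case True
      then have s': "enter b xs Q s = (fst s, (snd s)(B + code n t := Suc 0))"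
        using nb t(2) by (simp add: enter_def)
      have T': "table n a B (snd (enter b xs Q s)) = insert t T"
        unfolding s' using table_upd[OF ta] by (simp add: T_def)
      have "t \<in> L" using sound[OF TJ(1) ta] True Qs by simp
      have "same_off (set xs) B (B + n ^ a) s0 (enter b xs Q s)"
        using same code_less[OF ta] unfolding s' same_off_def by auto
      moreover have "\<forall>t'\<in>tuples n a. code n t' < Suc (code n t) \<longrightarrow> \<Phi> T0 t' \<longrightarrow> t' \<in> T0"
        if eq: "T0 = insert t T"
      proof -
        have "T0 = T" "t \<in> T0" using TJ(2) eq by auto
        then show ?thesis using less TJ(3) by auto
      qed
      ultimately show ?thesis
        unfolding J_def T' using TJ(1,2) \<open>t \<in> L\<close> t(2) by (auto simp: s')
    qed
  qed
  then have J: "J (n ^ a) s1" using a by simp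
  define T1 where "T1 = table n a B (snd s1)"
  have "L \<subseteq> T1 \<or> card T0 < card T1"
  proof (cases "T0 = T1")
    case True
    then have "\<And>t. t \<in> tuples n a \<Longrightarrow> \<Phi> T1 t \<Longrightarrow> t \<in> T1"
      using J code_less by (auto simp: J_def T1_def)
    moreover have "T1 \<subseteq> tuples n a" by (auto simp: T1_def table_def)
    ultimately show ?thesis using complete by blast
  next
    case False
    then have "T0 \<subset> T1" using J by (auto simp: J_def T1_def)
    then show ?thesis using fin by (auto simp: T1_def intro: psubset_card_mono)
  qed
  then show ?thesis using J by (simp add: J_def T1_def T0_def)
qed

theorem stage_correct:
  assumes xs: "distinct xs" "0 \<notin> set xs" "b \<notin> set xs"
    and ys: "distinct ys" "0 \<notin> set ys" "b \<notin> set ys" "set xs \<inter> set ys = {}" "length ys = a"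
    and n: "n = fst s0 0" and B: "B = fst s0 b" and a: "a = length xs"
    and Q: "\<And>s. same_off (set xs \<union> set ys) B (B + n ^ a) s0 s \<Longrightarrow> map (fst s) xs \<in> tuples n a \<Longrightarrow>
        Q s \<longleftrightarrow> \<Phi> (table n a B (snd s)) (map (fst s) xs)"
    and sound: "\<And>T t. T \<subseteq> L \<Longrightarrow> t \<in> tuples n a \<Longrightarrow> \<Phi> T t \<Longrightarrow> t \<in> L"
    and complete: "\<And>T. T \<subseteq> tuples n a \<Longrightarrow> (\<And>t. t \<in> tuples n a \<Longrightarrow> \<Phi> T t \<Longrightarrow> t \<in> T) \<Longrightarrow> L \<subseteq> T"
    and zero: "\<And>k. B \<le> k \<Longrightarrow> k < B + n ^ a \<Longrightarrow> snd s0 k = 0"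
  shows "same_off (set xs \<union> set ys) B (B + n ^ a) s0 (stage b ys xs Q s0) \<and>
    table n a B (snd (stage b ys xs Q s0)) = L"
proof -
  \<comment> \<open>A complete table cannot grow beyond \<open>L\<close>, so
    \<open>round_correct\<close> yields completeness again in all later rounds; before that,
    \<open>c\<close> rounds have made at least \<open>c\<close> entries.\<close>
  define K where "K = (\<lambda>c s. same_off (set xs \<union> set ys) B (B + n ^ a) s0 s \<and> table n a B (snd s) \<subseteq> L \<and>
    (L \<subseteq> table n a B (snd s) \<or> c \<le> card (table n a B (snd s))))"
  have L: "L \<subseteq> tuples n a" using complete by blast
  have "K (n ^ length ys) (stage b ys xs Q s0)"
    unfolding stage_def
  proof (rule loops_invariant[OF ys(1)])
    show "K c ((fst s)(x := v), snd s) \<longleftrightarrow> K c s" if "x \<in> set ys" for c s x v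
    proof -
      have "x \<in> set xs \<union> set ys" using that by simp
      then show ?thesis unfolding K_def by (simp only: same_off_upd snd_conv)
    qed
    show "fst s 0 = n" if "K c s" for c s
      using that xs ys n unfolding K_def same_off_def by auto
    have "table n a B (snd s0) = {}"
      unfolding table_def using zero code_less by fastforce
    then show "K 0 s0" unfolding K_def same_off_def by auto
    fix t s
    assume t: "t \<in> tuples n (length ys)" "map (fst s) ys = t" and K: "K (code n t) s"
    have same: "same_off (set xs \<union> set ys) B (B + n ^ a) s0 s" using K by (simp add: K_def)
    then have nb: "fst s 0 = n" "fst s b = B" using xs ys n B by (auto simp: same_off_def)
    define s' where "s' = loops xs (enter b xs Q) s"
    have r: "same_off (set xs) B (B + n ^ a) s s' \<and> table n a B (snd s') \<subseteq> L \<and>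
        (L \<subseteq> table n a B (snd s') \<or> card (table n a B (snd s)) < card (table n a B (snd s')))"
      unfolding s'_def
    proof (rule round_correct[where \<Phi> = \<Phi> and L = L])
      fix s2 assume "same_off (set xs) B (B + n ^ a) s s2" "map (fst s2) xs \<in> tuples n a"
      then show "Q s2 \<longleftrightarrow> \<Phi> (table n a B (snd s2)) (map (fst s2) xs)"
        by (intro Q same_off_trans[OF same]) auto
    qed (use xs nb a sound complete K in \<open>auto simp: K_def\<close>)
    have "table n a B (snd s) \<subseteq> L" "L \<subseteq> table n a B (snd s) \<or> code n t \<le> card (table n a B (snd s))"
      using K by (auto simp: K_def)
    then have "L \<subseteq> table n a B (snd s') \<or> Suc (code n t) \<le> card (table n a B (snd s'))"
    proof -
      assume 1: "table n a B (snd s) \<subseteq> L" and "L \<subseteq> table n a B (snd s) \<or> code n t \<le> card (table n a B (snd s))"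
      then consider "table n a B (snd s) = L" | "code n t \<le> card (table n a B (snd s))" by blast
      then show ?thesis
      proof cases
        case 1
        have "finite L" using L finite_tuples by (rule finite_subset)
        then have "card (table n a B (snd s')) \<le> card L" using r by (intro card_mono) auto
        then show ?thesis using r 1 by auto
      qed (use r in auto)
    qed
    moreover have "same_off (set xs \<union> set ys) B (B + n ^ a) s0 s'"
      using same_off_trans[OF same, of "set xs" s'] r by auto
    moreover have "map (fst s') ys = t"
    proof -
      have "fst s' z = fst s z" if "z \<in> set ys" for z
        using r ys(4) that unfolding same_off_def by auto
      then show ?thesis using t(2) by auto
    qed
    ultimately show "K (Suc (code n t)) (loops xs (enter b xs Q) s) \<and>
        map (fst (loops xs (enter b xs Q) s)) ys = t"
      using r unfolding K_def s'_def by simp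
  qed
  then have K: "K (n ^ a) (stage b ys xs Q s0)" using ys by simp
  have "L \<subseteq> table n a B (snd (stage b ys xs Q s0))"
  proof (rule ccontr)
    assume neg: "\<not> ?thesis"
    then have "n ^ a \<le> card (table n a B (snd (stage b ys xs Q s0)))" using K by (auto simp: K_def)
    moreover have "table n a B (snd (stage b ys xs Q s0)) \<subseteq> tuples n a" by (auto simp: table_def)
    ultimately have "table n a B (snd (stage b ys xs Q s0)) = tuples n a"
      using finite_tuples card_tuples by (intro card_seteq) auto
    then show False using L neg by simp
  qed
  then show ?thesis using K by (auto simp: K_def)
qed

text \<open>\<open>e b' := e b + n ^ length xs\<close>\<close>

definition advance :: "nat \<Rightarrow> nat \<Rightarrow> nat list \<Rightarrow> state \<Rightarrow> state" where
  "advance b' b xs s = loops xs (\<lambda>s. ((fst s)(b' := fst s b' + 1), snd s)) ((fst s)(b' := fst s b), snd s)"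

lemma runs_advance:
  assumes "0 \<notin> set xs" "b' \<noteq> 0"
  shows "runs (8 + 5 * length xs) (advance b' b xs)"
proof -
  have "runs (max 1 0 + 3 + 2) (\<lambda>s. ((fst s)(b' := fst s b' + 1), snd s))"
    by (intro runs_assign computes_plus computes_var computes_const)
  then have "runs (6 + 5 * length xs) (loops xs (\<lambda>s. ((fst s)(b' := fst s b' + 1), snd s)))"
    using runs_loops[OF _ _ assms(1)] assms(2) by (simp add: keeps_n_def)
  moreover have "runs (1 + 2) (\<lambda>s. ((fst s)(b' := fst s b), snd s))"
    by (intro runs_assign computes_var)
  moreover have "keeps_n (\<lambda>s. ((fst s)(b' := fst s b), snd s))"
    using assms(2) by (simp add: keeps_n_def)
  ultimately show ?thesis
    using runs_mono[OF runs_seq[of "1 + 2" "\<lambda>s. ((fst s)(b' := fst s b), snd s)" "6 + 5 * length xs"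
        "loops xs (\<lambda>s. ((fst s)(b' := fst s b' + 1), snd s))"], of "8 + 5 * length xs"]
    unfolding advance_def[abs_def] by simp
qed

lemma keeps_n_advance: "0 \<notin> set xs \<Longrightarrow> b' \<noteq> 0 \<Longrightarrow> keeps_n (advance b' b xs)"
  using loops_keeps_n[of "\<lambda>s. ((fst s)(b' := fst s b' + 1), snd s)" xs]
  by (simp add: keeps_n_def advance_def)

lemma advance_correct:
  assumes "distinct xs" "0 \<notin> set xs" "b' \<notin> set xs" "b' \<noteq> 0"
  shows "fst (advance b' b xs s) b' = fst s b + fst s 0 ^ length xs \<and>
    (\<forall>z. z \<notin> insert b' (set xs) \<longrightarrow> fst (advance b' b xs s) z = fst s z) \<and>
    snd (advance b' b xs s) = snd s"
proof -
  define J where "J = (\<lambda>c (s' :: state). fst s' b' = fst s b + c \<and>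
    (\<forall>z. z \<notin> insert b' (set xs) \<longrightarrow> fst s' z = fst s z) \<and> snd s' = snd s)"
  have "J (fst s 0 ^ length xs) (advance b' b xs s)"
    unfolding advance_def
  proof (rule loops_invariant[OF assms(1)])
    show "J c ((fst s)(x := v), snd s) \<longleftrightarrow> J c s" if "x \<in> set xs" for c s x v
      using that assms unfolding J_def by auto
    show "fst s' 0 = fst s 0" if "J c s'" for c s'
      using that assms by (auto simp: J_def)
  qed (use assms in \<open>auto simp: J_def\<close>)
  then show ?thesis by (simp add: J_def)
qed

section \<open>Output\<close>

definition emit :: "nat \<Rightarrow> nat \<Rightarrow> (state \<Rightarrow> bool) \<Rightarrow> state \<Rightarrow> state" where
  "emit x ptr mem = loop x (\<lambda>s. ((fst s)(ptr := fst s ptr + 1), (snd s)(fst s ptr := of_bool (mem s))))"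

definition listing :: "nat list \<Rightarrow> nat \<Rightarrow> nat \<Rightarrow> nat \<Rightarrow> (state \<Rightarrow> bool) \<Rightarrow> (state \<Rightarrow> bool) \<Rightarrow> state \<Rightarrow> state" where
  "listing ps x ptr cnt valid mem = loops ps (\<lambda>s. if valid s then
     (\<lambda>s. ((fst s)(cnt := fst s cnt + 1), snd s)) (emit x ptr mem s) else s)"

lemma runs_emit:
  assumes mem: "query d mem" "1 \<le> d" and x: "x \<noteq> 0" "ptr \<noteq> 0"
  shows "runs (d + 12) (emit x ptr mem)"
proof -
  have 1: "runs (max 1 d + 3) (\<lambda>s. (fst s, (snd s)(fst s ptr := of_bool (mem s))))"
    using mem(1) unfolding query_def by (intro runs_store computes_var)
  have 2: "runs (max 1 0 + 3 + 2) (\<lambda>s. ((fst s)(ptr := fst s ptr + 1), snd s))"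
    by (intro runs_assign computes_plus computes_var computes_const)
  have "runs (max (max 1 d + 3) (max 1 0 + 3 + 2) + 1)
     (\<lambda>s. ((fst s)(ptr := fst s ptr + 1), (snd s)(fst s ptr := of_bool (mem s))))"
    using runs_seq[OF 1 2] by (simp add: keeps_n_def)
  then have "runs (d + 7) (\<lambda>s. ((fst s)(ptr := fst s ptr + 1), (snd s)(fst s ptr := of_bool (mem s))))"
    by (rule runs_mono) (use mem(2) in simp)
  from runs_loop[OF this _ x(1)] show ?thesis
    unfolding emit_def using x(2) by (simp add: keeps_n_def add.commute)
qed

lemma keeps_n_emit: "x \<noteq> 0 \<Longrightarrow> ptr \<noteq> 0 \<Longrightarrow> keeps_n (emit x ptr mem)"
  unfolding emit_def by (rule loop_keeps_n) (simp_all add: keeps_n_def)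

lemma runs_listing:
  assumes "query d valid" "query d mem" "1 \<le> d" "x \<noteq> 0" "ptr \<noteq> 0" "cnt \<noteq> 0" "0 \<notin> set ps"
  shows "runs (d + 15 + 5 * length ps) (listing ps x ptr cnt valid mem)"
proof -
  have "runs (max 1 0 + 3 + 2) (\<lambda>s. ((fst s)(cnt := fst s cnt + 1), snd s))"
    by (intro runs_assign computes_plus computes_var computes_const)
  from runs_seq[OF runs_emit[OF assms(2-5)] this keeps_n_emit[OF assms(4,5)]]
  have "runs (d + 13) (\<lambda>s. (\<lambda>s. ((fst s)(cnt := fst s cnt + 1), snd s)) (emit x ptr mem s))"
    by (rule runs_mono) simp
  from runs_if[OF assms(1)[unfolded query_def] this]
  have "runs (d + 15) (\<lambda>s. if valid s then
      (\<lambda>s. ((fst s)(cnt := fst s cnt + 1), snd s)) (emit x ptr mem s) else s)"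
    by (simp add: max_def add.commute)
  then show ?thesis
    unfolding listing_def using keeps_n_emit[OF assms(4,5), of mem] assms(6,7)
    by (intro runs_loops) (simp_all add: keeps_n_def)
qed

lemma keeps_n_listing:
  assumes "x \<noteq> 0" "ptr \<noteq> 0" "cnt \<noteq> 0" "0 \<notin> set ps"
  shows "keeps_n (listing ps x ptr cnt valid mem)"
  unfolding listing_def using keeps_n_emit[OF assms(1,2), of mem] assms(3,4)
  by (intro loops_keeps_n) (simp_all add: keeps_n_def)

lemma emit_correct:
  assumes x: "x \<noteq> 0" "ptr \<noteq> 0" "x \<noteq> ptr" and n: "fst s0 0 = n" and P: "fst s0 ptr = P"
    and mem: "\<And>s. fst s x < n \<Longrightarrow> (\<And>z. z \<notin> {x, ptr} \<Longrightarrow> fst s z = fst s0 z) \<Longrightarrow>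
      (\<And>k. k < P \<Longrightarrow> snd s k = snd s0 k) \<Longrightarrow> mem s \<longleftrightarrow> MEM (fst s x)"
  shows "(\<forall>z. z \<notin> {x, ptr} \<longrightarrow> fst (emit x ptr mem s0) z = fst s0 z) \<and>
    fst (emit x ptr mem s0) ptr = P + n \<and>
    (\<forall>k. snd (emit x ptr mem s0) k = (if P \<le> k \<and> k < P + n then of_bool (MEM (k - P)) else snd s0 k))"
proof -
  define I where "I = (\<lambda>v s. (\<forall>z. z \<notin> {x, ptr} \<longrightarrow> fst s z = fst s0 z) \<and> fst s ptr = P + v \<and>
    (\<forall>k. snd s k = (if P \<le> k \<and> k < P + v then of_bool (MEM (k - P)) else snd s0 k)))"
  have "I n (emit x ptr mem s0)"
    unfolding emit_def
  proof (rule loop_invariant[where n = n])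
    show "I 0 ((fst s0)(x := 0), snd s0)" using x P unfolding I_def by auto
    show "fst s0 0 = n" by (rule n)
    fix v s assume v: "v < n" and I: "I v s" and xv: "fst s x = v"
    have "mem s \<longleftrightarrow> MEM v"
      using mem[of s] v xv I unfolding I_def by auto
    then show "fst ((fst s)(ptr := fst s ptr + 1), (snd s)(fst s ptr := of_bool (mem s))) x = v \<and>
      I (Suc v) ((fst ((fst s)(ptr := fst s ptr + 1), (snd s)(fst s ptr := of_bool (mem s))))(x := Suc v),
        snd ((fst s)(ptr := fst s ptr + 1), (snd s)(fst s ptr := of_bool (mem s))))"
      using I xv x unfolding I_def by auto
  qed
  then show ?thesis unfolding I_def by blast
qed

definition listed_sets :: "nat \<Rightarrow> nat \<Rightarrow> (nat list \<Rightarrow> bool) \<Rightarrow> (nat list \<Rightarrow> nat \<Rightarrow> bool) \<Rightarrow> nat \<Rightarrow> nat set set" where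
  "listed_sets n a VAL MEM c = (\<lambda>p. {i. i < n \<and> MEM p i}) ` {p \<in> tuples n a. VAL p \<and> code n p < c}"

text \<open>\<open>valid\<close> accepts a code only if no smaller valid code describes the same
  set, so each set is written once and the counter is the cardinality of the family. Both queries
  are assumed correct as soon as the memory below \<open>B\<close> is intact, because the output is
  written above it while they are still in use.\<close>

theorem listing_correct:
  assumes ps: "distinct ps" "0 \<notin> set ps" "x \<notin> set ps" "ptr \<notin> set ps" "cnt \<notin> set ps"
    and x: "x \<noteq> 0" "ptr \<noteq> 0" "cnt \<noteq> 0" "x \<noteq> ptr" "x \<noteq> cnt" "ptr \<noteq> cnt"
    and s0: "fst s0 0 = n" "fst s0 ptr = B" "fst s0 cnt = 0" and a: "length ps = a"
    and valid: "\<And>s p. (\<And>z. z \<notin> set ps \<union> {x, ptr, cnt} \<Longrightarrow> fst s z = fst s0 z) \<Longrightarrow>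
      (\<And>k. k < B \<Longrightarrow> snd s k = snd s0 k) \<Longrightarrow> map (fst s) ps = p \<Longrightarrow> p \<in> tuples n a \<Longrightarrow>
      valid s \<longleftrightarrow> VAL p \<and> \<not> (\<exists>p'\<in>tuples n a. code n p' < code n p \<and> VAL p' \<and> (\<forall>i<n. MEM p' i \<longleftrightarrow> MEM p i))"
    and mem: "\<And>s p. (\<And>z. z \<notin> set ps \<union> {x, ptr, cnt} \<Longrightarrow> fst s z = fst s0 z) \<Longrightarrow>
      (\<And>k. k < B \<Longrightarrow> snd s k = snd s0 k) \<Longrightarrow> map (fst s) ps = p \<Longrightarrow> p \<in> tuples n a \<Longrightarrow> fst s x < n \<Longrightarrow>
      mem s \<longleftrightarrow> MEM p (fst s x)"
  defines "s1 \<equiv> listing ps x ptr cnt valid mem s0" and "F \<equiv> (\<lambda>p. {i. i < n \<and> MEM p i}) ` {p \<in> tuples n a. VAL p}"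
  shows "fst s1 cnt = card F \<and> (\<forall>z. z \<notin> set ps \<union> {x, ptr, cnt} \<longrightarrow> fst s1 z = fst s0 z) \<and>
    F = (\<lambda>j. {i. i < n \<and> snd s1 (B + j * n + i) = 1}) ` {..<card F}"
proof -
  let ?F = "listed_sets n a VAL MEM"
  define J where "J = (\<lambda>c s. (\<forall>z. z \<notin> set ps \<union> {x, ptr, cnt} \<longrightarrow> fst s z = fst s0 z) \<and>
    (\<forall>k. k < B \<longrightarrow> snd s k = snd s0 k) \<and> fst s cnt = card (?F c) \<and>
    fst s ptr = B + card (?F c) * n \<and>
    ?F c = (\<lambda>j. {i. i < n \<and> snd s (B + j * n + i) = 1}) ` {..<card (?F c)})"
  have finF: "finite (?F c)" for c unfolding listed_sets_def using finite_tuples by simp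
  have "J (n ^ length ps) s1"
    unfolding s1_def listing_def
  proof (rule loops_invariant[OF ps(1)])
    show "J c ((fst s)(y := v), snd s) \<longleftrightarrow> J c s" if "y \<in> set ps" for c s y v
      using that ps unfolding J_def by (auto simp: fun_upd_def)
    show "fst s 0 = n" if "J c s" for c s using that ps x s0 unfolding J_def by auto
    have "?F 0 = {}" by (simp add: listed_sets_def)
    then show "J 0 s0" unfolding J_def using s0 by simp
    fix p s
    assume p: "p \<in> tuples n (length ps)" "map (fst s) ps = p" and J: "J (code n p) s"
    have pa: "p \<in> tuples n a" using p a by simp
    define c where "c = code n p"
    have Jc: "\<And>z. z \<notin> set ps \<union> {x, ptr, cnt} \<Longrightarrow> fst s z = fst s0 z" "\<And>k. k < B \<Longrightarrow> snd s k = snd s0 k"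
      "fst s cnt = card (?F c)" "fst s ptr = B + card (?F c) * n"
      "?F c = (\<lambda>j. {i. i < n \<and> snd s (B + j * n + i) = 1}) ` {..<card (?F c)}"
      using J unfolding J_def c_def by blast+
    have less: "code n p' < Suc c \<longleftrightarrow> code n p' < c \<or> p' = p" if "p' \<in> tuples n a" for p'
      using code_inj[OF that pa] by (auto simp: c_def)
    have FSuc: "?F (Suc c) = (if VAL p then insert {i. i < n \<and> MEM p i} (?F c) else ?F c)"
      unfolding listed_sets_def using less pa by auto
    have old: "(\<exists>p'\<in>tuples n a. code n p' < c \<and> VAL p' \<and> (\<forall>i<n. MEM p' i \<longleftrightarrow> MEM p i)) \<longleftrightarrow>
        {i. i < n \<and> MEM p i} \<in> ?F c"
      unfolding listed_sets_def by (auto simp: image_iff set_eq_iff)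
    have v: "valid s \<longleftrightarrow> VAL p \<and> {i. i < n \<and> MEM p i} \<notin> ?F c"
      using valid[OF Jc(1,2) p(2) pa] old unfolding c_def by blast
    show "J (Suc (code n p)) (if valid s then
        (\<lambda>s. ((fst s)(cnt := fst s cnt + 1), snd s)) (emit x ptr mem s) else s) \<and>
      map (fst (if valid s then (\<lambda>s. ((fst s)(cnt := fst s cnt + 1), snd s)) (emit x ptr mem s) else s)) ps = p"
    proof (cases "valid s")
      case False
      then have "?F (Suc c) = ?F c" using v FSuc by auto
      then show ?thesis using False J p(2) unfolding J_def c_def by simp
    next
      case True
      then have new: "VAL p" "{i. i < n \<and> MEM p i} \<notin> ?F c" using v by auto
      define N where "N = card (?F c)"
      define P where "P = B + N * n"
      define s' where "s' = emit x ptr mem s"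
      have e: "(\<forall>z. z \<notin> {x, ptr} \<longrightarrow> fst s' z = fst s z) \<and> fst s' ptr = P + n \<and>
        (\<forall>k. snd s' k = (if P \<le> k \<and> k < P + n then of_bool (MEM p (k - P)) else snd s k))"
        unfolding s'_def
      proof (rule emit_correct)
        show "fst s 0 = n" using Jc(1)[of 0] ps x s0 by auto
        show "fst s ptr = P" using Jc(4) by (simp add: P_def N_def)
        fix s2 assume s2: "fst s2 x < n" "\<And>z. z \<notin> {x, ptr} \<Longrightarrow> fst s2 z = fst s z"
          "\<And>k. k < P \<Longrightarrow> snd s2 k = snd s k"
        show "mem s2 \<longleftrightarrow> MEM p (fst s2 x)"
        proof (rule mem[OF _ _ _ pa s2(1)])
          show "fst s2 z = fst s0 z" if "z \<notin> set ps \<union> {x, ptr, cnt}" for z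
            using s2(2)[of z] Jc(1)[OF that] that by auto
          show "snd s2 k = snd s0 k" if "k < B" for k
            using s2(3)[of k] Jc(2)[OF that] that by (simp add: P_def)
          have "fst s2 z = fst s z" if "z \<in> set ps" for z by (rule s2(2)) (use ps that in auto)
          then show "map (fst s2) ps = p" using p(2) by (auto simp: map_eq_conv)
        qed
      qed (rule x)+
      have cS: "card (?F (Suc c)) = Suc N" using FSuc new finF by (simp add: N_def)
      have block: "{i. i < n \<and> snd s' (B + j * n + i) = 1} = {i. i < n \<and> snd s (B + j * n + i) = 1}"
        if "j < N" for j
      proof -
        have "B + j * n + i < P" if "i < n" for i
        proof -
          have "Suc j * n \<le> N * n" using \<open>j < N\<close> by (intro mult_le_mono1) simp
          then show ?thesis using that by (simp add: P_def)
        qed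
        then show ?thesis using e by (auto simp: not_le)
      qed
      have last: "{i. i < n \<and> snd s' (B + N * n + i) = 1} = {i. i < n \<and> MEM p i}"
        using e by (auto simp: P_def)
      have "?F (Suc c) = insert {i. i < n \<and> MEM p i} (?F c)" using FSuc new by simp
      also have "?F c = (\<lambda>j. {i. i < n \<and> snd s' (B + j * n + i) = 1}) ` {..<N}"
      proof -
        have "?F c = (\<lambda>j. {i. i < n \<and> snd s (B + j * n + i) = 1}) ` {..<N}"
          using Jc(5) unfolding N_def .
        also have "\<dots> = (\<lambda>j. {i. i < n \<and> snd s' (B + j * n + i) = 1}) ` {..<N}"
          by (rule image_cong) (use block in auto)
        finally show ?thesis .
      qed
      finally have FS: "?F (Suc c) = (\<lambda>j. {i. i < n \<and> snd s' (B + j * n + i) = 1}) ` {..<Suc N}"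
        using last by (simp add: lessThan_Suc)
      have "J (Suc c) ((fst s')(cnt := fst s' cnt + 1), snd s')"
        unfolding J_def cS
      proof (intro conjI allI impI)
        show "fst ((fst s')(cnt := fst s' cnt + 1), snd s') cnt = Suc N"
          using e x Jc(3) by (simp add: N_def)
        show "fst ((fst s')(cnt := fst s' cnt + 1), snd s') ptr = B + Suc N * n"
          using e x by (simp add: P_def)
        show "fst ((fst s')(cnt := fst s' cnt + 1), snd s') z = fst s0 z" if "z \<notin> set ps \<union> {x, ptr, cnt}" for z
          using e Jc(1)[OF that] that by auto
        show "snd ((fst s')(cnt := fst s' cnt + 1), snd s') k = snd s0 k" if "k < B" for k
          using e Jc(2)[OF that] that by (simp add: P_def)
        show "?F (Suc c) = (\<lambda>j. {i. i < n \<and> snd ((fst s')(cnt := fst s' cnt + 1), snd s') (B + j * n + i) = 1}) `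
            {..<Suc N}" using FS by simp
      qed
      moreover have "map (fst ((fst s')(cnt := fst s' cnt + 1), snd s')) ps = p"
        using e ps p(2) by (auto simp: map_eq_conv)
      ultimately show ?thesis using True unfolding s'_def c_def by simp
    qed
  qed
  moreover have "?F (n ^ length ps) = F"
    unfolding F_def listed_sets_def using code_less a by auto
  ultimately show ?thesis unfolding J_def by simp
qed

section \<open>Queries with linear exponents\<close>

text \<open>
  The query may depend on \<open>\<eta>\<close>, but not on the instance \<open>I\<close>: one program has to work for all graphs.
  Values below \<open>n\<close> are required since only those can serve as digits of table indices.
\<close>

definition below :: "nat set \<Rightarrow> state \<Rightarrow> bool" where
  "below X s \<longleftrightarrow> (\<forall>x\<in>X. fst s x < fst s 0)"

text \<open>\<open>c\<close> is chosen before \<open>\<eta>\<close>, which keeps the exponent of the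
  running time linear. Correctness is demanded only in states where the input and the tables
  computed so far are in place.\<close>

definition linear ::
  "(nat \<Rightarrow> 'i \<Rightarrow> state \<Rightarrow> bool) \<Rightarrow> (nat \<Rightarrow> nat set) \<Rightarrow> (nat \<Rightarrow> 'i \<Rightarrow> state \<Rightarrow> bool) \<Rightarrow> bool" where
  "linear good X P \<longleftrightarrow> (\<exists>c. \<forall>\<eta>. \<exists>Q. query (c * (\<eta> + 1)) Q \<and>
     (\<forall>I s. good \<eta> I s \<longrightarrow> below (X \<eta>) s \<longrightarrow> (Q s \<longleftrightarrow> P \<eta> I s)))"

text \<open>Variables from 20 on are free for quantifiers; those below hold \<open>n\<close> and
  addresses.\<close>

definition upd_closed :: "(nat \<Rightarrow> 'i \<Rightarrow> state \<Rightarrow> bool) \<Rightarrow> bool" where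
  "upd_closed good \<longleftrightarrow> (\<forall>\<eta> I s x v. good \<eta> I s \<longrightarrow> 20 \<le> x \<longrightarrow> good \<eta> I ((fst s)(x := v), snd s))"

lemma linearI:
  assumes "\<And>\<eta>. query (c * (\<eta> + 1)) (Q \<eta>)"
    "\<And>\<eta> I s. good \<eta> I s \<Longrightarrow> below (X \<eta>) s \<Longrightarrow> Q \<eta> s \<longleftrightarrow> P \<eta> I s"
  shows "linear good X P"
  unfolding linear_def using assms by blast

lemma linearE:
  assumes "linear good X P"
  obtains c Q where "\<forall>\<eta>. query (c * (\<eta> + 1)) (Q \<eta>)"
    "\<forall>\<eta> I s. good \<eta> I s \<longrightarrow> below (X \<eta>) s \<longrightarrow> (Q \<eta> s \<longleftrightarrow> P \<eta> I s)"
proof -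
  obtain c where "\<forall>\<eta>. \<exists>Q. query (c * (\<eta> + 1)) Q \<and>
     (\<forall>I s. good \<eta> I s \<longrightarrow> below (X \<eta>) s \<longrightarrow> (Q s \<longleftrightarrow> P \<eta> I s))"
    using assms unfolding linear_def by blast
  then obtain Q where "\<forall>\<eta>. query (c * (\<eta> + 1)) (Q \<eta>) \<and>
     (\<forall>I s. good \<eta> I s \<longrightarrow> below (X \<eta>) s \<longrightarrow> (Q \<eta> s \<longleftrightarrow> P \<eta> I s))"
    by metis
  then show ?thesis by (intro that[of c Q]) simp_all
qed

lemma linear_cong:
  assumes "linear good X P"
    "\<And>\<eta> I s. good' \<eta> I s \<Longrightarrow> below (Y \<eta>) s \<Longrightarrow>
      good \<eta> I s \<and> below (X \<eta>) s \<and> (P \<eta> I s \<longleftrightarrow> P' \<eta> I s)"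
  shows "linear good' Y P'"
proof -
  obtain c Q where QQ: "\<forall>\<eta>. query (c * (\<eta> + 1)) (Q \<eta>)"
    "\<forall>\<eta> I s. good \<eta> I s \<longrightarrow> below (X \<eta>) s \<longrightarrow> (Q \<eta> s \<longleftrightarrow> P \<eta> I s)"
    using assms(1) by (rule linearE)
  show ?thesis
  proof (rule linearI)
    show "query (c * (\<eta> + 1)) (Q \<eta>)" for \<eta> using QQ(1) by blast
    show "Q \<eta> s \<longleftrightarrow> P' \<eta> I s" if "good' \<eta> I s" "below (Y \<eta>) s" for \<eta> I s
    proof -
      note * = assms(2)[OF that]
      have "Q \<eta> s \<longleftrightarrow> P \<eta> I s" by (rule QQ(2)[rule_format]) (use * in simp_all)
      then show ?thesis using * by simp
    qed
  qed
qed

lemma linear_not: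
  assumes "linear good X P"
  shows "linear good X (\<lambda>\<eta> I s. \<not> P \<eta> I s)"
proof -
  obtain c Q where QQ: "\<forall>\<eta>. query (c * (\<eta> + 1)) (Q \<eta>)"
    "\<forall>\<eta> I s. good \<eta> I s \<longrightarrow> below (X \<eta>) s \<longrightarrow> (Q \<eta> s \<longleftrightarrow> P \<eta> I s)"
    using assms by (rule linearE)
  note Q = QQ(1)[rule_format] QQ(2)[rule_format]
  have "query ((c + 3) * (\<eta> + 1)) (\<lambda>s. \<not> Q \<eta> s)" for \<eta>
    by (rule query_mono[OF query_not[OF Q(1)[of \<eta>]]]) (simp add: algebra_simps)
  then show ?thesis by (rule linearI) (use Q(2) in simp)
qed

lemma linear_conj:
  assumes "linear good X P" "linear good X P'"
  shows "linear good X (\<lambda>\<eta> I s. P \<eta> I s \<and> P' \<eta> I s)"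
proof -
  obtain c Q where QQ: "\<forall>\<eta>. query (c * (\<eta> + 1)) (Q \<eta>)"
    "\<forall>\<eta> I s. good \<eta> I s \<longrightarrow> below (X \<eta>) s \<longrightarrow> (Q \<eta> s \<longleftrightarrow> P \<eta> I s)"
    using assms(1) by (rule linearE)
  note Q = QQ(1)[rule_format] QQ(2)[rule_format]
  obtain c' Q' where Q'': "\<forall>\<eta>. query (c' * (\<eta> + 1)) (Q' \<eta>)"
    "\<forall>\<eta> I s. good \<eta> I s \<longrightarrow> below (X \<eta>) s \<longrightarrow> (Q' \<eta> s \<longleftrightarrow> P' \<eta> I s)"
    using assms(2) by (rule linearE)
  note Q' = Q''(1)[rule_format] Q''(2)[rule_format]
  have "query ((c + c' + 6) * (\<eta> + 1)) (\<lambda>s. Q \<eta> s \<and> Q' \<eta> s)" for \<eta>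
  proof (rule query_mono[OF query_conj])
    show "query ((c + c') * (\<eta> + 1)) (Q \<eta>)" by (rule query_mono[OF Q(1)]) (simp add: algebra_simps)
    show "query ((c + c') * (\<eta> + 1)) (Q' \<eta>)" by (rule query_mono[OF Q'(1)]) (simp add: algebra_simps)
  qed (simp add: algebra_simps)
  then show ?thesis by (rule linearI) (use Q(2) Q'(2) in simp)
qed

lemma linear_disj:
  assumes "linear good X P" "linear good X P'"
  shows "linear good X (\<lambda>\<eta> I s. P \<eta> I s \<or> P' \<eta> I s)"
  using linear_not[OF linear_conj[OF linear_not[OF assms(1)] linear_not[OF assms(2)]]] by simp

lemma linear_imp:
  assumes "linear good X P" "linear good X P'"
  shows "linear good X (\<lambda>\<eta> I s. P \<eta> I s \<longrightarrow> P' \<eta> I s)"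
  using linear_not[OF linear_conj[OF assms(1) linear_not[OF assms(2)]]] by simp

lemma linear_eqv:
  assumes "linear good X P" "linear good X P'"
  shows "linear good X (\<lambda>\<eta> I s. P \<eta> I s \<longleftrightarrow> P' \<eta> I s)"
  using linear_conj[OF linear_imp[OF assms] linear_imp[OF assms(2,1)]]
  by (rule linear_cong) auto

lemma linear_ex:
  assumes "linear good (\<lambda>\<eta>. insert x (X \<eta>)) P" "upd_closed good" "20 \<le> x"
  shows "linear good X (\<lambda>\<eta> I s. \<exists>v<fst s 0. P \<eta> I ((fst s)(x := v), snd s))"
proof -
  obtain c Q where QQ: "\<forall>\<eta>. query (c * (\<eta> + 1)) (Q \<eta>)"
    "\<forall>\<eta> I s. good \<eta> I s \<longrightarrow> below (insert x (X \<eta>)) s \<longrightarrow> (Q \<eta> s \<longleftrightarrow> P \<eta> I s)"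
    using assms(1) by (rule linearE)
  note Q = QQ(1)[rule_format] QQ(2)[rule_format]
  have "query ((c + 11) * (\<eta> + 1)) (\<lambda>s. \<exists>v<fst s 0. Q \<eta> ((fst s)(x := v), snd s))" for \<eta>
    by (rule query_mono[OF query_ex[OF Q(1)[of \<eta>]]]) (use assms(3) in \<open>auto simp: algebra_simps\<close>)
  then show ?thesis
  proof (rule linearI)
    fix \<eta> I and s :: state
    assume g: "good \<eta> I s" "below (X \<eta>) s"
    have "Q \<eta> ((fst s)(x := v), snd s) \<longleftrightarrow> P \<eta> I ((fst s)(x := v), snd s)" if "v < fst s 0" for v
    proof (rule Q(2))
      show "good \<eta> I ((fst s)(x := v), snd s)"
        using assms(2,3) g(1) unfolding upd_closed_def by blast
    qed (use that g(2) assms(3) in \<open>auto simp: below_def\<close>)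
    then show "(\<exists>v<fst s 0. Q \<eta> ((fst s)(x := v), snd s)) \<longleftrightarrow>
      (\<exists>v<fst s 0. P \<eta> I ((fst s)(x := v), snd s))" by blast
  qed
qed

lemma linear_all:
  assumes "linear good (\<lambda>\<eta>. insert x (X \<eta>)) P" "upd_closed good" "20 \<le> x"
  shows "linear good X (\<lambda>\<eta> I s. \<forall>v<fst s 0. P \<eta> I ((fst s)(x := v), snd s))"
  using linear_not[OF linear_ex[OF linear_not[OF assms(1)] assms(2,3)]] by simp

lemma upd_closed_upds:
  "upd_closed good \<Longrightarrow> good \<eta> I s \<Longrightarrow> \<forall>x\<in>set xs. 20 \<le> x \<Longrightarrow> good \<eta> I (upds (fst s) xs t, snd s)"
proof (induction "fst s" xs t arbitrary: s rule: upds.induct)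
  case (1 x xs v vs)
  have "good \<eta> I ((fst s)(x := v), snd s)"
    using 1(2-4) unfolding upd_closed_def by simp
  then show ?case using 1(1)[of "((fst s)(x := v), snd s)"] 1(2,4) by simp
qed auto

lemma linear_ex_tuple:
  assumes "linear good (\<lambda>\<eta>. set (xs \<eta>) \<union> X \<eta>) P" "upd_closed good"
    "\<And>\<eta>. \<forall>x\<in>set (xs \<eta>). 20 \<le> x" "\<And>\<eta>. distinct (xs \<eta>)" "\<And>\<eta>. length (xs \<eta>) \<le> k * (\<eta> + 1)"
  shows "linear good X
    (\<lambda>\<eta> I s. \<exists>t\<in>tuples (fst s 0) (length (xs \<eta>)). P \<eta> I (upds (fst s) (xs \<eta>) t, snd s))"
proof -
  obtain c Q where QQ: "\<forall>\<eta>. query (c * (\<eta> + 1)) (Q \<eta>)"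
    "\<forall>\<eta> I s. good \<eta> I s \<longrightarrow> below (set (xs \<eta>) \<union> X \<eta>) s \<longrightarrow> (Q \<eta> s \<longleftrightarrow> P \<eta> I s)"
    using assms(1) by (rule linearE)
  note Q = QQ(1)[rule_format] QQ(2)[rule_format]
  have "query ((c + 11 * k) * (\<eta> + 1))
      (\<lambda>s. \<exists>t\<in>tuples (fst s 0) (length (xs \<eta>)). Q \<eta> (upds (fst s) (xs \<eta>) t, snd s))" for \<eta>
  proof (rule query_mono[OF query_ex_tuple[OF Q(1)[of \<eta>]]])
    show "0 \<notin> set (xs \<eta>)" using assms(3) by force
    show "c * (\<eta> + 1) + 11 * length (xs \<eta>) \<le> (c + 11 * k) * (\<eta> + 1)"
      using assms(5)[of \<eta>] by (simp add: algebra_simps)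
  qed
  then show ?thesis
  proof (rule linearI)
    fix \<eta> I and s :: state
    assume g: "good \<eta> I s" "below (X \<eta>) s"
    have "Q \<eta> (upds (fst s) (xs \<eta>) t, snd s) \<longleftrightarrow> P \<eta> I (upds (fst s) (xs \<eta>) t, snd s)"
      if t: "t \<in> tuples (fst s 0) (length (xs \<eta>))" for t
    proof (rule Q(2))
      show "good \<eta> I (upds (fst s) (xs \<eta>) t, snd s)" by (rule upd_closed_upds[OF assms(2) g(1) assms(3)])
      have "0 \<notin> set (xs \<eta>)" using assms(3) by force
      then have n: "upds (fst s) (xs \<eta>) t 0 = fst s 0" by simp
      have "upds (fst s) (xs \<eta>) t x < fst s 0" if x: "x \<in> set (xs \<eta>)" for x
      proof -
        have "upds (fst s) (xs \<eta>) t x \<in> set (map (upds (fst s) (xs \<eta>) t) (xs \<eta>))" using x by simp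
        also have "map (upds (fst s) (xs \<eta>) t) (xs \<eta>) = t"
          by (rule map_upds) (use assms(4) t in \<open>auto simp: tuples_def\<close>)
        finally show ?thesis using t by (auto simp: tuples_def)
      qed
      moreover have "upds (fst s) (xs \<eta>) t x < fst s 0" if "x \<in> X \<eta>" "x \<notin> set (xs \<eta>)" for x
        using g(2) that by (simp add: below_def)
      ultimately show "below (set (xs \<eta>) \<union> X \<eta>) (upds (fst s) (xs \<eta>) t, snd s)"
        unfolding below_def fst_conv n by blast
    qed
    then show "(\<exists>t\<in>tuples (fst s 0) (length (xs \<eta>)). Q \<eta> (upds (fst s) (xs \<eta>) t, snd s)) \<longleftrightarrow>
      (\<exists>t\<in>tuples (fst s 0) (length (xs \<eta>)). P \<eta> I (upds (fst s) (xs \<eta>) t, snd s))" by blast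
  qed
qed

lemma linear_lookup:
  assumes "\<And>\<eta>. 0 \<notin> set (xs \<eta>)" "\<And>\<eta>. 1 \<notin> set (xs \<eta>)" "\<And>\<eta>. length (xs \<eta>) \<le> k * (\<eta> + 1)"
  shows "linear good X (\<lambda>\<eta> I s. lookup b (xs \<eta>) s)"
proof (rule linearI)
  show "query ((11 + 8 * k) * (\<eta> + 1)) (lookup b (xs \<eta>))" for \<eta>
  proof (rule query_mono[OF query_lookup[OF assms(2,1)]])
    show "11 + 8 * length (xs \<eta>) \<le> (11 + 8 * k) * (\<eta> + 1)"
      using assms(3)[of \<eta>] by (simp add: algebra_simps)
  qed
qed simp

lemma linear_eq: "linear good X (\<lambda>\<eta> I s. fst s (x \<eta>) = fst s (y \<eta>))"
proof (rule linearI)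
  show "query (10 * (\<eta> + 1)) (\<lambda>s. fst s (x \<eta>) = fst s (y \<eta>))" for \<eta>
    by (rule query_mono[OF query_eq[OF computes_var computes_var]]) simp
qed simp

lemma linear_var_in:
  assumes "\<And>\<eta>. length (xs \<eta>) \<le> k * (\<eta> + 1)"
  shows "linear good X (\<lambda>\<eta> I s. fst s (x \<eta>) \<in> fst s ` set (xs \<eta>))"
proof (rule linearI)
  show "query ((22 + 12 * k) * (\<eta> + 1)) (\<lambda>s. fst s (x \<eta>) \<in> fst s ` set (xs \<eta>))" for \<eta>
    by (rule query_mono[OF query_var_in]) (use assms[of \<eta>] in \<open>simp add: algebra_simps\<close>)
qed simp

lemma linear_code_less:
  assumes "\<And>\<eta>. 0 \<notin> set (xs \<eta>)" "\<And>\<eta>. 1 \<notin> set (xs \<eta>)" "\<And>\<eta>. length (xs \<eta>) \<le> k * (\<eta> + 1)"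
    "\<And>\<eta>. 0 \<notin> set (ys \<eta>)" "\<And>\<eta>. 1 \<notin> set (ys \<eta>)" "\<And>\<eta>. length (ys \<eta>) \<le> k * (\<eta> + 1)"
  shows "linear good X (\<lambda>\<eta> I s. code (fst s 0) (map (fst s) (xs \<eta>)) < code (fst s 0) (map (fst s) (ys \<eta>)))"
proof (rule linearI)
  show "query ((10 + 8 * k) * (\<eta> + 1))
    (\<lambda>s. code (fst s 0) (map (fst s) (xs \<eta>)) < code (fst s 0) (map (fst s) (ys \<eta>)))" for \<eta>
  proof (rule query_mono[OF query_less[where d = "1 + 8 * (k * (\<eta> + 1))"]])
    show "computes (1 + 8 * (k * (\<eta> + 1))) (\<lambda>s. code (fst s 0) (map (fst s) (xs \<eta>)))"
      by (rule computes_mono[OF computes_code[OF assms(2,1)]]) (use assms(3)[of \<eta>] in simp)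
    show "computes (1 + 8 * (k * (\<eta> + 1))) (\<lambda>s. code (fst s 0) (map (fst s) (ys \<eta>)))"
      by (rule computes_mono[OF computes_code[OF assms(5,4)]]) (use assms(6)[of \<eta>] in simp)
  qed (simp add: algebra_simps)
qed simp

section \<open>Encoding vertex sets by tuples\<close>

text \<open>The first two entries of a tuple tell whether it encodes the empty set.\<close>

definition sset :: "nat list \<Rightarrow> nat set" where
  "sset t = (if t ! 0 = t ! 1 then set (drop 2 t) else {})"

text \<open>Repeating the last entry keeps both flags and the encoded set. Hence a tuple for a small
  separator can be used as an index into a table made for larger ones.\<close>

definition pad :: "nat \<Rightarrow> 'c list \<Rightarrow> 'c list" where
  "pad q t = t @ replicate (q - length t) (last t)"

lemma length_pad: "length t \<le> q \<Longrightarrow> length (pad q t) = q"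
  by (simp add: pad_def)

lemma map_pad: "t \<noteq> [] \<Longrightarrow> map f (pad q t) = pad q (map f t)"
  by (simp add: pad_def last_map)

lemma set_pad: "t \<noteq> [] \<Longrightarrow> set (pad q t) = set t"
  by (auto simp: pad_def)

lemma sset_pad:
  assumes "3 \<le> length t"
  shows "sset (pad q t) = sset t"
proof -
  have "t ! 0 = pad q t ! 0" "t ! 1 = pad q t ! 1"
  proof -
    have "0 < length t" "1 < length t" using assms by linarith+
    then show "t ! 0 = pad q t ! 0" "t ! 1 = pad q t ! 1"
      unfolding pad_def by (simp_all only: nth_append if_True)
  qed
  moreover have "last t \<in> set (drop 2 t)"
  proof -
    have "drop 2 t \<noteq> []" "last (drop 2 t) = last t" using assms by (simp_all add: last_drop)
    then show ?thesis using last_in_set[of "drop 2 t"] by simp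
  qed
  then have "set (drop 2 (pad q t)) = set (drop 2 t)" using assms by (auto simp: pad_def)
  ultimately show ?thesis by (simp add: sset_def)
qed

lemma sset_sub: "t \<in> tuples n a \<Longrightarrow> sset t \<subseteq> {..<n}"
  using set_drop_subset[of 2 t] by (auto simp: sset_def tuples_def)

lemma card_sset: "t \<in> tuples n (p + 2) \<Longrightarrow> card (sset t) \<le> p"
  using card_length[of "drop 2 t"] by (auto simp: sset_def tuples_def)

lemma ex_sset:
  assumes "A \<subseteq> {..<n}" "card A \<le> p" "2 \<le> n"
  shows "\<exists>t\<in>tuples n (p + 2). sset t = A"
proof (cases "A = {}")
  case True
  \<comment> \<open>The unequal flags \<open>0\<close> and \<open>1\<close> mark the empty set; they
    are available because \<open>2 \<le> n\<close>.\<close>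
  then show ?thesis using assms(3)
    by (intro bexI[of _ "0 # 1 # replicate p 0"]) (auto simp: tuples_def sset_def)
next
  case False
  have "finite A" using assms(1) finite_subset by blast
  then obtain l where l: "set l = A" "distinct l" using finite_distinct_list by blast
  then have len: "length l \<le> p" "l \<noteq> []" using assms(2) False distinct_card by fastforce+
  then show ?thesis using assms l
    by (intro bexI[of _ "0 # 0 # pad p l"]) (auto simp: tuples_def sset_def set_pad length_pad)
qed

section \<open>The relations to be computed\<close>

locale listed_graph = graph_treewidth G for G :: "('a, 'b) pre_digraph" +
  fixes vs :: "'a list"
  assumes distinct_vs: "distinct vs" and set_vs: "set vs = verts G" and two_vertices: "2 \<le> length vs"
begin

abbreviation n :: nat where "n \<equiv> length vs"

abbreviation adj :: "nat \<Rightarrow> nat \<Rightarrow> bool" where "adj i k \<equiv> vs ! i \<rightarrow>\<^bsub>G\<^esub> vs ! k"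

definition S :: "nat list \<Rightarrow> 'a set" where
  "S t = (!) vs ` sset t"

definition reach :: "nat list \<Rightarrow> nat \<Rightarrow> nat \<Rightarrow> bool" where
  "reach t u v \<longleftrightarrow> u \<notin> sset t \<and> vs ! v \<in> comp (S t) (vs ! u)"

definition wins :: "nat \<Rightarrow> nat list \<Rightarrow> nat \<Rightarrow> bool" where
  "wins p t v \<longleftrightarrow> v \<notin> sset t \<and> win p (comp (S t) (vs ! v))"

definition reach_table :: "nat \<Rightarrow> nat list set" where
  "reach_table K = {t \<in> tuples n (K + 4). reach (take (K + 2) t) (t ! (K + 2)) (t ! (K + 3))}"

definition win_table :: "nat \<Rightarrow> nat list set" where
  "win_table p = {t \<in> tuples n (p + 3). wins p (take (p + 2) t) (t ! (p + 2))}"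

definition reach_step :: "nat \<Rightarrow> nat list set \<Rightarrow> nat list \<Rightarrow> bool" where
  "reach_step K T t \<longleftrightarrow> (let s = take (K + 2) t; u = t ! (K + 2); v = t ! (K + 3) in
     u \<notin> sset s \<and> v \<notin> sset s \<and> (u = v \<or> (\<exists>w<n. s @ [u, w] \<in> T \<and> adj w v)))"

text \<open>One unfolding of \<open>win\<close>, with components given by a coded separator and a
  vertex. The first condition says that the new guards cover the neighborhood of the component,
  expressed through \<open>reach\<close>, whose table is computed beforehand.\<close>

definition win_step :: "nat \<Rightarrow> nat list set \<Rightarrow> nat list \<Rightarrow> bool" where
  "win_step p T t \<longleftrightarrow> (let s = take (p + 2) t; v = t ! (p + 2) in
     v \<notin> sset s \<and> (\<exists>s'\<in>tuples n (p + 2).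
       (\<forall>x<n. \<forall>y<n. reach s v x \<and> adj x y \<and> \<not> reach s v y \<longrightarrow> y \<in> sset s') \<and>
       (\<forall>u<n. reach s v u \<and> u \<notin> sset s' \<longrightarrow> s' @ [u] \<in> T)))"

lemma add_2_2: "a + 2 + 2 = a + (4 :: nat)" and add_2_1: "a + 2 + 1 = a + (3 :: nat)"
  by simp_all

lemma vs_V: "i < n \<Longrightarrow> vs ! i \<in> verts G"
  using set_vs nth_mem by blast

lemma ex_index: "x \<in> verts G \<Longrightarrow> \<exists>i<n. vs ! i = x"
  using set_vs by (metis in_set_conv_nth)

lemma vs_inj: "i < n \<Longrightarrow> k < n \<Longrightarrow> vs ! i = vs ! k \<longleftrightarrow> i = k"
  using distinct_vs by (simp add: nth_eq_iff_index_eq)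

lemma in_S: "t \<in> tuples n a \<Longrightarrow> i < n \<Longrightarrow> vs ! i \<in> S t \<longleftrightarrow> i \<in> sset t"
  using sset_sub[of t n a] vs_inj unfolding S_def by blast

lemma S_V: "t \<in> tuples n a \<Longrightarrow> S t \<subseteq> verts G"
  using sset_sub[of t n a] vs_V unfolding S_def by blast

lemma card_S: "t \<in> tuples n (p + 2) \<Longrightarrow> card (S t) \<le> p"
proof -
  assume t: "t \<in> tuples n (p + 2)"
  have "finite (sset t)" using sset_sub[OF t] by (rule finite_subset) simp
  then have "card (S t) \<le> card (sset t)" unfolding S_def by (rule card_image_le)
  also have "\<dots> \<le> p" by (rule card_sset[OF t])
  finally show ?thesis .
qed

lemma ex_S:
  assumes "A \<subseteq> verts G" "card A \<le> p"
  shows "\<exists>t\<in>tuples n (p + 2). S t = A"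
proof -
  define I where "I = {i. i < n \<and> vs ! i \<in> A}"
  have im: "(!) vs ` I = A" using ex_index assms(1) by (fastforce simp: I_def)
  have "inj_on ((!) vs) I" using vs_inj by (auto simp: I_def inj_on_def)
  then have "card I = card A" using im card_image by metis
  then obtain t where "t \<in> tuples n (p + 2)" "sset t = I"
    using ex_sset[of I n p] assms(2) two_vertices by (auto simp: I_def)
  then show ?thesis using im by (auto simp: S_def)
qed

lemma not_S: "t \<in> tuples n a \<Longrightarrow> v < n \<Longrightarrow> v \<notin> sset t \<Longrightarrow> vs ! v \<in> verts G - S t"
  using in_S vs_V by simp

lemma comp_reach:
  assumes "t \<in> tuples n a" "v < n" "v \<notin> sset t"
  shows "comp (S t) (vs ! v) = (!) vs ` {x. x < n \<and> reach t v x}"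
proof -
  have "comp (S t) (vs ! v) \<subseteq> verts G" using comp_sub[OF not_S[OF assms]] by auto
  then show ?thesis using ex_index assms(3) by (fastforce simp: reach_def)
qed

lemma split_tuple1:
  assumes "t \<in> tuples n (a + 1)"
  obtains s v where "t = s @ [v]" "s \<in> tuples n a" "v < n"
  using assms by (cases t rule: rev_cases) (auto simp: tuples_def)

lemma split_tuple2:
  assumes "t \<in> tuples n (a + 2)"
  obtains s u v where "t = s @ [u, v]" "s \<in> tuples n a" "u < n" "v < n"
proof -
  obtain t' v where 1: "t = t' @ [v]" "t' \<in> tuples n (a + 1)" "v < n"
    using split_tuple1[of t "a + 1"] assms by auto
  obtain s u where "t' = s @ [u]" "s \<in> tuples n a" "u < n"
    using split_tuple1[OF 1(2)] by blast
  then show ?thesis using that 1 by simp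
qed

lemma reach_table_snoc:
  "s \<in> tuples n (K + 2) \<Longrightarrow> u < n \<Longrightarrow> v < n \<Longrightarrow> s @ [u, v] \<in> reach_table K \<longleftrightarrow> reach s u v"
  by (auto simp: reach_table_def tuples_def nth_append)

lemma reach_step_snoc:
  "s \<in> tuples n (K + 2) \<Longrightarrow> reach_step K T (s @ [u, v]) \<longleftrightarrow>
    u \<notin> sset s \<and> v \<notin> sset s \<and> (u = v \<or> (\<exists>w<n. s @ [u, w] \<in> T \<and> adj w v))"
  by (simp add: reach_step_def tuples_def nth_append)

lemma win_table_snoc:
  "s \<in> tuples n (p + 2) \<Longrightarrow> v < n \<Longrightarrow> s @ [v] \<in> win_table p \<longleftrightarrow> wins p s v"
  by (auto simp: win_table_def tuples_def nth_append)

lemma win_step_snoc: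
  "s \<in> tuples n (p + 2) \<Longrightarrow> win_step p T (s @ [v]) \<longleftrightarrow> v \<notin> sset s \<and> (\<exists>s'\<in>tuples n (p + 2).
       (\<forall>x<n. \<forall>y<n. reach s v x \<and> adj x y \<and> \<not> reach s v y \<longrightarrow> y \<in> sset s') \<and>
       (\<forall>u<n. reach s v u \<and> u \<notin> sset s' \<longrightarrow> s' @ [u] \<in> T))"
  by (simp add: win_step_def tuples_def nth_append)

lemma reach_sound:
  assumes T: "T \<subseteq> reach_table K" and t: "t \<in> tuples n (K + 4)" and step: "reach_step K T t"
  shows "t \<in> reach_table K"
proof -
  have "t \<in> tuples n (K + 2 + 2)" using t by (simp only: add_2_2)
  then obtain s u v where s: "t = s @ [u, v]" "s \<in> tuples n (K + 2)" "u < n" "v < n"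
    by (rule split_tuple2)
  have step': "u \<notin> sset s" "v \<notin> sset s" "u = v \<or> (\<exists>w<n. s @ [u, w] \<in> T \<and> adj w v)"
    using step reach_step_snoc[OF s(2)] s(1) by auto
  have uV: "vs ! u \<in> verts G - S s" using not_S s step' by blast
  have "vs ! v \<in> comp (S s) (vs ! u)"
  proof (cases "u = v")
    case True
    then show ?thesis using comp_in by simp
  next
    case False
    then obtain w where w: "w < n" "s @ [u, w] \<in> T" "adj w v" using step' by auto
    then have "vs ! w \<in> comp (S s) (vs ! u)"
      using T reach_table_snoc[OF s(2,3) w(1)] by (auto simp: reach_def)
    moreover from this have "vs ! w \<in> verts G - S s" using comp_sub[OF uV] by auto
    moreover have "vs ! v \<notin> S s" using in_S[OF s(2,4)] step' by simp
    ultimately show ?thesis using w(3) comp_closed by blast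
  qed
  then show ?thesis using reach_table_snoc[OF s(2-4)] s(1) step' by (simp add: reach_def)
qed

lemma reach_complete:
  assumes closed: "\<And>t. t \<in> tuples n (K + 4) \<Longrightarrow> reach_step K T t \<Longrightarrow> t \<in> T"
  shows "reach_table K \<subseteq> T"
proof
  fix t assume t: "t \<in> reach_table K"
  then have "t \<in> tuples n (K + 2 + 2)" unfolding reach_table_def add_2_2 by simp
  then obtain s u v where s: "t = s @ [u, v]" "s \<in> tuples n (K + 2)" "u < n" "v < n"
    by (rule split_tuple2)
  have r: "u \<notin> sset s" "vs ! v \<in> comp (S s) (vs ! u)"
    using t reach_table_snoc[OF s(2-4)] s(1) by (auto simp: reach_def)
  have tup: "s @ [u, v] \<in> tuples n (K + 4)" if "v < n" for v
    using s that by (auto simp: tuples_def)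
  have "\<forall>v<n. vs ! v = z \<longrightarrow> s @ [u, v] \<in> T" if "(rE (verts G - S s))\<^sup>*\<^sup>* (vs ! u) z" for z
    using that
  proof (induction rule: rtranclp_induct)
    case base
    show ?case
    proof (intro allI impI)
      fix v assume v: "v < n" "vs ! v = vs ! u"
      then have "v = u" using vs_inj s by simp
      then show "s @ [u, v] \<in> T"
        by (intro closed[OF tup[OF v(1)]]) (use r in \<open>simp add: reach_step_snoc[OF s(2)]\<close>)
    qed
  next
    case (step y z)
    show ?case
    proof (intro allI impI)
      fix v assume v: "v < n" "vs ! v = z"
      have yz: "y \<rightarrow>\<^bsub>G\<^esub> z" "z \<notin> S s" "y \<in> verts G" using step.hyps(2) by (auto simp: rE_def)
      obtain w where w: "w < n" "vs ! w = y" using ex_index[OF yz(3)] by blast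
      then have "s @ [u, w] \<in> T" using step.IH by blast
      moreover have "v \<notin> sset s" using in_S[OF s(2) v(1)] yz v by simp
      ultimately show "s @ [u, v] \<in> T"
        using r w yz v by (intro closed[OF tup[OF v(1)]]) (auto simp: reach_step_snoc[OF s(2)])
    qed
  qed
  then show "t \<in> T" using r(2) s by (simp add: comp_def)
qed

lemma nb_reach:
  assumes s: "s \<in> tuples n a" "v < n" "v \<notin> sset s" and s': "s' \<in> tuples n b"
  shows "(\<forall>x<n. \<forall>y<n. reach s v x \<and> adj x y \<and> \<not> reach s v y \<longrightarrow> y \<in> sset s') \<longleftrightarrow>
    nb (comp (S s) (vs ! v)) \<subseteq> S s'"
proof
  assume L: "\<forall>x<n. \<forall>y<n. reach s v x \<and> adj x y \<and> \<not> reach s v y \<longrightarrow> y \<in> sset s'"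
  show "nb (comp (S s) (vs ! v)) \<subseteq> S s'"
  proof
    fix z assume z: "z \<in> nb (comp (S s) (vs ! v))"
    then obtain x' where x': "x' \<in> comp (S s) (vs ! v)" "x' \<rightarrow>\<^bsub>G\<^esub> z" "z \<notin> comp (S s) (vs ! v)"
      by (auto simp: nb_def)
    obtain x y where "x < n" "vs ! x = x'" "y < n" "vs ! y = z"
      using ex_index E_V[OF x'(2)] by metis
    then show "z \<in> S s'" using L x' s(3) in_S[OF s', of y] by (auto simp: reach_def)
  qed
next
  assume R: "nb (comp (S s) (vs ! v)) \<subseteq> S s'"
  show "\<forall>x<n. \<forall>y<n. reach s v x \<and> adj x y \<and> \<not> reach s v y \<longrightarrow> y \<in> sset s'"
  proof (intro allI impI)
    fix x y assume xy: "x < n" "y < n" "reach s v x \<and> adj x y \<and> \<not> reach s v y"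
    then have "vs ! y \<in> nb (comp (S s) (vs ! v))" using s(3) by (auto simp: reach_def nb_def)
    then show "y \<in> sset s'" using R in_S[OF s' xy(2)] by auto
  qed
qed

lemma win_sound:
  assumes T: "T \<subseteq> win_table p" and t: "t \<in> tuples n (p + 3)" and step: "win_step p T t"
  shows "t \<in> win_table p"
proof -
  have "t \<in> tuples n (p + 2 + 1)" using t by (simp only: add_2_1)
  then obtain s v where s: "t = s @ [v]" "s \<in> tuples n (p + 2)" "v < n"
    by (rule split_tuple1)
  obtain s' where v: "v \<notin> sset s" and s': "s' \<in> tuples n (p + 2)"
    "\<forall>x<n. \<forall>y<n. reach s v x \<and> adj x y \<and> \<not> reach s v y \<longrightarrow> y \<in> sset s'"
    "\<forall>u<n. reach s v u \<and> u \<notin> sset s' \<longrightarrow> s' @ [u] \<in> T"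
    using step win_step_snoc[OF s(2)] s(1) by auto
  define C where "C = comp (S s) (vs ! v)"
  have CV: "C \<subseteq> verts G" using comp_sub[OF not_S[OF s(2,3) v]] by (auto simp: C_def)
  have "win p C"
  proof (rule win.intros[of C "S s'"])
    show "nb C \<subseteq> S s'" using nb_reach[OF s(2,3) v s'(1)] s'(2) by (simp add: C_def)
    show "S s' \<subseteq> verts G" by (rule S_V[OF s'(1)])
    show "card (S s') \<le> p" by (rule card_S[OF s'(1)])
    fix z assume z: "z \<in> C - S s'"
    then obtain u where u: "u < n" "vs ! u = z" using CV ex_index by blast
    then have "reach s v u" "u \<notin> sset s'" using z v in_S[OF s'(1) u(1)] by (auto simp: reach_def C_def)
    then have "s' @ [u] \<in> win_table p" using s'(3) u T by blast
    then show "win p (comp (S s') z)" using win_table_snoc[OF s'(1) u(1)] u by (simp add: wins_def)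
  qed (rule CV)
  then show ?thesis using win_table_snoc[OF s(2,3)] s(1) v by (simp add: wins_def C_def)
qed

text \<open>Induction on the derivation of \<open>win\<close>, generalized over \<open>s\<close> and
  \<open>v\<close>: in the recursion a component is presented by the tuple that codes the guards
  just placed.\<close>

lemma win_complete:
  assumes closed: "\<And>t. t \<in> tuples n (p + 3) \<Longrightarrow> win_step p T t \<Longrightarrow> t \<in> T"
  shows "win_table p \<subseteq> T"
proof
  have "s @ [v] \<in> T" if "win p C" "C = comp (S s) (vs ! v)" "s \<in> tuples n (p + 2)" "v < n" "v \<notin> sset s" for C s v
    using that
  proof (induction arbitrary: s v rule: win.induct)
    case (win C A)
    obtain s' where s': "s' \<in> tuples n (p + 2)" "S s' = A" using ex_S[of A p] win.hyps by blast
    show ?case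
    proof (rule closed)
      show "s @ [v] \<in> tuples n (p + 3)" using win.prems by (auto simp: tuples_def)
      have "\<forall>x<n. \<forall>y<n. reach s v x \<and> adj x y \<and> \<not> reach s v y \<longrightarrow> y \<in> sset s'"
        using nb_reach[OF win.prems(2-4) s'(1)] win.hyps(1) win.prems(1) s'(2) by simp
      moreover have "s' @ [u] \<in> T" if u: "u < n" "reach s v u \<and> u \<notin> sset s'" for u
      proof (rule win.IH[OF _ _ s'(1) u(1)])
        show "vs ! u \<in> C - A" using u win.prems(1) s'(2) in_S[OF s'(1) u(1)] by (auto simp: reach_def)
        show "comp A (vs ! u) = comp (S s') (vs ! u)" using s'(2) by simp
      qed (use u in simp)
      ultimately show "win_step p T (s @ [v])"
        unfolding win_step_snoc[OF win.prems(2)] using s'(1) win.prems(4) by blast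
    qed
  qed
  note * = this
  fix t assume t: "t \<in> win_table p"
  then have "t \<in> tuples n (p + 2 + 1)" unfolding win_table_def add_2_1 by simp
  then obtain s v where s: "t = s @ [v]" "s \<in> tuples n (p + 2)" "v < n"
    by (rule split_tuple1)
  then have "wins p s v" using t win_table_snoc by blast
  then show "t \<in> T" using *[of "comp (S s) (vs ! v)" s v] s by (simp add: wins_def)
qed

subsection \<open>The family\<close>

text \<open>Each vertex of the separator sees the component of \<open>v\<close>. As the neighborhood
  of a component is contained in the separator anyway, this makes the two equal.\<close>

definition side :: "nat list \<Rightarrow> nat \<Rightarrow> bool" where
  "side t v \<longleftrightarrow> (\<forall>y<n. y \<in> sset t \<longrightarrow> (\<exists>x<n. reach t v x \<and> adj x y))"

definition bad_code :: "nat \<Rightarrow> nat list \<Rightarrow> nat \<Rightarrow> bool" where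
  "bad_code \<eta> t v \<longleftrightarrow> side t v \<and> wins (5 * \<eta> + 5) t v \<and> \<not> wins (3 * \<eta> + 3) t v"

definition small_code :: "nat \<Rightarrow> nat list \<Rightarrow> nat \<Rightarrow> bool" where
  "small_code \<eta> t v \<longleftrightarrow> side t v \<and> wins (3 * \<eta> + 3) t v"

text \<open>Only codes with the same vertex \<open>v\<close> have to compete, since every larger
  small set still contains \<open>v\<close>.\<close>

definition max_code :: "nat \<Rightarrow> nat list \<Rightarrow> nat \<Rightarrow> bool" where
  "max_code \<eta> t v \<longleftrightarrow> small_code \<eta> t v \<and> \<not> (\<exists>t'\<in>tuples n (2 * \<eta> + 4). small_code \<eta> t' v \<and>
     (\<exists>u<n. reach t' v u \<and> \<not> reach t v u) \<and> (\<forall>u<n. reach t v u \<longrightarrow> reach t' v u))"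

definition low :: "nat \<Rightarrow> nat \<Rightarrow> bool" where
  "low \<eta> u \<longleftrightarrow> (\<exists>t\<in>tuples n (2 * \<eta> + 4). small_code \<eta> t u)"

definition any_bad :: "nat \<Rightarrow> bool" where
  "any_bad \<eta> \<longleftrightarrow> (\<exists>t\<in>tuples n (2 * \<eta> + 4). \<exists>v<n. bad_code \<eta> t v)"

text \<open>If nothing is bad, \<open>f = g\<close> announces a filled neighborhood and
  \<open>f \<noteq> g\<close> an edge. The two uses cannot clash because a vertex is not adjacent to
  itself.\<close>

definition valid_code :: "nat \<Rightarrow> nat list \<Rightarrow> nat \<Rightarrow> nat \<Rightarrow> nat \<Rightarrow> bool" where
  "valid_code \<eta> t v f g \<longleftrightarrow> any_bad \<eta> \<and> bad_code \<eta> t v \<or>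
     \<not> any_bad \<eta> \<and> (f = g \<and> max_code \<eta> t v \<or> adj f g \<and> \<not> low \<eta> f \<and> \<not> low \<eta> g)"

text \<open>For a filled neighborhood, \<open>max_code \<eta> t x\<close> expresses that
  \<open>x\<close> itself lies in a maximal small set whose neighborhood is the one coded by
  \<open>t\<close>; so all these sets are collected at once.\<close>

definition member_code :: "nat \<Rightarrow> nat list \<Rightarrow> nat \<Rightarrow> nat \<Rightarrow> nat \<Rightarrow> nat \<Rightarrow> bool" where
  "member_code \<eta> t v f g x \<longleftrightarrow> any_bad \<eta> \<and> (reach t v x \<or> x \<in> sset t) \<or>
     \<not> any_bad \<eta> \<and> (f = g \<and> (x \<in> sset t \<or> max_code \<eta> t x) \<or> f \<noteq> g \<and> (x = f \<or> x = g))"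

lemma side_iff:
  assumes t: "t \<in> tuples n a" "v < n" "v \<notin> sset t"
  shows "side t v \<longleftrightarrow> nb (comp (S t) (vs ! v)) = S t"
proof
  define C where "C = comp (S t) (vs ! v)"
  have nbC: "nb C \<subseteq> S t" and CS: "C \<inter> S t = {}"
    unfolding C_def using comp_nb[OF not_S[OF t]] comp_sub[OF not_S[OF t]] by auto
  {
    assume L: "side t v"
    have "S t \<subseteq> nb C"
    proof
      fix z assume z: "z \<in> S t"
      then obtain y where y: "y < n" "vs ! y = z" using S_V[OF t(1)] ex_index by blast
      then have "y \<in> sset t" using in_S[OF t(1) y(1)] z by simp
      then obtain x where "x < n" "reach t v x" "adj x y" using L y by (auto simp: side_def)
      then show "z \<in> nb C" using z CS y by (auto simp: nb_def reach_def C_def)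
    qed
    then show "nb (comp (S t) (vs ! v)) = S t" using nbC unfolding C_def by blast
  }
  {
    assume R: "nb (comp (S t) (vs ! v)) = S t"
    show "side t v"
      unfolding side_def
    proof (intro allI impI)
      fix y assume y: "y < n" "y \<in> sset t"
      then have "vs ! y \<in> nb C" using R in_S[OF t(1)] by (simp add: C_def)
      then obtain x' where x': "x' \<in> C" "x' \<rightarrow>\<^bsub>G\<^esub> vs ! y" by (auto simp: nb_def)
      obtain x where "x < n" "vs ! x = x'" using ex_index E_V[OF x'(2)] by blast
      then show "\<exists>x<n. reach t v x \<and> adj x y" using x' t(3) by (auto simp: reach_def C_def)
    qed
  }
qed

lemma code_iff:
  assumes t: "t \<in> tuples n (2 * \<eta> + 4)" "v < n"
  shows "bad_code \<eta> t v \<longleftrightarrow> v \<notin> sset t \<and> bad \<eta> (comp (S t) (vs ! v)) \<and> nb (comp (S t) (vs ! v)) = S t"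
    and "small_code \<eta> t v \<longleftrightarrow> v \<notin> sset t \<and> small \<eta> (comp (S t) (vs ! v)) \<and> nb (comp (S t) (vs ! v)) = S t"
proof -
  have "card (S t) \<le> 2 * \<eta> + 2" using card_S[of t "2 * \<eta> + 2"] t by (simp only: add_2_2)
  then have *: "v \<notin> sset t \<longrightarrow> conn (comp (S t) (vs ! v)) \<and> (nb (comp (S t) (vs ! v)) = S t \<longrightarrow>
      card (nb (comp (S t) (vs ! v))) \<le> 2 * \<eta> + 2)"
    using comp_conn[OF not_S[OF t]] by simp
  show "bad_code \<eta> t v \<longleftrightarrow> v \<notin> sset t \<and> bad \<eta> (comp (S t) (vs ! v)) \<and> nb (comp (S t) (vs ! v)) = S t"
    using side_iff[OF t] * by (cases "v \<in> sset t") (auto simp: bad_code_def bad_def wins_def)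
  show "small_code \<eta> t v \<longleftrightarrow> v \<notin> sset t \<and> small \<eta> (comp (S t) (vs ! v)) \<and> nb (comp (S t) (vs ! v)) = S t"
    using side_iff[OF t] * by (cases "v \<in> sset t") (auto simp: small_code_def small_def wins_def)
qed

lemma ex_code:
  assumes C: "conn C" "card (nb C) \<le> 2 * \<eta> + 2" and v: "v < n" "vs ! v \<in> C"
  shows "\<exists>t\<in>tuples n (2 * \<eta> + 4). v \<notin> sset t \<and> comp (S t) (vs ! v) = C \<and> nb C = S t"
proof -
  obtain t where t: "t \<in> tuples n (2 * \<eta> + 2 + 2)" "S t = nb C"
    using ex_S[OF nb_V C(2)] by blast
  then have t': "t \<in> tuples n (2 * \<eta> + 4)" by (simp only: add_2_2)
  have "C \<inter> S t = {}" using t(2) by (auto simp: nb_def)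
  then have "v \<notin> sset t" using in_S[OF t' v(1)] v(2) by auto
  moreover have "comp (S t) (vs ! v) = C"
    using comp_eq[OF C(1) \<open>C \<inter> S t = {}\<close> v(2)] t(2) by simp
  ultimately show ?thesis using t' t(2) by blast
qed

lemma comp_subset_reach:
  assumes "t \<in> tuples n a" "v < n" "v \<notin> sset t" "v \<notin> sset t'"
  shows "(\<forall>u<n. reach t v u \<longrightarrow> reach t' v u) \<longleftrightarrow> comp (S t) (vs ! v) \<subseteq> comp (S t') (vs ! v)"
  unfolding comp_reach[OF assms(1-3)] using assms(4) by (auto simp: reach_def)

lemma max_code_iff:
  assumes t: "t \<in> tuples n (2 * \<eta> + 4)" "v < n"
  shows "max_code \<eta> t v \<longleftrightarrow> v \<notin> sset t \<and> maximal_small \<eta> (comp (S t) (vs ! v)) \<and>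
    nb (comp (S t) (vs ! v)) = S t"
proof -
  define C where "C = comp (S t) (vs ! v)"
  have "(\<exists>t'\<in>tuples n (2 * \<eta> + 4). small_code \<eta> t' v \<and>
     (\<exists>u<n. reach t' v u \<and> \<not> reach t v u) \<and> (\<forall>u<n. reach t v u \<longrightarrow> reach t' v u)) \<longleftrightarrow>
     (\<exists>D. small \<eta> D \<and> C \<subseteq> D \<and> D \<noteq> C)" if sm: "small_code \<eta> t v"
  proof -
    have v: "v \<notin> sset t" "small \<eta> C" using sm code_iff(2)[OF t] by (auto simp: C_def)
    show ?thesis
    proof
      assume "\<exists>t'\<in>tuples n (2 * \<eta> + 4). small_code \<eta> t' v \<and>
        (\<exists>u<n. reach t' v u \<and> \<not> reach t v u) \<and> (\<forall>u<n. reach t v u \<longrightarrow> reach t' v u)"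
      then obtain t' where t': "t' \<in> tuples n (2 * \<eta> + 4)" "small_code \<eta> t' v"
        "\<exists>u<n. reach t' v u \<and> \<not> reach t v u" "\<forall>u<n. reach t v u \<longrightarrow> reach t' v u" by blast
      have v': "v \<notin> sset t'" "small \<eta> (comp (S t') (vs ! v))"
        using code_iff(2)[OF t'(1) t(2)] t'(2) by auto
      have "C \<subseteq> comp (S t') (vs ! v)"
        using comp_subset_reach[OF t v(1) v'(1)] t'(4) unfolding C_def by blast
      moreover have "\<not> comp (S t') (vs ! v) \<subseteq> C"
        using comp_subset_reach[OF t'(1) t(2) v'(1) v(1)] t'(3) unfolding C_def by blast
      ultimately show "\<exists>D. small \<eta> D \<and> C \<subseteq> D \<and> D \<noteq> C" using v'(2) by blast
    next
      assume "\<exists>D. small \<eta> D \<and> C \<subseteq> D \<and> D \<noteq> C"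
      then obtain D where D: "small \<eta> D" "C \<subseteq> D" "D \<noteq> C" by blast
      have "vs ! v \<in> D" using D(2) comp_in unfolding C_def by blast
      then obtain t' where t': "t' \<in> tuples n (2 * \<eta> + 4)" "v \<notin> sset t'" "comp (S t') (vs ! v) = D" "nb D = S t'"
        using ex_code[of D \<eta> v] D(1) t(2) unfolding small_def by blast
      have "small_code \<eta> t' v" using code_iff(2)[OF t'(1) t(2)] t' D(1) by simp
      moreover have "\<forall>u<n. reach t v u \<longrightarrow> reach t' v u"
        using comp_subset_reach[OF t v(1) t'(2)] D(2) t'(3) unfolding C_def by blast
      moreover have "\<exists>u<n. reach t' v u \<and> \<not> reach t v u"
        using comp_subset_reach[OF t'(1) t(2) t'(2) v(1)] D(2,3) t'(3) unfolding C_def by blast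
      ultimately show "\<exists>t'\<in>tuples n (2 * \<eta> + 4). small_code \<eta> t' v \<and>
        (\<exists>u<n. reach t' v u \<and> \<not> reach t v u) \<and> (\<forall>u<n. reach t v u \<longrightarrow> reach t' v u)"
        using t'(1) by blast
    qed
  qed
  then have key: "small_code \<eta> t v \<Longrightarrow> max_code \<eta> t v \<longleftrightarrow> \<not> (\<exists>D. small \<eta> D \<and> C \<subseteq> D \<and> D \<noteq> C)"
    by (simp only: max_code_def simp_thms)
  show ?thesis
  proof (cases "small_code \<eta> t v")
    case True
    then show ?thesis using key[OF True] code_iff(2)[OF t] unfolding maximal_small_def C_def by metis
  next
    case False
    then have "\<not> max_code \<eta> t v" by (simp add: max_code_def)
    then show ?thesis using False code_iff(2)[OF t] unfolding maximal_small_def by metis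
  qed
qed

lemma low_iff:
  assumes "u < n"
  shows "low \<eta> u \<longleftrightarrow> (\<exists>C. small \<eta> C \<and> vs ! u \<in> C)"
proof
  assume "low \<eta> u"
  then obtain t where t: "t \<in> tuples n (2 * \<eta> + 4)" "small_code \<eta> t u" by (auto simp: low_def)
  then have "small \<eta> (comp (S t) (vs ! u))" using code_iff(2)[OF t(1) assms] by simp
  then show "\<exists>C. small \<eta> C \<and> vs ! u \<in> C" using comp_in by blast
next
  assume "\<exists>C. small \<eta> C \<and> vs ! u \<in> C"
  then obtain C where C: "small \<eta> C" "vs ! u \<in> C" by blast
  obtain t where t: "t \<in> tuples n (2 * \<eta> + 4)" "u \<notin> sset t" "comp (S t) (vs ! u) = C" "nb C = S t"
    using ex_code[of C \<eta> u] C assms unfolding small_def by blast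
  then have "small_code \<eta> t u" using code_iff(2)[OF t(1) assms] C(1) by simp
  then show "low \<eta> u" using t(1) by (auto simp: low_def)
qed

lemma ex_bad_code:
  assumes "bad \<eta> C"
  shows "\<exists>t\<in>tuples n (2 * \<eta> + 4). \<exists>v<n. bad_code \<eta> t v \<and> comp (S t) (vs ! v) = C \<and> nb C = S t"
proof -
  have C: "conn C" "card (nb C) \<le> 2 * \<eta> + 2" using assms by (auto simp: bad_def)
  then obtain x where "x \<in> C" using conn_ne by blast
  then obtain v where v: "v < n" "vs ! v \<in> C" using conn_V[OF C(1)] ex_index by blast
  obtain t where t: "t \<in> tuples n (2 * \<eta> + 4)" "v \<notin> sset t" "comp (S t) (vs ! v) = C" "nb C = S t"
    using ex_code[OF C v] by blast
  then have "bad_code \<eta> t v" using code_iff(1)[OF t(1) v(1)] assms by simp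
  then show ?thesis using t v by blast
qed

lemma any_bad_iff: "any_bad \<eta> \<longleftrightarrow> (\<exists>C. bad \<eta> C)"
proof
  assume "any_bad \<eta>"
  then obtain t v where "t \<in> tuples n (2 * \<eta> + 4)" "v < n" "bad_code \<eta> t v"
    unfolding any_bad_def by blast
  then show "\<exists>C. bad \<eta> C" using code_iff(1) by blast
next
  assume "\<exists>C. bad \<eta> C"
  then obtain C where "bad \<eta> C" by blast
  from ex_bad_code[OF this] show "any_bad \<eta>" unfolding any_bad_def by blast
qed

theorem hit_family_codes:
  "hit_family \<eta> = {(!) vs ` {x. x < n \<and> member_code \<eta> t v f g x} |t v f g.
     t \<in> tuples n (2 * \<eta> + 4) \<and> v < n \<and> f < n \<and> g < n \<and> valid_code \<eta> t v f g}"
    (is "_ = ?codes")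
proof (cases "any_bad \<eta>")
  case True
  then have P: "hit_family \<eta> = {C \<union> nb C |C. bad \<eta> C}"
    using any_bad_iff by (simp add: hit_family_def)
  have set: "(!) vs ` {x. x < n \<and> member_code \<eta> t v f g x} = comp (S t) (vs ! v) \<union> S t"
    if t: "t \<in> tuples n (2 * \<eta> + 4)" "v < n" "v \<notin> sset t" for t v f g
  proof -
    have "{x. x < n \<and> member_code \<eta> t v f g x} = {x. x < n \<and> reach t v x} \<union> sset t"
      using True sset_sub[OF t(1)] by (auto simp: member_code_def)
    then show ?thesis unfolding comp_reach[OF t] by (simp only: S_def image_Un)
  qed
  have n0: "0 < n" using two_vertices by linarith
  show ?thesis
  proof
    show "hit_family \<eta> \<subseteq> ?codes"
    proof
      fix A assume "A \<in> hit_family \<eta>"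
      then obtain C where C: "bad \<eta> C" "A = C \<union> nb C" using P by blast
      obtain t v where t: "t \<in> tuples n (2 * \<eta> + 4)" "v < n" "bad_code \<eta> t v"
        "comp (S t) (vs ! v) = C" "nb C = S t" using ex_bad_code[OF C(1)] by blast
      have "v \<notin> sset t" using t(3) code_iff(1)[OF t(1,2)] by blast
      then have "A = (!) vs ` {x. x < n \<and> member_code \<eta> t v 0 0 x}"
        using set[OF t(1,2)] t(4,5) C(2) by simp
      moreover have "valid_code \<eta> t v 0 0" using True t(3) by (simp add: valid_code_def)
      ultimately show "A \<in> ?codes" using t(1,2) n0 by blast
    qed
    show "?codes \<subseteq> hit_family \<eta>"
    proof
      fix A assume "A \<in> ?codes"
      then obtain t v f g where t: "t \<in> tuples n (2 * \<eta> + 4)" "v < n" "valid_code \<eta> t v f g"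
        "A = (!) vs ` {x. x < n \<and> member_code \<eta> t v f g x}" by blast
      then have "bad_code \<eta> t v" using True by (simp add: valid_code_def)
      then have b: "v \<notin> sset t" "bad \<eta> (comp (S t) (vs ! v))" "nb (comp (S t) (vs ! v)) = S t"
        using code_iff(1)[OF t(1,2)] by auto
      then have "A = comp (S t) (vs ! v) \<union> nb (comp (S t) (vs ! v))"
        using set[OF t(1,2)] t(4) by simp
      then show "A \<in> hit_family \<eta>" using P b(2) by blast
    qed
  qed
next
  case False
  define P1 where "P1 = {nb C \<union> \<Union>{D. maximal_small \<eta> D \<and> nb D = nb C} |C. maximal_small \<eta> C}"
  define P2 where "P2 = {{u, v} |u v. u \<rightarrow>\<^bsub>G\<^esub> v \<and> (\<forall>C. small \<eta> C \<longrightarrow> u \<notin> C \<and> v \<notin> C)}"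
  have P: "hit_family \<eta> = P1 \<union> P2"
    using False any_bad_iff by (simp add: hit_family_def P1_def P2_def)
  have n0: "0 < n" using two_vertices by linarith
  have set1: "(!) vs ` {x. x < n \<and> member_code \<eta> t v f f x} = S t \<union> \<Union>{D. maximal_small \<eta> D \<and> nb D = S t}"
    if t: "t \<in> tuples n (2 * \<eta> + 4)" for t v f
  proof -
    have 1: "{x. x < n \<and> member_code \<eta> t v f f x} = sset t \<union> {x. x < n \<and> max_code \<eta> t x}"
      using False sset_sub[OF t(1)] by (auto simp: member_code_def)
    have "(!) vs ` {x. x < n \<and> max_code \<eta> t x} = \<Union>{D. maximal_small \<eta> D \<and> nb D = S t}"
    proof
      show "(!) vs ` {x. x < n \<and> max_code \<eta> t x} \<subseteq> \<Union>{D. maximal_small \<eta> D \<and> nb D = S t}"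
        using max_code_iff[OF t] comp_in by blast
      show "\<Union>{D. maximal_small \<eta> D \<and> nb D = S t} \<subseteq> (!) vs ` {x. x < n \<and> max_code \<eta> t x}"
      proof
        fix y assume "y \<in> \<Union>{D. maximal_small \<eta> D \<and> nb D = S t}"
        then obtain D where D: "maximal_small \<eta> D" "nb D = S t" "y \<in> D" by blast
        have cD: "conn D" using D(1) by (simp add: maximal_small_def small_def)
        obtain x where x: "x < n" "vs ! x = y" using conn_V[OF cD] D(3) ex_index by blast
        have DS: "D \<inter> S t = {}" unfolding D(2)[symmetric] by (auto simp: nb_def)
        then have "x \<notin> sset t" using in_S[OF t x(1)] x(2) D(3) by auto
        moreover have "comp (S t) (vs ! x) = D"
          using comp_eq[OF cD DS, of y] D(2,3) x(2) by simp
        ultimately have "max_code \<eta> t x" using max_code_iff[OF t x(1)] D by simp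
        then show "y \<in> (!) vs ` {x. x < n \<and> max_code \<eta> t x}" using x by blast
      qed
    qed
    then show ?thesis unfolding 1 S_def by (simp add: image_Un)
  qed
  have set2: "(!) vs ` {x. x < n \<and> member_code \<eta> t v f g x} = {vs ! f, vs ! g}"
    if "f \<noteq> g" "f < n" "g < n" for t v f g
    using False that by (auto simp: member_code_def)
  have low2: "(\<forall>C. small \<eta> C \<longrightarrow> vs ! f \<notin> C \<and> vs ! g \<notin> C) \<longleftrightarrow> \<not> low \<eta> f \<and> \<not> low \<eta> g"
    if "f < n" "g < n" for f g
    using low_iff[OF that(1)] low_iff[OF that(2)] by blast
  have noloop: "\<not> adj f f" for f by (rule E_irrefl)
  \<comment> \<open>The code of an edge still needs some tuple in the place of the
    separator.\<close>
  obtain t0 where t0: "t0 \<in> tuples n (2 * \<eta> + 4)"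
    using ex_S[of "{}" "2 * \<eta> + 2"] unfolding add_2_2 by auto
  show ?thesis
  proof
    show "hit_family \<eta> \<subseteq> ?codes"
    proof
      fix A assume "A \<in> hit_family \<eta>"
      then consider "A \<in> P1" | "A \<in> P2" using P by blast
      then show "A \<in> ?codes"
      proof cases
        case 1
        then obtain C where C: "maximal_small \<eta> C" "A = nb C \<union> \<Union>{D. maximal_small \<eta> D \<and> nb D = nb C}"
          unfolding P1_def by blast
        have cC: "conn C" "card (nb C) \<le> 2 * \<eta> + 2" using C(1) by (auto simp: maximal_small_def small_def)
        then obtain x where "x \<in> C" using conn_ne by blast
        then obtain v where v: "v < n" "vs ! v \<in> C" using conn_V[OF cC(1)] ex_index by blast
        obtain t where t: "t \<in> tuples n (2 * \<eta> + 4)" "v \<notin> sset t" "comp (S t) (vs ! v) = C" "nb C = S t"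
          using ex_code[OF cC v] by blast
        have "max_code \<eta> t v" using max_code_iff[OF t(1) v(1)] t C(1) by simp
        then have "valid_code \<eta> t v 0 0" using False by (simp add: valid_code_def)
        moreover have "A = (!) vs ` {x. x < n \<and> member_code \<eta> t v 0 0 x}"
          unfolding set1[OF t(1)] C(2) t(4) ..
        ultimately show ?thesis using t(1) v(1) n0 by blast
      next
        case 2
        then obtain a b where ab: "A = {a, b}" "a \<rightarrow>\<^bsub>G\<^esub> b" "\<forall>C. small \<eta> C \<longrightarrow> a \<notin> C \<and> b \<notin> C"
          unfolding P2_def by blast
        obtain f g where fg: "f < n" "vs ! f = a" "g < n" "vs ! g = b"
          using ex_index E_V[OF ab(2)] by metis
        have "f \<noteq> g" using fg ab(2) noloop by auto
        moreover have "valid_code \<eta> t0 0 f g"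
          using False low2[OF fg(1,3)] ab fg by (auto simp: valid_code_def)
        moreover have "A = (!) vs ` {x. x < n \<and> member_code \<eta> t0 0 f g x}"
          using set2[OF \<open>f \<noteq> g\<close> fg(1,3)] ab(1) fg by simp
        ultimately show ?thesis using t0 n0 fg(1,3) by blast
      qed
    qed
    show "?codes \<subseteq> hit_family \<eta>"
    proof
      fix A assume "A \<in> ?codes"
      then obtain t v f g where t: "t \<in> tuples n (2 * \<eta> + 4)" "v < n" "f < n" "g < n" "valid_code \<eta> t v f g"
        "A = (!) vs ` {x. x < n \<and> member_code \<eta> t v f g x}" by blast
      from t(5) False consider "f = g" "max_code \<eta> t v" | "adj f g" "\<not> low \<eta> f" "\<not> low \<eta> g"
        unfolding valid_code_def by blast
      then show "A \<in> hit_family \<eta>"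
      proof cases
        case 1
        have m: "maximal_small \<eta> (comp (S t) (vs ! v))" "nb (comp (S t) (vs ! v)) = S t"
          using max_code_iff[OF t(1,2)] 1(2) by auto
        have "A = S t \<union> \<Union>{D. maximal_small \<eta> D \<and> nb D = S t}" using set1[OF t(1)] t(6) 1(1) by simp
        then have "A = nb (comp (S t) (vs ! v)) \<union> \<Union>{D. maximal_small \<eta> D \<and> nb D = nb (comp (S t) (vs ! v))}"
          unfolding m(2) .
        then have "A \<in> P1" unfolding P1_def mem_Collect_eq using m(1)
          by (intro exI[of _ "comp (S t) (vs ! v)"] conjI)
        then show ?thesis unfolding P by (rule UnI1)
      next
        case 2
        then have "f \<noteq> g" using noloop by auto
        then have "A = {vs ! f, vs ! g}" using set2 t by simp
        moreover have "\<forall>C. small \<eta> C \<longrightarrow> vs ! f \<notin> C \<and> vs ! g \<notin> C" using 2 low2[OF t(3,4)] by simp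
        ultimately have "A \<in> P2" unfolding P2_def mem_Collect_eq using 2(1)
          by (intro exI[of _ "vs ! f"] exI[of _ "vs ! g"] conjI)
        then show ?thesis unfolding P by (rule UnI2)
      qed
    qed
  qed
qed

end

section \<open>Deciding the relations\<close>

text \<open>The quantified value is passed to \<open>P\<close> as an argument, so that formulas can
  be written as in the definitions. The last assumption says that \<open>x\<close> is fresh.\<close>

lemma linear_exq:
  assumes "linear good (\<lambda>\<eta>. insert x (X \<eta>)) (\<lambda>\<eta> I s. P \<eta> I s (fst s x))" "upd_closed good" "20 \<le> x"
    "\<And>\<eta> I s. good \<eta> I s \<Longrightarrow> fst s 0 = length (snd I)"
    "\<And>\<eta> I s v w. P \<eta> I ((fst s)(x := v), snd s) w \<longleftrightarrow> P \<eta> I s w"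
  shows "linear good X (\<lambda>\<eta> I s. \<exists>v<length (snd I). P \<eta> I s v)"
  by (rule linear_cong[OF linear_ex[OF assms(1-3)]]) (simp add: assms(4,5))

lemma linear_allq:
  assumes "linear good (\<lambda>\<eta>. insert x (X \<eta>)) (\<lambda>\<eta> I s. P \<eta> I s (fst s x))" "upd_closed good" "20 \<le> x"
    "\<And>\<eta> I s. good \<eta> I s \<Longrightarrow> fst s 0 = length (snd I)"
    "\<And>\<eta> I s v w. P \<eta> I ((fst s)(x := v), snd s) w \<longleftrightarrow> P \<eta> I s w"
  shows "linear good X (\<lambda>\<eta> I s. \<forall>v<length (snd I). P \<eta> I s v)"
  by (rule linear_cong[OF linear_all[OF assms(1-3)]]) (simp add: assms(4,5))

lemma linear_ex_tupleq:
  assumes "linear good (\<lambda>\<eta>. set (xs \<eta>) \<union> X \<eta>) (\<lambda>\<eta> I s. P \<eta> I s (map (fst s) (xs \<eta>)))" "upd_closed good"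
    "\<And>\<eta>. \<forall>x\<in>set (xs \<eta>). 20 \<le> x" "\<And>\<eta>. distinct (xs \<eta>)" "\<And>\<eta>. length (xs \<eta>) = a \<eta>"
    "\<And>\<eta>. a \<eta> \<le> k * (\<eta> + 1)"
    "\<And>\<eta> I s. good \<eta> I s \<Longrightarrow> fst s 0 = length (snd I)"
    "\<And>\<eta> I s t w. P \<eta> I (upds (fst s) (xs \<eta>) t, snd s) w \<longleftrightarrow> P \<eta> I s w"
  shows "linear good X (\<lambda>\<eta> I s. \<exists>t\<in>tuples (length (snd I)) (a \<eta>). P \<eta> I s t)"
proof (rule linear_cong[OF linear_ex_tuple[OF assms(1-4)]])
  show "length (xs \<eta>) \<le> k * (\<eta> + 1)" for \<eta> using assms(5,6) by simp
  fix \<eta> I s assume g: "good \<eta> I s" "below (X \<eta>) s"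
  have "map (upds (fst s) (xs \<eta>) t) (xs \<eta>) = t" if "t \<in> tuples (length (snd I)) (a \<eta>)" for t
    by (rule map_upds) (use assms(4,5) that in \<open>auto simp: tuples_def\<close>)
  then show "good \<eta> I s \<and> below (X \<eta>) s \<and>
    ((\<exists>t\<in>tuples (fst s 0) (length (xs \<eta>)). P \<eta> I (upds (fst s) (xs \<eta>) t, snd s)
      (map (fst (upds (fst s) (xs \<eta>) t, snd s)) (xs \<eta>))) \<longleftrightarrow>
     (\<exists>t\<in>tuples (length (snd I)) (a \<eta>). P \<eta> I s t))"
    using g assms(5,7,8) by simp
qed

text \<open>
  Variable 0 holds \<open>n\<close>, variable 8 the address 0 of the adjacency matrix, and variables 2, 3, 4 the
  addresses of the tables.
\<close>

type_synonym ('a, 'b) listed = "('a, 'b) pre_digraph \<times> 'a list"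

definition input_state :: "nat \<Rightarrow> ('a, 'b) listed \<Rightarrow> state \<Rightarrow> bool" where
  "input_state \<eta> I s \<longleftrightarrow> listed_graph (fst I) (snd I) \<and> fst s 0 = length (snd I) \<and> fst s 8 = 0 \<and>
     (\<forall>i<length (snd I). \<forall>k<length (snd I).
        0 < snd s (i * length (snd I) + k) \<longleftrightarrow> snd I ! i \<rightarrow>\<^bsub>fst I\<^esub> snd I ! k)"

text \<open>Each of the following predicates adds one finished table to the previous one, so what is
  decided in an earlier phase remains decidable later.\<close>

definition reach_state :: "nat \<Rightarrow> ('a, 'b) listed \<Rightarrow> state \<Rightarrow> bool" where
  "reach_state \<eta> I s \<longleftrightarrow> input_state \<eta> I s \<and> table (length (snd I)) (5 * \<eta> + 5 + 4) (fst s 2) (snd s) =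
     listed_graph.reach_table (fst I) (snd I) (5 * \<eta> + 5)"

definition narrow_state :: "nat \<Rightarrow> ('a, 'b) listed \<Rightarrow> state \<Rightarrow> bool" where
  "narrow_state \<eta> I s \<longleftrightarrow> reach_state \<eta> I s \<and> table (length (snd I)) (3 * \<eta> + 3 + 3) (fst s 3) (snd s) =
     listed_graph.win_table (fst I) (snd I) (3 * \<eta> + 3)"

definition wide_state :: "nat \<Rightarrow> ('a, 'b) listed \<Rightarrow> state \<Rightarrow> bool" where
  "wide_state \<eta> I s \<longleftrightarrow> narrow_state \<eta> I s \<and> table (length (snd I)) (5 * \<eta> + 5 + 3) (fst s 4) (snd s) =
     listed_graph.win_table (fst I) (snd I) (5 * \<eta> + 5)"

lemma upd_closed_states:
  "upd_closed (input_state :: nat \<Rightarrow> ('a, 'b) listed \<Rightarrow> _)"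
  "upd_closed (reach_state :: nat \<Rightarrow> ('a, 'b) listed \<Rightarrow> _)"
  "upd_closed (narrow_state :: nat \<Rightarrow> ('a, 'b) listed \<Rightarrow> _)"
  "upd_closed (wide_state :: nat \<Rightarrow> ('a, 'b) listed \<Rightarrow> _)"
  by (simp_all add: upd_closed_def input_state_def reach_state_def narrow_state_def wide_state_def)

lemma input_state_n: "input_state \<eta> I s \<Longrightarrow> fst s 0 = length (snd I)"
  by (simp add: input_state_def)

lemma reach_state_n: "reach_state \<eta> I s \<Longrightarrow> fst s 0 = length (snd I)"
  by (simp add: reach_state_def input_state_def)

lemma narrow_state_n: "narrow_state \<eta> I s \<Longrightarrow> fst s 0 = length (snd I)"
  unfolding narrow_state_def using reach_state_n by blast

lemma wide_state_n: "wide_state \<eta> I s \<Longrightarrow> fst s 0 = length (snd I)"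
  unfolding wide_state_def using narrow_state_n by blast

lemma linear_reach_state: "linear input_state X P \<Longrightarrow> linear reach_state X P"
  by (erule linear_cong) (simp add: reach_state_def)

lemma linear_narrow_state: "linear reach_state X P \<Longrightarrow> linear narrow_state X P"
  by (erule linear_cong) (simp add: narrow_state_def)

lemma linear_wide_state: "linear narrow_state X P \<Longrightarrow> linear wide_state X P"
  by (erule linear_cong) (simp add: wide_state_def)

lemma below_tuple:
  "below X s \<Longrightarrow> set xs \<subseteq> X \<Longrightarrow> fst s 0 = m \<Longrightarrow> map (fst s) xs \<in> tuples m (length xs)"
  by (auto simp: below_def tuples_def)

lemma linear_table:
  assumes xs: "\<And>\<eta>. set (xs \<eta>) \<subseteq> X \<eta>" "\<And>\<eta>. \<forall>x\<in>set (xs \<eta>). 20 \<le> x" "\<And>\<eta>. length (xs \<eta>) = a \<eta>"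
    "\<And>\<eta>. a \<eta> \<le> k * (\<eta> + 1)"
    and n: "\<And>\<eta> I s. good \<eta> I s \<Longrightarrow> fst s 0 = length (snd I)"
  shows "linear good X (\<lambda>\<eta> I s. map (fst s) (xs \<eta>) \<in> table (length (snd I)) (a \<eta>) (fst s b) (snd s))"
proof (rule linear_cong[OF linear_lookup[of xs k good X b]])
  show "0 \<notin> set (xs \<eta>)" "1 \<notin> set (xs \<eta>)" for \<eta> using xs(2)[of \<eta>] by fastforce+
  show "length (xs \<eta>) \<le> k * (\<eta> + 1)" for \<eta> using xs(3,4) by simp
  fix \<eta> I s assume g: "good \<eta> I s" "below (X \<eta>) s"
  have "map (fst s) (xs \<eta>) \<in> tuples (length (snd I)) (a \<eta>)"
    using below_tuple[OF g(2) xs(1)] n[OF g(1)] xs(3) by metis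
  then show "good \<eta> I s \<and> below (X \<eta>) s \<and> (lookup b (xs \<eta>) s \<longleftrightarrow>
      map (fst s) (xs \<eta>) \<in> table (length (snd I)) (a \<eta>) (fst s b) (snd s))"
    using g n[OF g(1)] by (simp add: lookup_def table_def)
qed

lemma linear_adj:
  assumes "\<And>\<eta>. u \<in> X \<eta>" "\<And>\<eta>. v \<in> X \<eta>" "20 \<le> u" "20 \<le> v"
  shows "linear input_state X (\<lambda>\<eta> I s. snd I ! fst s u \<rightarrow>\<^bsub>fst I\<^esub> snd I ! fst s v)"
proof (rule linear_cong[OF linear_lookup[of "\<lambda>_. [u, v]" 2 input_state X 8]])
  fix \<eta> and I :: "('a, 'b) listed" and s assume g: "input_state \<eta> I s" "below (X \<eta>) s"
  have "fst s u < length (snd I)" "fst s v < length (snd I)"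
    using g(2) assms(1,2)[of \<eta>] input_state_n[OF g(1)] by (auto simp: below_def)
  then show "input_state \<eta> I s \<and> below (X \<eta>) s \<and>
    (lookup 8 [u, v] s \<longleftrightarrow> snd I ! fst s u \<rightarrow>\<^bsub>fst I\<^esub> snd I ! fst s v)"
    using g by (simp add: lookup_def input_state_def code_def)
qed (use assms in auto)

lemma linear_sset:
  assumes "\<And>\<eta>. length (xs \<eta>) \<le> k * (\<eta> + 1)" "\<And>\<eta>. 2 \<le> length (xs \<eta>)"
  shows "linear good X (\<lambda>\<eta> I s. fst s x \<in> sset (map (fst s) (xs \<eta>)))"
proof -
  have 1: "linear good X (\<lambda>\<eta> I s. fst s (xs \<eta> ! 0) = fst s (xs \<eta> ! 1))"
    by (rule linear_eq)
  have 2: "linear good X (\<lambda>\<eta> I s. fst s x \<in> fst s ` set (drop 2 (xs \<eta>)))"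
  proof (rule linear_var_in)
    show "length (drop 2 (xs \<eta>)) \<le> k * (\<eta> + 1)" for \<eta> using assms(1)[of \<eta>] by simp
  qed
  have "map (fst s) (xs \<eta>) ! 0 = fst s (xs \<eta> ! 0)" "map (fst s) (xs \<eta>) ! 1 = fst s (xs \<eta> ! 1)" for \<eta> and s :: state
    using assms(2)[of \<eta>] by (intro nth_map; linarith)+
  then show ?thesis
    by (intro linear_cong[OF linear_conj[OF 1 2]]) (simp add: sset_def drop_map)
qed

context listed_graph
begin

lemma reach_pad: "3 \<le> length t \<Longrightarrow> reach (pad q t) = reach t"
  by (simp add: reach_def[abs_def] S_def sset_pad)

lemma wins_pad: "3 \<le> length t \<Longrightarrow> wins p (pad q t) = wins p t"
  by (simp add: wins_def[abs_def] S_def sset_pad)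

end

lemma pad_tuple: "map f xs \<in> tuples m a \<Longrightarrow> xs \<noteq> [] \<Longrightarrow> a \<le> q \<Longrightarrow> map f (pad q xs) \<in> tuples m q"
  by (auto simp: tuples_def set_pad length_pad)

text \<open>A single table, made for separators of up to \<open>5 * \<eta> + 5\<close> vertices,
  answers the question for all shorter tuples after padding.\<close>

lemma linear_reach:
  assumes xs: "\<And>\<eta>. set (xs \<eta>) \<subseteq> X \<eta>" "\<And>\<eta>. \<forall>x\<in>set (xs \<eta>). 20 \<le> x" "\<And>\<eta>. 3 \<le> length (xs \<eta>)"
    "\<And>\<eta>. length (xs \<eta>) \<le> 5 * \<eta> + 7"
    and uv: "\<And>\<eta>. u \<in> X \<eta>" "\<And>\<eta>. v \<in> X \<eta>" "20 \<le> u" "20 \<le> v"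
  shows "linear reach_state X (\<lambda>\<eta> I s. listed_graph.reach (fst I) (snd I) (map (fst s) (xs \<eta>)) (fst s u) (fst s v))"
proof -
  define ys where "ys = (\<lambda>\<eta>. pad (5 * \<eta> + 5 + 2) (xs \<eta>) @ [u, v])"
  have ne: "xs \<eta> \<noteq> []" for \<eta> using xs(3)[of \<eta>] by auto
  have len: "length (pad (5 * \<eta> + 5 + 2) (xs \<eta>)) = 5 * \<eta> + 5 + 2" for \<eta>
    by (rule length_pad) (use xs(4)[of \<eta>] in simp)
  have "linear reach_state X (\<lambda>\<eta> I s. map (fst s) (ys \<eta>) \<in> table (length (snd I)) (5 * \<eta> + 5 + 4) (fst s 2) (snd s))"
  proof (rule linear_table)
    show "set (ys \<eta>) \<subseteq> X \<eta>" for \<eta> using xs(1) uv ne by (simp add: ys_def set_pad)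
    show "\<forall>x\<in>set (ys \<eta>). 20 \<le> x" for \<eta> using xs(2) uv ne by (auto simp: ys_def set_pad)
    show "length (ys \<eta>) = 5 * \<eta> + 5 + 4" for \<eta> using len[of \<eta>] by (simp add: ys_def)
    show "5 * \<eta> + 5 + 4 \<le> 9 * (\<eta> + 1)" for \<eta> :: nat by simp
  qed (rule reach_state_n)
  then show ?thesis
  proof (rule linear_cong)
    fix \<eta> and I :: "('a, 'b) listed" and s assume g: "reach_state \<eta> I s" "below (X \<eta>) s"
    interpret listed_graph "fst I" "snd I" using g(1) by (simp add: reach_state_def input_state_def)
    have n: "fst s 0 = n" by (rule reach_state_n[OF g(1)])
    have b: "fst s u < n" "fst s v < n" using g(2) uv(1,2)[of \<eta>] n by (auto simp: below_def)
    have t: "map (fst s) (pad (5 * \<eta> + 5 + 2) (xs \<eta>)) \<in> tuples n (5 * \<eta> + 5 + 2)"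
      by (rule pad_tuple[OF below_tuple[OF g(2) xs(1) n] ne]) (use xs(4)[of \<eta>] in simp)
    have "map (fst s) (ys \<eta>) \<in> table n (5 * \<eta> + 5 + 4) (fst s 2) (snd s) \<longleftrightarrow>
      map (fst s) (pad (5 * \<eta> + 5 + 2) (xs \<eta>)) @ [fst s u, fst s v] \<in> reach_table (5 * \<eta> + 5)"
      using g(1) by (simp add: ys_def reach_state_def)
    also have "\<dots> \<longleftrightarrow> reach (map (fst s) (pad (5 * \<eta> + 5 + 2) (xs \<eta>))) (fst s u) (fst s v)"
      by (rule reach_table_snoc[OF t b])
    also have "\<dots> \<longleftrightarrow> reach (map (fst s) (xs \<eta>)) (fst s u) (fst s v)"
      unfolding map_pad[OF ne] by (subst reach_pad) (use xs(3) in simp_all)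
    finally show "reach_state \<eta> I s \<and> below (X \<eta>) s \<and>
      (map (fst s) (ys \<eta>) \<in> table n (5 * \<eta> + 5 + 4) (fst s 2) (snd s) \<longleftrightarrow>
       reach (map (fst s) (xs \<eta>)) (fst s u) (fst s v))" using g by simp
  qed
qed

lemma linear_wins:
  assumes xs: "\<And>\<eta>. set (xs \<eta>) \<subseteq> X \<eta>" "\<And>\<eta>. \<forall>x\<in>set (xs \<eta>). 20 \<le> x" "\<And>\<eta>. 3 \<le> length (xs \<eta>)"
    "\<And>\<eta>. length (xs \<eta>) \<le> p \<eta> + 2"
    and v: "\<And>\<eta>. v \<in> X \<eta>" "20 \<le> v" and p: "\<And>\<eta>. p \<eta> + 3 \<le> k * (\<eta> + 1)"
    and good: "\<And>\<eta> I s. good \<eta> I s \<Longrightarrow> listed_graph (fst I) (snd I) \<and> fst s 0 = length (snd I) \<and>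
      table (length (snd I)) (p \<eta> + 3) (fst s b) (snd s) = listed_graph.win_table (fst I) (snd I) (p \<eta>)"
  shows "linear good X (\<lambda>\<eta> I s. listed_graph.wins (fst I) (snd I) (p \<eta>) (map (fst s) (xs \<eta>)) (fst s v))"
proof -
  define ys where "ys = (\<lambda>\<eta>. pad (p \<eta> + 2) (xs \<eta>) @ [v])"
  have ne: "xs \<eta> \<noteq> []" for \<eta> using xs(3)[of \<eta>] by auto
  have len: "length (pad (p \<eta> + 2) (xs \<eta>)) = p \<eta> + 2" for \<eta>
    by (rule length_pad) (use xs(4)[of \<eta>] in simp)
  have "linear good X (\<lambda>\<eta> I s. map (fst s) (ys \<eta>) \<in> table (length (snd I)) (p \<eta> + 3) (fst s b) (snd s))"
  proof (rule linear_table)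
    show "set (ys \<eta>) \<subseteq> X \<eta>" for \<eta> using xs(1) v ne by (simp add: ys_def set_pad)
    show "\<forall>x\<in>set (ys \<eta>). 20 \<le> x" for \<eta> using xs(2) v ne by (auto simp: ys_def set_pad)
    show "length (ys \<eta>) = p \<eta> + 3" for \<eta> using len[of \<eta>] by (simp add: ys_def)
  qed (use p good in auto)
  then show ?thesis
  proof (rule linear_cong)
    fix \<eta> I s assume g: "good \<eta> I s" "below (X \<eta>) s"
    interpret listed_graph "fst I" "snd I" using good[OF g(1)] by simp
    have n: "fst s 0 = n" using good[OF g(1)] by simp
    have b: "fst s v < n" using g(2) v(1)[of \<eta>] n by (auto simp: below_def)
    have t: "map (fst s) (pad (p \<eta> + 2) (xs \<eta>)) \<in> tuples n (p \<eta> + 2)"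
      by (rule pad_tuple[OF below_tuple[OF g(2) xs(1) n] ne xs(4)])
    have "map (fst s) (ys \<eta>) \<in> table n (p \<eta> + 3) (fst s b) (snd s) \<longleftrightarrow>
      map (fst s) (pad (p \<eta> + 2) (xs \<eta>)) @ [fst s v] \<in> win_table (p \<eta>)"
      using good[OF g(1)] by (simp add: ys_def)
    also have "\<dots> \<longleftrightarrow> wins (p \<eta>) (map (fst s) (pad (p \<eta> + 2) (xs \<eta>))) (fst s v)"
      by (rule win_table_snoc[OF t b])
    also have "\<dots> \<longleftrightarrow> wins (p \<eta>) (map (fst s) (xs \<eta>)) (fst s v)"
      unfolding map_pad[OF ne] by (subst wins_pad) (use xs(3) in simp_all)
    finally show "good \<eta> I s \<and> below (X \<eta>) s \<and>
      (map (fst s) (ys \<eta>) \<in> table n (p \<eta> + 3) (fst s b) (snd s) \<longleftrightarrow>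
       wins (p \<eta>) (map (fst s) (xs \<eta>)) (fst s v))" using g by simp
  qed
qed

text \<open>Variables below 40 are reserved for addresses and single quantified vertices.\<close>

definition block :: "nat \<Rightarrow> nat \<Rightarrow> nat \<Rightarrow> nat list" where
  "block i a \<eta> = [40 + i * (5 * \<eta> + 20)..<40 + i * (5 * \<eta> + 20) + a]"

lemma length_block [simp]: "length (block i a \<eta>) = a"
  and distinct_block [simp]: "distinct (block i a \<eta>)"
  by (simp_all add: block_def)

lemma block_ge: "x \<in> set (block i a \<eta>) \<Longrightarrow> 40 \<le> x"
  by (simp add: block_def)

lemma notin_block [simp]: "x < 40 \<Longrightarrow> x \<notin> set (block i a \<eta>)"
  using block_ge by fastforce

lemma block_disjoint:
  assumes "i < k" "a \<le> 5 * \<eta> + 20"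
  shows "set (block i a \<eta>) \<inter> set (block k b \<eta>) = {}"
proof -
  have "Suc i * (5 * \<eta> + 20) \<le> k * (5 * \<eta> + 20)" using assms(1) by (intro mult_le_mono1) simp
  then show ?thesis using assms(2) by (auto simp: block_def)
qed

lemma map_upd_notin: "x \<notin> set xs \<Longrightarrow> map (f(x := v)) xs = map f xs"
  by (induction xs) auto

lemma linear_reach_step:
  fixes good :: "nat \<Rightarrow> ('a, 'b) listed \<Rightarrow> state \<Rightarrow> bool"
  defines "good \<equiv> input_state"
  defines "xs \<equiv> \<lambda>\<eta>. block 0 (5 * \<eta> + 5 + 2) \<eta> @ [20, 21]"
  shows "linear good (\<lambda>\<eta>. set (xs \<eta>)) (\<lambda>\<eta> I s. listed_graph.reach_step (fst I) (snd I) (5 * \<eta> + 5)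
    (table (length (snd I)) (5 * \<eta> + 5 + 4) (fst s 2) (snd s)) (map (fst s) (xs \<eta>)))"
proof -
  let ?B = "\<lambda>\<eta>. block 0 (5 * \<eta> + 5 + 2) \<eta>"
  let ?X = "\<lambda>\<eta>. set (xs \<eta>)"
  note up = upd_closed_states(1)[where 'a = 'a and 'b = 'b, folded good_def]
  have n: "good \<eta> I s \<Longrightarrow> fst s 0 = length (snd I)" for \<eta> I s unfolding good_def by (rule input_state_n)
  have "linear good ?X (\<lambda>\<eta> I s. \<not> fst s 20 \<in> sset (map (fst s) (?B \<eta>)) \<and> \<not> fst s 21 \<in> sset (map (fst s) (?B \<eta>)) \<and>
    (fst s 20 = fst s 21 \<or> (\<exists>w<length (snd I).
      map (fst s) (?B \<eta>) @ [fst s 20, w] \<in> table (length (snd I)) (5 * \<eta> + 5 + 4) (fst s 2) (snd s) \<and>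
      snd I ! w \<rightarrow>\<^bsub>fst I\<^esub> snd I ! fst s 21)))"
  proof (intro linear_conj linear_not linear_disj)
    show "linear good ?X (\<lambda>\<eta> I s. \<exists>w<length (snd I).
      map (fst s) (?B \<eta>) @ [fst s 20, w] \<in> table (length (snd I)) (5 * \<eta> + 5 + 4) (fst s 2) (snd s) \<and>
      snd I ! w \<rightarrow>\<^bsub>fst I\<^esub> snd I ! fst s 21)"
    proof (rule linear_exq[where x = 30, OF linear_conj up])
      have "linear good (\<lambda>\<eta>. insert 30 (?X \<eta>)) (\<lambda>\<eta> I s. map (fst s) (?B \<eta> @ [20, 30]) \<in>
          table (length (snd I)) (5 * \<eta> + 5 + 4) (fst s 2) (snd s))"
        by (rule linear_table[where k = 9]) (use n in \<open>auto simp: xs_def dest: block_ge\<close>)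
      then show "linear good (\<lambda>\<eta>. insert 30 (?X \<eta>)) (\<lambda>\<eta> I s. map (fst s) (?B \<eta>) @ [fst s 20, fst s 30] \<in>
          table (length (snd I)) (5 * \<eta> + 5 + 4) (fst s 2) (snd s))" by simp
      show "linear good (\<lambda>\<eta>. insert 30 (?X \<eta>)) (\<lambda>\<eta> I s. snd I ! fst s 30 \<rightarrow>\<^bsub>fst I\<^esub> snd I ! fst s 21)"
        unfolding good_def by (rule linear_adj) (auto simp: xs_def)
    qed (auto simp: n map_upd_notin)
  qed (rule linear_sset[where k = 7] linear_eq; simp)+
  then show ?thesis
  proof (rule linear_cong)
    fix \<eta> and I :: "('a, 'b) listed" and s assume g: "good \<eta> I s" "below (?X \<eta>) s"
    interpret listed_graph "fst I" "snd I" using g(1) by (simp add: good_def input_state_def)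
    have t: "map (fst s) (?B \<eta>) \<in> tuples n (5 * \<eta> + 5 + 2)"
      using below_tuple[OF g(2), of "?B \<eta>" n] n[OF g(1)] by (auto simp: xs_def)
    show "good \<eta> I s \<and> below (?X \<eta>) s \<and> (
      (\<not> fst s 20 \<in> sset (map (fst s) (?B \<eta>)) \<and> \<not> fst s 21 \<in> sset (map (fst s) (?B \<eta>)) \<and>
        (fst s 20 = fst s 21 \<or> (\<exists>w<n.
          map (fst s) (?B \<eta>) @ [fst s 20, w] \<in> table n (5 * \<eta> + 5 + 4) (fst s 2) (snd s) \<and>
          snd I ! w \<rightarrow>\<^bsub>fst I\<^esub> snd I ! fst s 21))) \<longleftrightarrow>
      reach_step (5 * \<eta> + 5) (table n (5 * \<eta> + 5 + 4) (fst s 2) (snd s)) (map (fst s) (xs \<eta>)))"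
      using g reach_step_snoc[OF t, of "table n (5 * \<eta> + 5 + 4) (fst s 2) (snd s)" "fst s 20" "fst s 21"]
      by (simp only: xs_def map_append list.map)
  qed
qed

lemma linear_win_step:
  fixes good :: "nat \<Rightarrow> ('a, 'b) listed \<Rightarrow> state \<Rightarrow> bool"
  assumes p: "\<And>\<eta>. p \<eta> \<le> 5 * \<eta> + 5" "\<And>\<eta>. 1 \<le> p \<eta>" and b: "b < 20"
  defines "good \<equiv> reach_state"
  defines "xs \<equiv> \<lambda>\<eta>. block 0 (p \<eta> + 2) \<eta> @ [20]"
  shows "linear good (\<lambda>\<eta>. set (xs \<eta>)) (\<lambda>\<eta> I s. listed_graph.win_step (fst I) (snd I) (p \<eta>)
    (table (length (snd I)) (p \<eta> + 3) (fst s b) (snd s)) (map (fst s) (xs \<eta>)))"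
proof -
  \<comment> \<open>Block 0 holds the current tuple and block 1 the quantified next position of the
    guards.\<close>
  let ?B = "\<lambda>\<eta>. block 0 (p \<eta> + 2) \<eta>"
  let ?S = "\<lambda>\<eta>. block 1 (p \<eta> + 2) \<eta>"
  let ?X = "\<lambda>\<eta>. set (xs \<eta>)"
  let ?r = "\<lambda>\<eta> (I :: ('a, 'b) listed) s. listed_graph.reach (fst I) (snd I) (map (fst s) (?B \<eta>))"
  note up = upd_closed_states(2)[where 'a = 'a and 'b = 'b, folded good_def]
  have n: "good \<eta> I s \<Longrightarrow> fst s 0 = length (snd I)" for \<eta> I s unfolding good_def by (rule reach_state_n)
  have p3: "3 \<le> p \<eta> + 2" "p \<eta> + 2 \<le> 5 * \<eta> + 7" "p \<eta> + 3 \<le> 8 * (\<eta> + 1)" "p \<eta> + 2 \<le> 8 * (\<eta> + 1)" for \<eta>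
    using p(1,2)[of \<eta>] by simp_all
  have dis: "set (?B \<eta>) \<inter> set (?S \<eta>) = {}" "set (?S \<eta>) \<inter> set (?B \<eta>) = {}" for \<eta>
    using block_disjoint[of 0 1 "p \<eta> + 2" \<eta> "p \<eta> + 2"] p(1)[of \<eta>] by auto
  have upB: "map (upds e (?S \<eta>) t) (?B \<eta>) = map e (?B \<eta>)" for e t \<eta>
    by (rule map_upds_other[OF dis(1)])
  have upv: "upds e (?S \<eta>) t 20 = e 20" "upds e (?S \<eta>) t b = e b" for e t \<eta>
    using b by simp_all
  have reach: "linear good X (\<lambda>\<eta> I s. ?r \<eta> I s (fst s u) (fst s v))"
    if "\<And>\<eta>. set (xs \<eta>) \<subseteq> X \<eta>" "\<And>\<eta>. u \<in> X \<eta>" "\<And>\<eta>. v \<in> X \<eta>" "20 \<le> u" "20 \<le> v" for X u v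
    unfolding good_def
  proof (rule linear_reach)
    show "set (?B \<eta>) \<subseteq> X \<eta>" for \<eta> using that(1)[of \<eta>] by (simp add: xs_def)
    show "\<forall>x\<in>set (?B \<eta>). 20 \<le> x" for \<eta> using block_ge by fastforce
  qed (use that p3 in simp_all)
  have adj: "linear good X (\<lambda>\<eta> I s. snd I ! fst s u \<rightarrow>\<^bsub>fst I\<^esub> snd I ! fst s v)"
    if "\<And>\<eta>. u \<in> X \<eta>" "\<And>\<eta>. v \<in> X \<eta>" "20 \<le> u" "20 \<le> v" for X u v
    unfolding good_def by (rule linear_reach_state[OF linear_adj[OF that]])
  have "linear good ?X (\<lambda>\<eta> I s. \<not> fst s 20 \<in> sset (map (fst s) (?B \<eta>)) \<and>
    (\<exists>s'\<in>tuples (length (snd I)) (p \<eta> + 2).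
       (\<forall>x<length (snd I). \<forall>y<length (snd I). ?r \<eta> I s (fst s 20) x \<and> snd I ! x \<rightarrow>\<^bsub>fst I\<^esub> snd I ! y \<and>
         \<not> ?r \<eta> I s (fst s 20) y \<longrightarrow> y \<in> sset s') \<and>
       (\<forall>u<length (snd I). ?r \<eta> I s (fst s 20) u \<and> \<not> u \<in> sset s' \<longrightarrow>
         s' @ [u] \<in> table (length (snd I)) (p \<eta> + 3) (fst s b) (snd s))))"
  proof (intro linear_conj)
    show "linear good ?X (\<lambda>\<eta> I s. \<exists>s'\<in>tuples (length (snd I)) (p \<eta> + 2).
       (\<forall>x<length (snd I). \<forall>y<length (snd I). ?r \<eta> I s (fst s 20) x \<and> snd I ! x \<rightarrow>\<^bsub>fst I\<^esub> snd I ! y \<and>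
         \<not> ?r \<eta> I s (fst s 20) y \<longrightarrow> y \<in> sset s') \<and>
       (\<forall>u<length (snd I). ?r \<eta> I s (fst s 20) u \<and> \<not> u \<in> sset s' \<longrightarrow>
         s' @ [u] \<in> table (length (snd I)) (p \<eta> + 3) (fst s b) (snd s)))"
    proof (rule linear_ex_tupleq[where xs = ?S and k = 8, OF linear_conj up])
      show "linear good (\<lambda>\<eta>. set (?S \<eta>) \<union> ?X \<eta>) (\<lambda>\<eta> I s. \<forall>x<length (snd I). \<forall>y<length (snd I).
        ?r \<eta> I s (fst s 20) x \<and> snd I ! x \<rightarrow>\<^bsub>fst I\<^esub> snd I ! y \<and>
         \<not> ?r \<eta> I s (fst s 20) y \<longrightarrow> y \<in> sset (map (fst s) (?S \<eta>)))"
      proof (rule linear_allq[where x = 30, OF _ up])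
        show "linear good (\<lambda>\<eta>. insert 30 (set (?S \<eta>) \<union> ?X \<eta>)) (\<lambda>\<eta> I s. \<forall>y<length (snd I).
          ?r \<eta> I s (fst s 20) (fst s 30) \<and> snd I ! (fst s 30) \<rightarrow>\<^bsub>fst I\<^esub> snd I ! y \<and>
            \<not> ?r \<eta> I s (fst s 20) y \<longrightarrow> y \<in> sset (map (fst s) (?S \<eta>)))"
        proof (rule linear_allq[where x = 31, OF _ up], intro linear_imp linear_conj linear_not)
          show "linear good (\<lambda>\<eta>. insert 31 (insert 30 (set (?S \<eta>) \<union> ?X \<eta>)))
            (\<lambda>\<eta> I s. fst s 31 \<in> sset (map (fst s) (?S \<eta>)))"
            by (rule linear_sset[where k = 8]) (use p3 in simp_all)
        qed ((rule reach adj)?; auto simp: xs_def n map_upd_notin)+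
      qed (auto simp: n map_upd_notin)
      show "linear good (\<lambda>\<eta>. set (?S \<eta>) \<union> ?X \<eta>) (\<lambda>\<eta> I s. \<forall>u<length (snd I).
        ?r \<eta> I s (fst s 20) u \<and> \<not> u \<in> sset (map (fst s) (?S \<eta>)) \<longrightarrow>
         map (fst s) (?S \<eta>) @ [u] \<in> table (length (snd I)) (p \<eta> + 3) (fst s b) (snd s))"
      proof (rule linear_allq[where x = 32, OF _ up], intro linear_imp linear_conj linear_not)
        show "linear good (\<lambda>\<eta>. insert 32 (set (?S \<eta>) \<union> ?X \<eta>))
            (\<lambda>\<eta> I s. fst s 32 \<in> sset (map (fst s) (?S \<eta>)))"
          by (rule linear_sset[where k = 8]) (use p3 in simp_all)
        have "linear good (\<lambda>\<eta>. insert 32 (set (?S \<eta>) \<union> ?X \<eta>)) (\<lambda>\<eta> I s. map (fst s) (?S \<eta> @ [32]) \<in>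
            table (length (snd I)) (p \<eta> + 3) (fst s b) (snd s))"
          by (rule linear_table[where k = 8]) (use p3 n in \<open>auto dest: block_ge\<close>)
        then show "linear good (\<lambda>\<eta>. insert 32 (set (?S \<eta>) \<union> ?X \<eta>)) (\<lambda>\<eta> I s. map (fst s) (?S \<eta>) @ [fst s 32] \<in>
            table (length (snd I)) (p \<eta> + 3) (fst s b) (snd s))" by simp
      qed ((rule reach)?; use b in \<open>auto simp: xs_def n map_upd_notin\<close>)+
    next
      show "\<forall>x\<in>set (?S \<eta>). 20 \<le> x" for \<eta> using block_ge by fastforce
    qed (simp_all only: fst_conv snd_conv upB upv n length_block distinct_block p3)
  qed (rule linear_not linear_sset[where k = 8]; use p3 in simp)+
  then show ?thesis
  proof (rule linear_cong)
    fix \<eta> and I :: "('a, 'b) listed" and s assume g: "good \<eta> I s" "below (?X \<eta>) s"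
    interpret listed_graph "fst I" "snd I" using g(1) by (simp add: good_def reach_state_def input_state_def)
    have t: "map (fst s) (?B \<eta>) \<in> tuples n (p \<eta> + 2)"
      using below_tuple[OF g(2), of "?B \<eta>" n] n[OF g(1)] by (auto simp: xs_def)
    show "good \<eta> I s \<and> below (?X \<eta>) s \<and> (
      (\<not> fst s 20 \<in> sset (map (fst s) (?B \<eta>)) \<and>
    (\<exists>s'\<in>tuples n (p \<eta> + 2).
       (\<forall>x<n. \<forall>y<n. ?r \<eta> I s (fst s 20) x \<and> snd I ! x \<rightarrow>\<^bsub>fst I\<^esub> snd I ! y \<and>
         \<not> ?r \<eta> I s (fst s 20) y \<longrightarrow> y \<in> sset s') \<and>
       (\<forall>u<n. ?r \<eta> I s (fst s 20) u \<and> \<not> u \<in> sset s' \<longrightarrow>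
         s' @ [u] \<in> table n (p \<eta> + 3) (fst s b) (snd s)))) \<longleftrightarrow>
      win_step (p \<eta>) (table n (p \<eta> + 3) (fst s b) (snd s)) (map (fst s) (xs \<eta>)))"
      using g win_step_snoc[OF t, of "table n (p \<eta> + 3) (fst s b) (snd s)" "fst s 20"]
      by (simp only: xs_def map_append list.map)
  qed
qed

text \<open>The numbers 30, 31 and 32 are bound inside \<open>linear_side\<close> and
  \<open>linear_max\<close>, so variables for the vertices in these formulas have to differ from
  them.\<close>

definition sep :: "nat \<Rightarrow> bool" where
  "sep x \<longleftrightarrow> 20 \<le> x \<and> x < 40 \<and> x \<noteq> 30 \<and> x \<noteq> 31 \<and> x \<noteq> 32"

abbreviation sets :: "nat \<Rightarrow> nat \<Rightarrow> nat list" where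
  "sets i \<eta> \<equiv> block i (2 * \<eta> + 4) \<eta>"

lemma sets_facts:
  "x < 40 \<Longrightarrow> x \<notin> set (sets i \<eta>)" "\<forall>x\<in>set (sets i \<eta>). 20 \<le> x" "length (sets i \<eta>) = 2 * \<eta> + 4"
  "distinct (sets i \<eta>)"
  using block_ge[of _ i "2 * \<eta> + 4" \<eta>] by fastforce+

lemma upds_sets: "i \<noteq> k \<Longrightarrow> map (upds e (sets k \<eta>) t) (sets i \<eta>) = map e (sets i \<eta>)"
  using block_disjoint[of i k "2 * \<eta> + 4" \<eta> "2 * \<eta> + 4"] block_disjoint[of k i "2 * \<eta> + 4" \<eta> "2 * \<eta> + 4"]
  by (intro map_upds_other) (cases i k rule: linorder_cases; auto)

lemma upd_sets: "x < 40 \<Longrightarrow> map (e(x := v)) (sets i \<eta>) = map e (sets i \<eta>)"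
  by (rule map_upd_notin) simp

lemma upds_sets_var: "x < 40 \<Longrightarrow> upds e (sets k \<eta>) t x = e x"
  by simp

lemma wide_state_graph: "wide_state \<eta> I s \<Longrightarrow> listed_graph (fst I) (snd I)"
  unfolding wide_state_def narrow_state_def reach_state_def input_state_def by blast

lemma wide_state_tables:
  assumes "wide_state \<eta> I s"
  shows "listed_graph (fst I) (snd I) \<and> fst s 0 = length (snd I) \<and>
    table (length (snd I)) (3 * \<eta> + 3 + 3) (fst s 3) (snd s) = listed_graph.win_table (fst I) (snd I) (3 * \<eta> + 3)"
    "listed_graph (fst I) (snd I) \<and> fst s 0 = length (snd I) \<and>
    table (length (snd I)) (5 * \<eta> + 5 + 3) (fst s 4) (snd s) = listed_graph.win_table (fst I) (snd I) (5 * \<eta> + 5)"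
  using wide_state_graph[OF assms] wide_state_n[OF assms] assms
  unfolding wide_state_def narrow_state_def by blast+

lemma linear_sets_reach:
  assumes "\<And>\<eta>. set (sets i \<eta>) \<subseteq> X \<eta>" "\<And>\<eta>. u \<in> X \<eta>" "\<And>\<eta>. v \<in> X \<eta>" "20 \<le> u" "20 \<le> v"
  shows "linear wide_state X (\<lambda>\<eta> I s. listed_graph.reach (fst I) (snd I) (map (fst s) (sets i \<eta>)) (fst s u) (fst s v))"
  by (intro linear_wide_state linear_narrow_state linear_reach) (use assms sets_facts in simp_all)

lemma linear_wide_adj:
  assumes "\<And>\<eta>. u \<in> X \<eta>" "\<And>\<eta>. v \<in> X \<eta>" "20 \<le> u" "20 \<le> v"
  shows "linear wide_state X (\<lambda>\<eta> I s. snd I ! fst s u \<rightarrow>\<^bsub>fst I\<^esub> snd I ! fst s v)"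
  by (intro linear_wide_state linear_narrow_state linear_reach_state linear_adj assms)

lemma linear_sets_in: "linear good X (\<lambda>\<eta> I s. fst s x \<in> sset (map (fst s) (sets i \<eta>)))"
  by (rule linear_sset[where k = 4]) simp_all

lemma linear_side:
  assumes "\<And>\<eta>. set (sets i \<eta>) \<subseteq> X \<eta>" "\<And>\<eta>. v \<in> X \<eta>" "sep v"
  shows "linear wide_state X (\<lambda>\<eta> I s. listed_graph.side (fst I) (snd I) (map (fst s) (sets i \<eta>)) (fst s v))"
proof -
  have v: "20 \<le> v" "v \<noteq> 30" "v \<noteq> 31" using assms(3) by (simp_all add: sep_def)
  have "linear wide_state X (\<lambda>\<eta> I s. \<forall>y<length (snd I). y \<in> sset (map (fst s) (sets i \<eta>)) \<longrightarrow>
      (\<exists>x<length (snd I). listed_graph.reach (fst I) (snd I) (map (fst s) (sets i \<eta>)) (fst s v) x \<and>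
         snd I ! x \<rightarrow>\<^bsub>fst I\<^esub> snd I ! y))"
  proof (rule linear_allq[where x = 30, OF _ upd_closed_states(4)])
    show "linear wide_state (\<lambda>\<eta>. insert 30 (X \<eta>)) (\<lambda>\<eta> I s. fst s 30 \<in> sset (map (fst s) (sets i \<eta>)) \<longrightarrow>
      (\<exists>x<length (snd I). listed_graph.reach (fst I) (snd I) (map (fst s) (sets i \<eta>)) (fst s v) x \<and>
         snd I ! x \<rightarrow>\<^bsub>fst I\<^esub> snd I ! fst s 30))"
    proof (rule linear_imp[OF linear_sets_in], rule linear_exq[where x = 31, OF linear_conj upd_closed_states(4)])
      show "linear wide_state (\<lambda>\<eta>. insert 31 (insert 30 (X \<eta>)))
        (\<lambda>\<eta> I s. listed_graph.reach (fst I) (snd I) (map (fst s) (sets i \<eta>)) (fst s v) (fst s 31))"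
        by (rule linear_sets_reach) (use assms v in auto)
      show "linear wide_state (\<lambda>\<eta>. insert 31 (insert 30 (X \<eta>))) (\<lambda>\<eta> I s. snd I ! fst s 31 \<rightarrow>\<^bsub>fst I\<^esub> snd I ! fst s 30)"
        by (rule linear_wide_adj) auto
    qed (use v wide_state_n in \<open>simp_all add: upd_sets\<close>)
  qed (use v wide_state_n in \<open>simp_all add: upd_sets\<close>)
  then show ?thesis
    by (rule linear_cong) (simp add: listed_graph.side_def[OF wide_state_graph])
qed

lemma linear_small_bad:
  assumes "\<And>\<eta>. set (sets i \<eta>) \<subseteq> X \<eta>" "\<And>\<eta>. v \<in> X \<eta>" "sep v"
  shows "linear wide_state X (\<lambda>\<eta> I s. listed_graph.small_code (fst I) (snd I) \<eta> (map (fst s) (sets i \<eta>)) (fst s v))"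
    and "linear wide_state X (\<lambda>\<eta> I s. listed_graph.bad_code (fst I) (snd I) \<eta> (map (fst s) (sets i \<eta>)) (fst s v))"
proof -
  have v: "20 \<le> v" using assms(3) by (simp add: sep_def)
  have narrow: "linear wide_state X
    (\<lambda>\<eta> I s. listed_graph.wins (fst I) (snd I) (3 * \<eta> + 3) (map (fst s) (sets i \<eta>)) (fst s v))"
    by (rule linear_wins[where b = 3 and k = 6])
       (erule wide_state_tables | use assms v sets_facts in simp)+
  have wide: "linear wide_state X
    (\<lambda>\<eta> I s. listed_graph.wins (fst I) (snd I) (5 * \<eta> + 5) (map (fst s) (sets i \<eta>)) (fst s v))"
    by (rule linear_wins[where b = 4 and k = 8])
       (erule wide_state_tables | use assms v sets_facts in simp)+
  note side = linear_side[OF assms]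
  show "linear wide_state X (\<lambda>\<eta> I s. listed_graph.small_code (fst I) (snd I) \<eta> (map (fst s) (sets i \<eta>)) (fst s v))"
    by (rule linear_cong[OF linear_conj[OF side narrow]])
       (simp add: listed_graph.small_code_def[OF wide_state_graph])
  show "linear wide_state X (\<lambda>\<eta> I s. listed_graph.bad_code (fst I) (snd I) \<eta> (map (fst s) (sets i \<eta>)) (fst s v))"
    by (rule linear_cong[OF linear_conj[OF side linear_conj[OF wide linear_not[OF narrow]]]])
       (simp add: listed_graph.bad_code_def[OF wide_state_graph])
qed

text \<open>Block 2 is bound by the competing tuple; therefore \<open>i \<noteq> 2\<close>.\<close>

lemma linear_max:
  assumes "\<And>\<eta>. set (sets i \<eta>) \<subseteq> X \<eta>" "\<And>\<eta>. v \<in> X \<eta>" "sep v" "i \<noteq> 2"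
  shows "linear wide_state X (\<lambda>\<eta> I s. listed_graph.max_code (fst I) (snd I) \<eta> (map (fst s) (sets i \<eta>)) (fst s v))"
proof -
  have v: "20 \<le> v" "v < 40" "v \<noteq> 32" using assms(3) by (simp_all add: sep_def)
  let ?r = "\<lambda>(I :: ('a, 'b) listed). listed_graph.reach (fst I) (snd I)"
  let ?t = "\<lambda>\<eta> (s :: state). map (fst s) (sets i \<eta>)"
  have "linear wide_state X (\<lambda>\<eta> (I :: ('a, 'b) listed) s. \<exists>t'\<in>tuples (length (snd I)) (2 * \<eta> + 4).
     listed_graph.small_code (fst I) (snd I) \<eta> t' (fst s v) \<and>
     (\<exists>u<length (snd I). ?r I t' (fst s v) u \<and> \<not> ?r I (?t \<eta> s) (fst s v) u) \<and>
     (\<forall>u<length (snd I). ?r I (?t \<eta> s) (fst s v) u \<longrightarrow> ?r I t' (fst s v) u))"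
  proof (rule linear_ex_tupleq[where xs = "sets 2" and k = 4, OF linear_conj[OF _ linear_conj] upd_closed_states(4)])
    show "linear wide_state (\<lambda>\<eta>. set (sets 2 \<eta>) \<union> X \<eta>) (\<lambda>\<eta> I s.
      listed_graph.small_code (fst I) (snd I) \<eta> (map (fst s) (sets 2 \<eta>)) (fst s v))"
      by (rule linear_small_bad) (use assms in auto)
    have 1: "linear wide_state (\<lambda>\<eta>. insert 32 (set (sets 2 \<eta>) \<union> X \<eta>))
      (\<lambda>\<eta> I s. ?r I (map (fst s) (sets 2 \<eta>)) (fst s v) (fst s 32))"
      by (rule linear_sets_reach) (use assms v in auto)
    have 2: "linear wide_state (\<lambda>\<eta>. insert 32 (set (sets 2 \<eta>) \<union> X \<eta>))
      (\<lambda>\<eta> I s. ?r I (?t \<eta> s) (fst s v) (fst s 32))"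
      by (rule linear_sets_reach) (use assms v in auto)
    show "linear wide_state (\<lambda>\<eta>. set (sets 2 \<eta>) \<union> X \<eta>) (\<lambda>\<eta> I s. \<exists>u<length (snd I).
      ?r I (map (fst s) (sets 2 \<eta>)) (fst s v) u \<and> \<not> ?r I (?t \<eta> s) (fst s v) u)"
      by (rule linear_exq[where x = 32, OF _ upd_closed_states(4)], rule linear_conj[OF 1 linear_not[OF 2]])
         (use v wide_state_n in \<open>simp_all add: upd_sets\<close>)
    show "linear wide_state (\<lambda>\<eta>. set (sets 2 \<eta>) \<union> X \<eta>) (\<lambda>\<eta> I s. \<forall>u<length (snd I).
      ?r I (?t \<eta> s) (fst s v) u \<longrightarrow> ?r I (map (fst s) (sets 2 \<eta>)) (fst s v) u)"
      by (rule linear_allq[where x = 32, OF _ upd_closed_states(4)], rule linear_imp[OF 2 1])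
         (use v wide_state_n in \<open>simp_all add: upd_sets\<close>)
  next
    show "2 * \<eta> + 4 \<le> 4 * (\<eta> + 1)" for \<eta> :: nat by simp
    show "wide_state \<eta> I s \<Longrightarrow> fst s 0 = length (snd I)" for \<eta> s and I :: "('a, 'b) listed" by (rule wide_state_n)
  qed (rule sets_facts | simp only: fst_conv snd_conv upds_sets[OF assms(4)] upds_sets_var[OF v(2)])+
  from linear_conj[OF linear_small_bad(1)[OF assms(1-3)] linear_not[OF this]]
  show ?thesis
    by (rule linear_cong) (simp only: listed_graph.max_code_def[OF wide_state_graph] simp_thms)
qed

lemma linear_low:
  assumes "\<And>\<eta>. v \<in> X \<eta>" "sep v"
  shows "linear wide_state X (\<lambda>\<eta> I s. listed_graph.low (fst I) (snd I) \<eta> (fst s v))"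
proof -
  have v: "v < 40" using assms(2) by (simp add: sep_def)
  have "linear wide_state X (\<lambda>\<eta> (I :: ('a, 'b) listed) s. \<exists>t'\<in>tuples (length (snd I)) (2 * \<eta> + 4).
     listed_graph.small_code (fst I) (snd I) \<eta> t' (fst s v))"
  proof (rule linear_ex_tupleq[where xs = "sets 2" and k = 4, OF _ upd_closed_states(4)])
    show "linear wide_state (\<lambda>\<eta>. set (sets 2 \<eta>) \<union> X \<eta>) (\<lambda>\<eta> I s.
      listed_graph.small_code (fst I) (snd I) \<eta> (map (fst s) (sets 2 \<eta>)) (fst s v))"
      by (rule linear_small_bad) (use assms in auto)
  next
    show "2 * \<eta> + 4 \<le> 4 * (\<eta> + 1)" for \<eta> :: nat by simp
    show "wide_state \<eta> I s \<Longrightarrow> fst s 0 = length (snd I)" for \<eta> s and I :: "('a, 'b) listed" by (rule wide_state_n)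
  qed (rule sets_facts | simp only: fst_conv snd_conv upds_sets_var[OF v])+
  then show ?thesis
    by (rule linear_cong) (simp only: listed_graph.low_def[OF wide_state_graph] simp_thms)
qed

lemma linear_any_bad:
  "linear wide_state X (\<lambda>\<eta> I s. listed_graph.any_bad (fst I) (snd I) \<eta>)"
proof -
  have "linear wide_state X (\<lambda>\<eta> (I :: ('a, 'b) listed) s. \<exists>t'\<in>tuples (length (snd I)) (2 * \<eta> + 4).
     \<exists>v<length (snd I). listed_graph.bad_code (fst I) (snd I) \<eta> t' v)"
  proof (rule linear_ex_tupleq[where xs = "sets 2" and k = 4, OF _ upd_closed_states(4)])
    have "linear wide_state (\<lambda>\<eta>. insert 33 (set (sets 2 \<eta>) \<union> X \<eta>)) (\<lambda>\<eta> I s.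
      listed_graph.bad_code (fst I) (snd I) \<eta> (map (fst s) (sets 2 \<eta>)) (fst s 33))"
      by (rule linear_small_bad) (auto simp: sep_def)
    then show "linear wide_state (\<lambda>\<eta>. set (sets 2 \<eta>) \<union> X \<eta>) (\<lambda>\<eta> I s.
      \<exists>v<length (snd I). listed_graph.bad_code (fst I) (snd I) \<eta> (map (fst s) (sets 2 \<eta>)) v)"
    proof (rule linear_exq[where x = 33, OF _ upd_closed_states(4)])
      have "map (e(33 := v)) (sets 2 \<eta>) = map e (sets 2 \<eta>)" for e v \<eta> by (rule upd_sets) simp
      note * = this
      fix \<eta> I v w and s :: state
      show "listed_graph.bad_code (fst I) (snd I) \<eta> (map (fst ((fst s)(33 := v), snd s)) (sets 2 \<eta>)) w \<longleftrightarrow>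
        listed_graph.bad_code (fst I) (snd I) \<eta> (map (fst s) (sets 2 \<eta>)) w"
        by (simp only: fst_conv *)
    qed (use wide_state_n in simp_all)
  next
    show "2 * \<eta> + 4 \<le> 4 * (\<eta> + 1)" for \<eta> :: nat by simp
    show "wide_state \<eta> I s \<Longrightarrow> fst s 0 = length (snd I)" for \<eta> s and I :: "('a, 'b) listed" by (rule wide_state_n)
  qed (rule sets_facts refl)+
  then show ?thesis
    by (rule linear_cong) (simp only: listed_graph.any_bad_def[OF wide_state_graph] simp_thms)
qed

context listed_graph
begin

definition valid_tuple :: "nat \<Rightarrow> nat list \<Rightarrow> bool" where
  "valid_tuple \<eta> p \<longleftrightarrow>
     valid_code \<eta> (take (2 * \<eta> + 4) p) (p ! (2 * \<eta> + 4)) (p ! (2 * \<eta> + 5)) (p ! (2 * \<eta> + 6))"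

definition member_tuple :: "nat \<Rightarrow> nat list \<Rightarrow> nat \<Rightarrow> bool" where
  "member_tuple \<eta> p x \<longleftrightarrow>
     member_code \<eta> (take (2 * \<eta> + 4) p) (p ! (2 * \<eta> + 4)) (p ! (2 * \<eta> + 5)) (p ! (2 * \<eta> + 6)) x"

text \<open>A member has many codes, for instance by reordering a separator. The valid code with the
  least number represents it.\<close>

definition new_tuple :: "nat \<Rightarrow> nat list \<Rightarrow> bool" where
  "new_tuple \<eta> p \<longleftrightarrow> valid_tuple \<eta> p \<and>
     \<not> (\<exists>p'\<in>tuples n (2 * \<eta> + 7). code n p' < code n p \<and> valid_tuple \<eta> p' \<and>
       (\<forall>i<n. member_tuple \<eta> p' i \<longleftrightarrow> member_tuple \<eta> p i))"

lemma tuple_code: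
  assumes "length t = 2 * \<eta> + 4"
  shows "valid_tuple \<eta> (t @ [v, f, g]) = valid_code \<eta> t v f g"
    and "member_tuple \<eta> (t @ [v, f, g]) = member_code \<eta> t v f g"
  using assms by (simp_all add: valid_tuple_def member_tuple_def[abs_def] nth_append)

lemma hit_family_tuples:
  "hit_family \<eta> = (\<lambda>p. (!) vs ` {x. x < n \<and> member_tuple \<eta> p x}) ` {p \<in> tuples n (2 * \<eta> + 7). valid_tuple \<eta> p}"
  (is "_ = ?F")
proof
  show "hit_family \<eta> \<subseteq> ?F"
  proof
    fix A assume "A \<in> hit_family \<eta>"
    then obtain t v f g where t: "t \<in> tuples n (2 * \<eta> + 4)" "v < n" "f < n" "g < n" "valid_code \<eta> t v f g"
      "A = (!) vs ` {x. x < n \<and> member_code \<eta> t v f g x}"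
      unfolding hit_family_codes by blast
    have len: "length t = 2 * \<eta> + 4" using t(1) by (simp add: tuples_def)
    have "t @ [v, f, g] \<in> tuples n (2 * \<eta> + 7)" using t by (simp add: tuples_def)
    then show "A \<in> ?F" using t(5,6) unfolding tuple_code[OF len, symmetric] by blast
  qed
  show "?F \<subseteq> hit_family \<eta>"
  proof
    fix A assume "A \<in> ?F"
    then obtain p where p: "p \<in> tuples n (2 * \<eta> + 7)" "valid_tuple \<eta> p"
      "A = (!) vs ` {x. x < n \<and> member_tuple \<eta> p x}" by blast
    have "p \<in> tuples n (2 * \<eta> + 4 + 1 + 2)" using p(1) by (simp add: eval_nat_numeral)
    then obtain s f g where s: "p = s @ [f, g]" "s \<in> tuples n (2 * \<eta> + 4 + 1)" "f < n" "g < n"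
      by (rule split_tuple2)
    obtain t v where t: "s = t @ [v]" "t \<in> tuples n (2 * \<eta> + 4)" "v < n"
      using s(2) by (rule split_tuple1)
    have len: "length t = 2 * \<eta> + 4" using t(2) by (simp add: tuples_def)
    have pt: "p = t @ [v, f, g]" using s(1) t(1) by simp
    show "A \<in> hit_family \<eta>"
      using p(2,3) t(2,3) s(3,4) unfolding hit_family_codes pt tuple_code[OF len] by blast
  qed
qed

end

lemma linear_valid_tuple:
  assumes "\<And>\<eta>. set (sets i \<eta>) \<subseteq> X \<eta>" "i \<noteq> 2" "\<And>\<eta>. {v, f, g} \<subseteq> X \<eta>" "sep v" "sep f" "sep g"
  shows "linear wide_state X (\<lambda>\<eta> I s. listed_graph.valid_tuple (fst I) (snd I) \<eta> (map (fst s) (sets i \<eta> @ [v, f, g])))"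
proof -
  have X: "v \<in> X \<eta>" "f \<in> X \<eta>" "g \<in> X \<eta>" for \<eta> using assms(3) by auto
  have fg: "20 \<le> f" "20 \<le> g" using assms(5,6) by (simp_all add: sep_def)
  note any = linear_any_bad[of X]
  from linear_disj[OF linear_conj[OF any linear_small_bad(2)[OF assms(1) X(1) assms(4)]]
    linear_conj[OF linear_not[OF any] linear_disj[OF
      linear_conj[OF linear_eq[of _ _ "\<lambda>_. f" "\<lambda>_. g"] linear_max[OF assms(1) X(1) assms(4,2)]]
      linear_conj[OF linear_wide_adj[OF X(2,3) fg]
        linear_conj[OF linear_not[OF linear_low[OF X(2) assms(5)]] linear_not[OF linear_low[OF X(3) assms(6)]]]]]]]
  show ?thesis
  proof (rule linear_cong)
    fix \<eta> and I :: "('a, 'b) listed" and s assume g: "wide_state \<eta> I s" "below (X \<eta>) s"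
    interpret listed_graph "fst I" "snd I" by (rule wide_state_graph[OF g(1)])
    have "length (map (fst s) (sets i \<eta>)) = 2 * \<eta> + 4" by simp
    note * = tuple_code(1)[OF this]
    show "wide_state \<eta> I s \<and> below (X \<eta>) s \<and> ((any_bad \<eta> \<and> bad_code \<eta> (map (fst s) (sets i \<eta>)) (fst s v) \<or>
      \<not> any_bad \<eta> \<and> (fst s f = fst s g \<and> max_code \<eta> (map (fst s) (sets i \<eta>)) (fst s v) \<or>
        adj (fst s f) (fst s g) \<and> \<not> low \<eta> (fst s f) \<and> \<not> low \<eta> (fst s g))) \<longleftrightarrow>
      valid_tuple \<eta> (map (fst s) (sets i \<eta> @ [v, f, g])))"
      using g by (simp only: * map_append list.map valid_code_def simp_thms)
  qed
qed

lemma linear_member_tuple: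
  assumes "\<And>\<eta>. set (sets i \<eta>) \<subseteq> X \<eta>" "i \<noteq> 2" "\<And>\<eta>. {v, f, g, x} \<subseteq> X \<eta>" "sep v" "sep x"
  shows "linear wide_state X
    (\<lambda>\<eta> I s. listed_graph.member_tuple (fst I) (snd I) \<eta> (map (fst s) (sets i \<eta> @ [v, f, g])) (fst s x))"
proof -
  have X: "v \<in> X \<eta>" "f \<in> X \<eta>" "g \<in> X \<eta>" "x \<in> X \<eta>" for \<eta> using assms(3) by auto
  have vx: "20 \<le> v" "20 \<le> x" using assms(4,5) by (simp_all add: sep_def)
  note any = linear_any_bad[of X] and eq = linear_eq[of wide_state X "\<lambda>_. f" "\<lambda>_. g"]
  from linear_disj[OF linear_conj[OF any linear_disj[OF linear_sets_reach[OF assms(1) X(1,4) vx] linear_sets_in[of _ _ x i]]]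
    linear_conj[OF linear_not[OF any] linear_disj[OF
      linear_conj[OF eq linear_disj[OF linear_sets_in[of _ _ x i] linear_max[OF assms(1) X(4) assms(5,2)]]]
      linear_conj[OF linear_not[OF eq]
        linear_disj[OF linear_eq[of _ _ "\<lambda>_. x" "\<lambda>_. f"] linear_eq[of _ _ "\<lambda>_. x" "\<lambda>_. g"]]]]]]
  show ?thesis
  proof (rule linear_cong)
    fix \<eta> and I :: "('a, 'b) listed" and s assume g: "wide_state \<eta> I s" "below (X \<eta>) s"
    interpret listed_graph "fst I" "snd I" by (rule wide_state_graph[OF g(1)])
    let ?t = "map (fst s) (sets i \<eta>)"
    have "length ?t = 2 * \<eta> + 4" by simp
    note * = tuple_code(2)[OF this]
    show "wide_state \<eta> I s \<and> below (X \<eta>) s \<and> ((any_bad \<eta> \<and> (reach ?t (fst s v) (fst s x) \<or> fst s x \<in> sset ?t) \<or>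
      \<not> any_bad \<eta> \<and> (fst s f = fst s g \<and> (fst s x \<in> sset ?t \<or> max_code \<eta> ?t (fst s x)) \<or>
        fst s f \<noteq> fst s g \<and> (fst s x = fst s f \<or> fst s x = fst s g))) \<longleftrightarrow>
      member_tuple \<eta> (map (fst s) (sets i \<eta> @ [v, f, g])) (fst s x))"
      using g by (simp only: * map_append list.map member_code_def simp_thms)
  qed
qed

text \<open>Two disjoint sets of variables for codes are provided, because \<open>new_tuple\<close>
  compares two codes. The blocks 0 and 1 leave block 2 to the quantifiers inside.\<close>

definition params :: "nat \<Rightarrow> nat list" where
  "params \<eta> = sets 0 \<eta> @ [20, 21, 22]"

definition params' :: "nat \<Rightarrow> nat list" where
  "params' \<eta> = sets 1 \<eta> @ [23, 24, 25]"

lemma params_facts: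
  "length (params \<eta>) = 2 * \<eta> + 7" "length (params' \<eta>) = 2 * \<eta> + 7" "distinct (params \<eta>)" "distinct (params' \<eta>)"
  "set (params \<eta>) \<inter> set (params' \<eta>) = {}" "\<forall>x\<in>set (params \<eta>). 20 \<le> x" "\<forall>x\<in>set (params' \<eta>). 20 \<le> x"
  "26 \<notin> set (params \<eta>)" "34 \<notin> set (params \<eta>)" "34 \<notin> set (params' \<eta>)"
proof -
  show "set (params \<eta>) \<inter> set (params' \<eta>) = {}"
    using block_disjoint[of 0 1 "2 * \<eta> + 4" \<eta> "2 * \<eta> + 4"] by (auto simp: params_def params'_def dest: block_ge)
qed (auto simp: params_def params'_def dest: block_ge)

lemma linear_member:
  "linear wide_state (\<lambda>\<eta>. insert 26 (set (params \<eta>)))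
    (\<lambda>\<eta> I s. listed_graph.member_tuple (fst I) (snd I) \<eta> (map (fst s) (params \<eta>)) (fst s 26))"
  unfolding params_def by (rule linear_member_tuple) (auto simp: sep_def)

lemma linear_new:
  "linear wide_state (\<lambda>\<eta>. set (params \<eta>))
    (\<lambda>\<eta> I s. listed_graph.new_tuple (fst I) (snd I) \<eta> (map (fst s) (params \<eta>)))"
proof -
  let ?n = "\<lambda>I :: ('a, 'b) listed. length (snd I)"
  let ?v = "\<lambda>I :: ('a, 'b) listed. listed_graph.valid_tuple (fst I) (snd I)"
  let ?m = "\<lambda>I :: ('a, 'b) listed. listed_graph.member_tuple (fst I) (snd I)"
  let ?p = "\<lambda>\<eta> (s :: state). map (fst s) (params \<eta>)"
  let ?X = "\<lambda>\<eta>. set (params' \<eta>) \<union> set (params \<eta>)"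
  have valid: "linear wide_state (\<lambda>\<eta>. set (params \<eta>)) (\<lambda>\<eta> I s. ?v I \<eta> (?p \<eta> s))"
    unfolding params_def by (rule linear_valid_tuple) (auto simp: sep_def)
  have valid': "linear wide_state ?X (\<lambda>\<eta> I s. ?v I \<eta> (map (fst s) (params' \<eta>)))"
    unfolding params'_def by (rule linear_valid_tuple) (auto simp: sep_def)
  have member: "linear wide_state (\<lambda>\<eta>. insert 34 (?X \<eta>)) (\<lambda>\<eta> I s. ?m I \<eta> (?p \<eta> s) (fst s 34))"
    unfolding params_def by (rule linear_member_tuple) (auto simp: sep_def)
  have member': "linear wide_state (\<lambda>\<eta>. insert 34 (?X \<eta>)) (\<lambda>\<eta> I s. ?m I \<eta> (map (fst s) (params' \<eta>)) (fst s 34))"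
    unfolding params'_def by (rule linear_member_tuple) (auto simp: sep_def)
  have less: "linear wide_state ?X (\<lambda>\<eta> I s. code (?n I) (map (fst s) (params' \<eta>)) < code (?n I) (?p \<eta> s))"
  proof (rule linear_cong[OF linear_code_less[of params' 7 params wide_state]])
    show "0 \<notin> set (params \<eta>)" "1 \<notin> set (params \<eta>)" "0 \<notin> set (params' \<eta>)" "1 \<notin> set (params' \<eta>)" for \<eta>
      using params_facts(6,7)[of \<eta>] by fastforce+
    show "length (params' \<eta>) \<le> 7 * (\<eta> + 1)" "length (params \<eta>) \<le> 7 * (\<eta> + 1)" for \<eta>
      by (simp_all add: params_facts)
  qed (simp add: wide_state_n)
  have same: "linear wide_state ?X (\<lambda>\<eta> I s. \<forall>i<?n I. ?m I \<eta> (map (fst s) (params' \<eta>)) i \<longleftrightarrow> ?m I \<eta> (?p \<eta> s) i)"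
    by (rule linear_allq[where x = 34, OF _ upd_closed_states(4)], rule linear_eqv[OF member' member])
       (use wide_state_n in \<open>simp_all add: map_upd_notin params_facts\<close>)
  have "linear wide_state (\<lambda>\<eta>. set (params \<eta>)) (\<lambda>\<eta> I s. \<exists>p'\<in>tuples (?n I) (2 * \<eta> + 7).
      code (?n I) p' < code (?n I) (?p \<eta> s) \<and> ?v I \<eta> p' \<and> (\<forall>i<?n I. ?m I \<eta> p' i \<longleftrightarrow> ?m I \<eta> (?p \<eta> s) i))"
  proof (rule linear_ex_tupleq[where xs = params' and k = 7, OF _ upd_closed_states(4)],
      rule linear_conj[OF less linear_conj[OF valid' same]])
    show "2 * \<eta> + 7 \<le> 7 * (\<eta> + 1)" for \<eta> :: nat by simp
    show "wide_state \<eta> I s \<Longrightarrow> fst s 0 = length (snd I)" for \<eta> s and I :: "('a, 'b) listed" by (rule wide_state_n)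
    have "map (upds e (params' \<eta>) t) (params \<eta>) = map e (params \<eta>)" for e \<eta> t
      by (rule map_upds_other[OF params_facts(5)])
    note * = this
    fix \<eta> t w and I :: "('a, 'b) listed" and s :: state
    show "(code (?n I) w < code (?n I) (?p \<eta> (upds (fst s) (params' \<eta>) t, snd s)) \<and> ?v I \<eta> w \<and>
        (\<forall>i<?n I. ?m I \<eta> w i \<longleftrightarrow> ?m I \<eta> (?p \<eta> (upds (fst s) (params' \<eta>) t, snd s)) i)) \<longleftrightarrow>
      (code (?n I) w < code (?n I) (?p \<eta> s) \<and> ?v I \<eta> w \<and> (\<forall>i<?n I. ?m I \<eta> w i \<longleftrightarrow> ?m I \<eta> (?p \<eta> s) i))"
      by (simp only: fst_conv *)
  qed (rule params_facts)+
  from linear_conj[OF valid linear_not[OF this]] show ?thesis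
    by (rule linear_cong) (simp only: listed_graph.new_tuple_def[OF wide_state_graph] simp_thms)
qed

section \<open>The program\<close>

text \<open>What a phase must respect so that earlier results stay valid: the variables with the
  addresses, and the memory below its own area.\<close>

definition frame :: "nat set \<Rightarrow> nat \<Rightarrow> state \<Rightarrow> state \<Rightarrow> bool" where
  "frame X lo s s' \<longleftrightarrow> (\<forall>z\<in>X. fst s' z = fst s z) \<and> (\<forall>k<lo. snd s' k = snd s k)"

lemma table_cong:
  assumes "\<And>k. k < B + n ^ a \<Longrightarrow> M' k = M k"
  shows "table n a B M' = table n a B M"
  unfolding table_def using assms code_less by fastforce

lemma input_state_frame:
  assumes "input_state \<eta> I s" "frame X lo s s'" "{0, 8} \<subseteq> X" "length (snd I) * length (snd I) \<le> lo"
  shows "input_state \<eta> I s'"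
proof -
  have "i * length (snd I) + k < lo" if "i < length (snd I)" "k < length (snd I)" for i k
  proof -
    have "i * length (snd I) + k < Suc i * length (snd I)" using that by simp
    also have "\<dots> \<le> length (snd I) * length (snd I)" using that by (intro mult_le_mono1) simp
    finally show ?thesis using assms(4) by simp
  qed
  then show ?thesis using assms(1-3) by (auto simp: input_state_def frame_def)
qed

lemma reach_state_frame:
  assumes "reach_state \<eta> I s" "frame X lo s s'" "{0, 2, 8} \<subseteq> X" "length (snd I) * length (snd I) \<le> lo"
    "fst s 2 + length (snd I) ^ (5 * \<eta> + 5 + 4) \<le> lo"
  shows "reach_state \<eta> I s'"
proof -
  have "input_state \<eta> I s'"
    by (rule input_state_frame[OF _ assms(2) _ assms(4)]) (use assms(1,3) in \<open>auto simp: reach_state_def\<close>)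
  moreover have "table (length (snd I)) (5 * \<eta> + 5 + 4) (fst s 2) (snd s') =
      table (length (snd I)) (5 * \<eta> + 5 + 4) (fst s 2) (snd s)"
    by (rule table_cong) (use assms(2,5) in \<open>auto simp: frame_def\<close>)
  moreover have "fst s' 2 = fst s 2" using assms(2,3) by (auto simp: frame_def)
  ultimately show ?thesis using assms(1) unfolding reach_state_def by simp
qed

lemma narrow_state_frame:
  assumes "narrow_state \<eta> I s" "frame X lo s s'" "{0, 2, 3, 8} \<subseteq> X" "length (snd I) * length (snd I) \<le> lo"
    "fst s 2 + length (snd I) ^ (5 * \<eta> + 5 + 4) \<le> lo" "fst s 3 + length (snd I) ^ (3 * \<eta> + 3 + 3) \<le> lo"
  shows "narrow_state \<eta> I s'"
proof -
  have "reach_state \<eta> I s'"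
    by (rule reach_state_frame[OF _ assms(2) _ assms(4,5)]) (use assms(1,3) in \<open>auto simp: narrow_state_def\<close>)
  moreover have "table (length (snd I)) (3 * \<eta> + 3 + 3) (fst s 3) (snd s') =
      table (length (snd I)) (3 * \<eta> + 3 + 3) (fst s 3) (snd s)"
    by (rule table_cong) (use assms(2,6) in \<open>auto simp: frame_def\<close>)
  moreover have "fst s' 3 = fst s 3" using assms(2,3) by (auto simp: frame_def)
  ultimately show ?thesis using assms(1) unfolding narrow_state_def by simp
qed

lemma wide_state_frame:
  assumes "wide_state \<eta> I s" "frame X lo s s'" "{0, 2, 3, 4, 8} \<subseteq> X" "length (snd I) * length (snd I) \<le> lo"
    "fst s 2 + length (snd I) ^ (5 * \<eta> + 5 + 4) \<le> lo" "fst s 3 + length (snd I) ^ (3 * \<eta> + 3 + 3) \<le> lo"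
    "fst s 4 + length (snd I) ^ (5 * \<eta> + 5 + 3) \<le> lo"
  shows "wide_state \<eta> I s'"
proof -
  have "narrow_state \<eta> I s'"
    by (rule narrow_state_frame[OF _ assms(2) _ assms(4-6)]) (use assms(1,3) in \<open>auto simp: wide_state_def\<close>)
  moreover have "table (length (snd I)) (5 * \<eta> + 5 + 3) (fst s 4) (snd s') =
      table (length (snd I)) (5 * \<eta> + 5 + 3) (fst s 4) (snd s)"
    by (rule table_cong) (use assms(2,7) in \<open>auto simp: frame_def\<close>)
  moreover have "fst s' 4 = fst s 4" using assms(2,3) by (auto simp: frame_def)
  ultimately show ?thesis using assms(1) unfolding wide_state_def by simp
qed

definition reach_vars :: "nat \<Rightarrow> nat list" where
  "reach_vars \<eta> = block 0 (5 * \<eta> + 5 + 2) \<eta> @ [20, 21]"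

definition win_vars :: "nat \<Rightarrow> nat \<Rightarrow> nat list" where
  "win_vars p \<eta> = block 0 (p + 2) \<eta> @ [20]"

abbreviation round_vars :: "nat \<Rightarrow> nat \<Rightarrow> nat list" where
  "round_vars \<equiv> block 1"

lemma reach_vars_facts:
  "length (reach_vars \<eta>) = 5 * \<eta> + 5 + 4" "distinct (reach_vars \<eta>)" "x < 20 \<Longrightarrow> x \<notin> set (reach_vars \<eta>)"
  "set (reach_vars \<eta>) \<inter> set (round_vars a \<eta>) = {}"
  using block_disjoint[of 0 1 "5 * \<eta> + 5 + 2" \<eta> a]
  by (auto simp: reach_vars_def dest: block_ge)

lemma win_vars_facts:
  "length (win_vars p \<eta>) = p + 3" "distinct (win_vars p \<eta>)" "x < 20 \<Longrightarrow> x \<notin> set (win_vars p \<eta>)"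
  "p \<le> 5 * \<eta> + 5 \<Longrightarrow> set (win_vars p \<eta>) \<inter> set (round_vars a \<eta>) = {}"
  using block_disjoint[of 0 1 "p + 2" \<eta> a]
  by (auto simp: win_vars_def dest: block_ge)

lemma below_vars:
  "map (fst s) xs \<in> tuples m a \<Longrightarrow> fst s 0 = m \<Longrightarrow> below (set xs) s"
  by (auto simp: below_def tuples_def)

context listed_graph
begin

lemma reach_stage:
  assumes s: "input_state \<eta> (G, vs) s" "fst s 2 = n * n" and zero: "\<And>k. n * n \<le> k \<Longrightarrow> snd s k = 0"
    and Q: "\<And>s. input_state \<eta> (G, vs) s \<Longrightarrow> below (set (reach_vars \<eta>)) s \<Longrightarrow>
      Q s \<longleftrightarrow> reach_step (5 * \<eta> + 5) (table n (5 * \<eta> + 5 + 4) (fst s 2) (snd s)) (map (fst s) (reach_vars \<eta>))"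
  defines "s' \<equiv> stage 2 (round_vars (5 * \<eta> + 5 + 4) \<eta>) (reach_vars \<eta>) Q s"
  shows "reach_state \<eta> (G, vs) s' \<and> (\<forall>z<20. fst s' z = fst s z) \<and>
    (\<forall>k\<ge>n * n + n ^ (5 * \<eta> + 5 + 4). snd s' k = 0)"
proof -
  let ?a = "5 * \<eta> + 5 + 4"
  let ?V = "set (reach_vars \<eta>) \<union> set (round_vars ?a \<eta>)"
  have n: "n = fst s 0" using input_state_n[OF s(1)] by simp
  have frame: "frame {..<20} (n * n) s s2" if "same_off ?V (n * n) (n * n + n ^ ?a) s s2" for s2
    using that reach_vars_facts(3) unfolding same_off_def frame_def by auto
  have *: "same_off ?V (n * n) (n * n + n ^ ?a) s s' \<and> table n ?a (n * n) (snd s') = reach_table (5 * \<eta> + 5)"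
    unfolding s'_def
  proof (rule stage_correct[where \<Phi> = "reach_step (5 * \<eta> + 5)"])
    show "n * n = fst s 2" using s(2) by simp
    show "?a = length (reach_vars \<eta>)" using reach_vars_facts(1) by simp
    fix s2 assume s2: "same_off ?V (n * n) (n * n + n ^ ?a) s s2" "map (fst s2) (reach_vars \<eta>) \<in> tuples n ?a"
    note f = frame[OF s2(1)]
    have "fst s2 0 = n" "fst s2 2 = n * n" using f n s(2) by (simp_all add: frame_def)
    moreover have "input_state \<eta> (G, vs) s2" by (rule input_state_frame[OF s(1) f]) simp_all
    ultimately show "Q s2 \<longleftrightarrow> reach_step (5 * \<eta> + 5) (table n ?a (n * n) (snd s2)) (map (fst s2) (reach_vars \<eta>))"
      using Q[of s2] below_vars[OF s2(2)] by simp
  next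
    show "t \<in> reach_table (5 * \<eta> + 5)"
      if "T \<subseteq> reach_table (5 * \<eta> + 5)" "t \<in> tuples n ?a" "reach_step (5 * \<eta> + 5) T t" for T t
      by (rule reach_sound[OF that])
    show "reach_table (5 * \<eta> + 5) \<subseteq> T"
      if "T \<subseteq> tuples n ?a" "\<And>t. t \<in> tuples n ?a \<Longrightarrow> reach_step (5 * \<eta> + 5) T t \<Longrightarrow> t \<in> T" for T
      by (rule reach_complete[OF that(2)])
  qed (use n reach_vars_facts zero in simp_all)
  note f = frame[OF *[THEN conjunct1]]
  have "input_state \<eta> (G, vs) s'" by (rule input_state_frame[OF s(1) f]) simp_all
  moreover have "fst s' 2 = n * n" using f s(2) by (simp add: frame_def)
  moreover have "snd s' k = 0" if "n * n + n ^ ?a \<le> k" for k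
    using * that zero[of k] unfolding same_off_def by simp
  ultimately show ?thesis using f * unfolding reach_state_def frame_def by simp
qed

lemma win_stage:
  assumes s: "reach_state \<eta> (G, vs) s" "fst s 2 = n * n" and B: "fst s b = B" "n * n + n ^ (5 * \<eta> + 5 + 4) \<le> B"
    and zero: "\<And>k. B \<le> k \<Longrightarrow> snd s k = 0" and p: "p \<le> 5 * \<eta> + 5" and b: "0 < b" "b < 20"
    and Q: "\<And>s. reach_state \<eta> (G, vs) s \<Longrightarrow> below (set (win_vars p \<eta>)) s \<Longrightarrow>
      Q s \<longleftrightarrow> win_step p (table n (p + 3) (fst s b) (snd s)) (map (fst s) (win_vars p \<eta>))"
  defines "s' \<equiv> stage b (round_vars (p + 3) \<eta>) (win_vars p \<eta>) Q s"
  shows "frame {..<20} B s s' \<and> table n (p + 3) (fst s' b) (snd s') = win_table p \<and>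
    (\<forall>k\<ge>B + n ^ (p + 3). snd s' k = 0)"
proof -
  let ?V = "set (win_vars p \<eta>) \<union> set (round_vars (p + 3) \<eta>)"
  have n: "n = fst s 0" using reach_state_n[OF s(1)] by simp
  have frame: "frame {..<20} B s s2" if "same_off ?V B (B + n ^ (p + 3)) s s2" for s2
    using that win_vars_facts(3) unfolding same_off_def frame_def by auto
  have *: "same_off ?V B (B + n ^ (p + 3)) s s' \<and> table n (p + 3) B (snd s') = win_table p"
    unfolding s'_def
  proof (rule stage_correct[where \<Phi> = "win_step p"])
    show "B = fst s b" using B(1) by simp
    show "p + 3 = length (win_vars p \<eta>)" using win_vars_facts(1) by simp
    fix s2 assume s2: "same_off ?V B (B + n ^ (p + 3)) s s2" "map (fst s2) (win_vars p \<eta>) \<in> tuples n (p + 3)"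
    note f = frame[OF s2(1)]
    have "fst s2 0 = n" "fst s2 b = B" using f n B(1) b by (simp_all add: frame_def)
    moreover have "reach_state \<eta> (G, vs) s2"
      by (rule reach_state_frame[OF s(1) f]) (use B s(2) in simp_all)
    ultimately show "Q s2 \<longleftrightarrow> win_step p (table n (p + 3) B (snd s2)) (map (fst s2) (win_vars p \<eta>))"
      using Q[of s2] below_vars[OF s2(2)] by simp
  next
    show "t \<in> win_table p" if "T \<subseteq> win_table p" "t \<in> tuples n (p + 3)" "win_step p T t" for T t
      by (rule win_sound[OF that])
    show "win_table p \<subseteq> T"
      if "T \<subseteq> tuples n (p + 3)" "\<And>t. t \<in> tuples n (p + 3) \<Longrightarrow> win_step p T t \<Longrightarrow> t \<in> T" for T
      by (rule win_complete[OF that(2)])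
  qed (use n win_vars_facts p b zero in simp_all)
  note f = frame[OF *[THEN conjunct1]]
  have "fst s' b = B" using f B(1) b by (simp add: frame_def)
  moreover have "snd s' k = 0" if "B + n ^ (p + 3) \<le> k" for k
    using * that zero[of k] unfolding same_off_def by simp
  ultimately show ?thesis using f * by simp
qed

lemma listing_family:
  assumes s: "wide_state \<eta> (G, vs) s" "fst s 6 = B" "fst s 7 = 0" "n * n \<le> B"
    "fst s 2 + n ^ (5 * \<eta> + 5 + 4) \<le> B" "fst s 3 + n ^ (3 * \<eta> + 3 + 3) \<le> B" "fst s 4 + n ^ (5 * \<eta> + 5 + 3) \<le> B"
    and V: "\<And>s. wide_state \<eta> (G, vs) s \<Longrightarrow> below (set (params \<eta>)) s \<Longrightarrow> V s \<longleftrightarrow> new_tuple \<eta> (map (fst s) (params \<eta>))"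
    and M: "\<And>s. wide_state \<eta> (G, vs) s \<Longrightarrow> below (insert 26 (set (params \<eta>))) s \<Longrightarrow>
      M s \<longleftrightarrow> member_tuple \<eta> (map (fst s) (params \<eta>)) (fst s 26)"
  defines "s' \<equiv> listing (params \<eta>) 26 6 7 V M s"
  shows "fst s' 7 = card (hit_family \<eta>) \<and> fst s' 5 = fst s 5 \<and>
    hit_family \<eta> = (\<lambda>j. {vs ! i |i. i < n \<and> snd s' (B + j * n + i) = 1}) ` {..<card (hit_family \<eta>)}"
proof -
  define F where "F = (\<lambda>p. {i. i < n \<and> member_tuple \<eta> p i}) ` {p \<in> tuples n (2 * \<eta> + 7). valid_tuple \<eta> p}"
  have n: "fst s 0 = n" using wide_state_n[OF s(1)] by simp
  let ?Z = "set (params \<eta>) \<union> {26, 6, 7}"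
  have small: "x \<notin> set (params \<eta>)" if "x < 20" for x using params_facts(6)[of \<eta>] that by fastforce
  have wide: "wide_state \<eta> (G, vs) s2" "fst s2 0 = n"
    if "\<And>z. z \<notin> ?Z \<Longrightarrow> fst s2 z = fst s z" "\<And>k. k < B \<Longrightarrow> snd s2 k = snd s k" for s2
  proof -
    have f: "frame {0, 2, 3, 4, 8} B s s2" using that small by (simp add: frame_def)
    show "wide_state \<eta> (G, vs) s2" by (rule wide_state_frame[OF s(1) f]) (use s in simp_all)
    show "fst s2 0 = n" using f n by (simp add: frame_def)
  qed
  have *: "fst s' 7 = card F \<and> (\<forall>z. z \<notin> ?Z \<longrightarrow> fst s' z = fst s z) \<and>
    F = (\<lambda>j. {i. i < n \<and> snd s' (B + j * n + i) = 1}) ` {..<card F}"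
    unfolding s'_def F_def
  proof (rule listing_correct)
    fix s2 p
    assume s2: "\<And>z. z \<notin> ?Z \<Longrightarrow> fst s2 z = fst s z" "\<And>k. k < B \<Longrightarrow> snd s2 k = snd s k"
      "map (fst s2) (params \<eta>) = p" "p \<in> tuples n (2 * \<eta> + 7)"
    have w: "wide_state \<eta> (G, vs) s2" "fst s2 0 = n"
      by (rule wide[of s2]; erule s2)+
    have b: "below (set (params \<eta>)) s2" using below_vars w(2) s2(3,4) by blast
    show "V s2 \<longleftrightarrow> valid_tuple \<eta> p \<and> \<not> (\<exists>p'\<in>tuples n (2 * \<eta> + 7). code n p' < code n p \<and> valid_tuple \<eta> p' \<and>
        (\<forall>i<n. member_tuple \<eta> p' i \<longleftrightarrow> member_tuple \<eta> p i))"
      by (simp only: V[OF w(1) b] s2(3) new_tuple_def)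
    assume "fst s2 26 < n"
    then have "below (insert 26 (set (params \<eta>))) s2" using b w(2) by (simp add: below_def)
    from M[OF w(1) this] show "M s2 \<longleftrightarrow> member_tuple \<eta> p (fst s2 26)" unfolding s2(3) .
  qed (use s n small params_facts in simp_all)
  have sub: "A \<subseteq> {..<n}" if "A \<in> F" for A using that by (auto simp: F_def)
  have hF: "hit_family \<eta> = (\<lambda>A. (!) vs ` A) ` F"
    unfolding hit_family_tuples F_def image_image ..
  have "inj_on ((!) vs) {..<n}" using vs_inj by (auto simp: inj_on_def)
  then have "inj_on (\<lambda>A. (!) vs ` A) F"
    using inj_on_image_eq_iff[OF _ sub sub] by (intro inj_onI) blast
  then have card: "card (hit_family \<eta>) = card F" unfolding hF by (rule card_image)
  have "hit_family \<eta> = (\<lambda>A. (!) vs ` A) ` (\<lambda>j. {i. i < n \<and> snd s' (B + j * n + i) = 1}) ` {..<card F}"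
    unfolding hF by (rule arg_cong[OF *[THEN conjunct2, THEN conjunct2]])
  also have "\<dots> = (\<lambda>j. {vs ! i |i. i < n \<and> snd s' (B + j * n + i) = 1}) ` {..<card F}"
    unfolding image_image by (intro image_cong) auto
  finally show ?thesis using * card small[of 5] by simp
qed

end

text \<open>Variables 2 to 5 receive the addresses at which the adjacency matrix and the tables for
  reachability, for \<open>3 * \<eta> + 3\<close> and for \<open>5 * \<eta> + 5\<close> guards end;
  each table starts where its predecessor ends. Variable 6 is the moving output pointer, whose start
  is remembered in 5, and 7 counts the members. Variable 0 is overwritten last, since all loops
  depend on it.\<close>

definition main :: "nat \<Rightarrow> (state \<Rightarrow> bool) \<Rightarrow> (state \<Rightarrow> bool) \<Rightarrow> (state \<Rightarrow> bool) \<Rightarrow> (state \<Rightarrow> bool) \<Rightarrow>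
    (state \<Rightarrow> bool) \<Rightarrow> state \<Rightarrow> state" where
  "main \<eta> Q1 Q2 Q3 V M =
     (\<lambda>s. (\<lambda>s. ((fst s)(0 := fst s 7), snd s))
     (listing (params \<eta>) 26 6 7 V M
     ((\<lambda>s. ((fst s)(6 := fst s 5), snd s))
     (advance 5 4 (win_vars (5 * \<eta> + 5) \<eta>)
     (stage 4 (round_vars (5 * \<eta> + 5 + 3) \<eta>) (win_vars (5 * \<eta> + 5) \<eta>) Q3
     (advance 4 3 (win_vars (3 * \<eta> + 3) \<eta>)
     (stage 3 (round_vars (3 * \<eta> + 3 + 3) \<eta>) (win_vars (3 * \<eta> + 3) \<eta>) Q2
     (advance 3 2 (reach_vars \<eta>)
     (stage 2 (round_vars (5 * \<eta> + 5 + 4) \<eta>) (reach_vars \<eta>) Q1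
     ((\<lambda>s. ((fst s)(2 := fst s 0 * fst s 0), snd s)) s))))))))))"

lemma runs_then:
  assumes "runs (D + k) (\<lambda>s. g s)" "runs D f" "keeps_n f"
  shows "runs (D + Suc k) (\<lambda>s. g (f s))"
  using runs_seq[OF assms(2,1,3)] by simp

lemma zero_notin: "0 \<notin> set (reach_vars \<eta>)" "0 \<notin> set (win_vars p \<eta>)" "0 \<notin> set (params \<eta>)"
    "1 \<notin> set (reach_vars \<eta>)" "1 \<notin> set (win_vars p \<eta>)" "0 \<notin> set (round_vars a \<eta>)"
  using reach_vars_facts(3)[of _ \<eta>] win_vars_facts(3)[of _ p \<eta>] params_facts(6)[of \<eta>] by fastforce+

lemma runs_main:
  assumes Q: "query (c * (\<eta> + 1)) Q1" "query (c * (\<eta> + 1)) Q2" "query (c * (\<eta> + 1)) Q3"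
    "query (c * (\<eta> + 1)) V" "query (c * (\<eta> + 1)) M"
  shows "runs ((c + 300) * (\<eta> + 1)) (main \<eta> Q1 Q2 Q3 V M)"
proof -
  define D where "D = (c + 200) * (\<eta> + 1)"
  have assign: "runs D (\<lambda>s. ((fst s)(x := fst s y), snd s))" for x y
    by (rule runs_mono[OF runs_assign[OF computes_var]]) (simp add: D_def)
  have square: "runs D (\<lambda>s. ((fst s)(2 := fst s 0 * fst s 0), snd s))"
    by (rule runs_mono[OF runs_assign[OF computes_times_n[OF computes_var]]]) (simp_all add: D_def)
  have st: "runs D (stage b ys xs Q)"
    if "query (c * (\<eta> + 1)) Q" "1 \<notin> set xs" "0 \<notin> set xs" "0 \<notin> set ys" "length xs \<le> 5 * \<eta> + 9"
      "length ys \<le> 5 * \<eta> + 9" for b xs ys Q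
  proof (rule runs_mono[OF runs_stage[OF query_mono[OF that(1)] that(2-4)]])
    show "c * (\<eta> + 1) \<le> c * (\<eta> + 1) + (4 + 8 * length xs)" "4 + 8 * length xs \<le> c * (\<eta> + 1) + (4 + 8 * length xs)"
      by simp_all
    show "c * (\<eta> + 1) + (4 + 8 * length xs) + 5 + 5 * length xs + 5 * length ys \<le> D"
      using that(5,6) by (simp add: D_def algebra_simps)
  qed
  have adv: "runs D (advance b' b xs)" if "0 \<notin> set xs" "b' \<noteq> 0" "length xs \<le> 5 * \<eta> + 9" for b' b xs
    by (rule runs_mono[OF runs_advance[OF that(1,2)]]) (use that(3) in \<open>simp add: D_def algebra_simps\<close>)
  have lst: "runs D (listing (params \<eta>) 26 6 7 V M)"
  proof (rule runs_mono[OF runs_listing[OF query_mono[OF Q(4)] query_mono[OF Q(5)]]])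
    show "c * (\<eta> + 1) \<le> (c + 1) * (\<eta> + 1)" "c * (\<eta> + 1) \<le> (c + 1) * (\<eta> + 1)" "1 \<le> (c + 1) * (\<eta> + 1)"
      by simp_all
    show "(c + 1) * (\<eta> + 1) + 15 + 5 * length (params \<eta>) \<le> D" by (simp add: D_def params_facts algebra_simps)
  qed (use zero_notin in simp_all)
  have keeps: "keeps_n (\<lambda>s. ((fst s)(x := h s), snd s))" if "x \<noteq> 0" for x h
    using that by (simp add: keeps_n_def)
  have "runs (D + 0) (\<lambda>s. ((fst s)(0 := fst s 7), snd s))" using assign by simp
  from runs_then[OF this lst] have "runs (D + Suc 0) (\<lambda>s. (\<lambda>s. ((fst s)(0 := fst s 7), snd s))
      (listing (params \<eta>) 26 6 7 V M s))"
    using keeps_n_listing[of 26 6 7 "params \<eta>" V M] zero_notin by simp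
  from runs_then[OF this assign[of 6 5] keeps]
  have "runs (D + Suc (Suc 0)) (\<lambda>s. (\<lambda>s. ((fst s)(0 := fst s 7), snd s))
      (listing (params \<eta>) 26 6 7 V M ((\<lambda>s. ((fst s)(6 := fst s 5), snd s)) s)))" by simp
  note r = this
  have a: "runs D (advance 5 4 (win_vars (5 * \<eta> + 5) \<eta>))" "runs D (advance 4 3 (win_vars (3 * \<eta> + 3) \<eta>))"
    "runs D (advance 3 2 (reach_vars \<eta>))"
    by (rule adv; simp add: zero_notin win_vars_facts reach_vars_facts)+
  have b: "runs D (stage 4 (round_vars (5 * \<eta> + 5 + 3) \<eta>) (win_vars (5 * \<eta> + 5) \<eta>) Q3)"
    "runs D (stage 3 (round_vars (3 * \<eta> + 3 + 3) \<eta>) (win_vars (3 * \<eta> + 3) \<eta>) Q2)"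
    "runs D (stage 2 (round_vars (5 * \<eta> + 5 + 4) \<eta>) (reach_vars \<eta>) Q1)"
    by (rule st, rule Q, (rule zero_notin)+, simp_all add: win_vars_facts reach_vars_facts)+
  have ka: "keeps_n (advance 5 4 (win_vars (5 * \<eta> + 5) \<eta>))" "keeps_n (advance 4 3 (win_vars (3 * \<eta> + 3) \<eta>))"
    "keeps_n (advance 3 2 (reach_vars \<eta>))"
    by (rule keeps_n_advance; simp add: zero_notin)+
  have kb: "keeps_n (stage 4 (round_vars (5 * \<eta> + 5 + 3) \<eta>) (win_vars (5 * \<eta> + 5) \<eta>) Q3)"
    "keeps_n (stage 3 (round_vars (3 * \<eta> + 3 + 3) \<eta>) (win_vars (3 * \<eta> + 3) \<eta>) Q2)"
    "keeps_n (stage 2 (round_vars (5 * \<eta> + 5 + 4) \<eta>) (reach_vars \<eta>) Q1)"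
    by (rule keeps_n_stage; rule zero_notin)+
  have k2: "keeps_n (\<lambda>s. ((fst s)(2 := fst s 0 * fst s 0), snd s))" by (rule keeps) simp
  note r = runs_then[OF r a(1) ka(1)]
  note r = runs_then[OF r b(1) kb(1)]
  note r = runs_then[OF r a(2) ka(2)]
  note r = runs_then[OF r b(2) kb(2)]
  note r = runs_then[OF r a(3) ka(3)]
  note r = runs_then[OF r b(3) kb(3)]
  note r = runs_then[OF r square k2]
  have r: "runs (D + 9) (main \<eta> Q1 Q2 Q3 V M)"
    unfolding main_def by (rule runs_mono[OF r]) simp
  show ?thesis by (rule runs_mono[OF r]) (simp add: D_def algebra_simps)
qed

context listed_graph
begin

lemma main_correct:
  fixes s :: state
  assumes s: "s = (\<lambda>x. if x = 0 then n else 0, snd (graph_input vs G))"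
    and Q1: "\<And>s. input_state \<eta> (G, vs) s \<Longrightarrow> below (set (reach_vars \<eta>)) s \<Longrightarrow>
      Q1 s \<longleftrightarrow> reach_step (5 * \<eta> + 5) (table n (5 * \<eta> + 5 + 4) (fst s 2) (snd s)) (map (fst s) (reach_vars \<eta>))"
    and Q2: "\<And>s. reach_state \<eta> (G, vs) s \<Longrightarrow> below (set (win_vars (3 * \<eta> + 3) \<eta>)) s \<Longrightarrow>
      Q2 s \<longleftrightarrow> win_step (3 * \<eta> + 3) (table n (3 * \<eta> + 3 + 3) (fst s 3) (snd s)) (map (fst s) (win_vars (3 * \<eta> + 3) \<eta>))"
    and Q3: "\<And>s. reach_state \<eta> (G, vs) s \<Longrightarrow> below (set (win_vars (5 * \<eta> + 5) \<eta>)) s \<Longrightarrow>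
      Q3 s \<longleftrightarrow> win_step (5 * \<eta> + 5) (table n (5 * \<eta> + 5 + 3) (fst s 4) (snd s)) (map (fst s) (win_vars (5 * \<eta> + 5) \<eta>))"
    and V: "\<And>s. wide_state \<eta> (G, vs) s \<Longrightarrow> below (set (params \<eta>)) s \<Longrightarrow> V s \<longleftrightarrow> new_tuple \<eta> (map (fst s) (params \<eta>))"
    and M: "\<And>s. wide_state \<eta> (G, vs) s \<Longrightarrow> below (insert 26 (set (params \<eta>))) s \<Longrightarrow>
      M s \<longleftrightarrow> member_tuple \<eta> (map (fst s) (params \<eta>)) (fst s 26)"
  defines "s' \<equiv> main \<eta> Q1 Q2 Q3 V M s"
  shows "fst s' 0 = card (hit_family \<eta>) \<and>
    hit_family \<eta> = (\<lambda>j. {vs ! i |i. i < n \<and> snd s' (fst s' 5 + j * n + i) = 1}) ` {..<card (hit_family \<eta>)}"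
proof -
  define B1 where "B1 = n * n"
  define B2 where "B2 = B1 + n ^ (5 * \<eta> + 5 + 4)"
  define B3 where "B3 = B2 + n ^ (3 * \<eta> + 3 + 3)"
  define B4 where "B4 = B3 + n ^ (5 * \<eta> + 5 + 3)"
  define s1 where "s1 = ((fst s)(2 := fst s 0 * fst s 0), snd s)"
  define s2 where "s2 = stage 2 (round_vars (5 * \<eta> + 5 + 4) \<eta>) (reach_vars \<eta>) Q1 s1"
  define s3 where "s3 = advance 3 2 (reach_vars \<eta>) s2"
  define s4 where "s4 = stage 3 (round_vars (3 * \<eta> + 3 + 3) \<eta>) (win_vars (3 * \<eta> + 3) \<eta>) Q2 s3"
  define s5 where "s5 = advance 4 3 (win_vars (3 * \<eta> + 3) \<eta>) s4"
  define s6 where "s6 = stage 4 (round_vars (5 * \<eta> + 5 + 3) \<eta>) (win_vars (5 * \<eta> + 5) \<eta>) Q3 s5"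
  define s7 where "s7 = advance 5 4 (win_vars (5 * \<eta> + 5) \<eta>) s6"
  define s8 where "s8 = ((fst s7)(6 := fst s7 5), snd s7)"
  define s9 where "s9 = listing (params \<eta>) 26 6 7 V M s8"
  have s': "s' = ((fst s9)(0 := fst s9 7), snd s9)"
    unfolding s'_def main_def s9_def s8_def s7_def s6_def s5_def s4_def s3_def s2_def s1_def ..
  have e1: "fst s1 z = (if z = 0 then n else if z = 2 then B1 else 0)" for z
    by (simp add: s1_def s B1_def)
  have zero1: "snd s1 k = 0" if "n * n \<le> k" for k
    using that by (simp add: s1_def s graph_input_def Let_def)
  have "0 < snd s1 (i * n + k) \<longleftrightarrow> adj i k" if "i < n" "k < n" for i k
  proof -
    have "i * n + k < Suc i * n" using that by simp
    also have "\<dots> \<le> n * n" using that by (intro mult_le_mono1) simp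
    finally have "i * n + k < n * n" .
    moreover have "n \<noteq> 0" using that by linarith
    then have "(i * n + k) div n = i" "(i * n + k) mod n = k"
      using div_mult_self3[of n k i] that by simp_all
    ultimately show ?thesis by (simp add: s1_def s graph_input_def Let_def)
  qed
  then have "input_state \<eta> (G, vs) s1"
    using e1 listed_graph_axioms by (simp add: input_state_def)
  from reach_stage[OF this _ zero1 Q1] e1[of 2]
  have "reach_state \<eta> (G, vs) s2 \<and> (\<forall>z<20. fst s2 z = fst s1 z) \<and> (\<forall>k\<ge>n * n + n ^ (5 * \<eta> + 5 + 4). snd s2 k = 0)"
    unfolding s2_def B1_def by simp
  then have s2: "reach_state \<eta> (G, vs) s2" "\<And>z. z < 20 \<Longrightarrow> fst s2 z = fst s1 z" "\<And>k. B2 \<le> k \<Longrightarrow> snd s2 k = 0"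
    unfolding B2_def B1_def by blast+
  have s3: "fst s3 3 = B2" "\<And>z. z < 20 \<Longrightarrow> z \<noteq> 3 \<Longrightarrow> fst s3 z = fst s2 z" "snd s3 = snd s2"
    using advance_correct[of "reach_vars \<eta>" 3 2 s2] reach_vars_facts s2(2) e1 zero_notin
    unfolding s3_def by (auto simp: B2_def)
  have r3: "reach_state \<eta> (G, vs) s3"
    by (rule reach_state_frame[OF s2(1), of "{0, 2, 8}" B2])
       (use s2 s3 e1 in \<open>simp_all add: frame_def B2_def B1_def\<close>)
  have e3: "fst s3 2 = n * n" "fst s3 5 = 0" "fst s3 6 = 0" "fst s3 7 = 0" "fst s3 8 = 0"
    using s3(2) s2(2) e1 by (simp_all add: B1_def)
  have "frame {..<20} B2 s3 s4 \<and> table n (3 * \<eta> + 3 + 3) (fst s4 3) (snd s4) = win_table (3 * \<eta> + 3) \<and>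
    (\<forall>k\<ge>B2 + n ^ (3 * \<eta> + 3 + 3). snd s4 k = 0)"
    unfolding s4_def by (rule win_stage[OF r3 e3(1) s3(1)]) (use s2 s3 Q2 in \<open>simp_all add: B2_def B1_def\<close>)
  then have s4: "frame {..<20} B2 s3 s4" "table n (3 * \<eta> + 3 + 3) (fst s4 3) (snd s4) = win_table (3 * \<eta> + 3)"
    "\<And>k. B3 \<le> k \<Longrightarrow> snd s4 k = 0" unfolding B3_def by blast+
  have v4: "fst s4 z = fst s3 z" if "z < 20" for z using s4(1) that by (simp add: frame_def)
  have r4: "reach_state \<eta> (G, vs) s4"
    by (rule reach_state_frame[OF r3 s4(1)]) (use e3 in \<open>simp_all add: B2_def B1_def\<close>)
  have n4: "narrow_state \<eta> (G, vs) s4" using r4 s4(2) by (simp add: narrow_state_def)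
  have s5: "fst s5 4 = B3" "\<And>z. z < 20 \<Longrightarrow> z \<noteq> 4 \<Longrightarrow> fst s5 z = fst s4 z" "snd s5 = snd s4"
    using advance_correct[of "win_vars (3 * \<eta> + 3) \<eta>" 4 3 s4] win_vars_facts v4 s3(1) reach_state_n[OF r4] zero_notin
    unfolding s5_def by (auto simp: B3_def)
  have e5: "fst s5 2 = n * n" "fst s5 3 = B2" "fst s5 7 = 0"
    using s5(2) v4 e3 s3(1) by simp_all
  have n5: "narrow_state \<eta> (G, vs) s5"
    by (rule narrow_state_frame[OF n4, of "{0, 2, 3, 8}" B3])
       (use s5 e5 in \<open>simp_all add: frame_def B3_def B2_def B1_def\<close>)
  have r5: "reach_state \<eta> (G, vs) s5" using n5 by (simp add: narrow_state_def)
  have "frame {..<20} B3 s5 s6 \<and> table n (5 * \<eta> + 5 + 3) (fst s6 4) (snd s6) = win_table (5 * \<eta> + 5) \<and>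
    (\<forall>k\<ge>B3 + n ^ (5 * \<eta> + 5 + 3). snd s6 k = 0)"
    unfolding s6_def by (rule win_stage[OF r5 e5(1) s5(1)])
      (use s4(3) s5(3) Q3 in \<open>simp_all add: B3_def B2_def B1_def\<close>)
  then have s6: "frame {..<20} B3 s5 s6" "table n (5 * \<eta> + 5 + 3) (fst s6 4) (snd s6) = win_table (5 * \<eta> + 5)"
    by blast+
  have v6: "fst s6 z = fst s5 z" if "z < 20" for z using s6(1) that by (simp add: frame_def)
  have "narrow_state \<eta> (G, vs) s6"
    by (rule narrow_state_frame[OF n5 s6(1)]) (use e5 in \<open>simp_all add: B3_def B2_def B1_def\<close>)
  then have w6: "wide_state \<eta> (G, vs) s6" using s6(2) by (simp add: wide_state_def)
  have s7: "fst s7 5 = B4" "\<And>z. z < 20 \<Longrightarrow> z \<noteq> 5 \<Longrightarrow> fst s7 z = fst s6 z" "snd s7 = snd s6"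
    using advance_correct[of "win_vars (5 * \<eta> + 5) \<eta>" 5 4 s6] win_vars_facts v6 s5(1) wide_state_n[OF w6] zero_notin
    unfolding s7_def by (auto simp: B4_def)
  have e8: "fst s8 6 = B4" "fst s8 5 = B4" "\<And>z. z < 20 \<Longrightarrow> z \<noteq> 5 \<Longrightarrow> z \<noteq> 6 \<Longrightarrow> fst s8 z = fst s5 z" "snd s8 = snd s6"
    using s7 v6 by (simp_all add: s8_def)
  have w8: "wide_state \<eta> (G, vs) s8"
    by (rule wide_state_frame[OF w6, of "{0, 2, 3, 4, 8}" B4])
       (use e5 e8 v6 s5(1) in \<open>simp_all add: frame_def B4_def B3_def B2_def B1_def\<close>)
  have "fst s9 7 = card (hit_family \<eta>) \<and> fst s9 5 = fst s8 5 \<and>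
    hit_family \<eta> = (\<lambda>j. {vs ! i |i. i < n \<and> snd s9 (B4 + j * n + i) = 1}) ` {..<card (hit_family \<eta>)}"
    unfolding s9_def
    by (rule listing_family[OF w8 e8(1)])
       (use e5 e8(3) s5(1) V M in \<open>simp_all add: B4_def B3_def B2_def B1_def\<close>)
  then show ?thesis unfolding s' using e8(2) by simp
qed

lemma card_hit_family: "card (hit_family \<eta>) \<le> n ^ (2 * \<eta> + 7)"
proof -
  have "card (hit_family \<eta>) \<le> card {p \<in> tuples n (2 * \<eta> + 7). valid_tuple \<eta> p}"
    unfolding hit_family_tuples by (intro card_image_le) (use finite_tuples in simp)
  also have "\<dots> \<le> card (tuples n (2 * \<eta> + 7))" by (intro card_mono finite_tuples) auto
  finally show ?thesis by (simp add: card_tuples)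
qed

end

text \<open>The queries are obtained for all instances of \<open>linear\<close> at once, before
  \<open>G\<close> and \<open>vs\<close> are fixed; thus one program for each \<open>\<eta>\<close>
  serves all graphs.\<close>

lemma exists_main:
  "\<exists>c. \<forall>\<eta>. \<exists>f. runs (c * (\<eta> + 1)) f \<and> (\<forall>(G :: ('a, 'b) pre_digraph) vs. listed_graph G vs \<longrightarrow> \<eta> < treewidth G \<longrightarrow>
     (\<exists>P. modulator_hitting_family \<eta> (5 * \<eta> + 5) (2 ^ (6 * \<eta> + 10)) G P \<and> card P \<le> length vs ^ (2 * \<eta> + 7) \<and>
       (let s' = f (\<lambda>x. if x = 0 then length vs else 0, snd (graph_input vs G)) in
         fst s' 0 = card P \<and>
         P = (\<lambda>j. {vs ! i |i. i < length vs \<and> snd s' (fst s' 5 + j * length vs + i) = 1}) ` {..<card P})))"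
proof -
  have p1: "linear input_state (\<lambda>\<eta>. set (reach_vars \<eta>)) (\<lambda>\<eta> (I :: ('a, 'b) listed) s.
    listed_graph.reach_step (fst I) (snd I) (5 * \<eta> + 5)
      (table (length (snd I)) (5 * \<eta> + 5 + 4) (fst s 2) (snd s)) (map (fst s) (reach_vars \<eta>)))"
    unfolding reach_vars_def by (rule linear_reach_step)
  have p2: "linear reach_state (\<lambda>\<eta>. set (win_vars (3 * \<eta> + 3) \<eta>)) (\<lambda>\<eta> (I :: ('a, 'b) listed) s.
    listed_graph.win_step (fst I) (snd I) (3 * \<eta> + 3)
      (table (length (snd I)) (3 * \<eta> + 3 + 3) (fst s 3) (snd s)) (map (fst s) (win_vars (3 * \<eta> + 3) \<eta>)))"
    unfolding win_vars_def by (rule linear_win_step) simp_all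
  have p3: "linear reach_state (\<lambda>\<eta>. set (win_vars (5 * \<eta> + 5) \<eta>)) (\<lambda>\<eta> (I :: ('a, 'b) listed) s.
    listed_graph.win_step (fst I) (snd I) (5 * \<eta> + 5)
      (table (length (snd I)) (5 * \<eta> + 5 + 3) (fst s 4) (snd s)) (map (fst s) (win_vars (5 * \<eta> + 5) \<eta>)))"
    unfolding win_vars_def by (rule linear_win_step) simp_all
  obtain c1 Q1 where Q1: "\<forall>\<eta>. query (c1 * (\<eta> + 1)) (Q1 \<eta>)"
    "\<forall>\<eta> (I :: ('a, 'b) listed) s. input_state \<eta> I s \<longrightarrow> below (set (reach_vars \<eta>)) s \<longrightarrow>
      (Q1 \<eta> s \<longleftrightarrow> listed_graph.reach_step (fst I) (snd I) (5 * \<eta> + 5)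
        (table (length (snd I)) (5 * \<eta> + 5 + 4) (fst s 2) (snd s)) (map (fst s) (reach_vars \<eta>)))"
    using p1 by (rule linearE)
  obtain c2 Q2 where Q2: "\<forall>\<eta>. query (c2 * (\<eta> + 1)) (Q2 \<eta>)"
    "\<forall>\<eta> (I :: ('a, 'b) listed) s. reach_state \<eta> I s \<longrightarrow> below (set (win_vars (3 * \<eta> + 3) \<eta>)) s \<longrightarrow>
      (Q2 \<eta> s \<longleftrightarrow> listed_graph.win_step (fst I) (snd I) (3 * \<eta> + 3)
        (table (length (snd I)) (3 * \<eta> + 3 + 3) (fst s 3) (snd s)) (map (fst s) (win_vars (3 * \<eta> + 3) \<eta>)))"
    using p2 by (rule linearE)
  obtain c3 Q3 where Q3: "\<forall>\<eta>. query (c3 * (\<eta> + 1)) (Q3 \<eta>)"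
    "\<forall>\<eta> (I :: ('a, 'b) listed) s. reach_state \<eta> I s \<longrightarrow> below (set (win_vars (5 * \<eta> + 5) \<eta>)) s \<longrightarrow>
      (Q3 \<eta> s \<longleftrightarrow> listed_graph.win_step (fst I) (snd I) (5 * \<eta> + 5)
        (table (length (snd I)) (5 * \<eta> + 5 + 3) (fst s 4) (snd s)) (map (fst s) (win_vars (5 * \<eta> + 5) \<eta>)))"
    using p3 by (rule linearE)
  obtain c4 V where V: "\<forall>\<eta>. query (c4 * (\<eta> + 1)) (V \<eta>)"
    "\<forall>\<eta> (I :: ('a, 'b) listed) s. wide_state \<eta> I s \<longrightarrow> below (set (params \<eta>)) s \<longrightarrow>
      (V \<eta> s \<longleftrightarrow> listed_graph.new_tuple (fst I) (snd I) \<eta> (map (fst s) (params \<eta>)))"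
    using linear_new by (rule linearE)
  obtain c5 M where M: "\<forall>\<eta>. query (c5 * (\<eta> + 1)) (M \<eta>)"
    "\<forall>\<eta> (I :: ('a, 'b) listed) s. wide_state \<eta> I s \<longrightarrow> below (insert 26 (set (params \<eta>))) s \<longrightarrow>
      (M \<eta> s \<longleftrightarrow> listed_graph.member_tuple (fst I) (snd I) \<eta> (map (fst s) (params \<eta>)) (fst s 26))"
    using linear_member by (rule linearE)
  define c where "c = c1 + c2 + c3 + c4 + c5"
  have mono: "query (d * (\<eta> + 1)) Q \<Longrightarrow> d \<le> c \<Longrightarrow> query (c * (\<eta> + 1)) Q" for d \<eta> Q
    by (erule query_mono) (rule mult_le_mono1)
  show ?thesis
  proof (intro exI[of _ "c + 300"] allI, rule exI[of _ "main \<eta> (Q1 \<eta>) (Q2 \<eta>) (Q3 \<eta>) (V \<eta>) (M \<eta>)" for \<eta>],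
      intro conjI allI impI)
    fix \<eta>
    show "runs ((c + 300) * (\<eta> + 1)) (main \<eta> (Q1 \<eta>) (Q2 \<eta>) (Q3 \<eta>) (V \<eta>) (M \<eta>))"
      by (rule runs_main; rule mono[OF spec[OF Q1(1)]] mono[OF spec[OF Q2(1)]] mono[OF spec[OF Q3(1)]]
          mono[OF spec[OF V(1)]] mono[OF spec[OF M(1)]]; simp add: c_def)
    fix G :: "('a, 'b) pre_digraph" and vs
    assume lg: "listed_graph G vs" and tw: "\<eta> < treewidth G"
    interpret listed_graph G vs by (rule lg)
    note * = main_correct[OF refl, of \<eta> "Q1 \<eta>" "Q2 \<eta>" "Q3 \<eta>" "V \<eta>" "M \<eta>",
        OF Q1(2)[rule_format, of \<eta> "(G, vs)", unfolded fst_conv snd_conv]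
        Q2(2)[rule_format, of \<eta> "(G, vs)", unfolded fst_conv snd_conv]
        Q3(2)[rule_format, of \<eta> "(G, vs)", unfolded fst_conv snd_conv]
        V(2)[rule_format, of \<eta> "(G, vs)", unfolded fst_conv snd_conv]
        M(2)[rule_format, of \<eta> "(G, vs)", unfolded fst_conv snd_conv]]
    show "\<exists>P. modulator_hitting_family \<eta> (5 * \<eta> + 5) (2 ^ (6 * \<eta> + 10)) G P \<and> card P \<le> length vs ^ (2 * \<eta> + 7) \<and>
       (let s' = main \<eta> (Q1 \<eta>) (Q2 \<eta>) (Q3 \<eta>) (V \<eta>) (M \<eta>)
            (\<lambda>x. if x = 0 then length vs else 0, snd (graph_input vs G)) in
         fst s' 0 = card P \<and>
         P = (\<lambda>j. {vs ! i |i. i < length vs \<and> snd s' (fst s' 5 + j * length vs + i) = 1}) ` {..<card P})"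
      unfolding Let_def by (intro exI[of _ "hit_family \<eta>"] conjI hit_family_hitting[OF tw] card_hit_family
        *[THEN conjunct1] *[THEN conjunct2]) simp_all
  qed
qed

text \<open>A single bag with at most one vertex has width 0. This supplies
  \<open>2 \<le> n\<close>, on which all time bounds rest.\<close>

lemma two_vertices_if_treewidth:
  assumes "graph G" "0 < treewidth G"
  shows "2 \<le> card (verts G)"
proof (rule ccontr)
  assume "\<not> 2 \<le> card (verts G)"
  then have "card (verts G) \<le> 1" by simp
  interpret graph_treewidth G unfolding graph_treewidth_def by (rule assms(1))
  have "ptd 1 (verts G) 1 id (\<lambda>_. verts G)" by (rule ptd_single) (use \<open>card (verts G) \<le> 1\<close> in simp_all)
  from treewidth_le[OF this] have "treewidth G \<le> 0" unfolding induce_all by simp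
  then show False using assms(2) by simp
qed

lemma linear_bigo: "(\<lambda>\<eta>. real (a * \<eta> + b)) \<in> O(\<lambda>\<eta>. real \<eta>)"
proof (rule bigoI[where c = "real (a + b)"], rule eventually_sequentiallyI[of 1])
  fix \<eta> :: nat assume "1 \<le> \<eta>"
  then have "b * 1 \<le> b * \<eta>" by (intro mult_le_mono2)
  then have "a * \<eta> + b \<le> (a + b) * \<eta>" by (simp add: algebra_simps)
  then have "real (a * \<eta> + b) \<le> real ((a + b) * \<eta>)" by (rule of_nat_mono)
  then show "norm (real (a * \<eta> + b)) \<le> real (a + b) * norm (real \<eta>)" by simp
qed

theorem theorem1:
  shows "\<exists>(r :: nat \<Rightarrow> nat) (c :: nat \<Rightarrow> nat) (a :: nat \<Rightarrow> nat) (s :: nat \<Rightarrow> nat) (t :: nat \<Rightarrow> nat).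
     (\<lambda>\<eta>. real (r \<eta>)) \<in> O(\<lambda>\<eta>. real \<eta>) \<and>
     (\<lambda>\<eta>. real (a \<eta>)) \<in> O(\<lambda>\<eta>. real \<eta>) \<and>
     (\<lambda>\<eta>. real (s \<eta>)) \<in> O(\<lambda>\<eta>. real \<eta>) \<and>
     (\<lambda>\<eta>. real (t \<eta>)) \<in> O(\<lambda>\<eta>. real \<eta>) \<and>
     (\<forall>\<eta>>0. c \<eta> \<le> 2 ^ a \<eta> \<and>
       (\<exists>prog. \<forall>(G :: ('a, 'b) pre_digraph) vs.
          graph G \<and> \<eta> < treewidth G \<and> distinct vs \<and> set vs = verts G \<longrightarrow>
          (\<exists>P. modulator_hitting_family \<eta> (r \<eta>) (c \<eta>) G P \<and>
               card P \<le> card (verts G) ^ s \<eta> \<and>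
               (\<exists>\<tau> \<sigma>. exec prog (graph_input vs G) \<tau> \<sigma> \<and>
                      \<tau> \<le> card (verts G) ^ t \<eta> \<and> family_output vs P \<sigma>))))"
proof -
  obtain d where d: "\<forall>\<eta>. \<exists>f. runs (d * (\<eta> + 1)) f \<and>
     (\<forall>(G :: ('a, 'b) pre_digraph) vs. listed_graph G vs \<longrightarrow> \<eta> < treewidth G \<longrightarrow>
     (\<exists>P. modulator_hitting_family \<eta> (5 * \<eta> + 5) (2 ^ (6 * \<eta> + 10)) G P \<and> card P \<le> length vs ^ (2 * \<eta> + 7) \<and>
       (let s' = f (\<lambda>x. if x = 0 then length vs else 0, snd (graph_input vs G)) in
         fst s' 0 = card P \<and>
         P = (\<lambda>j. {vs ! i |i. i < length vs \<and> snd s' (fst s' 5 + j * length vs + i) = 1}) ` {..<card P})))"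
    using exists_main by blast
  have prog: "\<exists>prog. \<forall>(G :: ('a, 'b) pre_digraph) vs.
          graph G \<and> \<eta> < treewidth G \<and> distinct vs \<and> set vs = verts G \<longrightarrow>
          (\<exists>P. modulator_hitting_family \<eta> (5 * \<eta> + 5) (2 ^ (6 * \<eta> + 10)) G P \<and>
               card P \<le> card (verts G) ^ (2 * \<eta> + 7) \<and>
               (\<exists>\<tau> \<sigma>. exec prog (graph_input vs G) \<tau> \<sigma> \<and>
                      \<tau> \<le> card (verts G) ^ (d * \<eta> + (d + 2)) \<and> family_output vs P \<sigma>))" for \<eta>
  proof -
    obtain f where f: "runs (d * (\<eta> + 1)) f"
      "\<forall>(G :: ('a, 'b) pre_digraph) vs. listed_graph G vs \<longrightarrow> \<eta> < treewidth G \<longrightarrow>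
      (\<exists>P. modulator_hitting_family \<eta> (5 * \<eta> + 5) (2 ^ (6 * \<eta> + 10)) G P \<and> card P \<le> length vs ^ (2 * \<eta> + 7) \<and>
       (let s' = f (\<lambda>x. if x = 0 then length vs else 0, snd (graph_input vs G)) in
         fst s' 0 = card P \<and>
         P = (\<lambda>j. {vs ! i |i. i < length vs \<and> snd s' (fst s' 5 + j * length vs + i) = 1}) ` {..<card P}))"
      using d by blast
    obtain p k where p: "\<And>R M. 2 \<le> R (0::nat) \<Longrightarrow>
     \<exists>R' M' t. exec p (R, M) t (R', M') \<and> t \<le> R 0 ^ (d * (\<eta> + 1)) \<and>
        (\<lambda>x. R' (2 * x), M') = f (\<lambda>x. R (2 * x), M) \<and>
        (\<forall>y. odd y \<and> k \<le> y \<longrightarrow> R' y = R y)"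
      using runsE[OF f(1)] by blast
    show ?thesis
    \<comment> \<open>The start of the output is in variable 5, that is, in register 10. It is
      copied to register 1 as the output format demands, with register 3 serving as zero.\<close>
    proof (intro exI[of _ "Seq p (Seq (Const 3 0) (Add 1 10 3))"] allI impI)
      fix G :: "('a, 'b) pre_digraph" and vs
      assume G: "graph G \<and> \<eta> < treewidth G \<and> distinct vs \<and> set vs = verts G"
      have n: "card (verts G) = length vs" using G distinct_card by metis
      have two: "2 \<le> length vs" using two_vertices_if_treewidth[of G] G n by simp
      have lg: "listed_graph G vs"
        using G two by (simp add: listed_graph_def listed_graph_axioms_def graph_treewidth_def)
      define R :: "nat \<Rightarrow> nat" where "R = (\<lambda>_. 0)(0 := length vs)"
      define M where "M = snd (graph_input vs G)"
      have start: "graph_input vs G = (R, M)" by (simp add: R_def M_def graph_input_def Let_def)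
      have "2 \<le> R 0" using two by (simp add: R_def)
      from p[of R M, OF this] obtain R' M' t where run: "exec p (R, M) t (R', M')" "t \<le> R 0 ^ (d * (\<eta> + 1))"
        "(\<lambda>x. R' (2 * x), M') = f (\<lambda>x. R (2 * x), M)" by blast
      have "(\<lambda>x. R (2 * x)) = (\<lambda>x. if x = 0 then length vs else 0)" by (auto simp: R_def)
      then have res: "f (\<lambda>x. if x = 0 then length vs else 0, snd (graph_input vs G)) = (\<lambda>x. R' (2 * x), M')"
        using run(3) by (simp add: M_def)
      obtain P where P: "modulator_hitting_family \<eta> (5 * \<eta> + 5) (2 ^ (6 * \<eta> + 10)) G P"
        "card P \<le> length vs ^ (2 * \<eta> + 7)" "R' 0 = card P"
        "P = (\<lambda>j. {vs ! i |i. i < length vs \<and> M' (R' 10 + j * length vs + i) = 1}) ` {..<card P}"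
        using f(2)[rule_format, OF lg] G unfolding res Let_def by auto
      define R2 where "R2 = (R'(3 := 0))(1 := R' 10)"
      have "exec (Const 3 0) (R', M') 1 (R'(3 := 0), M')" by (rule exec_Const)
      moreover have "exec (Add 1 10 3) (R'(3 := 0), M') 1 (R2, M')"
        using exec_Add[of 1 10 3 "R'(3 := 0)" M'] by (simp add: R2_def)
      ultimately have e: "exec (Seq p (Seq (Const 3 0) (Add 1 10 3))) (graph_input vs G) (t + (1 + 1)) (R2, M')"
        unfolding start by (intro exec_Seq[OF run(1)] exec_Seq)
      \<comment> \<open>The factor \<open>length vs ^ 2\<close> is at least 4 and pays for the two
        instructions of the copy.\<close>
      have "t + 2 \<le> length vs ^ (d * (\<eta> + 1)) * length vs ^ 2"
      proof -
        define q where "q = length vs ^ (d * (\<eta> + 1))"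
        have "1 \<le> q" using two by (simp add: q_def)
        moreover have "2 * 2 \<le> length vs * length vs" using two by (intro mult_le_mono)
        then have "q * 4 \<le> q * length vs ^ 2" by (intro mult_le_mono2) (simp add: power2_eq_square)
        moreover have "t \<le> q" using run(2) by (simp add: R_def q_def)
        ultimately show ?thesis unfolding q_def[symmetric] by linarith
      qed
      then have time: "t + (1 + 1) \<le> length vs ^ (d * \<eta> + (d + 2))"
        by (simp add: power_add[symmetric] algebra_simps)
      have out: "family_output vs P (R2, M')"
        unfolding family_output_def prod.case using P(3,4) by (simp add: R2_def)
      show "\<exists>P. modulator_hitting_family \<eta> (5 * \<eta> + 5) (2 ^ (6 * \<eta> + 10)) G P \<and>
               card P \<le> card (verts G) ^ (2 * \<eta> + 7) \<and>
               (\<exists>\<tau> \<sigma>. exec (Seq p (Seq (Const 3 0) (Add 1 10 3))) (graph_input vs G) \<tau> \<sigma> \<and>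
                      \<tau> \<le> card (verts G) ^ (d * \<eta> + (d + 2)) \<and> family_output vs P \<sigma>)"
        unfolding n using P(1,2) e time out by blast
    qed
  qed
  show ?thesis
    by (rule exI[of _ "\<lambda>\<eta>. 5 * \<eta> + 5"], rule exI[of _ "\<lambda>\<eta>. 2 ^ (6 * \<eta> + 10)"], rule exI[of _ "\<lambda>\<eta>. 6 * \<eta> + 10"],
        rule exI[of _ "\<lambda>\<eta>. 2 * \<eta> + 7"], rule exI[of _ "\<lambda>\<eta>. d * \<eta> + (d + 2)"])
       (intro conjI allI impI linear_bigo order.refl prog)
qed

end
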